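(* Let $k$ be a field, let $k\langle x,y\rangle$ be the free associative algebra graded by $\deg x=\deg y=1$, let $R = yxyx + xy^2x + xyxy$, and let $\mathcal{A}$ be the quotient of $k\langle x,y\rangle$ by the two-sided ideal generated by the commutators $[x^2,y]$, $[x,y^3]$ and $[x,yRy]$. Then $\mathcal{A}$ is Artin-Schelter regular. The graded free resolution of the residue field $k$ over $\mathcal{A}$ is $$\mathcal{A} \xleftarrow{d_1} \mathcal{A}(-1)^2 \xleftarrow{d_2} \mathcal{A}(-3)\oplus\mathcal{A}(-4)\oplus\mathcal{A}(-7) \xleftarrow{d_3} \mathcal{A}(-5)\oplus\mathcal{A}(-8)\oplus\mathcal{A}(-9) \xleftarrow{d_4} \mathcal{A}(-11)^2 \xleftarrow{d_5} \mathcal{A}(-12)$$ with differentials $$d_1=\begin{bmatrix} x & y\end{bmatrix},\quad d_2=\begin{bmatrix} xy & y^3 & yRy\\ -x^2 & -y^2x & -Ryx\end{bmatrix},\quad d_3=\begin{bmatrix} y^2 & Ry & 0\\ -x & 0 & -yR\\ 0 & -x & y^2\end{bmatrix},$$ $$d_4=\begin{bmatrix} -yRy & xyR\\ y^3 & -xy^2\\ yx & -x^2\end{bmatrix},\quad d_5=\begin{bmatrix} x\\ y\end{bmatrix}.$$ The Hilbert series $\sum_{i\ge 0}\dim_k(\mathcal{A}_i)\,t^i$ of $\mathcal{A}$ is $$\frac{1}{(1-t)^2(1-t^2)(1-t^3)(1-t^5)}.$$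
   Context: Commutators are $[a,b]=ab-ba$. The matrices act by left multiplication on column vectors, so the complex is one of graded right $\mathcal{A}$-modules; $\mathcal{A}(-j)$ is the free module of rank one with generator in degree $j$. The residue field $k$ is $\mathcal{A}/\mathcal{A}_{\ge 1}$. A graded algebra $A=k\oplus A_1\oplus A_2\oplus\cdots$ is called Artin-Schelter regular of dimension $d$ if: (i) $A$ has finite global dimension $d$; (ii) $A$ has finite Gelfand-Kirillov dimension (so the Hilbert function $i\mapsto\dim_k A_i$ is bounded by a polynomial); (iii) $A$ is Gorenstein: $\operatorname{Ext}^i_A(k,A)=0$ for $i\ne d$ and $\operatorname{Ext}^d_A(k,A)\cong k(l)$ for some integer $l$, where $k(l)$ is the module $k$ placed in degree $-l$. It is called Artin-Schelter regular if this holds for some $d$. *)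

theory Defs
  imports
    "HOL-Library.Poly_Mapping"
    "HOL-Library.Extended_Nat"
    "HOL-Library.Extended_Real"
    "HOL-Library.Liminf_Limsup"
    "HOL-Computational_Algebra.Polynomial"
    "HOL-Computational_Algebra.Formal_Power_Series"
    "HOL-Algebra.AbelCoset"
    "HOL-Algebra.Module"
    "Jordan_Normal_Form.Matrix"
begin

section \<open>Connected graded algebras\<close>

locale connected_graded_algebra = vector_space scale
  for scale :: "'k::field \<Rightarrow> 'a::ring_1 \<Rightarrow> 'a" +
  fixes G :: "nat \<Rightarrow> 'a set"
  assumes scale_mult_left: "scale c (a * b) = scale c a * b"
    and scale_mult_right: "scale c (a * b) = a * scale c b"
    and subspace_grade: "subspace (G i)"
    and decomposition: "\<exists>!f. (\<forall>i. f i \<in> G i) \<and> finite {i. f i \<noteq> 0} \<and> a = (\<Sum>i | f i \<noteq> 0. f i)"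
    and grade_mult: "a \<in> G i \<Longrightarrow> b \<in> G j \<Longrightarrow> a * b \<in> G (i + j)"
    and connected: "G 0 = range (\<lambda>c. scale c 1)"

definition int_grade :: "(nat \<Rightarrow> 'a::zero set) \<Rightarrow> int \<Rightarrow> 'a set" where
  "int_grade G i = (if i < 0 then {0} else G (nat i))"

text \<open>The ideal of elements without component in degree \<open>0\<close>.\<close>

definition positive_part :: "(nat \<Rightarrow> 'a::comm_monoid_add set) \<Rightarrow> 'a set" where
  "positive_part G = {\<Sum>i\<in>I. f i | f I. finite I \<and> (\<forall>i\<in>I. 0 < i \<and> f i \<in> G i)}"

text \<open>For \<open>V = span S\<close>, the span of all products of at most \<open>n\<close> elements of \<open>S\<close> is
  \<open>k + V + \<dots> + V\<^sup>n\<close>. The Gelfand-Kirillov dimension is the supremum of the growth exponents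
  over all finite-dimensional subspaces \<open>V\<close>.\<close>

definition gk_dimension :: "('k::field \<Rightarrow> 'a::ring_1 \<Rightarrow> 'a) \<Rightarrow> ereal" where
  "gk_dimension scale =
    (SUP S\<in>{S. finite S}. limsup (\<lambda>n. ereal
      (ln (real (vector_space.dim scale
          (module.span scale {prod_list w | w. set w \<subseteq> S \<and> length w \<le> n}))) / ln (real n))))"

definition polynomial_growth ::
    "('k::field \<Rightarrow> 'a::ring_1 \<Rightarrow> 'a) \<Rightarrow> (nat \<Rightarrow> 'a set) \<Rightarrow> bool" where
  "polynomial_growth scale G \<longleftrightarrow>
    (\<forall>i. \<exists>B. finite B \<and> G i \<subseteq> module.span scale B) \<and>
    (\<exists>p :: real poly. \<forall>i. real (vector_space.dim scale (G i)) \<le> poly p (real i))"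


section \<open>Modules over a noncommutative ring\<close>

text \<open>The module record of HOL-Algebra has ring multiplication and unit as fields; these play no
  role here. For a right module, \<open>smult M a m\<close> is the element \<open>m a\<close>, for a left module
  it is \<open>a m\<close>.\<close>

locale right_module = abelian_group M
  for M :: "('a::ring_1, 'm, 'z) module_scheme" (structure) +
  assumes act_closed: "m \<in> carrier M \<Longrightarrow> smult M a m \<in> carrier M"
    and act_add: "m \<in> carrier M \<Longrightarrow> n \<in> carrier M \<Longrightarrow>
      smult M a (m \<oplus> n) = smult M a m \<oplus> smult M a n"
    and add_act: "m \<in> carrier M \<Longrightarrow> smult M (a + b) m = smult M a m \<oplus> smult M b m"
    and act_act: "m \<in> carrier M \<Longrightarrow> smult M (a * b) m = smult M b (smult M a m)"
    and act_one: "m \<in> carrier M \<Longrightarrow> smult M 1 m = m"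

definition module_hom ::
    "('a, 'm, 'y) module_scheme \<Rightarrow> ('a, 'n, 'z) module_scheme \<Rightarrow> ('m \<Rightarrow> 'n) \<Rightarrow> bool" where
  "module_hom M N f \<longleftrightarrow>
    f \<in> carrier M \<rightarrow> carrier N \<and>
    (\<forall>m\<in>carrier M. \<forall>n\<in>carrier M. f (m \<oplus>\<^bsub>M\<^esub> n) = f m \<oplus>\<^bsub>N\<^esub> f n) \<and>
    (\<forall>a. \<forall>m\<in>carrier M. f (smult M a m) = smult N a (f m))"

definition free_module :: "'b set \<Rightarrow> ('a::ring_1, 'b \<Rightarrow>\<^sub>0 'a) module" where
  "free_module B =
    \<lparr>carrier = {f. Poly_Mapping.keys f \<subseteq> B}, mult = undefined, one = undefined, zero = 0,
     add = (+), smult = (\<lambda>a. Poly_Mapping.map (\<lambda>c. c * a))\<rparr>"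

text \<open>Projective modules are the direct summands of free modules. As a module is generated by
  its own elements, it is enough to consider bases inside its carrier type.\<close>

definition projective_module :: "('a::ring_1, 'm, 'z) module_scheme \<Rightarrow> bool" where
  "projective_module P \<longleftrightarrow> right_module P \<and>
    (\<exists>(B :: 'm set) s r. module_hom P (free_module B) s \<and> module_hom (free_module B) P r \<and>
      (\<forall>p\<in>carrier P. r (s p) = p))"

text \<open>\<open>P 0 \<leftarrow> P 1 \<leftarrow> \<dots>\<close> with differentials \<open>d n : P (n + 1) \<rightarrow> P n\<close> and augmentation
  \<open>e : P 0 \<rightarrow> M\<close>\<close>

definition resolution ::
    "('a::ring_1, 'm, 'y) module_scheme \<Rightarrow> (nat \<Rightarrow> ('a, 'p, 'z) module_scheme) \<Rightarrow>
     (nat \<Rightarrow> 'p \<Rightarrow> 'p) \<Rightarrow> ('p \<Rightarrow> 'm) \<Rightarrow> bool" where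
  "resolution M P d e \<longleftrightarrow>
    right_module M \<and> (\<forall>n. right_module (P n)) \<and>
    (\<forall>n. module_hom (P (Suc n)) (P n) (d n)) \<and> module_hom (P 0) M e \<and>
    e ` carrier (P 0) = carrier M \<and>
    d 0 ` carrier (P 1) = a_kernel (P 0) M e \<and>
    (\<forall>n. d (Suc n) ` carrier (P (Suc (Suc n))) = a_kernel (P (Suc n)) (P n) (d n))"


section \<open>Global dimension\<close>

text \<open>A universe for the elements of modules. It contains \<open>'a\<close> and an arbitrary type \<open>'u\<close>, and
  for every module with elements in it the free modules on subsets of that module embed into it
  again. So modules and their projective resolutions can be taken in the same universe, and
  varying \<open>'u\<close> covers modules of every size.\<close>

datatype ('a, 'u) universe = Scalar 'a | Label 'u | Tuple "('a, 'u) universe list"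

definition projective_dimension :: "('a::ring_1, ('a, 'u) universe) module \<Rightarrow> enat" where
  "projective_dimension M =
    Inf {enat n | n. \<exists>(P :: nat \<Rightarrow> ('a, ('a, 'u) universe) module) d e.
      resolution M P d e \<and> (\<forall>i. projective_module (P i)) \<and>
      (\<forall>i>n. carrier (P i) = {\<zero>\<^bsub>P i\<^esub>})}"

text \<open>This is the right global dimension of the ring \<open>'a\<close>.\<close>

definition global_dimension :: "'u itself \<Rightarrow> 'a::ring_1 itself \<Rightarrow> enat" where
  "global_dimension _ _ =
    (SUP M\<in>{M :: ('a, ('a, 'u) universe) module. right_module M}. projective_dimension M)"


section \<open>Graded modules\<close>

record ('a, 'm) graded_module = "('a, 'm) module" +
  grade :: "int \<Rightarrow> 'm set"

locale graded_right_module = right_module M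
  for G :: "nat \<Rightarrow> 'a::ring_1 set" and M :: "('a, 'm) graded_module" (structure) +
  assumes grade_subgroup: "additive_subgroup (grade M i) M"
    and grade_decomposition: "m \<in> carrier M \<Longrightarrow>
      \<exists>!f. (\<forall>i. f i \<in> grade M i) \<and> finite {i. f i \<noteq> \<zero>} \<and> m = finsum M f {i. f i \<noteq> \<zero>}"
    and grade_act: "m \<in> grade M i \<Longrightarrow> a \<in> G j \<Longrightarrow> smult M a m \<in> grade M (i + int j)"

definition graded_hom ::
    "('a, 'm) graded_module \<Rightarrow> ('a, 'n) graded_module \<Rightarrow> int \<Rightarrow> ('m \<Rightarrow> 'n) \<Rightarrow> bool" where
  "graded_hom M N j f \<longleftrightarrow> module_hom M N f \<and> (\<forall>i. f ` grade M i \<subseteq> grade N (i + j))"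

definition graded_isomorphic ::
    "('a, 'm) graded_module \<Rightarrow> ('a, 'n) graded_module \<Rightarrow> bool" where
  "graded_isomorphic M N \<longleftrightarrow> (\<exists>f. module_hom M N f \<and> bij_betw f (carrier M) (carrier N) \<and>
    (\<forall>i. f ` grade M i = grade N i))"

text \<open>The shift \<open>M(l)\<close>, with \<open>M(l)\<^sub>i = M\<^sub>l\<^sub>+\<^sub>i\<close>\<close>

definition shift :: "('a, 'm) graded_module \<Rightarrow> int \<Rightarrow> ('a, 'm) graded_module" where
  "shift M l = M\<lparr>grade := \<lambda>i. grade M (i + l)\<rparr>"

text \<open>The quotient \<open>Z / B\<close> of submodules \<open>B \<subseteq> Z\<close> of \<open>M\<close>, consisting of cosets\<close>

definition subquotient :: "('a, 'm) graded_module \<Rightarrow> 'm set \<Rightarrow> 'm set \<Rightarrow>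
    ('a, 'm set) graded_module" where
  "subquotient M Z B =
    \<lparr>carrier = (\<lambda>z. B +>\<^bsub>M\<^esub> z) ` Z, mult = undefined, one = undefined, zero = B,
     add = (\<lambda>X Y. X <+>\<^bsub>M\<^esub> Y), smult = (\<lambda>a X. B <+>\<^bsub>M\<^esub> (smult M a ` X)),
     grade = (\<lambda>i. (\<lambda>z. B +>\<^bsub>M\<^esub> z) ` (Z \<inter> grade M i))\<rparr>"

definition right_regular :: "(nat \<Rightarrow> 'a::ring_1 set) \<Rightarrow> ('a, 'a) graded_module" where
  "right_regular G =
    \<lparr>carrier = UNIV, mult = undefined, one = undefined, zero = 0, add = (+),
     smult = (\<lambda>a m. m * a), grade = int_grade G\<rparr>"

definition left_regular :: "(nat \<Rightarrow> 'a::ring_1 set) \<Rightarrow> ('a, 'a) graded_module" where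
  "left_regular G =
    \<lparr>carrier = UNIV, mult = undefined, one = undefined, zero = 0, add = (+),
     smult = (\<lambda>a m. a * m), grade = int_grade G\<rparr>"

text \<open>The residue field \<open>k = A / A\<^sub>\<ge>\<^sub>1\<close> as a right and as a left module\<close>

definition right_residue_field :: "(nat \<Rightarrow> 'a::ring_1 set) \<Rightarrow> ('a, 'a set) graded_module" where
  "right_residue_field G = subquotient (right_regular G) UNIV (positive_part G)"

definition left_residue_field :: "(nat \<Rightarrow> 'a::ring_1 set) \<Rightarrow> ('a, 'a set) graded_module" where
  "left_residue_field G = subquotient (left_regular G) UNIV (positive_part G)"

definition graded_resolution ::
    "(nat \<Rightarrow> 'a::ring_1 set) \<Rightarrow> ('a, 'm) graded_module \<Rightarrow> (nat \<Rightarrow> ('a, 'p) graded_module) \<Rightarrow>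
     (nat \<Rightarrow> 'p \<Rightarrow> 'p) \<Rightarrow> ('p \<Rightarrow> 'm) \<Rightarrow> bool" where
  "graded_resolution G M P d e \<longleftrightarrow> resolution M P d e \<and>
    graded_right_module G M \<and> (\<forall>n. graded_right_module G (P n)) \<and>
    (\<forall>n. graded_hom (P (Suc n)) (P n) 0 (d n)) \<and> graded_hom (P 0) M 0 e"


section \<open>Ext with values in the algebra\<close>

text \<open>Homomorphisms \<open>P \<rightarrow> A\<close> of right modules that are homogeneous of degree \<open>j\<close>, as extensional
  functions\<close>

definition dual_grade ::
    "(nat \<Rightarrow> 'a::ring_1 set) \<Rightarrow> ('a, 'p) graded_module \<Rightarrow> int \<Rightarrow> ('p \<Rightarrow> 'a) set" where
  "dual_grade G P j = {f \<in> extensional (carrier P). graded_hom P (right_regular G) j f}"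

text \<open>The graded left module \<open>Hom\<^sub>A(P, A)\<close> of finite sums of homogeneous homomorphisms, with
  \<open>(a f)(p) = a f(p)\<close>\<close>

definition graded_dual ::
    "(nat \<Rightarrow> 'a::ring_1 set) \<Rightarrow> ('a, 'p) graded_module \<Rightarrow> ('a, 'p \<Rightarrow> 'a) graded_module" where
  "graded_dual G P =
    \<lparr>carrier = {\<lambda>p\<in>carrier P. \<Sum>j\<in>J. g j p | g J. finite J \<and> (\<forall>j\<in>J. g j \<in> dual_grade G P j)},
     mult = undefined, one = undefined, zero = (\<lambda>p\<in>carrier P. 0),
     add = (\<lambda>f g. \<lambda>p\<in>carrier P. f p + g p), smult = (\<lambda>a f. \<lambda>p\<in>carrier P. a * f p),
     grade = dual_grade G P\<rparr>"

definition dual_map ::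
    "(nat \<Rightarrow> ('a, 'p) graded_module) \<Rightarrow> (nat \<Rightarrow> 'p \<Rightarrow> 'p) \<Rightarrow> nat \<Rightarrow> ('p \<Rightarrow> 'a) \<Rightarrow> ('p \<Rightarrow> 'a)" where
  "dual_map P d n f = (\<lambda>p\<in>carrier (P (Suc n)). f (d n p))"

definition dual_cocycles ::
    "(nat \<Rightarrow> 'a::ring_1 set) \<Rightarrow> (nat \<Rightarrow> ('a, 'p) graded_module) \<Rightarrow> (nat \<Rightarrow> 'p \<Rightarrow> 'p) \<Rightarrow>
     nat \<Rightarrow> ('p \<Rightarrow> 'a) set" where
  "dual_cocycles G P d n =
    a_kernel (graded_dual G (P n)) (graded_dual G (P (Suc n))) (dual_map P d n)"

fun dual_coboundaries ::
    "(nat \<Rightarrow> 'a::ring_1 set) \<Rightarrow> (nat \<Rightarrow> ('a, 'p) graded_module) \<Rightarrow> (nat \<Rightarrow> 'p \<Rightarrow> 'p) \<Rightarrow>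
     nat \<Rightarrow> ('p \<Rightarrow> 'a) set" where
  "dual_coboundaries G P d 0 = {\<zero>\<^bsub>graded_dual G (P 0)\<^esub>}"
| "dual_coboundaries G P d (Suc n) = dual_map P d n ` carrier (graded_dual G (P n))"

text \<open>For a graded projective resolution \<open>(P, d)\<close> of \<open>M\<close>, the graded left module
  \<open>H\<^sup>n(Hom\<^sub>A(P, A)) = Ext\<^sup>n\<^sub>A(M, A)\<close>\<close>

definition Ext_of ::
    "(nat \<Rightarrow> 'a::ring_1 set) \<Rightarrow> (nat \<Rightarrow> ('a, 'p) graded_module) \<Rightarrow> (nat \<Rightarrow> 'p \<Rightarrow> 'p) \<Rightarrow>
     nat \<Rightarrow> ('a, ('p \<Rightarrow> 'a) set) graded_module" where
  "Ext_of G P d n =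
    subquotient (graded_dual G (P n)) (dual_cocycles G P d n) (dual_coboundaries G P d n)"

text \<open>\<open>Ext\<close> does not depend on the projective resolution, up to isomorphism of graded modules.
  So it is computed from some resolution here.\<close>

definition gorenstein :: "'u itself \<Rightarrow> (nat \<Rightarrow> 'a::ring_1 set) \<Rightarrow> nat \<Rightarrow> bool" where
  "gorenstein _ G n \<longleftrightarrow>
    (\<exists>(P :: nat \<Rightarrow> ('a, ('a, 'u) universe) graded_module) d e.
      graded_resolution G (right_residue_field G) P d e \<and> (\<forall>i. projective_module (P i)) \<and>
      (\<forall>i. i \<noteq> n \<longrightarrow> carrier (Ext_of G P d i) = {\<zero>\<^bsub>Ext_of G P d i\<^esub>}) \<and>
      (\<exists>l. graded_isomorphic (Ext_of G P d n) (shift (left_residue_field G) l)))"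


section \<open>Artin-Schelter regular algebras\<close>

definition artin_schelter_regular_of_dim ::
    "'u itself \<Rightarrow> ('k::field \<Rightarrow> 'a::ring_1 \<Rightarrow> 'a) \<Rightarrow> (nat \<Rightarrow> 'a set) \<Rightarrow> nat \<Rightarrow> bool" where
  "artin_schelter_regular_of_dim U scale G n \<longleftrightarrow>
    connected_graded_algebra scale G \<and>
    global_dimension U TYPE('a) = enat n \<and>
    gk_dimension scale < \<infinity> \<and> polynomial_growth scale G \<and>
    gorenstein U G n"

definition artin_schelter_regular ::
    "'u itself \<Rightarrow> ('k::field \<Rightarrow> 'a::ring_1 \<Rightarrow> 'a) \<Rightarrow> (nat \<Rightarrow> 'a set) \<Rightarrow> bool" where
  "artin_schelter_regular U scale G \<longleftrightarrow> (\<exists>n. artin_schelter_regular_of_dim U scale G n)"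


section \<open>Complexes of graded free modules given by matrices\<close>

text \<open>For \<open>js = [j\<^sub>1, \<dots>, j\<^sub>r]\<close> the graded right module \<open>A(-j\<^sub>1) \<oplus> \<dots> \<oplus> A(-j\<^sub>r)\<close> of column vectors\<close>

definition free_graded_module ::
    "(nat \<Rightarrow> 'a::ring_1 set) \<Rightarrow> int list \<Rightarrow> ('a, 'a vec) graded_module" where
  "free_graded_module G js =
    \<lparr>carrier = carrier_vec (length js), mult = undefined, one = undefined,
     zero = 0\<^sub>v (length js), add = (+), smult = (\<lambda>a. map_vec (\<lambda>c. c * a)),
     grade = (\<lambda>i. {v \<in> carrier_vec (length js). \<forall>r<length js. v $ r \<in> int_grade G (i - js ! r)})\<rparr>"

text \<open>Outside the given range the complexes are continued by \<open>0\<close>.\<close>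

definition free_terms ::
    "(nat \<Rightarrow> 'a::ring_1 set) \<Rightarrow> int list list \<Rightarrow> nat \<Rightarrow> ('a, 'a vec) graded_module" where
  "free_terms G js n = free_graded_module G (if n < length js then js ! n else [])"

definition matrix_maps ::
    "int list list \<Rightarrow> 'a::ring_1 mat list \<Rightarrow> nat \<Rightarrow> 'a vec \<Rightarrow> 'a vec" where
  "matrix_maps js Ds n v =
    (if n < length Ds then Ds ! n *\<^sub>v v else 0\<^sub>v (if n < length js then length (js ! n) else 0))"

text \<open>The canonical map \<open>A \<rightarrow> A / A\<^sub>\<ge>\<^sub>1\<close>, where \<open>A\<close> consists of vectors of length \<open>1\<close>\<close>

definition augmentation :: "(nat \<Rightarrow> 'a::ring_1 set) \<Rightarrow> 'a vec \<Rightarrow> 'a set" where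
  "augmentation G v = positive_part G +>\<^bsub>right_regular G\<^esub> (v $ 0)"


section \<open>The free algebra on two generators\<close>

datatype letter = LX | LY

datatype word = Word (letters: "letter list")

instantiation word :: monoid_add
begin
definition "0 = Word []"
definition "u + v = Word (letters u @ letters v)"
instance by standard (auto simp: zero_word_def plus_word_def)
end

text \<open>The monoid operation on words (concatenation) is written additively, so \<open>word \<Rightarrow>\<^sub>0 'k\<close> with
  its convolution product is the free associative algebra.\<close>

type_synonym 'k free_algebra = "word \<Rightarrow>\<^sub>0 'k"

definition free_var :: "letter \<Rightarrow> 'k::field free_algebra" where
  "free_var l = Poly_Mapping.single (Word [l]) 1"

definition free_grade :: "nat \<Rightarrow> 'k::field free_algebra set" where
  "free_grade i = {p. \<forall>w\<in>Poly_Mapping.keys p. length (letters w) = i}"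

definition commutator :: "'a::ring_1 \<Rightarrow> 'a \<Rightarrow> 'a" where
  "commutator a b = a * b - b * a"

definition R_of :: "'a::ring_1 \<Rightarrow> 'a \<Rightarrow> 'a" where
  "R_of x y = y * x * y * x + x * y^2 * x + x * y * x * y"

definition relators :: "'k::field free_algebra set" where
  "relators = (let x = free_var LX; y = free_var LY; R = R_of x y in
    {commutator (x^2) y, commutator x (y^3), commutator x (y * R * y)})"

definition two_sided_ideal :: "'a::ring_1 set \<Rightarrow> bool" where
  "two_sided_ideal I \<longleftrightarrow> 0 \<in> I \<and> (\<forall>a\<in>I. \<forall>b\<in>I. a + b \<in> I) \<and>
    (\<forall>a\<in>I. \<forall>r. r * a \<in> I \<and> a * r \<in> I)"

definition relation_ideal :: "'k::field free_algebra set" where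
  "relation_ideal = two_sided_ideal hull relators"


section \<open>The quotient algebra\<close>

definition ideal_cong :: "'k::field free_algebra \<Rightarrow> 'k free_algebra \<Rightarrow> bool" where
  "ideal_cong p q \<longleftrightarrow> p - q \<in> relation_ideal"

lemma two_sided_ideal_relation_ideal: "two_sided_ideal relation_ideal"
  unfolding relation_ideal_def by (rule hull_in) (auto simp: two_sided_ideal_def)

lemma relation_ideal_zero: "0 \<in> relation_ideal"
  and relation_ideal_add: "p \<in> relation_ideal \<Longrightarrow> q \<in> relation_ideal \<Longrightarrow> p + q \<in> relation_ideal"
  and relation_ideal_mult_left: "p \<in> relation_ideal \<Longrightarrow> r * p \<in> relation_ideal"
  and relation_ideal_mult_right: "p \<in> relation_ideal \<Longrightarrow> p * r \<in> relation_ideal"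
  using two_sided_ideal_relation_ideal by (auto simp: two_sided_ideal_def)

lemma relation_ideal_uminus: "p \<in> relation_ideal \<Longrightarrow> - p \<in> relation_ideal"
  using relation_ideal_mult_left[of p "- 1"] by simp

lemma equivp_ideal_cong: "equivp ideal_cong"
proof (rule equivpI)
  show "reflp ideal_cong"
    by (auto simp: reflp_def ideal_cong_def relation_ideal_zero)
  show "symp ideal_cong"
    unfolding symp_def ideal_cong_def using relation_ideal_uminus by (metis minus_diff_eq)
  show "transp ideal_cong"
    unfolding transp_def ideal_cong_def using relation_ideal_add
    by (metis diff_add_cancel add_diff_eq)
qed

lemma word_add_eq_zero_iff: "u + v = 0 \<longleftrightarrow> u = 0 \<and> v = (0::word)"
  by (cases u; cases v) (auto simp: zero_word_def plus_word_def)

lemma lookup_mult_zero_word: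
  fixes p q :: "'k::field free_algebra"
  shows "Poly_Mapping.lookup (p * q) 0 = Poly_Mapping.lookup p 0 * Poly_Mapping.lookup q 0"
proof -
  have 1: "(\<Sum>v. Poly_Mapping.lookup q v when 0 = u + v) = (Poly_Mapping.lookup q 0 when u = 0)" for u
  proof -
    have "(\<lambda>v. Poly_Mapping.lookup q v when 0 = u + v) =
        (\<lambda>v. (Poly_Mapping.lookup q v when u = 0) when v = 0)"
      by (rule ext) (auto simp: when_def word_add_eq_zero_iff eq_commute[of 0])
    then show ?thesis by (simp only: Sum_any_when_equal)
  qed
  show ?thesis unfolding lookup_mult 1 by (simp add: mult_when)
qed

lemma one_notin_relation_ideal: "1 \<notin> (relation_ideal :: 'k::field free_algebra set)"
proof -
  let ?K = "{p :: 'k free_algebra. Poly_Mapping.lookup p 0 = 0}"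
  have "two_sided_ideal ?K"
    by (auto simp: two_sided_ideal_def lookup_add lookup_mult_zero_word)
  moreover have "relators \<subseteq> ?K"
    by (auto simp: relators_def Let_def commutator_def lookup_minus lookup_mult_zero_word)
  ultimately have "relation_ideal \<subseteq> ?K"
    unfolding relation_ideal_def by (intro hull_minimal)
  then show ?thesis by (auto simp: lookup_one)
qed

quotient_type (overloaded) 'k algA = "'k::field free_algebra" / ideal_cong
  by (rule equivp_ideal_cong)

instantiation algA :: (field) ring_1
begin

lift_definition zero_algA :: "'a algA" is 0 .
lift_definition one_algA :: "'a algA" is 1 .

lift_definition plus_algA :: "'a algA \<Rightarrow> 'a algA \<Rightarrow> 'a algA" is "(+)"
  unfolding ideal_cong_def by (metis add_diff_add relation_ideal_add)

lift_definition minus_algA :: "'a algA \<Rightarrow> 'a algA \<Rightarrow> 'a algA" is "(-)"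
proof -
  fix p q r s :: "'a free_algebra"
  assume "ideal_cong p q" "ideal_cong r s"
  then have "(p - q) + - (r - s) \<in> relation_ideal"
    unfolding ideal_cong_def by (intro relation_ideal_add relation_ideal_uminus)
  then show "ideal_cong (p - r) (q - s)"
    by (simp add: ideal_cong_def algebra_simps)
qed

lift_definition uminus_algA :: "'a algA \<Rightarrow> 'a algA" is uminus
  unfolding ideal_cong_def using relation_ideal_uminus by (metis minus_diff_minus)

lift_definition times_algA :: "'a algA \<Rightarrow> 'a algA \<Rightarrow> 'a algA" is "(*)"
proof -
  fix p q r s :: "'a free_algebra"
  assume "ideal_cong p q" "ideal_cong r s"
  then have "(p - q) * r + q * (r - s) \<in> relation_ideal"
    unfolding ideal_cong_def
    by (intro relation_ideal_add relation_ideal_mult_left relation_ideal_mult_right)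
  then show "ideal_cong (p * r) (q * s)"
    by (simp add: ideal_cong_def algebra_simps)
qed

instance
proof
  show "(0 :: 'a algA) \<noteq> 1"
    by transfer (use one_notin_relation_ideal relation_ideal_uminus in
      \<open>force simp: ideal_cong_def\<close>)
qed (transfer; simp add: ideal_cong_def algebra_simps relation_ideal_zero)+

end

lift_definition scaleA :: "'k::field \<Rightarrow> 'k algA \<Rightarrow> 'k algA" is
  "\<lambda>c p. Poly_Mapping.single 0 c * p"
  unfolding ideal_cong_def by (metis relation_ideal_mult_left right_diff_distrib)

definition gradeA :: "nat \<Rightarrow> 'k::field algA set" where
  "gradeA i = abs_algA ` free_grade i"

definition xA :: "'k::field algA" where "xA = abs_algA (free_var LX)"

definition yA :: "'k::field algA" where "yA = abs_algA (free_var LY)"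

definition RA :: "'k::field algA" where
  "RA = abs_algA (R_of (free_var LX) (free_var LY))"

definition d1 :: "'k::field algA mat" where
  "d1 = mat_of_rows_list 2 (let x = xA; y = yA in
    [[x, y]])"

definition d2 :: "'k::field algA mat" where
  "d2 = mat_of_rows_list 3 (let x = xA; y = yA; R = RA in
    [[x * y,   y^3,         y * R * y],
     [- (x^2), - (y^2 * x), - (R * y * x)]])"

definition d3 :: "'k::field algA mat" where
  "d3 = mat_of_rows_list 3 (let x = xA; y = yA; R = RA in
    [[y^2, R * y, 0],
     [- x, 0,     - (y * R)],
     [0,   - x,   y^2]])"

definition d4 :: "'k::field algA mat" where
  "d4 = mat_of_rows_list 2 (let x = xA; y = yA; R = RA in
    [[- (y * R * y), x * y * R],
     [y^3,           - (x * y^2)],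
     [y * x,         - (x^2)]])"

definition d5 :: "'k::field algA mat" where
  "d5 = mat_of_rows_list 1 (let x = xA; y = yA in
    [[x],
     [y]])"

end

(* The relations are rewritten into a confluent system whose normal words are explicit, which gives a
   basis of the algebra and hence the Hilbert series and the growth. The complex of free modules is
   exact in every degree by filtering it and reducing to syzygies between normal words; reversing
   words maps the transposed complex onto the complex itself, up to signs, which gives the Ext groups.
   Tensoring the resolution of k with a k-basis of an arbitrary module M and correcting the
   differentials by terms of lower degree gives a resolution of M of length 5, and comparing two
   resolutions of k shows that 5 cannot be improved, because the entries of the last differential
   have positive degree. *)

theory Submission
  imports Defs "HOL-Library.Sublist" "HOL-Library.Function_Algebras"
begin

section \<open>Words and monomials\<close>

text \<open>Termination of the rewriting only shows that the normal words span. Their independence,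
  and with it confluence, comes out of the complex instead of a check of overlaps. A relation among
  normal words of degree n, split by first letters, is a syzygy of the row (x y), and all such
  syzygies are combinations of the columns of the second matrix, because these columns are the left
  quotients of the relators. The coefficients of the syzygy have degree n - 1, so induction on the
  degree breaks the circle that exactness uses a basis and the basis uses exactness. Both arguments
  rest on one matching of the basis elements (generator, normal word) of the free modules, in the
  style of discrete Morse theory: except for the unit, each is the leading term of a chosen element
  or of the differential of one. That everything reduces to chosen elements modulo boundaries needs
  only spanning; uniqueness is a triangularity argument in degrees already known. A further obstacle
  is size: modules and their resolutions have to live in one type \<open>universe\<close>, which
  forces explicit encodings.\<close>

lemma free_algebra_sum_singles:
  fixes p :: "'k::field free_algebra"
  shows "p = (\<Sum>w\<in>Poly_Mapping.keys p. Poly_Mapping.single w (Poly_Mapping.lookup p w))"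
  by (rule poly_mapping_eqI)
    (auto simp: lookup_sum lookup_single when_def sum.delta in_keys_iff)

lemma free_algebra_induct [case_names single add]:
  fixes p :: "'k::field free_algebra"
  assumes "\<And>w c. P (Poly_Mapping.single w c)" "\<And>p q. P p \<Longrightarrow> P q \<Longrightarrow> P (p + q)"
  shows "P p"
proof -
  have "P (\<Sum>w\<in>K. Poly_Mapping.single w (Poly_Mapping.lookup p w))" if "finite K" for K
    using that
  proof induction
    case empty
    then show ?case using assms(1)[of 0 0] by simp
  next
    case (insert w K)
    then show ?case by (simp add: assms)
  qed
  then show ?thesis by (subst free_algebra_sum_singles) simp
qed

section \<open>Classes of words and the scalar action on the quotient\<close>

definition mon :: "letter list \<Rightarrow> 'k::field algA" where
  "mon w = abs_algA (Poly_Mapping.single (Word w) 1)"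

lemma mon_append: "mon (u @ v) = mon u * mon v"
  by (simp add: mon_def times_algA.abs_eq mult_single plus_word_def)

lemma mon_Nil [simp]: "mon [] = 1"
  by (simp add: mon_def one_algA_def flip: zero_word_def)

lemma xA_eq_mon: "xA = mon [LX]" and yA_eq_mon: "yA = mon [LY]"
  by (auto simp: xA_def yA_def mon_def free_var_def)

lemma scaleA_abs: "scaleA c (abs_algA p) = abs_algA (Poly_Mapping.single 0 c * p)"
  by (rule scaleA.abs_eq)

lemma scaleA_mon: "scaleA c (mon w) = abs_algA (Poly_Mapping.single (Word w) c)"
  by (simp add: mon_def scaleA_abs mult_single)

lemma single_zero_commute:
  fixes p :: "'k::field free_algebra"
  shows "Poly_Mapping.single 0 c * p = p * Poly_Mapping.single 0 c"
  by (induction p rule: free_algebra_induct)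
    (simp_all add: mult_single distrib_left distrib_right mult.commute)

lemma vector_space_scaleA: "vector_space (scaleA :: 'k::field \<Rightarrow> 'k algA \<Rightarrow> 'k algA)"
proof
  fix a b :: 'k and x y :: "'k algA"
  show "scaleA a (x + y) = scaleA a x + scaleA a y"
    by transfer (simp add: distrib_left ideal_cong_def relation_ideal_zero)
  show "scaleA (a + b) x = scaleA a x + scaleA b x"
    by transfer (simp add: distrib_right single_add ideal_cong_def relation_ideal_zero)
  show "scaleA a (scaleA b x) = scaleA (a * b) x"
    by transfer (simp add: ideal_cong_def relation_ideal_zero mult_single flip: mult.assoc)
  show "scaleA 1 x = x"
    by transfer (simp add: ideal_cong_def relation_ideal_zero)
qed

interpretation A: vector_space "scaleA :: 'k::field \<Rightarrow> 'k algA \<Rightarrow> 'k algA"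
  by (rule vector_space_scaleA)

lemma scaleA_mult_left: "scaleA c (a * b) = scaleA c a * b"
  by transfer (simp add: ideal_cong_def relation_ideal_zero mult.assoc)

lemma scaleA_mult_right: "scaleA c (a * b) = a * scaleA c b"
proof (transfer)
  fix c :: 'a and a b :: "'a free_algebra"
  have "Poly_Mapping.single 0 c * (a * b) = a * (Poly_Mapping.single 0 c * b)"
    by (metis mult.assoc single_zero_commute)
  then show "ideal_cong (Poly_Mapping.single 0 c * (a * b)) (a * (Poly_Mapping.single 0 c * b))"
    by (simp add: ideal_cong_def relation_ideal_zero)
qed

lemma scaleA_conv_mult: "scaleA c a = scaleA c 1 * a" "scaleA c a = a * scaleA c 1"
  by (simp_all flip: scaleA_mult_left scaleA_mult_right)

lemma abs_algA_add: "abs_algA (p + q) = abs_algA p + abs_algA q"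
  by (simp add: plus_algA.abs_eq)

lemma abs_algA_zero: "abs_algA 0 = 0"
  by (simp add: zero_algA_def)

lemma abs_algA_sum: "abs_algA (\<Sum>i\<in>I. f i) = (\<Sum>i\<in>I. abs_algA (f i))"
  by (induction I rule: infinite_finite_induct) (simp_all add: abs_algA_zero abs_algA_add)

lemma abs_algA_eq_iff: "abs_algA p = abs_algA q \<longleftrightarrow> p - q \<in> relation_ideal"
  using algA.abs_eq_iff ideal_cong_def by metis

lemma algA_cases: obtains p where "a = abs_algA p"
  by (metis Quotient_algA Quotient_abs_rep)

lemma abs_algA_expand:
  "abs_algA p = (\<Sum>w\<in>Poly_Mapping.keys p. scaleA (Poly_Mapping.lookup p w) (mon (letters w)))"
  by (subst free_algebra_sum_singles) (simp add: abs_algA_sum scaleA_mon)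

section \<open>The grading as spans of words\<close>

lemma gradeA_eq_span: "gradeA n = A.span {mon w :: 'k::field algA | w. length w = n}"
(is "_ = ?S")
proof
  show "gradeA n \<subseteq> ?S"
    unfolding gradeA_def
  proof (rule image_subsetI)
    fix p :: "'k free_algebra" assume "p \<in> free_grade n"
    then have "mon (letters w) \<in> {mon w | w. length w = n}" if "w \<in> Poly_Mapping.keys p" for w
      using that by (auto simp: free_grade_def)
    then show "abs_algA p \<in> ?S"
      unfolding abs_algA_expand by (intro A.span_sum A.span_scale A.span_base)
  qed
  show "?S \<subseteq> gradeA n"
  proof (rule A.span_minimal)
    show "{mon w :: 'k algA | w. length w = n} \<subseteq> gradeA n"
      by (auto simp: gradeA_def mon_def free_grade_def)
    show "A.subspace (gradeA n :: 'k algA set)"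
    proof (rule A.subspaceI)
      show "0 \<in> (gradeA n :: 'k algA set)"
        by (auto simp: gradeA_def free_grade_def intro!: image_eqI[of _ _ 0] simp: abs_algA_zero)
      show "x + y \<in> gradeA n" if "x \<in> gradeA n" "y \<in> gradeA n" for x y :: "'k algA"
      proof -
        from that obtain p q where "x = abs_algA p" "y = abs_algA q" "p \<in> free_grade n" "q \<in> free_grade n"
          by (auto simp: gradeA_def)
        moreover have "p + q \<in> free_grade n" using calculation keys_add[of p q]
          by (auto simp: free_grade_def)
        ultimately show ?thesis by (auto simp: gradeA_def abs_algA_add[symmetric])
      qed
      show "scaleA c x \<in> gradeA n" if "x \<in> gradeA n" for c and x :: "'k algA"
      proof -
        from that obtain p where p: "x = abs_algA p" "p \<in> free_grade n"
          by (auto simp: gradeA_def)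
        have "Poly_Mapping.single 0 c * p \<in> free_grade n" using p(2)
          by (auto simp: free_grade_def mult_map_scale_conv_mult[symmetric] in_keys_iff map.rep_eq when_def
              split: if_splits)
        then show ?thesis using p by (auto simp: gradeA_def scaleA_abs)
      qed
    qed
  qed
qed

lemma mon_in_gradeA: "mon w \<in> gradeA (length w)"
  unfolding gradeA_eq_span by (rule A.span_base) auto

lemma subspace_gradeA: "A.subspace (gradeA n)"
  by (simp add: gradeA_eq_span)

lemma span_mon: "A.span (range mon) = UNIV"
proof -
  have "a \<in> A.span (range mon)" for a
    by (cases a rule: algA_cases) (simp add: abs_algA_expand A.span_sum A.span_scale A.span_base)
  then show ?thesis by auto
qed

lemma algA_induct [case_names mon add scale]:
  assumes "\<And>w. P (mon w)" "\<And>a b. P a \<Longrightarrow> P b \<Longrightarrow> P (a + b)" "\<And>c a. P a \<Longrightarrow> P (scaleA c a)"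
  shows "P a"
proof -
  have z: "P 0" using assms(3)[OF assms(1), of 0] by simp
  have "a \<in> A.span (range mon)" by (simp add: span_mon)
  then show ?thesis
    by (induction rule: A.span_induct_alt) (auto simp: z intro: assms)
qed

lemma gradeA_mult: assumes a: "a \<in> gradeA i" and b: "b \<in> gradeA j" shows "a * b \<in> gradeA (i + j)"
  using a unfolding gradeA_eq_span
proof (induction rule: A.span_induct_alt)
  case base
  then show ?case by (simp add: A.span_zero)
next
  case (step c x y)
  then obtain u where u: "x = mon u" "length u = i" by auto
  from b have "x * b \<in> A.span {mon w | w. length w = i + j}" unfolding gradeA_eq_span
  proof (induction rule: A.span_induct_alt)
    case base
    then show ?case by (simp add: A.span_zero)
  next
    case (step c' x' y')
    then obtain v where v: "x' = mon v" "length v = j" by auto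
    have "mon (u @ v) \<in> A.span {mon w | w. length w = i + j}"
      using u v by (intro A.span_base) auto
    then show ?case using step u v
      by (auto simp: distrib_left mon_append simp flip: scaleA_mult_right intro!: A.span_add A.span_scale)
  qed
  then show ?case using step
    by (auto simp: distrib_right simp flip: scaleA_mult_left intro!: A.span_add A.span_scale)
qed

section \<open>Homogeneous components\<close>

lift_definition projF :: "nat \<Rightarrow> 'k::field free_algebra \<Rightarrow> 'k free_algebra" is
  "\<lambda>n f w. if length (letters w) = n then f w else 0"
  by (rule finite_subset[rotated]) auto

lemma lookup_projF: "Poly_Mapping.lookup (projF n p) w = (if length (letters w) = n then Poly_Mapping.lookup p w else 0)"
  by (simp add: projF.rep_eq)

lemma projF_add: "projF n (p + q) = projF n p + projF n q"
  by (rule poly_mapping_eqI) (simp add: lookup_projF lookup_add)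

lemma projF_diff: "projF n (p - q) = projF n p - projF n q"
  by (rule poly_mapping_eqI) (simp add: lookup_projF lookup_minus)

lemma projF_zero [simp]: "projF n 0 = 0"
  by (rule poly_mapping_eqI) (simp add: lookup_projF)

lemma projF_single: "projF n (Poly_Mapping.single w c) = (if length (letters w) = n then Poly_Mapping.single w c else 0)"
  by (rule poly_mapping_eqI) (auto simp: lookup_projF lookup_single when_def)

lemma letters_add: "letters (u + v) = letters u @ letters v"
  by (simp add: plus_word_def)

lemma projF_single_mult_left:
  fixes p :: "'k::field free_algebra"
  shows "projF n (Poly_Mapping.single w c * p) =
    (if length (letters w) \<le> n then Poly_Mapping.single w c * projF (n - length (letters w)) p else 0)"
  by (induction p rule: free_algebra_induct)
    (auto simp: distrib_left projF_add projF_single mult_single letters_add)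

lemma projF_single_mult_right:
  fixes p :: "'k::field free_algebra"
  shows "projF n (p * Poly_Mapping.single w c) =
    (if length (letters w) \<le> n then projF (n - length (letters w)) p * Poly_Mapping.single w c else 0)"
  by (induction p rule: free_algebra_induct)
    (auto simp: distrib_right projF_add projF_single mult_single letters_add)

lemma relators_eq:
  defines "s \<equiv> \<lambda>w. Poly_Mapping.single (Word w) (1 :: 'k::field)"
  shows "relators = {s [LX,LX,LY] - s [LY,LX,LX], s [LX,LY,LY,LY] - s [LY,LY,LY,LX],
    s [LX,LY,LY,LX,LY,LX,LY] + s [LX,LY,LX,LY,LY,LX,LY] + s [LX,LY,LX,LY,LX,LY,LY]
    - (s [LY,LY,LX,LY,LX,LY,LX] + s [LY,LX,LY,LY,LX,LY,LX] + s [LY,LX,LY,LX,LY,LY,LX])}"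
  by (simp add: relators_def Let_def commutator_def R_of_def free_var_def mult_single power2_eq_square
      power3_eq_cube distrib_left distrib_right plus_word_def s_def)

text \<open>Each relator is homogeneous, of degree 3, 4 or 7.\<close>

lemma projF_relator: "r \<in> relators \<Longrightarrow> projF n r = r \<or> projF n r = 0"
  by (auto simp: relators_eq projF_add projF_diff projF_single)

lemma relators_in_relation_ideal: "relators \<subseteq> relation_ideal"
  by (simp add: relation_ideal_def hull_subset)

lemma relation_ideal_minimal: "two_sided_ideal K \<Longrightarrow> relators \<subseteq> K \<Longrightarrow> relation_ideal \<subseteq> K"
  unfolding relation_ideal_def by (rule hull_minimal)

text \<open>The elements all of whose components lie in the ideal form a two-sided ideal, since
  multiplication by a word only shifts components, and this ideal contains the homogeneous relators.
  Hence the projections, and with them the grading, descend to the quotient.\<close>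

lemma projF_relation_ideal: "p \<in> relation_ideal \<Longrightarrow> projF n p \<in> relation_ideal"
proof -
  define K :: "'a free_algebra set" where "K = {p. \<forall>n. projF n p \<in> relation_ideal}"
  have "two_sided_ideal K"
    unfolding two_sided_ideal_def
  proof (intro conjI ballI allI)
    show "0 \<in> K" by (simp add: K_def relation_ideal_zero)
    show add: "a + b \<in> K" if "a \<in> K" "b \<in> K" for a b
      using that by (auto simp: K_def projF_add intro: relation_ideal_add)
    show "r * a \<in> K" if "a \<in> K" for a r
      using that
    proof (induction r rule: free_algebra_induct)
      case (single w c)
      then show ?case
        by (auto simp: K_def projF_single_mult_left relation_ideal_zero intro: relation_ideal_mult_left)
    qed (auto simp: distrib_right intro: add)
    show "a * r \<in> K" if "a \<in> K" for a r
      using that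
    proof (induction r rule: free_algebra_induct)
      case (single w c)
      then show ?case
        by (auto simp: K_def projF_single_mult_right relation_ideal_zero intro: relation_ideal_mult_right)
    qed (auto simp: distrib_left intro: add)
  qed
  moreover have "relators \<subseteq> K"
  proof
    fix r :: "'a free_algebra" assume r: "r \<in> relators"
    have "projF n r \<in> relation_ideal" for n
      using projF_relator[OF r, of n] r relators_in_relation_ideal relation_ideal_zero by auto
    then show "r \<in> K" by (simp add: K_def)
  qed
  ultimately have "relation_ideal \<subseteq> K" by (rule relation_ideal_minimal)
  then show "p \<in> relation_ideal \<Longrightarrow> projF n p \<in> relation_ideal" by (auto simp: K_def)
qed

lift_definition projA :: "nat \<Rightarrow> 'k::field algA \<Rightarrow> 'k algA" is projF
  unfolding ideal_cong_def by (metis projF_diff projF_relation_ideal)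

lemma projA_add: "projA n (a + b) = projA n a + projA n b"
  by transfer (simp add: projF_add ideal_cong_def relation_ideal_zero)

lemma projA_zero [simp]: "projA n 0 = 0"
  by transfer (simp add: ideal_cong_def relation_ideal_zero)

lemma projA_sum: "projA n (\<Sum>i\<in>I. f i) = (\<Sum>i\<in>I. projA n (f i))"
  by (induction I rule: infinite_finite_induct) (simp_all add: projA_add)

lemma projA_uminus: "projA n (- a) = - projA n a"
  by (metis add_eq_0_iff2 projA_add projA_zero)

lemma projA_diff: "projA n (a - b) = projA n a - projA n b"
  by (metis diff_conv_add_uminus projA_add projA_uminus)

lemma projA_mon: "projA n (mon w) = (if length w = n then mon w else 0)"
  by (simp add: mon_def projA.abs_eq projF_single abs_algA_zero)

lemma projA_scale: "projA n (scaleA c a) = scaleA c (projA n a)"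
  by transfer (simp add: projF_single_mult_left zero_word_def ideal_cong_def relation_ideal_zero)

lemma projA_in_gradeA: "projA n a \<in> gradeA n"
proof (induction a rule: algA_induct)
  case (mon w)
  then show ?case using mon_in_gradeA A.subspace_0[OF subspace_gradeA] by (auto simp: projA_mon)
qed (auto simp: projA_add projA_scale intro: A.subspace_add[OF subspace_gradeA] A.subspace_scale[OF subspace_gradeA])

lemma projA_gradeA: assumes "a \<in> gradeA m" shows "projA n a = (if m = n then a else 0)"
  using assms unfolding gradeA_eq_span
  by (induction rule: A.span_induct_alt) (auto simp: projA_add projA_scale projA_mon)

lemma gradeA_iff_projA: "a \<in> gradeA n \<longleftrightarrow> projA n a = a"
  using projA_gradeA projA_in_gradeA by metis

lemma projA_projA: "projA n (projA m a) = (if m = n then projA n a else 0)"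
  using projA_gradeA[OF projA_in_gradeA] by metis

lemma finite_projA: "finite {n. projA n a \<noteq> 0}"
proof (induction a rule: algA_induct)
  case (mon w)
  then show ?case by (rule finite_subset[of _ "{length w}"]) (auto simp: projA_mon)
next
  case (add a b)
  then show ?case by (rule_tac finite_subset[OF _ finite_UnI[OF add]]) (auto simp: projA_add)
next
  case (scale c a)
  then show ?case by (rule_tac finite_subset[OF _ scale]) (auto simp: projA_scale)
qed

text \<open>Any finite set containing the support serves as index set. This freedom lets two
  elements be summed over a common set although the support of a sum may be smaller than the union
  of the supports.\<close>

lemma projA_sum_superset:
  assumes "finite N" "{n. projA n a \<noteq> 0} \<subseteq> N"
  shows "(\<Sum>n\<in>N. projA n a) = a"
proof -
  have *: "\<exists>N. finite N \<and> {n. projA n a \<noteq> 0} \<subseteq> N \<and> (\<Sum>n\<in>N. projA n a) = a" for a :: "'a algA"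
  proof (induction a rule: algA_induct)
    case (mon w)
    show ?case by (rule exI[of _ "{length w}"]) (auto simp: projA_mon)
  next
    case (add a b)
    then obtain N M where N: "finite N" "{n. projA n a \<noteq> 0} \<subseteq> N" "(\<Sum>n\<in>N. projA n a) = a"
      and M: "finite M" "{n. projA n b \<noteq> 0} \<subseteq> M" "(\<Sum>n\<in>M. projA n b) = b" by auto
    have "(\<Sum>n\<in>N \<union> M. projA n a) = a"
      using N M by (subst N(3)[symmetric]) (rule sum.mono_neutral_right; auto)
    moreover have "(\<Sum>n\<in>N \<union> M. projA n b) = b"
      using N M by (subst M(3)[symmetric]) (rule sum.mono_neutral_right; auto)
    ultimately show ?case using N M
      by (intro exI[of _ "N \<union> M"]) (force simp: projA_add sum.distrib)
  next
    case (scale c a)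
    then obtain N where "finite N" "{n. projA n a \<noteq> 0} \<subseteq> N" "(\<Sum>n\<in>N. projA n a) = a" by auto
    then show ?case
      by (intro exI[of _ N]) (auto simp: projA_scale simp flip: A.scale_sum_right)
  qed
  obtain M where M: "finite M" "{n. projA n a \<noteq> 0} \<subseteq> M" "(\<Sum>n\<in>M. projA n a) = a" using * by blast
  have "(\<Sum>n\<in>M. projA n a) = (\<Sum>n\<in>{n. projA n a \<noteq> 0}. projA n a)"
    using M by (intro sum.mono_neutral_right) auto
  moreover have "(\<Sum>n\<in>N. projA n a) = (\<Sum>n\<in>{n. projA n a \<noteq> 0}. projA n a)"
    using assms by (intro sum.mono_neutral_right) auto
  ultimately show ?thesis using M by simp
qed

lemma projA_eqI: "(\<And>n. projA n a = projA n b) \<Longrightarrow> a = b"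
  by (metis (no_types, lifting) finite_projA order_refl projA_sum_superset sum.cong Collect_cong)

text \<open>Only the left factor is homogeneous: matrix entries are homogeneous and multiply from
  the left, the coordinates of a vector are arbitrary.\<close>

lemma projA_mult_left: assumes "h \<in> gradeA j"
  shows "projA n (h * a) = (if j \<le> n then h * projA (n - j) a else 0)"
proof -
  have "finite {n. projA n a \<noteq> 0}" (is "finite ?N") by (rule finite_projA)
  have "projA n (h * a) = projA n (h * (\<Sum>i\<in>?N. projA i a))"
    by (subst projA_sum_superset) (auto simp: finite_projA)
  also have "\<dots> = (\<Sum>i\<in>?N. projA n (h * projA i a))"
    by (simp add: sum_distrib_left projA_sum)
  also have "\<dots> = (\<Sum>i\<in>?N. if j + i = n then h * projA i a else 0)"
    using projA_gradeA[OF gradeA_mult[OF assms projA_in_gradeA]] by (intro sum.cong) auto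
  also have "\<dots> = (\<Sum>i\<in>?N. if i = n - j then (if j \<le> n then h * projA i a else 0) else 0)"
    by (intro sum.cong) auto
  also have "\<dots> = (if j \<le> n then h * projA (n - j) a else 0)"
    using finite_projA by (subst sum.delta) auto
  finally show ?thesis .
qed

lemma connected_graded_algebra_algA: "connected_graded_algebra (scaleA :: 'k::field \<Rightarrow> 'k algA \<Rightarrow> 'k algA) gradeA"
proof
  show "scaleA c (a * b) = scaleA c a * b" for c and a b :: "'k algA" by (rule scaleA_mult_left)
  show "scaleA c (a * b) = a * scaleA c b" for c and a b :: "'k algA" by (rule scaleA_mult_right)
  show "A.subspace (gradeA i :: 'k algA set)" for i by (rule subspace_gradeA)
  show "a * b \<in> gradeA (i + j)" if "a \<in> gradeA i" "b \<in> gradeA j" for a b :: "'k algA" and i j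
    using that by (rule gradeA_mult)
  show "gradeA 0 = range (\<lambda>c. scaleA c (1 :: 'k algA))"
    unfolding gradeA_eq_span by (auto simp: A.span_singleton)
  show "\<exists>!f. (\<forall>i. f i \<in> gradeA i) \<and> finite {i. f i \<noteq> 0} \<and> a = (\<Sum>i | f i \<noteq> 0. f i)" for a :: "'k algA"
  proof (rule ex1I[of _ "\<lambda>i. projA i a"])
    show "(\<forall>i. projA i a \<in> gradeA i) \<and> finite {i. projA i a \<noteq> 0} \<and> a = (\<Sum>i | projA i a \<noteq> 0. projA i a)"
      using finite_projA[of a] projA_sum_superset[of "{i. projA i a \<noteq> 0}" a] by (simp add: projA_in_gradeA)
    fix f assume f: "(\<forall>i. f i \<in> gradeA i) \<and> finite {i. f i \<noteq> 0} \<and> a = (\<Sum>i | f i \<noteq> 0. f i)"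
    have "f n = projA n a" for n
    proof -
      have "projA n a = projA n (\<Sum>i | f i \<noteq> 0. f i)" using f by metis
      also have "\<dots> = (\<Sum>i | f i \<noteq> 0. projA n (f i))" by (rule projA_sum)
      also have "\<dots> = (\<Sum>i | f i \<noteq> 0. if i = n then f i else 0)"
        using f by (intro sum.cong refl projA_gradeA) auto
      also have "\<dots> = f n" using f by (subst sum.delta) auto
      finally show ?thesis by simp
    qed
    then show "f = (\<lambda>i. projA i a)" by auto
  qed
qed

section \<open>Word reversal\<close>

lift_definition revF :: "'k::field free_algebra \<Rightarrow> 'k free_algebra" is
  "\<lambda>f w. f (Word (rev (letters w)))"
proof -
  fix f :: "word \<Rightarrow> 'b::field" assume "finite {x. f x \<noteq> 0}"
  then have "finite ((\<lambda>w. Word (rev (letters w))) ` {x. f x \<noteq> 0})" by simp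
  moreover have "{x. f (Word (rev (letters x))) \<noteq> 0} \<subseteq> (\<lambda>w. Word (rev (letters w))) ` {x. f x \<noteq> 0}"
    by (auto intro!: image_eqI[where x="Word (rev (letters _))"])
  ultimately show "finite {x. f (Word (rev (letters x))) \<noteq> 0}" by (rule rev_finite_subset)
qed

lemma revF_add: "revF (p + q) = revF p + revF q"
  by (rule poly_mapping_eqI) (simp add: revF.rep_eq lookup_add)

lemma revF_diff: "revF (p - q) = revF p - revF q"
  by (rule poly_mapping_eqI) (simp add: revF.rep_eq lookup_minus)

lemma revF_zero: "revF 0 = 0"
  by (rule poly_mapping_eqI) (simp add: revF.rep_eq)

lemma revF_single: "revF (Poly_Mapping.single w c) = Poly_Mapping.single (Word (rev (letters w))) c"
  by (rule poly_mapping_eqI) (auto simp: revF.rep_eq lookup_single when_def)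

lemma revF_mult: fixes p q :: "'k::field free_algebra" shows "revF (p * q) = revF q * revF p"
proof (induction p rule: free_algebra_induct)
  case (single w c)
  show ?case
    by (induction q rule: free_algebra_induct)
      (simp_all add: mult_single revF_single revF_add distrib_left distrib_right plus_word_def mult.commute)
qed (simp add: revF_add distrib_left distrib_right)

text \<open>Each relator is a commutator of two elements invariant under reversal (\<open>R\<close>
  is invariant as well), and an antiautomorphism changes the sign of such a commutator.\<close>

lemma revF_relator: "r \<in> relators \<Longrightarrow> - revF r \<in> relators"
  by (auto simp: relators_eq revF_add revF_diff revF_single add_ac)

lemma revF_relation_ideal: "p \<in> relation_ideal \<Longrightarrow> revF p \<in> relation_ideal"
proof -
  define K :: "'a free_algebra set" where "K = {p. revF p \<in> relation_ideal}"
  have "two_sided_ideal K"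
    by (auto simp: two_sided_ideal_def K_def revF_zero relation_ideal_zero revF_add revF_mult
        intro: relation_ideal_add relation_ideal_mult_left relation_ideal_mult_right)
  moreover have "relators \<subseteq> K"
  proof
    fix r :: "'a free_algebra" assume "r \<in> relators"
    then have "- revF r \<in> relation_ideal" using revF_relator relators_in_relation_ideal by blast
    then show "r \<in> K" using relation_ideal_uminus by (fastforce simp: K_def)
  qed
  ultimately have "relation_ideal \<subseteq> K" by (rule relation_ideal_minimal)
  then show "p \<in> relation_ideal \<Longrightarrow> revF p \<in> relation_ideal" by (auto simp: K_def)
qed

lift_definition revA :: "'k::field algA \<Rightarrow> 'k algA" is revF
  unfolding ideal_cong_def by (metis revF_diff revF_relation_ideal)

lemma revA_add: "revA (a + b) = revA a + revA b"
  by transfer (simp add: revF_add ideal_cong_def relation_ideal_zero)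

lemma revA_diff: "revA (a - b) = revA a - revA b"
  by transfer (simp add: revF_diff ideal_cong_def relation_ideal_zero)

lemma revA_zero [simp]: "revA 0 = 0"
  by transfer (simp add: revF_zero ideal_cong_def relation_ideal_zero)

lemma revA_uminus: "revA (- a) = - revA a"
  by (metis add_eq_0_iff2 revA_add revA_zero)

lemma revA_mult: "revA (a * b) = revA b * revA a"
  by transfer (simp add: revF_mult ideal_cong_def relation_ideal_zero)

lemma revA_mon: "revA (mon w) = mon (rev w)"
  by (simp add: mon_def revA.abs_eq revF_single)

lemma revA_scale: "revA (scaleA c a) = scaleA c (revA a)"
  by transfer (simp add: revF_mult revF_single zero_word_def single_zero_commute[symmetric, unfolded zero_word_def]
      ideal_cong_def relation_ideal_zero)

lemma revA_revA [simp]: "revA (revA a) = a"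
  by (induction a rule: algA_induct) (auto simp: revA_mon revA_add revA_scale)

lemma RA_eq_mon: "RA = mon [LY,LX,LY,LX] + mon [LX,LY,LY,LX] + mon [LX,LY,LX,LY]"
  by (simp add: RA_def R_of_def abs_algA_add mon_def free_var_def mult_single power2_eq_square plus_word_def)

lemma revA_gens [simp]: "revA xA = xA" "revA yA = yA" "revA RA = RA"
  by (simp_all add: xA_eq_mon yA_eq_mon RA_eq_mon revA_add revA_mon)

lemma RA_eq: "RA = yA * xA * yA * xA + xA * yA^2 * xA + xA * yA * xA * yA"
  by (simp add: RA_eq_mon xA_eq_mon yA_eq_mon power2_eq_square flip: mon_append)

section \<open>Syzygies of the generators\<close>

text \<open>Keeps the words that begin with \<open>l\<close> and removes that letter. It separates
  the summands of x q + y r, because the elements without constant term form a free right module on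
  the two letters.\<close>

lift_definition lquot :: "letter \<Rightarrow> 'k::field free_algebra \<Rightarrow> 'k free_algebra" is
  "\<lambda>l f w. f (Word (l # letters w))"
proof -
  fix l and f :: "word \<Rightarrow> 'b::field" assume "finite {x. f x \<noteq> 0}"
  then have "finite ((\<lambda>w. Word (tl (letters w))) ` {x. f x \<noteq> 0})" by simp
  moreover have "{x. f (Word (l # letters x)) \<noteq> 0} \<subseteq> (\<lambda>w. Word (tl (letters w))) ` {x. f x \<noteq> 0}"
    by (auto intro!: image_eqI[where x="Word (l # letters _)"])
  ultimately show "finite {x. f (Word (l # letters x)) \<noteq> 0}" by (rule rev_finite_subset)
qed

lemma lquot_add: "lquot l (p + q) = lquot l p + lquot l q"
  by (rule poly_mapping_eqI) (simp add: lquot.rep_eq lookup_add)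

lemma lquot_single_Cons:
  "lquot l (Poly_Mapping.single (Word (l' # w)) c) = (if l = l' then Poly_Mapping.single (Word w) c else 0)"
  by (rule poly_mapping_eqI) (auto simp: lquot.rep_eq lookup_single when_def word.expand)

lemma lquot_free_var_mult: fixes p :: "'k::field free_algebra"
  shows "lquot l (free_var l' * p) = (if l = l' then p else 0)"
proof (induction p rule: free_algebra_induct)
  case (single w c)
  then show ?case by (simp add: free_var_def mult_single plus_word_def lquot_single_Cons)
qed (auto simp: distrib_left lquot_add)

lemma free_algebra_split:
  fixes p :: "'k::field free_algebra"
  shows "\<exists>c q r. p = Poly_Mapping.single 0 c + free_var LX * q + free_var LY * r"
proof (induction p rule: free_algebra_induct)
  case (single w c)
  show ?case
  proof (cases "letters w")
    case Nil
    then have "w = 0" by (metis word.collapse zero_word_def)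
    then show ?thesis by (intro exI[of _ c] exI[of _ 0]) simp
  next
    case (Cons l u)
    have *: "Poly_Mapping.single w c = free_var l * Poly_Mapping.single (Word u) c"
      using Cons by (cases w) (simp add: free_var_def mult_single plus_word_def)
    show ?thesis
    proof (cases l)
      case LX
      then show ?thesis using *
        by (intro exI[of _ "0::'k"] exI[of _ "Poly_Mapping.single (Word u) c"] exI[of _ "0::'k free_algebra"]) simp
    next
      case LY
      then show ?thesis using *
        by (intro exI[of _ "0::'k"] exI[of _ "0::'k free_algebra"] exI[of _ "Poly_Mapping.single (Word u) c"]) simp
    qed
  qed
next
  case (add p q)
  then obtain c q1 r c' q1' r' where
    "p = Poly_Mapping.single 0 c + free_var LX * q1 + free_var LY * r"
    "q = Poly_Mapping.single 0 c' + free_var LX * q1' + free_var LY * r'" by blast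
  then show ?case
    by (intro exI[of _ "c + c'"] exI[of _ "q1 + q1'"] exI[of _ "r + r'"]) (simp add: single_add algebra_simps)
qed

text \<open>The free algebra is k + x F + y F, so a left factor of a relator is a scalar up to terms
  that begin with a letter. Therefore the ideal I is generated by the relators as a right ideal, up
  to x I + y I.\<close>

lemma relation_ideal_expand:
  fixes p :: "'k::field free_algebra"
  defines "x \<equiv> free_var LX :: 'k free_algebra" and "y \<equiv> free_var LY :: 'k free_algebra"
  defines "R \<equiv> R_of x y"
  assumes "p \<in> relation_ideal"
  shows "\<exists>q1 q2 q3 i j. i \<in> relation_ideal \<and> j \<in> relation_ideal \<and>
    p = commutator (x^2) y * q1 + commutator x (y^3) * q2 + commutator x (y * R * y) * q3 + x * i + y * j"
proof -
  define E where "E q1 q2 q3 i j = commutator (x^2) y * q1 + commutator x (y^3) * q2 +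
      commutator x (y * R * y) * q3 + x * i + y * j" for q1 q2 q3 i j
  define K where "K = {p. \<exists>q1 q2 q3 i j. i \<in> relation_ideal \<and> j \<in> relation_ideal \<and> p = E q1 q2 q3 i j}"
  have rel: "commutator (x^2) y \<in> relation_ideal" "commutator x (y^3) \<in> relation_ideal"
    "commutator x (y * R * y) \<in> relation_ideal"
    using relators_in_relation_ideal by (auto simp: relators_def x_def y_def R_def Let_def)
  have KI: "K \<subseteq> relation_ideal"
    by (auto simp: K_def E_def intro!: relation_ideal_add relation_ideal_mult_left
        relation_ideal_mult_right[OF rel(1)] relation_ideal_mult_right[OF rel(2)] relation_ideal_mult_right[OF rel(3)])
  have KE: "E q1 q2 q3 i j \<in> K" if "i \<in> relation_ideal" "j \<in> relation_ideal" for q1 q2 q3 i j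
    using that unfolding K_def by blast
  have E0: "E 0 0 0 0 0 = 0" "E 1 0 0 0 0 = commutator (x^2) y" "E 0 1 0 0 0 = commutator x (y^3)"
    "E 0 0 1 0 0 = commutator x (y * R * y)"
    and Exy: "E 0 0 0 i j = x * i + y * j" for i j
    by (simp_all add: E_def)
  have Eadd: "E q1 q2 q3 i j + E q1' q2' q3' i' j' = E (q1 + q1') (q2 + q2') (q3 + q3') (i + i') (j + j')"
    for q1 q2 q3 i j q1' q2' q3' i' j'
    by (simp add: E_def algebra_simps)
  have Emult: "E q1 q2 q3 i j * r = E (q1 * r) (q2 * r) (q3 * r) (i * r) (j * r)" for q1 q2 q3 i j r
    by (simp add: E_def algebra_simps)
  have add: "a + b \<in> K" if "a \<in> K" "b \<in> K" for a b
    using that unfolding K_def mem_Collect_eq by (metis Eadd relation_ideal_add)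
  have right: "a * r \<in> K" if "a \<in> K" for a r
    using that unfolding K_def mem_Collect_eq by (metis Emult relation_ideal_mult_right)
  have "two_sided_ideal K"
    unfolding two_sided_ideal_def
  proof (intro conjI ballI allI)
    show "0 \<in> K" using KE[of 0 0 0 0 0] E0 by (simp add: relation_ideal_zero)
    show "a + b \<in> K" if "a \<in> K" "b \<in> K" for a b using that by (rule add)
    show "a * r \<in> K" if "a \<in> K" for a r using that by (rule right)
    show "r * a \<in> K" if a: "a \<in> K" for a r
    proof -
      \<comment> \<open>The scalar part of the left factor moves to the right, where
        \<open>K\<close> is closed; the rest puts a letter in front of an element of the ideal,
        which the last two summands allow.\<close>
      obtain c q s where r: "r = Poly_Mapping.single 0 c + x * q + y * s"
        using free_algebra_split unfolding x_def y_def by blast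
      have "r * a = a * Poly_Mapping.single 0 c + E 0 0 0 (q * a) (s * a)"
        by (simp add: r Exy distrib_left distrib_right single_zero_commute mult.assoc)
      moreover have "q * a \<in> relation_ideal" "s * a \<in> relation_ideal"
        using a KI relation_ideal_mult_left by blast+
      ultimately show ?thesis using add right[OF a] KE by simp
    qed
  qed
  moreover have "relators \<subseteq> K"
    using KE[of 0 0 1 0 0] KE[of 0 0 0 1 0] KE[of 0 0 0 0 1] E0
    by (auto simp: relators_def x_def y_def R_def Let_def relation_ideal_zero)
  ultimately have "p \<in> K" using relation_ideal_minimal assms(4) by blast
  then show ?thesis unfolding K_def E_def by blast
qed

text \<open>Exactness at the second term, directly from the presentation: a syzygy lifts to an
  element of the ideal, which is expanded by the relators and then cut after its first letter. The
  parts in x I and y I vanish in the quotient.\<close>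

lemma syzygies_generators:
  fixes u v :: "'k::field algA"
  assumes "xA * u + yA * v = 0"
  shows "\<exists>p q r. u = xA * yA * p + yA^3 * q + yA * RA * yA * r \<and>
    v = - (xA^2 * p) - yA^2 * xA * q - RA * yA * xA * r"
proof -
  let ?x = "free_var LX :: 'k free_algebra" and ?y = "free_var LY :: 'k free_algebra"
  let ?R = "R_of ?x ?y"
  obtain U V where U: "u = abs_algA U" and V: "v = abs_algA V" by (metis algA_cases)
  have "abs_algA (?x * U + ?y * V) = abs_algA 0"
    using assms by (simp add: U V xA_def yA_def times_algA.abs_eq plus_algA.abs_eq zero_algA_def)
  then have "?x * U + ?y * V \<in> relation_ideal" by (simp add: abs_algA_eq_iff)
  then obtain p q r i j where ij: "i \<in> relation_ideal" "j \<in> relation_ideal" and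
    "?x * U + ?y * V = commutator (?x^2) ?y * p + commutator ?x (?y^3) * q +
      commutator ?x (?y * ?R * ?y) * r + ?x * i + ?y * j"
    using relation_ideal_expand by blast
  \<comment> \<open>Each relator is written as x times one element plus y times another; these two
    elements form a column of the second matrix.\<close>
  then have eq: "?x * U + ?y * V =
    ?x * (?x * ?y * p + ?y^3 * q + ?y * ?R * ?y * r + i) +
    ?y * (- (?x^2 * p) - ?y^2 * ?x * q - ?R * ?y * ?x * r + j)"
    by (simp add: commutator_def algebra_simps power2_eq_square power3_eq_cube)
  have "U = ?x * ?y * p + ?y^3 * q + ?y * ?R * ?y * r + i"
    using arg_cong[OF eq, of "lquot LX"] by (simp add: lquot_add lquot_free_var_mult)
  moreover have "V = - (?x^2 * p) - ?y^2 * ?x * q - ?R * ?y * ?x * r + j"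
    using arg_cong[OF eq, of "lquot LY"] by (simp add: lquot_add lquot_free_var_mult)
  moreover have "abs_algA i = 0" "abs_algA j = 0"
    using ij by (simp_all add: zero_algA_def abs_algA_eq_iff)
  moreover have "abs_algA (a + b) = abs_algA a + abs_algA b" "abs_algA (a - b) = abs_algA a - abs_algA b"
    "abs_algA (- a) = - abs_algA a" "abs_algA (a * b) = abs_algA a * abs_algA b" for a b :: "'k free_algebra"
    by (simp_all add: times_algA.abs_eq plus_algA.abs_eq minus_algA.abs_eq uminus_algA.abs_eq)
  ultimately have "u = xA * yA * abs_algA p + yA^3 * abs_algA q + yA * RA * yA * abs_algA r \<and>
      v = - (xA^2 * abs_algA p) - yA^2 * xA * abs_algA q - RA * yA * xA * abs_algA r"
    by (simp add: U V xA_def yA_def RA_def power2_eq_square power3_eq_cube)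
  then show ?thesis by blast
qed

section \<open>Normal words\<close>

text \<open>Words of a given length are compared as binary numbers with \<open>x = 0\<close> and \<open>y = 1\<close>; the
  leading word of an element is the smallest one.\<close>

fun val :: "letter list \<Rightarrow> nat" where
  "val [] = 0"
| "val (LX # w) = val w"
| "val (LY # w) = 2 ^ length w + val w"

lemma val_append: "val (u @ v) = val u * 2 ^ length v + val v"
  by (induction u rule: val.induct) (auto simp: algebra_simps power_add)

lemma val_less: "val w < 2 ^ length w"
  by (induction w rule: val.induct) auto

lemma val_inj: "length u = length v \<Longrightarrow> val u = val v \<Longrightarrow> u = v"
proof (induction u v rule: list_induct2)
  case (Cons a u b v)
  then show ?case using val_less[of u] val_less[of v] by (cases a; cases b) auto
qed simp

text \<open>The four obstructions without their first letter. All of them begin with x, so a y in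
  front of a normal word keeps it normal, and normality can be decided recursively at the letters
  x.\<close>

definition bad :: "letter list \<Rightarrow> bool" where
  "bad w \<longleftrightarrow> prefix [LX,LY] w \<or> prefix [LY,LY,LY] w \<or> prefix [LY,LX,LY,LX,LY,LY] w \<or>
     prefix [LY,LX,LY,LY,LX,LY,LY] w"

fun normal :: "letter list \<Rightarrow> bool" where
  "normal [] \<longleftrightarrow> True"
| "normal (LX # w) \<longleftrightarrow> normal w \<and> \<not> bad w"
| "normal (LY # w) \<longleftrightarrow> normal w"

abbreviation "ob3 \<equiv> [LX,LX,LY]"
abbreviation "ob4 \<equiv> [LX,LY,LY,LY]"
abbreviation "ob7 \<equiv> [LX,LY,LX,LY,LX,LY,LY]"
abbreviation "ob8 \<equiv> [LX,LY,LX,LY,LY,LX,LY,LY]"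

lemma not_normal_cases:
  assumes "\<not> normal w"
  obtains u v where "w = u @ ob3 @ v" | u v where "w = u @ ob4 @ v"
    | u v where "w = u @ ob7 @ v" | u v where "w = u @ ob8 @ v"
proof -
  have "\<not> normal w \<Longrightarrow> \<exists>u ob v. ob \<in> {ob3, ob4, ob7, ob8} \<and> w = u @ ob @ v"
  proof (induction w rule: normal.induct)
    case (2 w)
    show ?case
    proof (cases "normal w")
      case True
      then have "bad w" using 2 by simp
      then consider v where "LX # w = [] @ ob3 @ v" | v where "LX # w = [] @ ob4 @ v"
        | v where "LX # w = [] @ ob7 @ v" | v where "LX # w = [] @ ob8 @ v"
        unfolding bad_def prefix_def by (elim disjE exE) simp_all
      then show ?thesis by cases (blast intro: insertI1 insertI2)+
    next
      case False
      then obtain u ob v where "ob \<in> {ob3, ob4, ob7, ob8}" "w = u @ ob @ v" using 2 by blast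
      then show ?thesis by (intro exI[of _ "LX # u"] exI[of _ ob] exI[of _ v]) simp
    qed
  next
    case (3 w)
    then obtain u ob v where "ob \<in> {ob3, ob4, ob7, ob8}" "w = u @ ob @ v" by auto
    then show ?case by (intro exI[of _ "LY # u"] exI[of _ ob] exI[of _ v]) simp
  qed simp
  then obtain u ob v where "ob = ob3 \<or> ob = ob4 \<or> ob = ob7 \<or> ob = ob8" and w: "w = u @ ob @ v"
    using assms by auto
  then show ?thesis using that(1)[of u v] that(2)[of u v] that(3)[of u v] that(4)[of u v] by (elim disjE) simp_all
qed

section \<open>The rewriting rules of the algebra\<close>

lemma abs_relator: "r \<in> relators \<Longrightarrow> abs_algA r = 0"
  using relators_in_relation_ideal by (auto simp: zero_algA_def abs_algA_eq_iff)

lemma abs_algA_ops: "abs_algA (a + b) = abs_algA a + abs_algA b" "abs_algA (a - b) = abs_algA a - abs_algA b"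
    "abs_algA (- a) = - abs_algA a" "abs_algA (a * b) = abs_algA a * abs_algA b" for a b :: "'k::field free_algebra"
  by (simp_all add: times_algA.abs_eq plus_algA.abs_eq minus_algA.abs_eq uminus_algA.abs_eq)

lemma mon_relations:
  shows "mon [LX,LX,LY] = (mon [LY,LX,LX] :: 'k::field algA)" "mon [LX,LY,LY,LY] = (mon [LY,LY,LY,LX] :: 'k algA)"
  "mon [LX,LY,LY,LX,LY,LX,LY] + mon [LX,LY,LX,LY,LY,LX,LY] + mon [LX,LY,LX,LY,LX,LY,LY] =
    (mon [LY,LY,LX,LY,LX,LY,LX] + mon [LY,LX,LY,LY,LX,LY,LX] + mon [LY,LX,LY,LX,LY,LY,LX] :: 'k algA)"
proof -
  note r = abs_relator[unfolded relators_eq]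
  show "mon [LX,LX,LY] = (mon [LY,LX,LX] :: 'k algA)"
    by (rule iffD1[OF right_minus_eq], unfold mon_def abs_algA_ops[symmetric], rule r, rule insertI1)
  show "mon [LX,LY,LY,LY] = (mon [LY,LY,LY,LX] :: 'k algA)"
    by (rule iffD1[OF right_minus_eq], unfold mon_def abs_algA_ops[symmetric], rule r, rule insertI2, rule insertI1)
  show "mon [LX,LY,LY,LX,LY,LX,LY] + mon [LX,LY,LX,LY,LY,LX,LY] + mon [LX,LY,LX,LY,LX,LY,LY] =
    (mon [LY,LY,LX,LY,LX,LY,LX] + mon [LY,LX,LY,LY,LX,LY,LX] + mon [LY,LX,LY,LX,LY,LY,LX] :: 'k algA)"
    by (rule iffD1[OF right_minus_eq], unfold mon_def abs_algA_ops[symmetric], rule r, rule insertI2, rule insertI2, rule insertI1)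
qed

text \<open>The rules carry an arbitrary right factor \<open>a\<close>, so that they rewrite inside
  products bracketed to the right.\<close>

lemma rule3: "xA * (xA * (yA * a)) = yA * (xA * (xA * a))"
  using arg_cong[OF mon_relations(1), of "\<lambda>t. t * a"]
  by (simp add: mon_append[of "[_]" "_ # _", simplified] xA_eq_mon yA_eq_mon mult.assoc)

lemma rule4: "xA * (yA * (yA * (yA * a))) = yA * (yA * (yA * (xA * a)))"
  using arg_cong[OF mon_relations(2), of "\<lambda>t. t * a"]
  by (simp add: mon_append[of "[_]" "_ # _", simplified] xA_eq_mon yA_eq_mon mult.assoc)

lemma rule7: "xA * (yA * (xA * (yA * (xA * (yA * (yA * a)))))) =
    yA * (yA * (xA * (yA * (xA * (yA * (xA * a)))))) + yA * (xA * (yA * (yA * (xA * (yA * (xA * a)))))) +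
    yA * (xA * (yA * (xA * (yA * (yA * (xA * a)))))) - xA * (yA * (yA * (xA * (yA * (xA * (yA * a)))))) -
    xA * (yA * (xA * (yA * (yA * (xA * (yA * a))))))"
  using arg_cong[OF mon_relations(3), of "\<lambda>t. t * a"]
  by (simp add: mon_append[of "[_]" "_ # _", simplified] xA_eq_mon yA_eq_mon mult.assoc distrib_right algebra_simps)

text \<open>This rule is the only S-polynomial that does not reduce to zero: it comes from the overlap
  of \<open>xyxyxyy\<close> with \<open>xyyy\<close>.\<close>

lemma rule8: "xA * (yA * (xA * (yA * (yA * (xA * (yA * (yA * a))))))) =
    yA * (yA * (xA * (yA * (xA * (yA * (xA * (yA * a))))))) + yA * (xA * (yA * (yA * (xA * (yA * (xA * (yA * a))))))) +
    yA * (xA * (yA * (xA * (yA * (yA * (xA * (yA * a))))))) - xA * (yA * (yA * (xA * (yA * (xA * (yA * (yA * a))))))) -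
    yA * (yA * (yA * (xA * (yA * (xA * (yA * (xA * a)))))))"
proof -
  have "xA * (yA * (xA * (yA * (xA * (yA * (yA * (yA * a))))))) = yA * (yA * (yA * (xA * (yA * (xA * (yA * (xA * a)))))))"
    by (simp add: rule4)
  then show ?thesis using rule7[of "yA * a"] by (simp add: algebra_simps)
qed

lemmas rewrite_rules = rule3 rule4 rule7 rule8

lemma mon_Cons_xy: "mon (LX # w) = xA * mon w" "mon (LY # w) = yA * mon w"
  by (simp_all add: xA_eq_mon yA_eq_mon flip: mon_append)

text \<open>Every rule replaces an obstruction by words of the same length and larger value, and
  values are bounded by the power of 2, so rewriting terminates. The bound
  \<open>val w \<le> val v\<close> is recorded because reduction must not disturb leading
  terms.\<close>

lemma normal_words_span:
  "mon w \<in> A.span {mon v :: 'k::field algA | v. normal v \<and> length v = length w \<and> val w \<le> val v}"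
proof (induction "2 ^ length w - val w" arbitrary: w rule: less_induct)
  case less
  let ?V = "A.span {mon v :: 'k algA | v. normal v \<and> length v = length w \<and> val w \<le> val v}"
  have up: "mon v \<in> ?V" if "length v = length w" "val w < val v" for v
  proof -
    have "(mon v :: 'k algA) \<in> A.span {mon u | u. normal u \<and> length u = length v \<and> val v \<le> val u}"
      using that val_less[of v] by (intro less.hyps) auto
    then show ?thesis
      by (rule subsetD[OF A.span_mono, rotated]) (use that in auto)
  qed
  show ?case
  proof (cases "normal w")
    case True
    then show ?thesis by (intro A.span_base) auto
  next
    case False
    then show ?thesis
    proof (cases rule: not_normal_cases)
      case (1 u v)
      have "mon w = mon (u @ [LY,LX,LX] @ v)"
        by (simp add: 1 mon_append[of u] mon_Cons_xy rewrite_rules)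
      also have "\<dots> \<in> ?V" by (rule up) (simp_all add: 1 val_append[of u])
      finally show ?thesis .
    next
      case (2 u v)
      have "mon w = mon (u @ [LY,LY,LY,LX] @ v)"
        by (simp add: 2 mon_append[of u] mon_Cons_xy rewrite_rules)
      also have "\<dots> \<in> ?V" by (rule up) (use val_less[of v] in \<open>simp_all add: 2 val_append[of u]\<close>)
      finally show ?thesis .
    next
      case (3 u v)
      have "mon w = mon (u @ [LY,LY,LX,LY,LX,LY,LX] @ v) + mon (u @ [LY,LX,LY,LY,LX,LY,LX] @ v) +
          mon (u @ [LY,LX,LY,LX,LY,LY,LX] @ v) - mon (u @ [LX,LY,LY,LX,LY,LX,LY] @ v) -
          mon (u @ [LX,LY,LX,LY,LY,LX,LY] @ v)"
        by (simp add: 3 mon_append[of u] mon_Cons_xy rule7 distrib_left right_diff_distrib)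
      also have "\<dots> \<in> ?V"
        by (intro A.span_diff A.span_add up) (use val_less[of v] in \<open>simp_all add: 3 val_append[of u]\<close>)
      finally show ?thesis .
    next
      case (4 u v)
      have "mon w = mon (u @ [LY,LY,LX,LY,LX,LY,LX,LY] @ v) + mon (u @ [LY,LX,LY,LY,LX,LY,LX,LY] @ v) +
          mon (u @ [LY,LX,LY,LX,LY,LY,LX,LY] @ v) - mon (u @ [LX,LY,LY,LX,LY,LX,LY,LY] @ v) -
          mon (u @ [LY,LY,LY,LX,LY,LX,LY,LX] @ v)"
        by (simp add: 4 mon_append[of u] mon_Cons_xy rule8 distrib_left right_diff_distrib)
      also have "\<dots> \<in> ?V"
        by (intro A.span_diff A.span_add up) (use val_less[of v] in \<open>simp_all add: 4 val_append[of u]\<close>)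
      finally show ?thesis .
    qed
  qed
qed

section \<open>The total complex and its Morse matching\<close>

text \<open>The generators of the six free modules are numbered consecutively from \<open>0\<close> to \<open>11\<close>, and
  \<open>diff\<close> is the direct sum of the five differentials.\<close>

definition gdeg :: "nat \<Rightarrow> nat" where "gdeg j = [0,1,1,3,4,7,5,8,9,11,11,12] ! j"

definition hdeg :: "nat \<Rightarrow> nat" where "hdeg j = [0,1,1,2,2,2,3,3,3,4,4,5] ! j"

definition diff :: "(nat \<Rightarrow> 'k::field algA) \<Rightarrow> nat \<Rightarrow> 'k algA" where
  "diff v r = (let x = xA; y = yA; R = RA in
    if r = 0 then x * v 1 + y * v 2
    else if r = 1 then x * y * v 3 + y^3 * v 4 + y * R * y * v 5
    else if r = 2 then - (x^2 * v 3) - y^2 * x * v 4 - R * y * x * v 5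
    else if r = 3 then y^2 * v 6 + R * y * v 7
    else if r = 4 then - (x * v 6) - y * R * v 8
    else if r = 5 then - (x * v 7) + y^2 * v 8
    else if r = 6 then - (y * R * y * v 9) + x * y * R * v 10
    else if r = 7 then y^3 * v 9 - x * y^2 * v 10
    else if r = 8 then y * x * v 9 - x^2 * v 10
    else if r = 9 then x * v 11
    else if r = 10 then y * v 11
    else 0)"

text \<open>The products of consecutive matrices expand into words that cancel after rewriting. The
  rules are identities of the algebra, so this is available before the normal words are known to be
  a basis.\<close>

lemma diff_diff: "diff (diff v) = 0"
proof
  fix r
  show "diff (diff v) r = 0 r"
    unfolding diff_def[of "diff v"] Let_def
    by (simp add: diff_def Let_def RA_eq power2_eq_square power3_eq_cube mult.assoc)
      (auto simp: distrib_left distrib_right right_diff_distrib left_diff_distrib mult.assoc rewrite_rules)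
qed

section \<open>Basis elements and linearity of the total differential\<close>

definition bas :: "nat \<Rightarrow> letter list \<Rightarrow> nat \<Rightarrow> 'k::field algA" where
  "bas j w i = (if i = j then mon w else 0)"

definition scaleF :: "'k::field \<Rightarrow> (nat \<Rightarrow> 'k algA) \<Rightarrow> nat \<Rightarrow> 'k algA" where
  "scaleF c v i = scaleA c (v i)"

interpretation F: vector_space "scaleF :: 'k::field \<Rightarrow> (nat \<Rightarrow> 'k algA) \<Rightarrow> nat \<Rightarrow> 'k algA"
  by unfold_locales
    (auto simp: scaleF_def fun_eq_iff A.scale_right_distrib A.scale_left_distrib)

lemma diff_add: "diff (u + v) = diff u + diff v"
  by (auto simp: diff_def Let_def fun_eq_iff distrib_left)

lemma diff_scale: "diff (scaleF c v) = scaleF c (diff v)"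
  by (auto simp: diff_def Let_def fun_eq_iff scaleF_def A.scale_right_distrib A.scale_right_diff_distrib
      simp flip: scaleA_mult_right)

lemma diff_zero [simp]: "diff 0 = 0"
  by (auto simp: diff_def Let_def fun_eq_iff)

lemma diff_uminus: "diff (- v) = - diff v"
  by (auto simp: diff_def Let_def fun_eq_iff)

lemma diff_minus: "diff (u - v) = diff u - diff v"
  by (metis diff_add diff_uminus diff_conv_add_uminus)

lemma diff_sum: "diff (\<Sum>i\<in>I. f i) = (\<Sum>i\<in>I. diff (f i))"
  by (induction I rule: infinite_finite_induct)
    (simp_all only: sum.insert sum.empty sum.infinite diff_add diff_zero not_False_eq_True)

text \<open>The Anick chains of the generators, which translate the comparison of basis elements of a
  free module into the comparison of words.\<close>

definition chain :: "nat \<Rightarrow> letter list" where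
  "chain j = [[], [LX], [LY], [LX,LX,LY], [LX,LY,LY,LY], [LX,LY,LX,LY,LX,LY,LY], [LX,LX,LY,LY,LY],
    [LX,LX,LY,LX,LY,LX,LY,LY], [LX,LY,LX,LY,LX,LY,LY,LY,LY], [LX,LX,LY,LX,LY,LX,LY,LY,LY,LY,LY],
    [LX,LX,LY,LX,LY,LX,LY,LY,LX,LY,LY], [LX,LX,LY,LX,LY,LX,LY,LY,LX,LY,LY,LY]] ! j"

text \<open>This is Schreyer's order: \<open>chain j\<close> is the chain of the generator in the
  leading term of the differential of the j-th generator, followed by the word there; for instance
  \<open>chain 6 = chain 3 @ [LY,LY]\<close>. In a fixed internal degree all words
  \<open>chain j @ w\<close> have the same length, so their values compare.\<close>

definition key :: "nat \<Rightarrow> letter list \<Rightarrow> nat" where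
  "key j w = val (chain j @ w)"

lemma lt12: "j < (12::nat) \<longleftrightarrow> j \<in> {0,1,2,3,4,5,6,7,8,9,10,11}"
  by (simp add: less_Suc_eq numeral_eq_Suc)

lemmas gen_simps = gdeg_def hdeg_def chain_def key_def

lemma length_chain: "j < 12 \<Longrightarrow> length (chain j) = gdeg j"
  by (auto simp: lt12 gen_simps)

lemma key_less: "j < 12 \<Longrightarrow> key j w < 2 ^ (gdeg j + length w)"
  using val_less[of "chain j @ w"] by (simp add: key_def length_chain)

text \<open>\<open>h\<close> is the homological and \<open>n\<close> the internal degree. With
  \<open>N = Suc (key j w)\<close> these are the terms strictly after a leading term at generator
  \<open>j\<close> and word \<open>w\<close>.\<close>

definition upper :: "nat \<Rightarrow> nat \<Rightarrow> nat \<Rightarrow> (nat \<Rightarrow> 'k::field algA) set" where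
  "upper h n N = F.span {bas j w | j w. j < 12 \<and> hdeg j = h \<and> gdeg j + length w = n \<and> normal w \<and> N \<le> key j w}"

lemma upper_zero: "0 \<in> upper h n N"
  and upper_add: "u \<in> upper h n N \<Longrightarrow> v \<in> upper h n N \<Longrightarrow> u + v \<in> upper h n N"
  and upper_diff: "u \<in> upper h n N \<Longrightarrow> v \<in> upper h n N \<Longrightarrow> u - v \<in> upper h n N"
  and upper_neg: "u \<in> upper h n N \<Longrightarrow> - u \<in> upper h n N"
  and upper_scale: "u \<in> upper h n N \<Longrightarrow> scaleF c u \<in> upper h n N"
  unfolding upper_def by (rule F.span_zero F.span_add F.span_diff F.span_neg F.span_scale; assumption)+

text \<open>The word need not be normal: its reduction has only words of at least the same value,
  and a common chain in front preserves the comparison.\<close>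

lemma bas_upper:
  assumes "j < 12" "hdeg j = h" "gdeg j + length w = n" "N \<le> key j w"
  shows "(bas j w :: nat \<Rightarrow> 'k::field algA) \<in> upper h n N"
proof -
  have *: "(\<lambda>i. if i = j then a else 0) \<in> upper h n N"
    if "a \<in> A.span {mon v | v. normal v \<and> length v = length w \<and> val w \<le> val v}" for a :: "'k algA"
    using that
  proof (induction rule: A.span_induct_alt)
    case base
    have "(\<lambda>i. if i = j then 0 else 0) = (0 :: nat \<Rightarrow> 'k algA)" by auto
    then show ?case by (simp only: upper_zero)
  next
    case (step c x y)
    then obtain v where v: "x = mon v" "normal v" "length v = length w" "val w \<le> val v" by auto
    have "key j w \<le> key j v" using v by (simp add: key_def val_append)
    then have "(bas j v :: nat \<Rightarrow> 'k algA) \<in> upper h n N" using assms v unfolding upper_def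
      by (intro F.span_base CollectI exI[of _ j] exI[of _ v]) simp
    moreover have "(\<lambda>i. if i = j then scaleA c x + y else 0) = scaleF c (bas j v) + (\<lambda>i. if i = j then y else 0)"
      by (auto simp: bas_def scaleF_def v fun_eq_iff)
    ultimately show ?case using step(2) by (simp only: upper_add upper_scale)
  qed
  show ?thesis using *[OF normal_words_span] by (simp add: bas_def[abs_def])
qed

lemma upper_mono: "M \<le> N \<Longrightarrow> upper h n N \<subseteq> upper h n M"
  unfolding upper_def by (rule F.span_mono, rule subsetI, elim CollectE exE conjE, intro CollectI exI conjI, assumption, simp_all)

text \<open>\<open>matched j w j' w'\<close>: the differential of a basis element with leading term \<open>e\<^sub>j w\<close> has the
  leading term \<open>e\<^sub>j\<^sub>' w'\<close>.\<close>

inductive matched :: "nat \<Rightarrow> letter list \<Rightarrow> nat \<Rightarrow> letter list \<Rightarrow> bool" where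
  m1: "normal (LX # w) \<Longrightarrow> matched (Suc 0) w 0 (LX # w)"
| m2: "normal w \<Longrightarrow> matched 2 w 0 (LY # w)"
| m3: "normal (LX # LY # w) \<Longrightarrow> matched 3 w (Suc 0) (LX # LY # w)"
| m4: "normal w \<Longrightarrow> matched 4 w (Suc 0) (LY # LY # LY # w)"
| m5: "normal (LY # LX # LY # LX # LY # LY # w) \<Longrightarrow> matched 5 w (Suc 0) (LY # LX # LY # LX # LY # LY # w)"
| m5y: "normal (LY # LX # LY # LY # LX # LY # LY # w) \<Longrightarrow>
    matched 5 (LY # w) (Suc 0) (LY # LX # LY # LY # LX # LY # LY # w)"
| m6: "normal w \<Longrightarrow> matched 6 w 3 (LY # LY # w)"
| m7: "normal (LX # LY # LX # LY # LY # w) \<Longrightarrow> matched 7 w 3 (LX # LY # LX # LY # LY # w)"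
| m7y: "normal (LX # LY # LY # LX # LY # LY # w) \<Longrightarrow> matched 7 (LY # w) 3 (LX # LY # LY # LX # LY # LY # w)"
| m7yy: "normal (LX # LY # LY # w) \<Longrightarrow> matched 7 (LY # LY # w) 5 (LX # LY # LY # w)"
| m8: "normal w \<Longrightarrow> matched 8 w 5 (LY # LY # w)"
| m9: "normal w \<Longrightarrow> matched 9 w 7 (LY # LY # LY # w)"
| m10: "normal (LX # LY # LY # w) \<Longrightarrow> matched 10 w 7 (LX # LY # LY # w)"
| m11: "normal w \<Longrightarrow> matched 11 w 10 (LY # w)"

lemma matchedD:
  assumes "matched j w j' w'"
  shows "j < 12" "j' < 12" "normal w" "normal w'" "hdeg j = Suc (hdeg j')"
    "gdeg j + length w = gdeg j' + length w'"
  using assms by (induction, auto simp: gen_simps)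

lemma matched_inj: assumes "matched i u j w" "matched i' u' j w" shows "i = i'" "u = u'"
  by (cases rule: matched.cases[OF assms(1)]; cases rule: matched.cases[OF assms(2)]; simp)+

text \<open>What may follow a given beginning: for instance, after xyxyy the letter y would complete
  xyyy and the word xyy would complete xyxyyxyy.\<close>

lemma normal_simps:
  "normal (LX # LY # LY # w) \<longleftrightarrow> normal w \<and> \<not> prefix [LY] w"
  "normal (LX # LY # LX # LY # LY # w) \<longleftrightarrow> normal w \<and> \<not> prefix [LY] w \<and> \<not> prefix [LX,LY,LY] w"
  "normal (LX # LY # LY # LX # LY # LY # w) \<longleftrightarrow> normal w \<and> \<not> prefix [LY] w"
  "normal (LX # LY # w) \<longleftrightarrow> normal w \<and> \<not> prefix [LY,LY] w \<and> \<not> prefix [LX,LY,LX,LY,LY] w \<and>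
    \<not> prefix [LX,LY,LY,LX,LY,LY] w"
  by (auto simp: bad_def)

text \<open>The combinatorial form of exactness: only the unit of the first term is unmatched. A
  word fails to be a source when the word of its target would contain an obstruction, and then its
  beginning has the shape of a target.\<close>

lemma matched_or:
  assumes "j < 12" "normal w" "(j, w) \<noteq> (0, [])"
  shows "(\<exists>j' w'. matched j w j' w') \<or> (\<exists>j' w'. matched j' w' j w)"
proof -
  have nY: "prefix [LY] u \<longleftrightarrow> (\<exists>v. u = LY # v)" for u by (auto simp: prefix_def)
  have pY: "\<not> prefix [LY] u \<or> (\<exists>v. u = LY # LY # v) \<or> (\<exists>v. u = LY # v \<and> \<not> prefix [LY] v)" for u
    unfolding nY by metis
  have pX: "\<not> prefix [LX,LY,LY] u \<or> (\<exists>v. u = LX # LY # LY # v)" for u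
    by (auto simp: prefix_def)
  have pYY: "(\<exists>v. u = LY # v) \<or> \<not> prefix [LY] u" for u
    unfolding nY by metis
  have w: "w = [] \<or> (\<exists>v. w = LX # v) \<or> (\<exists>v. w = LY # v)"
    by (metis letter.exhaust list.exhaust)
  from \<open>j < 12\<close> have j: "j = 0 \<or> j = Suc 0 \<or> j = 2 \<or> j = 3 \<or> j = 4 \<or> j = 5 \<or> j = 6 \<or> j = 7 \<or> j = 8 \<or>
    j = 9 \<or> j = 10 \<or> j = 11"
    unfolding lt12 One_nat_def by blast
  have L: ?thesis if "matched j w a b" for a b using that by blast
  have R: ?thesis if "matched a b j w" for a b using that by blast
  note aw = assms(2)
  from j consider "j = 0" | "j = Suc 0" | "j = 2" | "j = 3" | "j = 4" | "j = 5" | "j = 6" | "j = 7"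
    | "j = 8" | "j = 9" | "j = 10" | "j = 11"
    by blast
  then show ?thesis
  proof cases
    case 1
    then consider v where "w = LX # v" | v where "w = LY # v" using w assms by blast
    then show ?thesis
    proof cases
        case (1 v)
        show ?thesis by (rule R, unfold \<open>j = 0\<close> 1, rule m1) (use aw 1 in simp)
      next
        case (2 v)
        show ?thesis by (rule R, unfold \<open>j = 0\<close> 2, rule m2) (use aw 2 in simp)
    qed
  next
    case 2
    consider v where "w = LX # LY # v" | v where "w = LY # LY # LY # v"
      | v where "w = LY # LX # LY # LX # LY # LY # v" | v where "w = LY # LX # LY # LY # LX # LY # LY # v"
      | "normal (LX # w)"
      using aw unfolding bad_def prefix_def normal.simps by auto
    then show ?thesis
    proof cases
        case (1 v)
        show ?thesis by (rule R, unfold \<open>j = Suc 0\<close> 1, rule m3) (use aw 1 in simp)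
      next
        case (2 v)
        show ?thesis by (rule R, unfold \<open>j = Suc 0\<close> 2, rule m4) (use aw 2 in simp)
      next
        case (3 v)
        show ?thesis by (rule R, unfold \<open>j = Suc 0\<close> 3, rule m5) (use aw 3 in simp)
      next
        case (4 v)
        show ?thesis by (rule R, unfold \<open>j = Suc 0\<close> 4, rule m5y) (use aw 4 in simp)
      next
        case 5
        show ?thesis by (rule L, unfold \<open>j = Suc 0\<close>, rule m1, rule 5)
    qed
  next
    case 4
    consider v where "w = LY # LY # v" | v where "w = LX # LY # LX # LY # LY # v"
      | v where "w = LX # LY # LY # LX # LY # LY # v" | "normal (LX # LY # w)"
      using aw unfolding normal_simps prefix_def by auto
    then show ?thesis
    proof cases
        case (1 v)
        show ?thesis by (rule R, unfold \<open>j = 3\<close> 1, rule m6) (use aw 1 in simp)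
      next
        case (2 v)
        show ?thesis by (rule R, unfold \<open>j = 3\<close> 2, rule m7) (use aw 2 in simp)
      next
        case (3 v)
        show ?thesis by (rule R, unfold \<open>j = 3\<close> 3, rule m7y) (use aw 3 in simp)
      next
        case 4
        show ?thesis by (rule L, unfold \<open>j = 3\<close>, rule m3, rule 4)
    qed
  next
    case 6
    consider u where "w = LX # LY # LY # u" | u where "w = LY # LY # u" | u where "w = LY # u" "\<not> prefix [LY] u"
      | "\<not> prefix [LY] w" "\<not> prefix [LX,LY,LY] w"
      using pY[of w] pX[of w] by metis
    then show ?thesis
    proof cases
        case (1 u)
        show ?thesis by (rule R, unfold \<open>j = 5\<close> 1, rule m7yy) (use aw 1 in simp)
      next
        case (2 u)
        show ?thesis by (rule R, unfold \<open>j = 5\<close> 2, rule m8) (use aw 2 in simp)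
      next
        case (3 u)
        show ?thesis by (rule L, unfold \<open>j = 5\<close> 3(1), rule m5y) (use aw 3 in \<open>simp only: normal_simps(1,3) normal.simps(3) prefix_code list.distinct letter.distinct simp_thms\<close>)
      next
        case 4
        show ?thesis by (rule L, unfold \<open>j = 5\<close>, rule m5) (use aw 4 in \<open>simp only: normal.simps(3) normal_simps(2) simp_thms\<close>)
    qed
  next
    case 8
    consider u where "w = LX # LY # LY # u" | u where "w = LY # LY # LY # u" | u where "w = LY # LY # u" "\<not> prefix [LY] u"
      | u where "w = LY # u" "\<not> prefix [LY] u" | "\<not> prefix [LY] w" "\<not> prefix [LX,LY,LY] w"
      using pY[of w] pX[of w] pYY by metis
    then show ?thesis
    proof cases
        case (1 u)
        show ?thesis by (rule R, unfold \<open>j = 7\<close> 1, rule m10) (use aw 1 in simp)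
      next
        case (2 u)
        show ?thesis by (rule R, unfold \<open>j = 7\<close> 2, rule m9) (use aw 2 in simp)
      next
        case (3 u)
        show ?thesis by (rule L, unfold \<open>j = 7\<close> 3(1), rule m7yy) (use aw 3 in \<open>simp only: normal_simps(1,3) normal.simps(3) prefix_code list.distinct letter.distinct simp_thms\<close>)
      next
        case (4 u)
        show ?thesis by (rule L, unfold \<open>j = 7\<close> 4(1), rule m7y) (use aw 4 in \<open>simp only: normal_simps(1,3) normal.simps(3) prefix_code list.distinct letter.distinct simp_thms\<close>)
      next
        case 5
        show ?thesis by (rule L, unfold \<open>j = 7\<close>, rule m7) (use aw 5 in \<open>simp only: normal.simps(3) normal_simps(2) simp_thms\<close>)
    qed
  next
    case 11
    consider u where "w = LY # u" | "\<not> prefix [LY] w" unfolding nY by metis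
    then show ?thesis
    proof cases
        case (1 u)
        show ?thesis by (rule R, unfold \<open>j = 10\<close> 1, rule m11) (use aw 1 in simp)
      next
        case 2
        show ?thesis by (rule L, unfold \<open>j = 10\<close>, rule m10) (use aw 2 in \<open>simp only: normal_simps(1,3) normal.simps(3) prefix_code list.distinct letter.distinct simp_thms\<close>)
    qed
  next
    case 3
    show ?thesis by (rule L, unfold \<open>j = 2\<close>, rule m2, rule aw)
  next
    case 5
    show ?thesis by (rule L, unfold \<open>j = 4\<close>, rule m4, rule aw)
  next
    case 7
    show ?thesis by (rule L, unfold \<open>j = 6\<close>, rule m6, rule aw)
  next
    case 9
    show ?thesis by (rule L, unfold \<open>j = 8\<close>, rule m8, rule aw)
  next
    case 10
    show ?thesis by (rule L, unfold \<open>j = 9\<close>, rule m9, rule aw)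
  next
    case 12
    show ?thesis by (rule L, unfold \<open>j = 11\<close>, rule m11, rule aw)
  qed
qed

text \<open>A source at the first generator is not bad, while every target there begins with an
  obstruction that lacks its x.\<close>

lemma matched_source_not_target:
  assumes "matched (Suc 0) w 0 u" shows "\<not> matched j v (Suc 0) w"
proof
  have nb: "\<not> bad w" using assms by cases simp_all
  assume "matched j v (Suc 0) w"
  then show False by cases (use nb in \<open>simp_all add: bad_def\<close>)
qed

lemma diff_bas:
  "diff (bas (Suc 0) w) = bas 0 (LX # w)"
  "diff (bas 2 w) = bas 0 (LY # w)"
  "diff (bas 3 w) = bas (Suc 0) (LX # LY # w) - bas 2 (LX # LX # w)"
  "diff (bas 4 w) = bas (Suc 0) (LY # LY # LY # w) - bas 2 (LY # LY # LX # w)"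
  "diff (bas 5 w) = bas (Suc 0) (LY # LY # LX # LY # LX # LY # w) + bas (Suc 0) (LY # LX # LY # LY # LX # LY # w) +
    bas (Suc 0) (LY # LX # LY # LX # LY # LY # w) - bas 2 (LY # LX # LY # LX # LY # LX # w) -
    bas 2 (LX # LY # LY # LX # LY # LX # w) - bas 2 (LX # LY # LX # LY # LY # LX # w)"
  "diff (bas 6 w) = bas 3 (LY # LY # w) - bas 4 (LX # w)"
  "diff (bas 7 w) = bas 3 (LY # LX # LY # LX # LY # w) + bas 3 (LX # LY # LY # LX # LY # w) +
    bas 3 (LX # LY # LX # LY # LY # w) - bas 5 (LX # w)"
  "diff (bas 8 w) = bas 5 (LY # LY # w) - bas 4 (LY # LY # LX # LY # LX # w) -
    bas 4 (LY # LX # LY # LY # LX # w) - bas 4 (LY # LX # LY # LX # LY # w)"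
  "diff (bas 9 w) = bas 7 (LY # LY # LY # w) + bas 8 (LY # LX # w) - bas 6 (LY # LY # LX # LY # LX # LY # w) -
    bas 6 (LY # LX # LY # LY # LX # LY # w) - bas 6 (LY # LX # LY # LX # LY # LY # w)"
  "diff (bas 10 w) = bas 6 (LX # LY # LY # LX # LY # LX # w) + bas 6 (LX # LY # LX # LY # LY # LX # w) +
    bas 6 (LX # LY # LX # LY # LX # LY # w) - bas 7 (LX # LY # LY # w) - bas 8 (LX # LX # w)"
  "diff (bas 11 w) = bas 9 (LX # w) + bas 10 (LY # w)"
  by (rule ext, simp add: diff_def Let_def bas_def mon_Cons_xy RA_eq power2_eq_square power3_eq_cube mult.assoc
      distrib_left distrib_right)+

text \<open>The element y^3 is central, so it moves to the front of a word, where it makes the value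
  large.\<close>

lemma bas_y3:
  "bas j (u @ LY # LY # LY # v) = bas j (LY # LY # LY # u @ v)"
proof -
  have "mon (u @ LY # LY # LY # v) = mon (LY # LY # LY # u @ v)" for v
    by (induction u rule: val.induct) (simp_all add: mon_Cons_xy rewrite_rules)
  then show ?thesis by (simp add: bas_def fun_eq_iff)
qed

text \<open>In all cases but \<open>m7yy\<close> the basis element itself serves as
  \<open>s\<close>: the other terms of its differential have larger keys, through the chain of their
  generator or through the word. The coefficient of the leading term is 1 or -1.\<close>

lemma matched_leading:
  assumes "matched j w j' w'"
  shows "\<exists>(s :: nat \<Rightarrow> 'k::field algA) \<epsilon>. \<epsilon> \<noteq> 0 \<and> s - bas j w \<in> upper (hdeg j) (gdeg j + length w) (Suc (key j w)) \<and>
    diff s - scaleF \<epsilon> (bas j' w') \<in> upper (hdeg j') (gdeg j + length w) (Suc (key j' w'))"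
proof -
  have mono: "\<exists>(s :: nat \<Rightarrow> 'k algA) \<epsilon>. \<epsilon> \<noteq> 0 \<and> s - bas j w \<in> upper (hdeg j) (gdeg j + length w) (Suc (key j w)) \<and>
    diff s - scaleF \<epsilon> (bas j' w') \<in> upper (hdeg j') (gdeg j + length w) (Suc (key j' w'))"
    if "\<epsilon> = 1 \<or> \<epsilon> = -1" "r \<in> upper (hdeg j') (gdeg j + length w) (Suc (key j' w'))"
      "diff (bas j w) = scaleF \<epsilon> (bas j' w') + r" for \<epsilon> :: 'k and r j w j' w'
    using that by (intro exI[of _ "bas j w"] exI[of _ \<epsilon>] conjI) (auto simp: upper_zero)
  show ?thesis
    using assms
  proof induction
    case (m1 w)
    show ?case by (rule mono[where \<epsilon> = 1 and r = 0]) (simp_all add: diff_bas upper_zero)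
  next
    case (m2 w)
    show ?case by (rule mono[where \<epsilon> = 1 and r = 0]) (simp_all add: diff_bas upper_zero)
  next
    case (m3 w)
    show ?case
      by (rule mono[where \<epsilon> = "1" and r = "- bas 2 (LX # LX # w)"], simp,
        (intro upper_add upper_diff upper_neg bas_upper; use val_less[of w] in \<open>simp add: gen_simps\<close>),
        simp add: diff_bas)
  next
    case (m4 w)
    show ?case
      by (rule mono[where \<epsilon> = "1" and r = "- bas 2 (LY # LY # LX # w)"], simp,
        (intro upper_add upper_diff upper_neg bas_upper; use val_less[of w] in \<open>simp add: gen_simps\<close>),
        simp add: diff_bas)
  next
    case (m5 w)
    show ?case
      by (rule mono[where \<epsilon> = "1" and r = "bas (Suc 0) (LY # LY # LX # LY # LX # LY # w) + bas (Suc 0) (LY # LX # LY # LY # LX # LY # w) - bas 2 (LY # LX # LY # LX # LY # LX # w) - bas 2 (LX # LY # LY # LX # LY # LX # w) - bas 2 (LX # LY # LX # LY # LY # LX # w)"], simp,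
        (intro upper_add upper_diff upper_neg bas_upper; use val_less[of w] in \<open>simp add: gen_simps\<close>),
        simp add: diff_bas)
  next
    \<comment> \<open>The word that leads in case \<open>m5\<close> now contains y^3, which moves to
      the front and makes its key large, so another word takes the lead. The same happens in
      \<open>m7y\<close>.\<close>
    case (m5y w)
    show ?case
      by (rule mono[where \<epsilon> = "1" and r = "bas (Suc 0) (LY # LY # LX # LY # LX # LY # LY # w) + bas (Suc 0) (LY # LY # LY # LY # LX # LY # LX # w) - bas 2 (LY # LX # LY # LX # LY # LX # LY # w) - bas 2 (LX # LY # LY # LX # LY # LX # LY # w) - bas 2 (LX # LY # LX # LY # LY # LX # LY # w)"], simp,
        (intro upper_add upper_diff upper_neg bas_upper; use val_less[of w] in \<open>simp add: gen_simps\<close>),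
        simp add: diff_bas bas_y3[of _ "[LY,LX,LY,LX]" w, simplified])
  next
    case (m6 w)
    show ?case
      by (rule mono[where \<epsilon> = "1" and r = "- bas 4 (LX # w)"], simp,
        (intro upper_add upper_diff upper_neg bas_upper; use val_less[of w] in \<open>simp add: gen_simps\<close>),
        simp add: diff_bas)
  next
    case (m7 w)
    show ?case
      by (rule mono[where \<epsilon> = "1" and r = "bas 3 (LY # LX # LY # LX # LY # w) + bas 3 (LX # LY # LY # LX # LY # w) - bas 5 (LX # w)"], simp,
        (intro upper_add upper_diff upper_neg bas_upper; use val_less[of w] in \<open>simp add: gen_simps\<close>),
        simp add: diff_bas)
  next
    case (m7y w)
    show ?case
      by (rule mono[where \<epsilon> = "1" and r = "bas 3 (LY # LX # LY # LX # LY # LY # w) + bas 3 (LY # LY # LY # LX # LY # LX # w) - bas 5 (LX # LY # w)"], simp,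
        (intro upper_add upper_diff upper_neg bas_upper; use val_less[of w] in \<open>simp add: gen_simps\<close>),
        simp add: diff_bas bas_y3[of _ "[LX,LY,LX]" w, simplified])
  next
    case (m7yy w)
    \<comment> \<open>Once y^3 is in front, the terms at generator 3 begin with yy and are leading
      terms of differentials from generator 6. Subtracting \<open>?c\<close> cancels them; the term
      at generator 5 then leads, with coefficient -1, and the rest \<open>?r\<close> at generator 4
      has larger keys.\<close>
    let ?c = "(bas 6 (LY # LY # LX # LY # LX # w) :: nat \<Rightarrow> 'k algA) + bas 6 (LY # LX # LY # LY # LX # w) + bas 6 (LY # LX # LY # LX # LY # w)"
    let ?r = "(bas 4 (LX # LY # LY # LX # LY # LX # w) :: nat \<Rightarrow> 'k algA) + bas 4 (LX # LY # LX # LY # LY # LX # w) + bas 4 (LX # LY # LX # LY # LX # LY # w)"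
    have "?c \<in> upper 3 (gdeg 7 + length (LY # LY # w)) (Suc (key 7 (LY # LY # w)))"
      by (intro upper_add bas_upper; use val_less[of w] in \<open>simp add: gen_simps\<close>)
    then have 1: "(bas 7 (LY # LY # w) - ?c) - bas 7 (LY # LY # w) \<in>
        upper (hdeg 7) (gdeg 7 + length (LY # LY # w)) (Suc (key 7 (LY # LY # w)))"
      using upper_neg[of ?c] by (simp add: hdeg_def)
    have 2: "diff (bas 7 (LY # LY # w) - ?c) - scaleF (-1) (bas 5 (LX # LY # LY # w)) = ?r"
      by (simp add: diff_minus diff_add diff_bas bas_y3[of _ "[LY,LX,LY,LX]" w, simplified]
        bas_y3[of _ "[LX,LY,LY,LX]" w, simplified]
        bas_y3[of _ "[LX,LY,LX]" "LY # w", simplified])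
    have 3: "?r \<in> upper (hdeg 5) (gdeg 7 + length (LY # LY # w)) (Suc (key 5 (LX # LY # LY # w)))"
      by (intro upper_add bas_upper; use val_less[of w] in \<open>simp add: gen_simps\<close>)
    show ?case
      by (rule exI[of _ "bas 7 (LY # LY # w) - ?c"], rule exI[of _ "-1"], intro conjI)
        (simp, rule 1, subst 2, rule 3)
  next
    case (m8 w)
    show ?case
      by (rule mono[where \<epsilon> = "1" and r = "- bas 4 (LY # LY # LX # LY # LX # w) - bas 4 (LY # LX # LY # LY # LX # w) - bas 4 (LY # LX # LY # LX # LY # w)"], simp,
        (intro upper_add upper_diff upper_neg bas_upper; use val_less[of w] in \<open>simp add: gen_simps\<close>),
        simp add: diff_bas)
  next
    case (m9 w)
    show ?case
      by (rule mono[where \<epsilon> = "1" and r = "bas 8 (LY # LX # w) - bas 6 (LY # LY # LX # LY # LX # LY # w) - bas 6 (LY # LX # LY # LY # LX # LY # w) - bas 6 (LY # LX # LY # LX # LY # LY # w)"], simp,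
        (intro upper_add upper_diff upper_neg bas_upper; use val_less[of w] in \<open>simp add: gen_simps\<close>),
        simp add: diff_bas)
  next
    case (m10 w)
    show ?case
      by (rule mono[where \<epsilon> = "-1" and r = "bas 6 (LX # LY # LY # LX # LY # LX # w) + bas 6 (LX # LY # LX # LY # LY # LX # w) + bas 6 (LX # LY # LX # LY # LX # LY # w) - bas 8 (LX # LX # w)"], simp,
        (intro upper_add upper_diff upper_neg bas_upper; use val_less[of w] in \<open>simp add: gen_simps\<close>),
        simp add: diff_bas)
  next
    case (m11 w)
    show ?case
      by (rule mono[where \<epsilon> = "1" and r = "bas 9 (LX # w)"], simp,
        (intro upper_add upper_diff upper_neg bas_upper; use val_less[of w] in \<open>simp add: gen_simps\<close>),
        simp add: diff_bas)
  qed
qed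

section \<open>Linear independence of the normal words and exactness\<close>

definition lead :: "nat \<Rightarrow> letter list \<Rightarrow> nat \<Rightarrow> letter list \<Rightarrow> nat \<Rightarrow> 'k::field algA" where
  "lead j w j' w' = (SOME s. \<exists>\<epsilon>. \<epsilon> \<noteq> 0 \<and>
    s - bas j w \<in> upper (hdeg j) (gdeg j + length w) (Suc (key j w)) \<and>
    diff s - scaleF \<epsilon> (bas j' w') \<in> upper (hdeg j') (gdeg j + length w) (Suc (key j' w')))"

lemma lead:
  assumes "matched j w j' w'"
  shows "\<exists>\<epsilon>. \<epsilon> \<noteq> (0 :: 'k::field) \<and>
    (lead j w j' w' :: nat \<Rightarrow> 'k algA) - bas j w \<in> upper (hdeg j) (gdeg j + length w) (Suc (key j w)) \<and>
    diff (lead j w j' w' :: nat \<Rightarrow> 'k algA) - scaleF \<epsilon> (bas j' w') \<in> upper (hdeg j') (gdeg j + length w) (Suc (key j' w'))"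
  unfolding lead_def by (rule someI_ex[OF matched_leading[OF assms]])

lemma lead_upper:
  assumes "matched j w j' w'"
  shows "(lead j w j' w' :: nat \<Rightarrow> 'k::field algA) \<in> upper (hdeg j) (gdeg j + length w) 0"
proof -
  have "(lead j w j' w' :: nat \<Rightarrow> 'k algA) - bas j w \<in> upper (hdeg j) (gdeg j + length w) 0"
    using lead[OF assms] upper_mono[of 0 "Suc (key j w)"] by blast
  moreover have "(bas j w :: nat \<Rightarrow> 'k algA) \<in> upper (hdeg j) (gdeg j + length w) 0"
    using matchedD[OF assms] by (intro bas_upper) auto
  ultimately have "(lead j w j' w' :: nat \<Rightarrow> 'k algA) - bas j w + bas j w \<in> upper (hdeg j) (gdeg j + length w) 0"
    by (rule upper_add)
  then show ?thesis by simp
qed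

section \<open>Reduction of chains modulo boundaries\<close>

definition sources :: "nat \<Rightarrow> nat \<Rightarrow> (nat \<times> letter list \<times> nat \<times> letter list) set" where
  "sources h n = {(j, w, j', w') | j w j' w'. matched j w j' w' \<and> hdeg j = h \<and> gdeg j + length w = n}"

definition lead4 :: "nat \<times> letter list \<times> nat \<times> letter list \<Rightarrow> nat \<Rightarrow> 'k::field algA" where
  "lead4 = (\<lambda>(j, w, j', w'). lead j w j' w')"

definition span_lead :: "nat \<Rightarrow> nat \<Rightarrow> (nat \<Rightarrow> 'k::field algA) set" where
  "span_lead h n = F.span (lead4 ` sources h n)"

definition reach :: "nat \<Rightarrow> nat \<Rightarrow> (nat \<Rightarrow> 'k::field algA) set" where
  "reach h n = {s + diff u | s u. s \<in> span_lead h n \<and> u \<in> upper (Suc h) n 0}"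

lemma reachI: "s \<in> span_lead h n \<Longrightarrow> u \<in> upper (Suc h) n 0 \<Longrightarrow> s + diff u \<in> reach h n"
  unfolding reach_def by blast

lemma subspace_reach: "F.subspace (reach h n :: (nat \<Rightarrow> 'k::field algA) set)"
proof (rule F.subspaceI)
  show "0 \<in> (reach h n :: (nat \<Rightarrow> 'k algA) set)"
    using reachI[of 0 h n 0] by (simp add: span_lead_def F.span_zero upper_zero)
  fix x y :: "nat \<Rightarrow> 'k algA" and c :: 'k
  assume "x \<in> reach h n"
  then obtain s u where x: "x = s + diff u" "s \<in> span_lead h n" "u \<in> upper (Suc h) n 0"
    unfolding reach_def by blast
  have "scaleF c s + diff (scaleF c u) \<in> reach h n"
    by (intro reachI upper_scale x) (use x in \<open>simp add: span_lead_def F.span_scale\<close>)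
  then show "scaleF c x \<in> reach h n" by (simp add: x diff_scale F.scale_right_distrib)
  assume "y \<in> reach h n"
  then obtain t v where y: "y = t + diff v" "t \<in> span_lead h n" "v \<in> upper (Suc h) n 0"
    unfolding reach_def by blast
  have "(s + t) + diff (u + v) \<in> reach h n"
    by (intro reachI upper_add x y) (use x y in \<open>simp add: span_lead_def F.span_add\<close>)
  then show "x + y \<in> reach h n" by (simp only: x y diff_add add_ac)
qed

lemma upper_subset_reach:
  assumes "\<And>j w. j < 12 \<Longrightarrow> hdeg j = h \<Longrightarrow> gdeg j + length w = n \<Longrightarrow> normal w \<Longrightarrow> N \<le> key j w \<Longrightarrow>
    bas j w \<in> (reach h n :: (nat \<Rightarrow> 'k::field algA) set)"
  shows "upper h n N \<subseteq> (reach h n :: (nat \<Rightarrow> 'k::field algA) set)"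
  unfolding upper_def
proof (rule F.span_minimal[OF _ subspace_reach], rule subsetI)
  fix x :: "nat \<Rightarrow> 'k algA"
  assume "x \<in> {bas j w |j w. j < 12 \<and> hdeg j = h \<and> gdeg j + length w = n \<and> normal w \<and> N \<le> key j w}"
  then obtain j w where "x = bas j w" "j < 12" "hdeg j = h" "gdeg j + length w = n" "normal w" "N \<le> key j w"
    by blast
  then show "x \<in> reach h n" using assms by simp
qed

lemma hdeg_eq_0: "j < 12 \<Longrightarrow> hdeg j = 0 \<Longrightarrow> j = 0"
  unfolding lt12 by (auto simp: hdeg_def)

text \<open>Induction from large keys downwards. At a source the chosen element differs from the
  basis element by terms with larger keys; at a target the differential of the chosen element does
  so, up to a nonzero scalar. This rests on the spanning property of the normal words alone, so it
  can serve in the proof of their independence.\<close>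

lemma bas_reach:
  assumes "j < 12" "normal w" "(j, w) \<noteq> (0, [])"
  shows "(bas j w :: nat \<Rightarrow> 'k::field algA) \<in> reach (hdeg j) (gdeg j + length w)"
  using assms
proof (induction "2 ^ (gdeg j + length w) - key j w" arbitrary: j w rule: less_induct)
  case less
  let ?h = "hdeg j" and ?n = "gdeg j + length w"
  let ?Q = "reach ?h ?n :: (nat \<Rightarrow> 'k algA) set"
  have up: "upper ?h ?n (Suc (key j w)) \<subseteq> ?Q"
  proof (rule upper_subset_reach)
    fix i v assume iv: "i < 12" "hdeg i = ?h" "gdeg i + length v = ?n" "normal v" "Suc (key j w) \<le> key i v"
    have "(i, v) \<noteq> (0, [])"
    proof
      assume 0: "(i, v) = (0, [])"
      then have "hdeg j = 0" "gdeg j + length w = 0"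
        using iv(2,3) by (simp_all add: hdeg_def[of 0] gdeg_def[of 0])
      then have "j = 0" "w = []" using hdeg_eq_0 less.prems(1) by auto
      then show False using less.prems(3) by simp
    qed
    moreover have "key i v < 2 ^ ?n" using key_less[OF iv(1), of v] iv by simp
    ultimately have "(bas i v :: nat \<Rightarrow> 'k algA) \<in> reach (hdeg i) (gdeg i + length v)"
      using iv(1,3,4,5) by (intro less.hyps) simp_all
    then show "(bas i v :: nat \<Rightarrow> 'k algA) \<in> ?Q" using iv by simp
  qed
  note Q = F.subspace_diff[OF subspace_reach] F.subspace_scale[OF subspace_reach]
  consider j' w' where "matched j w j' w'" | j' w' where "matched j' w' j w"
    using matched_or[OF less.prems] by blast
  then show ?case
  proof cases
    case (1 j' w')
    have "lead4 (j, w, j', w') + diff 0 \<in> ?Q"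
      by (rule reachI) (use 1 in \<open>auto simp: span_lead_def sources_def upper_zero intro!: F.span_base\<close>)
    then have l: "lead j w j' w' \<in> ?Q" by (simp add: lead4_def)
    have "lead j w j' w' - bas j w \<in> ?Q" using lead[OF 1] up by blast
    from Q(1)[OF l this] show ?thesis by simp
  next
    case (2 j' w')
    note m = matchedD[OF 2]
    have l: "(lead j' w' j w :: nat \<Rightarrow> 'k algA) \<in> upper (Suc ?h) ?n 0" using lead_upper[OF 2] m by simp
    have "0 + diff (lead j' w' j w :: nat \<Rightarrow> 'k algA) \<in> ?Q"
      by (rule reachI[OF _ l]) (simp add: span_lead_def F.span_zero)
    then have d: "diff (lead j' w' j w :: nat \<Rightarrow> 'k algA) \<in> ?Q" by simp
    obtain \<epsilon> :: 'k where e: "\<epsilon> \<noteq> 0" "diff (lead j' w' j w) - scaleF \<epsilon> (bas j w) \<in> ?Q"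
      using lead[OF 2, where ?'k = 'k] subsetD[OF up] unfolding m(6) by blast
    from Q(1)[OF d e(2)] have "scaleF \<epsilon> (bas j w) \<in> ?Q" by simp
    from Q(2)[OF this, of "inverse \<epsilon>"] show ?thesis using e(1) by simp
  qed
qed

lemma upper_reach:
  assumes "(h, n) \<noteq> (0, 0)" "(v :: nat \<Rightarrow> 'a::field algA) \<in> upper h n 0"
  obtains s u where "v = s + diff u" "s \<in> span_lead h n" "u \<in> upper (Suc h) n 0"
proof -
  have "upper h n 0 \<subseteq> (reach h n :: (nat \<Rightarrow> 'a algA) set)"
  proof (rule upper_subset_reach)
    fix j w assume j: "j < 12" "hdeg j = h" "gdeg j + length w = n" "normal w"
    have "(j, w) \<noteq> (0, [])"
    proof
      assume "(j, w) = (0, [])"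
      then have "h = 0 \<and> n = 0" using j(2,3) by (simp add: gdeg_def hdeg_def)
      then show False using assms(1) by simp
    qed
    then show "(bas j w :: nat \<Rightarrow> 'a algA) \<in> reach h n" using bas_reach[OF j(1,4)] j by auto
  qed
  then have "v \<in> reach h n" using assms(2) by (rule subsetD)
  then show ?thesis unfolding reach_def using that by auto
qed

section \<open>Independence in the free modules and triangular families\<close>

definition normal_words :: "nat \<Rightarrow> letter list set" where
  "normal_words n = {w. normal w \<and> length w = n}"

lemma finite_words: "finite {w :: letter list. length w = n}"
proof -
  have "finite {w. set w \<subseteq> {LX, LY} \<and> length w = n}" by (rule finite_lists_length_eq) simp
  moreover have "{w. set w \<subseteq> {LX, LY} \<and> length w = n} = {w. length w = n}"
    using letter.exhaust by blast
  ultimately show ?thesis by simp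
qed

lemma finite_normal_words: "finite (normal_words n)"
  unfolding normal_words_def by (rule finite_subset[OF _ finite_words[of n]]) auto

definition cell :: "nat \<Rightarrow> nat \<Rightarrow> (nat \<times> letter list) set" where
  "cell h n = {(j, w). j < 12 \<and> hdeg j = h \<and> gdeg j + length w = n \<and> normal w}"

lemma cell_eq: "cell h n = Sigma {j. j < 12 \<and> hdeg j = h \<and> gdeg j \<le> n} (\<lambda>j. normal_words (n - gdeg j))"
  by (auto simp: cell_def normal_words_def)

lemma finite_cell: "finite (cell h n)"
  unfolding cell_eq by (intro finite_SigmaI finite_normal_words) auto

definition bas2 :: "nat \<times> letter list \<Rightarrow> nat \<Rightarrow> 'k::field algA" where
  "bas2 = (\<lambda>(j, w). bas j w)"

lemma sum_fun_apply: "(\<Sum>t\<in>T. f t) i = (\<Sum>t\<in>T. f t i)" for f :: "'t \<Rightarrow> nat \<Rightarrow> 'a::comm_monoid_add"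
  by (induction T rule: infinite_finite_induct) auto

lemma lincomb_cell:
  "(\<Sum>t\<in>cell h n. scaleF (c t) (bas2 t)) i =
    (if i < 12 \<and> hdeg i = h \<and> gdeg i \<le> n then \<Sum>w\<in>normal_words (n - gdeg i). scaleA (c (i, w)) (mon w) else 0)"
proof -
  let ?J = "{j. j < 12 \<and> hdeg j = h \<and> gdeg j \<le> n}"
  have "(\<Sum>t\<in>cell h n. scaleF (c t) (bas2 t)) i =
    (\<Sum>j\<in>?J. \<Sum>w\<in>normal_words (n - gdeg j). scaleF (c (j, w)) (bas j w) i)"
    unfolding cell_eq sum_fun_apply by (subst sum.Sigma) (auto simp: finite_normal_words bas2_def split_def)
  also have "\<dots> = (\<Sum>j\<in>?J. if j = i then \<Sum>w\<in>normal_words (n - gdeg i). scaleA (c (i, w)) (mon w) else 0)"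
    by (intro sum.cong) (auto simp: scaleF_def bas_def)
  also have "\<dots> = (if i \<in> ?J then \<Sum>w\<in>normal_words (n - gdeg i). scaleA (c (i, w)) (mon w) else 0)"
    by (subst sum.delta) auto
  finally show ?thesis by simp
qed

text \<open>Coefficients are indexed by words and not by elements of the algebra, so the condition
  also says that different normal words give different elements.\<close>

definition indep_degree :: "'k::field itself \<Rightarrow> nat \<Rightarrow> bool" where
  "indep_degree _ n \<longleftrightarrow> (\<forall>c :: letter list \<Rightarrow> 'k. (\<Sum>w\<in>normal_words n. scaleA (c w) (mon w)) = 0 \<longrightarrow>
    (\<forall>w\<in>normal_words n. c w = 0))"

lemma indep_cell:
  assumes "\<And>j. j < 12 \<Longrightarrow> hdeg j = h \<Longrightarrow> gdeg j \<le> n \<Longrightarrow> indep_degree TYPE('k::field) (n - gdeg j)"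
    and "(\<Sum>t\<in>cell h n. scaleF (c t :: 'k) (bas2 t)) = 0" "t \<in> cell h n"
  shows "c t = 0"
proof -
  obtain j w where t: "t = (j, w)" by force
  with assms(3) have jw: "j < 12" "hdeg j = h" "gdeg j \<le> n" "w \<in> normal_words (n - gdeg j)"
    unfolding cell_eq by auto
  have "(\<Sum>w\<in>normal_words (n - gdeg j). scaleA (c (j, w)) (mon w)) = 0"
    using fun_cong[OF assms(2), of j] jw unfolding lincomb_cell by simp
  then show ?thesis
    using assms(1)[OF jw(1-3), unfolded indep_degree_def, rule_format, of "\<lambda>w. c (j, w)"] jw(4) by (simp add: t)
qed

lemma span_expand:
  assumes "v \<in> F.span (E ` T)" "T \<subseteq> N" "finite N"
  shows "\<exists>a. (\<forall>t. t \<notin> T \<longrightarrow> a t = 0) \<and> v = (\<Sum>t\<in>N. scaleF (a t) (E t))"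
  using assms(1)
proof (induction rule: F.span_induct_alt)
  case base
  show ?case by (rule exI[of _ "\<lambda>_. 0"]) simp
next
  case (step c x y)
  then obtain a t where a: "\<forall>t. t \<notin> T \<longrightarrow> a t = 0" "y = (\<Sum>t\<in>N. scaleF (a t) (E t))" and t: "t \<in> T" "x = E t"
    by blast
  have "(\<Sum>s\<in>N. scaleF (a s + (if s = t then c else 0)) (E s)) = y + (\<Sum>s\<in>N. if s = t then scaleF c (E s) else 0)"
    unfolding a(2) sum.distrib[symmetric] by (intro sum.cong) (auto simp: F.scale_left_distrib)
  also have "(\<Sum>s\<in>N. if s = t then scaleF c (E s) else 0) = scaleF c x"
    using t assms by (subst sum.delta) auto
  finally show ?case using a t
    by (intro exI[of _ "\<lambda>s. a s + (if s = t then c else 0)"]) (auto simp: add.commute)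
qed

text \<open>Elements \<open>g s\<close> with distinct leading positions \<open>\<mu> s\<close> are
  independent even modulo a combination \<open>b\<close> that avoids all these positions: at the
  lowest leading position with nonzero coefficient only one element contributes.\<close>

lemma triangular:
  fixes E :: "'t \<Rightarrow> nat \<Rightarrow> 'k::field algA" and K :: "'t \<Rightarrow> nat"
  assumes N: "finite N" "\<And>c t. (\<Sum>t\<in>N. scaleF (c t) (E t)) = 0 \<Longrightarrow> t \<in> N \<Longrightarrow> c t = 0" "inj_on K N"
    and S: "finite S" "\<mu> ` S \<subseteq> N" "inj_on \<mu> S"
    and g: "\<And>s. s \<in> S \<Longrightarrow> \<exists>\<epsilon>. \<epsilon> \<noteq> 0 \<and> g s - scaleF \<epsilon> (E (\<mu> s)) \<in> F.span (E ` {t\<in>N. K (\<mu> s) < K t})"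
    and eq: "(\<Sum>s\<in>S. scaleF (c s) (g s)) = (\<Sum>t\<in>N. scaleF (b t) (E t))" "\<And>s. s \<in> S \<Longrightarrow> b (\<mu> s) = 0"
  shows "\<forall>s\<in>S. c s = 0"
proof -
  have "\<exists>\<rho>. \<rho> (\<mu> s) \<noteq> 0 \<and> (\<forall>t\<in>N. K t < K (\<mu> s) \<longrightarrow> \<rho> t = 0) \<and> g s = (\<Sum>t\<in>N. scaleF (\<rho> t) (E t))"
    if s: "s \<in> S" for s
  proof -
    obtain \<epsilon> where e: "\<epsilon> \<noteq> 0" "g s - scaleF \<epsilon> (E (\<mu> s)) \<in> F.span (E ` {t\<in>N. K (\<mu> s) < K t})"
      using g[OF s] by blast
    then obtain a where a: "\<forall>t. t \<notin> {t\<in>N. K (\<mu> s) < K t} \<longrightarrow> a t = 0"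
        "g s - scaleF \<epsilon> (E (\<mu> s)) = (\<Sum>t\<in>N. scaleF (a t) (E t))"
      using span_expand[OF e(2) _ N(1)] by blast
    define \<rho> where "\<rho> t = a t + (if t = \<mu> s then \<epsilon> else 0)" for t
    have "(\<Sum>t\<in>N. scaleF (\<rho> t) (E t)) = (\<Sum>t\<in>N. scaleF (a t) (E t)) + (\<Sum>t\<in>N. if t = \<mu> s then scaleF \<epsilon> (E t) else 0)"
      unfolding sum.distrib[symmetric] \<rho>_def by (intro sum.cong) (auto simp: F.scale_left_distrib)
    also have "(\<Sum>t\<in>N. if t = \<mu> s then scaleF \<epsilon> (E t) else 0) = scaleF \<epsilon> (E (\<mu> s))"
      using N(1) S(2) s by (subst sum.delta) auto
    finally have "g s = (\<Sum>t\<in>N. scaleF (\<rho> t) (E t))" by (simp add: a(2)[symmetric])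
    moreover have "\<rho> (\<mu> s) \<noteq> 0" "\<forall>t\<in>N. K t < K (\<mu> s) \<longrightarrow> \<rho> t = 0"
      using a(1) e(1) by (auto simp: \<rho>_def)
    ultimately show ?thesis by blast
  qed
  then obtain \<rho> where \<rho>: "\<And>s. s \<in> S \<Longrightarrow> \<rho> s (\<mu> s) \<noteq> 0"
      "\<And>s t. s \<in> S \<Longrightarrow> t \<in> N \<Longrightarrow> K t < K (\<mu> s) \<Longrightarrow> \<rho> s t = 0"
      "\<And>s. s \<in> S \<Longrightarrow> g s = (\<Sum>t\<in>N. scaleF (\<rho> s t) (E t))"
    by metis
  have "(\<Sum>t\<in>N. scaleF ((\<Sum>s\<in>S. c s * \<rho> s t) - b t) (E t)) =
      (\<Sum>t\<in>N. \<Sum>s\<in>S. scaleF (c s) (scaleF (\<rho> s t) (E t))) - (\<Sum>t\<in>N. scaleF (b t) (E t))"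
    by (simp add: F.scale_left_diff_distrib F.scale_sum_left sum_subtractf)
  also have "(\<Sum>t\<in>N. \<Sum>s\<in>S. scaleF (c s) (scaleF (\<rho> s t) (E t))) = (\<Sum>s\<in>S. scaleF (c s) (g s))"
    by (subst sum.swap) (simp only: \<rho>(3) F.scale_sum_right[symmetric] cong: sum.cong)
  finally have "(\<Sum>t\<in>N. scaleF ((\<Sum>s\<in>S. c s * \<rho> s t) - b t) (E t)) = 0" by (simp only: eq(1) diff_self)
  from N(2)[OF this] have z: "(\<Sum>s\<in>S. c s * \<rho> s t) = b t" if "t \<in> N" for t using that by simp
  show ?thesis
  proof (rule ccontr)
    assume "\<not> (\<forall>s\<in>S. c s = 0)"
    then have "{s\<in>S. c s \<noteq> 0} \<noteq> {}" "finite {s\<in>S. c s \<noteq> 0}" using S(1) by auto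
    \<comment> \<open>The minimum is taken over leading positions; as \<open>K\<close> and
      \<open>\<mu>\<close> are injective, every other element with nonzero coefficient starts
      strictly later.\<close>
    then obtain s0 where s0: "s0 \<in> S" "c s0 \<noteq> 0" "\<And>s. s \<in> S \<Longrightarrow> c s \<noteq> 0 \<Longrightarrow> K (\<mu> s0) \<le> K (\<mu> s)"
      using ex_min_if_finite[of "(\<lambda>s. K (\<mu> s)) ` {s\<in>S. c s \<noteq> 0}"] by (auto simp: not_less)
    have "(\<Sum>s\<in>S. c s * \<rho> s (\<mu> s0)) = (\<Sum>s\<in>S. if s = s0 then c s0 * \<rho> s0 (\<mu> s0) else 0)"
    proof (rule sum.cong[OF refl])
      fix s assume s: "s \<in> S"
      show "c s * \<rho> s (\<mu> s0) = (if s = s0 then c s0 * \<rho> s0 (\<mu> s0) else 0)"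
      proof (cases "s = s0 \<or> c s = 0")
        case False
        then have "K (\<mu> s0) < K (\<mu> s)"
          using s0(3)[OF s] s0(1) s N(3) S(2,3) by (metis image_subset_iff inj_on_eq_iff le_neq_implies_less)
        then show ?thesis using \<rho>(2)[OF s] s0(1) S(2) False by auto
      qed auto
    qed
    also have "\<dots> = c s0 * \<rho> s0 (\<mu> s0)" using S(1) s0(1) by (subst sum.delta) auto
    finally show False using z[of "\<mu> s0"] s0 S(2) eq(2) \<rho>(1) by auto
  qed
qed

text \<open>In one homological degree no chain is a proper prefix of another, so the word
  \<open>chain j @ w\<close> determines both parts.\<close>

lemma key_inj: "inj_on (\<lambda>(j, w). key j w) (cell h n)"
proof (rule inj_onI, clarify)
  fix i u j w assume "(i, u) \<in> cell h n" "(j, w) \<in> cell h n" "key i u = key j w"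
  then have c: "i < 12" "j < 12" "hdeg i = hdeg j" "gdeg i + length u = gdeg j + length w"
    and k: "key i u = key j w" by (auto simp: cell_def)
  then have e: "chain i @ u = chain j @ w"
    by (intro val_inj) (simp_all add: length_chain key_def)
  have "i = j"
  proof (rule ccontr)
    assume "i \<noteq> j"
    with c(1,2,3) e show False unfolding lt12 by (auto simp: hdeg_def chain_def)
  qed
  then show "i = j \<and> u = w" using e by simp
qed

lemma upper_eq_span: "upper h n N = F.span (bas2 ` {t \<in> cell h n. N \<le> case_prod key t})"
proof -
  have "{bas j w | j w. j < 12 \<and> hdeg j = h \<and> gdeg j + length w = n \<and> normal w \<and> N \<le> key j w} =
    (bas2 ` {t \<in> cell h n. N \<le> case_prod key t} :: (nat \<Rightarrow> 'a algA) set)" (is "?A = ?B")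
  proof
    show "?A \<subseteq> ?B"
    proof
      fix x assume "x \<in> ?A"
      then obtain j w where "x = bas2 (j, w)" "(j, w) \<in> {t \<in> cell h n. N \<le> case_prod key t}"
        by (auto simp: cell_def bas2_def)
      then show "x \<in> ?B" by (rule image_eqI)
    qed
    show "?B \<subseteq> ?A" by (auto simp: cell_def bas2_def)
  qed
  then show ?thesis by (simp add: upper_def)
qed

lemma sources_target: "s \<in> sources (Suc h) n \<Longrightarrow> snd (snd s) \<in> cell h n"
  by (auto simp: sources_def cell_def dest: matchedD)

lemma finite_sources: "finite (sources (Suc h) n)"
proof (rule finite_subset)
  show "sources (Suc h) n \<subseteq> (\<lambda>(t, u). (fst t, snd t, u)) ` (cell (Suc h) n \<times> cell h n)"
  proof
    fix s assume s: "s \<in> sources (Suc h) n"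
    then have "(fst s, fst (snd s)) \<in> cell (Suc h) n" by (auto simp: sources_def cell_def dest: matchedD)
    then show "s \<in> (\<lambda>(t, u). (fst t, snd t, u)) ` (cell (Suc h) n \<times> cell h n)"
      using sources_target[OF s] by (intro image_eqI[of _ _ "((fst s, fst (snd s)), snd (snd s))"]) auto
  qed
qed (simp add: finite_cell)

text \<open>For \<open>b = 0\<close>: no nonzero combination of chosen elements is a cycle, which
  gives exactness. General \<open>b\<close> serves the independence proof, where the differential is
  only known to avoid all targets. Independence enters just in the degrees \<open>n - gdeg j\<close>
  with \<open>j\<close> of homological degree \<open>h\<close>.\<close>

lemma span_lead_triangular:
  fixes v :: "nat \<Rightarrow> 'k::field algA"
  assumes indep: "\<And>j. j < 12 \<Longrightarrow> hdeg j = h \<Longrightarrow> gdeg j \<le> n \<Longrightarrow> indep_degree TYPE('k) (n - gdeg j)"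
    and v: "v \<in> span_lead (Suc h) n"
    and eq: "diff v = (\<Sum>t\<in>cell h n. scaleF (b t) (bas2 t))" "\<And>s. s \<in> sources (Suc h) n \<Longrightarrow> b (snd (snd s)) = 0"
  shows "v = 0"
proof -
  obtain a where a: "v = (\<Sum>s\<in>sources (Suc h) n. scaleF (a s) (lead4 s))"
    using span_expand[OF v[unfolded span_lead_def] order_refl finite_sources] by blast
  have "\<forall>s\<in>sources (Suc h) n. a s = 0"
  proof (rule triangular[where N = "cell h n" and E = bas2 and K = "case_prod key" and \<mu> = "\<lambda>s. snd (snd s)"
        and b = b and g = "\<lambda>s. diff (lead4 s)"])
    show "c t = 0" if "(\<Sum>t\<in>cell h n. scaleF (c t :: 'k) (bas2 t)) = 0" "t \<in> cell h n" for c t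
      using indep_cell[OF indep that] by simp
    show "inj_on (\<lambda>s. snd (snd s)) (sources (Suc h) n)"
      by (rule inj_onI) (auto simp: sources_def dest: matched_inj)
    show "(\<lambda>s. snd (snd s)) ` sources (Suc h) n \<subseteq> cell h n" using sources_target by blast
    show "\<exists>\<epsilon>. \<epsilon> \<noteq> 0 \<and> diff (lead4 s) - scaleF (\<epsilon> :: 'k) (bas2 (snd (snd s))) \<in>
        F.span (bas2 ` {t \<in> cell h n. case_prod key (snd (snd s)) < case_prod key t})"
      if s: "s \<in> sources (Suc h) n" for s
    proof -
      obtain j w j' w' where q: "s = (j, w, j', w')" "matched j w j' w'" "hdeg j = Suc h" "gdeg j + length w = n"
        using s by (auto simp: sources_def)
      then have "hdeg j' = h" using matchedD(5)[OF q(2)] by simp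
      then show ?thesis using lead[OF q(2), where ?'k = 'k] q(4)
        unfolding q(1) upper_eq_span by (auto simp: lead4_def bas2_def Suc_le_eq)
    qed
    show "(\<Sum>s\<in>sources (Suc h) n. scaleF (a s) (diff (lead4 s))) = (\<Sum>t\<in>cell h n. scaleF (b t) (bas2 t))"
      unfolding eq(1)[symmetric] a diff_sum diff_scale ..
  qed (use finite_cell key_inj finite_sources eq in auto)
  then show ?thesis unfolding a by (intro sum.neutral) simp
qed

section \<open>Homogeneous components of the total complex\<close>

definition hom_part :: "nat \<Rightarrow> (nat \<Rightarrow> 'k::field algA) \<Rightarrow> nat \<Rightarrow> 'k algA" where
  "hom_part n v i = (if i < 12 \<and> gdeg i \<le> n then projA (n - gdeg i) (v i) else 0)"

lemma grade_gens: "xA \<in> gradeA (Suc 0)" "yA \<in> gradeA (Suc 0)" "RA \<in> gradeA 4"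
  unfolding xA_eq_mon yA_eq_mon RA_eq_mon
  using mon_in_gradeA[of "[LX]"] mon_in_gradeA[of "[LY]"] mon_in_gradeA[of "[LY,LX,LY,LX]"]
    mon_in_gradeA[of "[LX,LY,LY,LX]"] mon_in_gradeA[of "[LX,LY,LX,LY]"]
  by (auto intro!: A.subspace_add[OF subspace_gradeA] simp: numeral_eq_Suc)

lemma projA_gens:
  "projA n (xA * a) = (if 1 \<le> n then xA * projA (n - 1) a else 0)"
  "projA n (yA * a) = (if 1 \<le> n then yA * projA (n - 1) a else 0)"
  "projA n (RA * a) = (if 4 \<le> n then RA * projA (n - 4) a else 0)"
  by (simp_all add: projA_mult_left[OF grade_gens(1)] projA_mult_left[OF grade_gens(2)]
      projA_mult_left[OF grade_gens(3)])

lemma hom_part_diff: "hom_part n (diff v) = diff (hom_part n v)"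
proof
  fix r
  show "hom_part n (diff v) r = diff (hom_part n v) r"
  proof (cases "r < 12")
    case True
    then consider "r = 0" | "r = 1" | "r = 2" | "r = 3" | "r = 4" | "r = 5" | "r = 6" | "r = 7"
      | "r = 8" | "r = 9" | "r = 10" | "r = 11"
      unfolding lt12 by blast
    then show ?thesis
      by cases (auto simp: hom_part_def diff_def Let_def projA_add projA_diff projA_uminus mult.assoc
          power2_eq_square power3_eq_cube projA_gens gdeg_def numeral_eq_Suc)
  qed (auto simp: hom_part_def diff_def Let_def)
qed

text \<open>With bound 0 the condition on keys is void, and \<open>upper\<close> becomes the
  component of internal degree \<open>n\<close> of the \<open>h\<close>-th free module. This gives
  elements described by components access to the reduction.\<close>

lemma upper_zero_iff:
  "v \<in> upper h n 0 \<longleftrightarrow>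
    (\<forall>i. if i < 12 \<and> hdeg i = h \<and> gdeg i \<le> n then v i \<in> gradeA (n - gdeg i) else v i = 0)"
  (is "_ \<longleftrightarrow> ?P v")
proof
  assume "v \<in> upper h n 0"
  then show "?P v" unfolding upper_def
  proof (induction rule: F.span_induct_alt)
    case base
    show ?case by (auto intro: A.subspace_0[OF subspace_gradeA])
  next
    case (step c x y)
    obtain j w where jw: "x = bas j w" "j < 12" "hdeg j = h" "gdeg j + length w = n" using step(1) by blast
    then have w: "mon w \<in> gradeA (n - gdeg j)" using mon_in_gradeA[of w] by auto
    show ?case
    proof
      fix i
      show "if i < 12 \<and> hdeg i = h \<and> gdeg i \<le> n then (scaleF c x + y) i \<in> gradeA (n - gdeg i)
        else (scaleF c x + y) i = 0"
        using spec[OF step(2), of i] w jw(2,3,4)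
        by (auto simp: jw(1) bas_def scaleF_def
            intro: A.subspace_add[OF subspace_gradeA] A.subspace_scale[OF subspace_gradeA])
    qed
  qed
next
  assume P: "?P v"
  let ?J = "{i. i < 12 \<and> hdeg i = h \<and> gdeg i \<le> n}"
  have *: "(\<lambda>i. if i = j then a else 0) \<in> upper h n 0" if j: "j \<in> ?J" and "a \<in> gradeA (n - gdeg j)" for j and a :: "'a algA"
    using that(2) unfolding gradeA_eq_span
  proof (induction rule: A.span_induct_alt)
    case base
    have "(\<lambda>i. if i = j then 0 else 0) = (0 :: nat \<Rightarrow> 'a algA)" by auto
    then show ?case by (simp only: upper_zero)
  next
    case (step c x y)
    then obtain w where w: "x = mon w" "length w = n - gdeg j" by auto
    have "(\<lambda>i. if i = j then scaleA c x + y else 0) = scaleF c (bas j w) + (\<lambda>i. if i = j then y else 0)"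
      by (auto simp: bas_def scaleF_def w fun_eq_iff)
    moreover have "(bas j w :: nat \<Rightarrow> 'a algA) \<in> upper h n 0"
      using j w by (intro bas_upper) auto
    ultimately show ?case using step(2) by (simp only: upper_add upper_scale)
  qed
  have "v = (\<Sum>j\<in>?J. (\<lambda>i. if i = j then v j else 0))"
  proof
    fix i
    have "(\<Sum>j\<in>?J. (\<lambda>i. if i = j then v j else 0)) i = (\<Sum>j\<in>?J. if j = i then v i else 0)"
      unfolding sum_fun_apply by (intro sum.cong) auto
    also have "\<dots> = v i" using P by (subst sum.delta) auto
    finally show "v i = (\<Sum>j\<in>?J. (\<lambda>i. if i = j then v j else 0)) i" by simp
  qed
  moreover have "(\<Sum>j\<in>?J. (\<lambda>i. if i = j then v j else 0)) \<in> upper h n 0"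
    unfolding upper_def by (rule F.span_sum, fold upper_def, rule *) (use P in auto)
  ultimately show "v \<in> upper h n 0" by metis
qed

section \<open>Independence of the normal words\<close>

lemma normal_words_Suc:
  "normal_words (Suc n) = (#) LX ` {w \<in> normal_words n. \<not> bad w} \<union> (#) LY ` normal_words n"
proof -
  have "w \<in> normal_words (Suc n) \<longleftrightarrow>
    w \<in> (#) LX ` {w \<in> normal_words n. \<not> bad w} \<union> (#) LY ` normal_words n" for w
  proof (cases w)
    case (Cons l u)
    then show ?thesis by (cases l) (auto simp: normal_words_def)
  qed (auto simp: normal_words_def)
  then show ?thesis by blast
qed

lemma sum_normal_words_Suc:
  "(\<Sum>w\<in>normal_words (Suc n). f w) =
    (\<Sum>w\<in>normal_words n. if bad w then 0 else f (LX # w)) + (\<Sum>w\<in>normal_words n. f (LY # w))"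
    (is "_ = ?A + _")
proof -
  have "?A = (\<Sum>w\<in>{w \<in> normal_words n. \<not> bad w}. f (LX # w))"
    by (subst sum.inter_filter[OF finite_normal_words]) (intro sum.cong; auto)
  then show ?thesis unfolding normal_words_Suc
    by (subst sum.union_disjoint) (auto simp: finite_normal_words sum.reindex)
qed

text \<open>Splitting a relation by first letters gives a syzygy \<sigma> of (x y), hence \<sigma>
  is a differential from the third term. Modulo boundaries its preimage is a combination
  \<open>s\<close> of chosen elements. Their differentials lead at bad words of the first generator,
  where \<sigma> has no term because x followed by a bad word is not normal. Triangularity gives
  \<open>s = 0\<close>, so \<sigma> = 0, and independence in degree n - 1 finishes.\<close>

lemma indep_degree: "indep_degree TYPE('k::field) n"
proof (induction n rule: less_induct)
  case (less n)
  show ?case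
  proof (cases n)
    case 0
    have "normal_words 0 = {[]}" by (auto simp: normal_words_def)
    then show ?thesis unfolding indep_degree_def 0 by simp
  next
    case (Suc m)
    \<comment> \<open>The two generators of homological degree 1 have degree 1, so only degree
      \<open>n - 1\<close> is called for.\<close>
    have ind: "indep_degree TYPE('k) (n - gdeg j)" if "j < 12" "hdeg j = 1" "gdeg j \<le> n" for j
      using less[of "n - gdeg j"] that Suc unfolding lt12 by (auto simp: gdeg_def hdeg_def)
    show ?thesis unfolding indep_degree_def
    proof (intro allI impI)
      fix c :: "letter list \<Rightarrow> 'k" assume c: "(\<Sum>w\<in>normal_words n. scaleA (c w) (mon w)) = 0"
      \<comment> \<open>At generator 1 the bad words receive coefficient 0, since they do not arise
        from normal words of length \<open>n\<close>.\<close>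
      define b where "b t = (if fst t = 1 then if bad (snd t) then 0 else c (LX # snd t) else c (LY # snd t))" for t :: "nat \<times> letter list"
      define \<sigma> where "\<sigma> = (\<Sum>t\<in>cell 1 n. scaleF (b t) (bas2 t))"
      have \<sigma>: "\<sigma> i = (if i = 1 \<or> i = 2 then \<Sum>w\<in>normal_words m. scaleA (b (i, w)) (mon w) else 0)" for i
      proof -
        have "i < 12 \<and> hdeg i = 1 \<and> gdeg i \<le> n \<longleftrightarrow> i = 1 \<or> i = 2"
          unfolding lt12 by (auto simp: gdeg_def hdeg_def Suc)
        then show ?thesis unfolding \<sigma>_def lincomb_cell by (auto simp: gdeg_def Suc)
      qed
      have xs: "xA * \<sigma> 1 = (\<Sum>w\<in>normal_words m. if bad w then 0 else scaleA (c (LX # w)) (mon (LX # w)))"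
        by (auto simp: \<sigma> b_def sum_distrib_left mon_Cons_xy scaleA_mult_right intro!: sum.cong)
      have ys: "yA * \<sigma> 2 = (\<Sum>w\<in>normal_words m. scaleA (c (LY # w)) (mon (LY # w)))"
        by (auto simp: \<sigma> b_def sum_distrib_left mon_Cons_xy scaleA_mult_right intro!: sum.cong)
      have "xA * \<sigma> 1 + yA * \<sigma> 2 = 0"
        unfolding xs ys using c unfolding Suc sum_normal_words_Suc .
      then obtain p q r where pqr: "\<sigma> 1 = xA * yA * p + yA^3 * q + yA * RA * yA * r"
          "\<sigma> 2 = - (xA^2 * p) - yA^2 * xA * q - RA * yA * xA * r"
        using syzygies_generators by blast
      define u0 where "u0 i = (if i = 3 then p else if i = 4 then q else if i = 5 then r else 0)" for i :: nat
      have du0: "diff u0 = \<sigma>"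
      proof
        fix i
        show "diff u0 i = \<sigma> i"
        proof (cases "i = 1 \<or> i = 2")
          case True
          then show ?thesis using pqr by (auto simp: diff_def u0_def Let_def)
        next
          case False
          then show ?thesis unfolding \<sigma> by (simp add: diff_def u0_def Let_def)
        qed
      qed
      \<comment> \<open>The witnesses \<open>p\<close>, \<open>q\<close>, \<open>r\<close> need not
        be homogeneous; their parts in internal degree \<open>n\<close> have the same differential
        because \<sigma> is homogeneous.\<close>
      define u where "u = hom_part n u0"
      have \<sigma>_upper: "\<sigma> \<in> upper 1 n 0"
        unfolding \<sigma>_def upper_eq_span by (intro F.span_sum F.span_scale F.span_base) auto
      have "diff u = hom_part n \<sigma>" unfolding u_def hom_part_diff[symmetric] du0 ..
      also have "\<dots> = \<sigma>"
      proof
        fix i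
        show "hom_part n \<sigma> i = \<sigma> i"
          using \<sigma>_upper[unfolded upper_zero_iff, rule_format, of i]
          by (cases "i < 12 \<and> hdeg i = 1 \<and> gdeg i \<le> n") (auto simp: hom_part_def gradeA_iff_projA)
      qed
      finally have du: "diff u = \<sigma>" .
      have "u \<in> upper 2 n 0" unfolding upper_zero_iff
      proof
        fix i
        show "if i < 12 \<and> hdeg i = 2 \<and> gdeg i \<le> n then u i \<in> gradeA (n - gdeg i) else u i = 0"
          by (auto simp: u_def hom_part_def projA_in_gradeA u0_def hdeg_def)
      qed
      \<comment> \<open>Dropping the boundary leaves the differential unchanged and replaces
        \<open>u\<close> by a combination of chosen elements.\<close>
      then obtain s v where sv: "u = s + diff v" "s \<in> span_lead 2 n"
        by (rule upper_reach[of 2 n, rotated]) auto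
      have ds: "diff s = \<sigma>" using du unfolding sv diff_add diff_diff by simp
      have "s = 0"
      proof (rule span_lead_triangular[where h = 1 and n = n and b = b])
        show "s \<in> span_lead (Suc 1) n" using sv(2) by (simp add: numeral_2_eq_2)
        show "diff s = (\<Sum>t\<in>cell 1 n. scaleF (b t) (bas2 t))" using ds by (simp add: \<sigma>_def)
        \<comment> \<open>All targets of sources of homological degree 2 sit at generator 1 and at
          bad words, exactly where \<open>b\<close> is 0.\<close>
        fix q assume "q \<in> sources (Suc 1) n"
        then obtain j w j' w' where q: "q = (j, w, j', w')" "matched j w j' w'" "hdeg j = 2"
          by (auto simp: sources_def numeral_2_eq_2)
        have j': "j' = Suc 0" using q(2,3) by cases (simp_all add: hdeg_def)
        have "bad w'"
        proof (rule ccontr)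
          assume "\<not> bad w'"
          then have "matched (Suc 0) w' 0 (LX # w')" using matchedD(4)[OF q(2)] by (intro m1) simp
          then show False using matched_source_not_target q(2) j' by blast
        qed
        then show "b (snd (snd q)) = 0" by (simp add: q(1) j' b_def)
      qed (use ind in simp)
      then have "(\<Sum>t\<in>cell 1 n. scaleF (b t) (bas2 t)) = 0" using ds by (simp add: \<sigma>_def)
      from indep_cell[OF ind this] have b0: "b t = 0" if "t \<in> cell 1 n" for t using that by simp
      have cell: "(i, w) \<in> cell 1 n" if "i = 1 \<or> i = 2" "w \<in> normal_words m" for i w
        using that by (auto simp: cell_def normal_words_def hdeg_def gdeg_def Suc)
      show "\<forall>w\<in>normal_words n. c w = 0"
        unfolding Suc normal_words_Suc
        using b0[OF cell[of 1]] b0[OF cell[of 2]] by (fastforce simp: b_def)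
    qed
  qed
qed

text \<open>Modulo a boundary a cycle is a combination of chosen elements that is again a cycle, so
  it vanishes by triangularity. Bidegree (0, 0) holds the unmatched unit and with it the homology
  k.\<close>

theorem exact_homogeneous:
  assumes "(h, n) \<noteq> (0, 0)" "v \<in> upper h n 0" "diff v = 0"
  shows "\<exists>u\<in>upper (Suc h) n 0. v = (diff u :: nat \<Rightarrow> 'k::field algA)"
proof -
  obtain s u where su: "v = s + diff u" "s \<in> span_lead h n" "u \<in> upper (Suc h) n 0"
    using upper_reach[OF assms(1,2)] by blast
  have "s = 0"
  proof (cases h)
    case 0
    have "sources 0 n = {}" by (auto simp: sources_def dest: matchedD)
    then show ?thesis using su(2) by (simp add: span_lead_def 0)
  next
    case (Suc h')
    have "diff s = 0" using assms(3) unfolding su(1) diff_add diff_diff by simp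
    then show ?thesis using su(2) unfolding Suc
      by (intro span_lead_triangular[where b = "\<lambda>_. 0" and h = h' and n = n]) (auto intro: indep_degree)
  qed
  then show ?thesis using su by auto
qed

lemma hom_part_in_upper:
  assumes "\<And>i. \<not> (i < 12 \<and> hdeg i = h) \<Longrightarrow> v i = 0"
  shows "hom_part n v \<in> upper h n 0"
  using assms unfolding upper_zero_iff by (auto simp: hom_part_def projA_in_gradeA)

lemma sum_hom_part:
  assumes "\<And>i. \<not> i < 12 \<Longrightarrow> v i = 0"
  shows "\<exists>T. finite T \<and> v = (\<Sum>n\<in>T. hom_part n v)"
proof -
  define T where "T = (\<Union>i\<in>{..<12}. (\<lambda>m. m + gdeg i) ` {m. projA m (v i) \<noteq> 0})"
  have T: "finite T" unfolding T_def by (auto intro: finite_projA)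
  have "v i = (\<Sum>n\<in>T. hom_part n v) i" for i
  proof (cases "i < 12")
    case True
    have "v i = (\<Sum>m\<in>(\<lambda>n. n - gdeg i) ` {n\<in>T. gdeg i \<le> n}. projA m (v i))"
    proof (rule projA_sum_superset[symmetric])
      show "{m. projA m (v i) \<noteq> 0} \<subseteq> (\<lambda>n. n - gdeg i) ` {n \<in> T. gdeg i \<le> n}"
      proof
        fix m assume "m \<in> {m. projA m (v i) \<noteq> 0}"
        then show "m \<in> (\<lambda>n. n - gdeg i) ` {n \<in> T. gdeg i \<le> n}"
          using True by (intro image_eqI[of _ _ "m + gdeg i"]) (auto simp: T_def)
      qed
    qed (use T in simp)
    also have "\<dots> = (\<Sum>n\<in>{n\<in>T. gdeg i \<le> n}. projA (n - gdeg i) (v i))"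
      by (subst sum.reindex) (auto simp: inj_on_def)
    also have "\<dots> = (\<Sum>n\<in>T. hom_part n v i)"
      using True T by (subst sum.inter_filter) (auto simp: hom_part_def intro: sum.cong)
    finally show ?thesis by (simp add: sum_fun_apply)
  qed (simp add: assms sum_fun_apply hom_part_def)
  then show ?thesis using T by blast
qed

text \<open>An element is a finite sum of its homogeneous components, and the differential respects
  them. The condition on \<open>projA 0\<close> removes the component that carries the homology
  k.\<close>

theorem exact_total:
  fixes v :: "nat \<Rightarrow> 'k::field algA"
  assumes supp: "\<And>i. \<not> (i < 12 \<and> hdeg i = h) \<Longrightarrow> v i = 0"
    and cycle: "diff v = 0" and aug: "h = 0 \<Longrightarrow> projA 0 (v 0) = 0"
  shows "\<exists>u. (\<forall>i. \<not> (i < 12 \<and> hdeg i = Suc h) \<longrightarrow> u i = 0) \<and> v = diff u"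
proof -
  obtain T where T: "finite T" "v = (\<Sum>n\<in>T. hom_part n v)" using sum_hom_part[of v] supp by blast
  have "\<exists>u. (\<forall>i. \<not> (i < 12 \<and> hdeg i = Suc h) \<longrightarrow> u i = 0) \<and> hom_part n v = diff u" for n
  proof (cases "(h, n) = (0, 0)")
    case True
    have "hom_part n v i = 0" for i
    proof (cases "i = 0")
      case False
      then have "\<not> (i < 12 \<and> hdeg i = h)" using True hdeg_eq_0[of i] by auto
      then show ?thesis using supp[of i] by (simp add: hom_part_def)
    qed (use True aug in \<open>simp add: hom_part_def gdeg_def\<close>)
    then have "hom_part n v = diff 0" by (auto simp: fun_eq_iff)
    then show ?thesis by (intro exI[of _ 0]) simp
  next
    case False
    have "diff (hom_part n v) = 0" unfolding hom_part_diff[symmetric] cycle by (auto simp: hom_part_def)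
    then obtain u where u: "u \<in> upper (Suc h) n 0" "hom_part n v = diff u"
      using exact_homogeneous[OF False hom_part_in_upper] supp by blast
    have "u i = 0" if "\<not> (i < 12 \<and> hdeg i = Suc h)" for i
      using u(1)[unfolded upper_zero_iff, rule_format, of i] that by (auto split: if_splits)
    then show ?thesis using u(2) by blast
  qed
  then obtain u where u: "\<And>n i. \<not> (i < 12 \<and> hdeg i = Suc h) \<Longrightarrow> u n i = 0" "\<And>n. hom_part n v = diff (u n)"
    by metis
  show ?thesis
  proof (intro exI conjI allI impI)
    show "v = diff (\<Sum>n\<in>T. u n)" unfolding diff_sum u(2)[symmetric] by (rule T(2))
    show "(\<Sum>n\<in>T. u n) i = 0" if "\<not> (i < 12 \<and> hdeg i = Suc h)" for i
      using u(1)[OF that] by (simp add: sum_fun_apply)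
  qed
qed

section \<open>Self-duality of the complex\<close>

text \<open>\<open>codiff\<close> is the action of the matrices on row vectors. Up to permutation and signs of the
  generators, word reversal turns it into \<open>diff\<close>.\<close>

definition codiff :: "(nat \<Rightarrow> 'k::field algA) \<Rightarrow> nat \<Rightarrow> 'k algA" where
  "codiff f j = (let x = xA; y = yA; R = RA in
    if j = 1 then f 0 * x
    else if j = 2 then f 0 * y
    else if j = 3 then f 1 * (x * y) - f 2 * x^2
    else if j = 4 then f 1 * y^3 - f 2 * (y^2 * x)
    else if j = 5 then f 1 * (y * R * y) - f 2 * (R * y * x)
    else if j = 6 then f 3 * y^2 - f 4 * x
    else if j = 7 then f 3 * (R * y) - f 5 * x
    else if j = 8 then f 5 * y^2 - f 4 * (y * R)
    else if j = 9 then f 7 * y^3 + f 8 * (y * x) - f 6 * (y * R * y)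
    else if j = 10 then f 6 * (x * y * R) - f 7 * (x * y^2) - f 8 * x^2
    else if j = 11 then f 9 * x + f 10 * y
    else 0)"

text \<open>The permutation pairs each generator with the one of complementary degree: internal
  degrees add up to 12, homological degrees to 5. The signs make the transposed, reversed matrices
  agree with the original ones.\<close>

definition dualize :: "(nat \<Rightarrow> 'k::field algA) \<Rightarrow> nat \<Rightarrow> 'k algA" where
  "dualize f j = (if j < 12 then
    revA (f ([11, 9, 10, 8, 7, 6, 5, 4, 3, 1, 2, 0] ! j)) * [1, 1, 1, 1, 1, -1, 1, -1, -1, -1, -1, -1] ! j else 0)"

text \<open>The permutation is an involution, but paired generators carry opposite signs in
  \<open>dualize\<close>; so its inverse has all signs negated.\<close>

definition undualize :: "(nat \<Rightarrow> 'k::field algA) \<Rightarrow> nat \<Rightarrow> 'k algA" where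
  "undualize v j = (if j < 12 then
    revA (v ([11, 9, 10, 8, 7, 6, 5, 4, 3, 1, 2, 0] ! j)) * [-1, -1, -1, -1, -1, 1, -1, 1, 1, 1, 1, 1] ! j else 0)"

lemma all_lt12: "(\<forall>j<12. P j) \<longleftrightarrow> P 0 \<and> P 1 \<and> P 2 \<and> P 3 \<and> P 4 \<and> P 5 \<and> P 6 \<and> P 7 \<and> P 8 \<and> P 9 \<and> P 10 \<and> P (11::nat)"
  unfolding lt12 by blast

lemma revA_one [simp]: "revA 1 = 1"
  using revA_mon[of "[]"] by simp

lemma diff_dualize: "diff (dualize f) = dualize (codiff f)"
proof
  fix j
  have "\<forall>j<12. diff (dualize f) j = dualize (codiff f) j"
    unfolding all_lt12
    by (simp add: diff_def dualize_def codiff_def Let_def revA_add revA_diff revA_mult revA_uminus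
        power2_eq_square power3_eq_cube mult.assoc)
  then show "diff (dualize f) j = dualize (codiff f) j"
    by (cases "j < 12") (auto simp: diff_def dualize_def Let_def)
qed

lemma dualize_undualize: "(\<And>i. \<not> i < 12 \<Longrightarrow> v i = 0) \<Longrightarrow> dualize (undualize v) = v"
proof
  fix j assume v: "\<And>i. \<not> i < 12 \<Longrightarrow> v i = 0"
  have "\<forall>j<12. dualize (undualize v) j = v j"
    unfolding all_lt12 by (simp add: dualize_def undualize_def revA_uminus)
  then show "dualize (undualize v) j = v j" using v by (cases "j < 12") (auto simp: dualize_def)
qed

lemma dualize_inject:
  assumes "dualize f = dualize g" "\<And>i. \<not> i < 12 \<Longrightarrow> f i = g i" shows "f = g"
proof
  fix j
  have "revA (f j) = revA (g j)" if "j < 12" for j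
  proof -
    have *: "\<forall>j<12. dualize f j = dualize g j" using assms(1) by simp
    have "\<forall>j<12. revA (f j) = revA (g j)"
      using * unfolding all_lt12 by (simp add: dualize_def)
    then show ?thesis using that by blast
  qed
  then show "f j = g j" using assms(2) by (metis revA_revA)
qed

text \<open>Exactness of the original complex in homological degree \<open>5 - h\<close>, carried
  over by \<open>dualize\<close>. The homology k at the start becomes cohomology at the end, hence
  the extra condition for \<open>h = 5\<close>.\<close>

theorem coexact_total:
  fixes f :: "nat \<Rightarrow> 'k::field algA"
  assumes supp: "\<And>i. \<not> (i < 12 \<and> hdeg i = h) \<Longrightarrow> f i = 0"
    and h: "h \<le> 5" and cocycle: "codiff f = 0" and aug: "h = 5 \<Longrightarrow> projA 0 (f 11) = 0"
  shows "\<exists>g. (\<forall>i. \<not> (i < 12 \<and> Suc (hdeg i) = h) \<longrightarrow> g i = 0) \<and> f = codiff g"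
proof -
  let ?p = "\<lambda>j. [11, 9, 10, 8, 7, 6, 5, 4, 3, 1, 2, 0] ! j :: nat"
  have p: "?p j < 12" "hdeg (?p j) = 5 - hdeg j" "hdeg j \<le> 5" if "j < 12" for j
    using that unfolding lt12 by (auto simp: hdeg_def)
  have supp': "\<not> (i < 12 \<and> hdeg i = 5 - h) \<Longrightarrow> dualize f i = 0" for i
    using supp[of "?p i"] p[of i] h by (auto simp: dualize_def)
  have d0: "diff (dualize f) = 0"
    unfolding diff_dualize cocycle by (auto simp: dualize_def)
  have a0: "projA 0 (dualize f 0) = 0" if "5 - h = 0"
  proof -
    have "projA 0 (revA a) = revA (projA 0 a)" for a :: "'k algA"
      by (induction a rule: algA_induct) (auto simp: revA_add revA_scale revA_mon projA_add projA_scale projA_mon)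
    then show ?thesis using aug h that by (simp add: dualize_def)
  qed
  obtain u where u: "\<And>i. \<not> (i < 12 \<and> hdeg i = Suc (5 - h)) \<Longrightarrow> u i = 0" "dualize f = diff u"
    using exact_total[of "5 - h" "dualize f", OF supp' d0 a0] by blast
  show ?thesis
  proof (intro exI conjI allI impI)
    show "undualize u i = 0" if "\<not> (i < 12 \<and> Suc (hdeg i) = h)" for i
    proof (cases "i < 12")
      case True
      then have "\<not> (?p i < 12 \<and> hdeg (?p i) = Suc (5 - h))" using p[OF True] that h by auto
      from u(1)[OF this] show ?thesis by (simp add: undualize_def)
    qed (simp add: undualize_def)
    show "f = codiff (undualize u)"
    proof (rule dualize_inject)
      have "dualize (undualize u) = u" by (rule dualize_undualize) (simp add: u(1))
      then show "dualize f = dualize (codiff (undualize u))"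
        unfolding diff_dualize[symmetric] u(2) by simp
      show "f i = codiff (undualize u) i" if "\<not> i < 12" for i
        using supp[of i] that by (auto simp: codiff_def Let_def)
    qed
  qed
qed

section \<open>The Hilbert series and growth\<close>

lemma inj_on_mon: "inj_on (mon :: letter list \<Rightarrow> 'k::field algA) (normal_words n)"
proof (rule inj_onI, rule ccontr)
  fix u v assume uv: "u \<in> normal_words n" "v \<in> normal_words n" "(mon u :: 'k algA) = mon v" "u \<noteq> v"
  define c :: "letter list \<Rightarrow> 'k" where "c w = (if w = u then 1 else if w = v then -1 else 0)" for w
  have "(\<Sum>w\<in>normal_words n. scaleA (c w) (mon w)) = (\<Sum>w\<in>{u,v}. scaleA (c w) (mon w))"
    using uv by (intro sum.mono_neutral_right) (auto simp: c_def finite_normal_words)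
  also have "\<dots> = 0" using uv by (simp add: c_def A.scale_minus_left)
  finally have "c u = 0" using indep_degree uv(1) unfolding indep_degree_def by blast
  then show False by (simp add: c_def)
qed

lemma independent_mon: "A.independent (mon ` normal_words n :: 'k::field algA set)"
  unfolding A.independent_explicit_finite_subsets
proof (intro allI impI ballI)
  fix S :: "'k algA set" and c v
  assume S: "S \<subseteq> mon ` normal_words n" "finite S" and 0: "(\<Sum>v\<in>S. scaleA (c v) v) = 0" and v: "v \<in> S"
  define d where "d w = (if mon w \<in> S then c (mon w) else 0)" for w
  have "(\<Sum>w\<in>normal_words n. scaleA (d w) (mon w)) = (\<Sum>a\<in>mon ` normal_words n. if a \<in> S then scaleA (c a) a else 0)"
    unfolding sum.reindex[OF inj_on_mon] by (intro sum.cong) (auto simp: d_def)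
  also have "\<dots> = (\<Sum>v\<in>S. scaleA (c v) v)"
    using S by (subst sum.inter_restrict[symmetric]) (auto simp: finite_normal_words Int_absorb1)
  finally have "\<forall>w\<in>normal_words n. d w = 0"
    using 0 indep_degree unfolding indep_degree_def by metis
  moreover obtain w where "w \<in> normal_words n" "v = mon w" using S v by blast
  ultimately show "c v = 0" using v by (auto simp: d_def)
qed

lemma gradeA_eq_span_normal: "gradeA n = A.span (mon ` normal_words n)"
proof
  show "gradeA n \<subseteq> A.span (mon ` normal_words n :: 'a algA set)"
    unfolding gradeA_eq_span
  proof (rule A.span_minimal)
    show "{mon w |w. length w = n} \<subseteq> A.span (mon ` normal_words n :: 'a algA set)"
    proof
      fix a :: "'a algA" assume "a \<in> {mon w |w. length w = n}"
      then obtain w where w: "a = mon w" "length w = n" by blast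
      have "{mon v | v. normal v \<and> length v = length w \<and> val w \<le> val v} \<subseteq> (mon ` normal_words n :: 'a algA set)"
        using w by (auto simp: normal_words_def)
      then show "a \<in> A.span (mon ` normal_words n)"
        using normal_words_span[of w] A.span_mono unfolding w(1) by blast
    qed
  qed simp
  show "A.span (mon ` normal_words n) \<subseteq> gradeA n"
    unfolding gradeA_eq_span by (intro A.span_mono) (auto simp: normal_words_def)
qed

lemma dim_gradeA: "A.dim (gradeA n :: 'k::field algA set) = card (normal_words n)"
proof -
  have "A.dim (gradeA n :: 'k algA set) = card (mon ` normal_words n :: 'k algA set)"
    using independent_mon by (intro A.dim_eq_card) (simp_all add: gradeA_eq_span_normal A.span_span)
  then show ?thesis by (simp add: card_image inj_on_mon)
qed

section \<open>The generating function of the normal words\<close>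

definition gen_fun :: "letter list set \<Rightarrow> rat fps" where
  "gen_fun L = Abs_fps (\<lambda>n. of_nat (card {w\<in>L. length w = n}))"

lemma gen_fun_union: "A \<inter> B = {} \<Longrightarrow> gen_fun (A \<union> B) = gen_fun A + gen_fun B"
proof (rule fps_ext)
  fix n assume "A \<inter> B = {}"
  moreover have "finite {w\<in>L. length w = n}" for L :: "letter list set"
    by (rule finite_subset[OF _ finite_words[of n]]) auto
  ultimately have "card ({w\<in>A. length w = n} \<union> {w\<in>B. length w = n}) = card {w\<in>A. length w = n} + card {w\<in>B. length w = n}"
    by (intro card_Un_disjoint) auto
  moreover have "{w\<in>A \<union> B. length w = n} = {w\<in>A. length w = n} \<union> {w\<in>B. length w = n}" by auto
  ultimately show "fps_nth (gen_fun (A \<union> B)) n = fps_nth (gen_fun A + gen_fun B) n" by (simp add: gen_fun_def)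
qed

lemma gen_fun_prefix: "gen_fun ((@) p ` L) = fps_X ^ length p * gen_fun L"
proof (rule fps_ext)
  fix n
  have "{w \<in> (@) p ` L. length w = n} = (if n < length p then {} else (@) p ` {w\<in>L. length w = n - length p})"
    by auto
  then show "fps_nth (gen_fun ((@) p ` L)) n = fps_nth (fps_X ^ length p * gen_fun L) n"
    by (auto simp: gen_fun_def fps_X_power_mult_nth card_image inj_on_def)
qed

text \<open>Continuations of normal words are described by a finite automaton: \<open>U\<close>,
  \<open>V\<close>, \<open>Z\<close>, \<open>G\<close> are the words that may follow xyy, xyxyy, xy
  and x. Splitting off prefixes gives five linear equations for the generating functions, and
  elimination leaves the claim.\<close>

lemma gen_fun_normal:
  "gen_fun {w. normal w} * ((1 - fps_X)^2 * (1 - fps_X^2) * (1 - fps_X^3) * (1 - fps_X^5)) = 1"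
proof -
  define N where "N = {w. normal w}"
  define U where "U = {w. normal w \<and> \<not> prefix [LY] w}"
  define V where "V = {w. normal w \<and> \<not> prefix [LY] w \<and> \<not> prefix [LX,LY,LY] w}"
  define Z where "Z = {w. normal (LX # LY # w)}"
  define G where "G = {w. normal (LX # w)}"
  \<comment> \<open>Words with a given prefix \<open>p\<close> are split off; \<open>B\<close>
    collects what remains of them after \<open>p\<close>.\<close>
  have sp: "gen_fun L = gen_fun {w\<in>L. \<not> prefix p w} + fps_X ^ n * gen_fun B"
    if "\<And>v. p @ v \<in> L \<longleftrightarrow> v \<in> B" "length p = n" for p n and L B :: "letter list set"
  proof -
    have "L = {w\<in>L. \<not> prefix p w} \<union> (@) p ` B"
      using that by (auto simp: prefix_def)
    moreover have "{w\<in>L. \<not> prefix p w} \<inter> (@) p ` B = {}" by auto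
    ultimately show ?thesis using that(2) by (metis gen_fun_union gen_fun_prefix)
  qed
  have 1: "gen_fun N = gen_fun U + fps_X * gen_fun N"
    using sp[of "[LY]" N N 1] by (simp add: N_def U_def)
  have 2: "gen_fun U = gen_fun V + fps_X^3 * gen_fun U"
  proof -
    have "{w\<in>U. \<not> prefix [LX,LY,LY] w} = V" by (auto simp: U_def V_def)
    moreover have "[LX,LY,LY] @ v \<in> U \<longleftrightarrow> v \<in> U" for v
      by (simp add: U_def normal_simps(1) del: normal.simps(2))
    ultimately show ?thesis using sp[of "[LX,LY,LY]" U U 3] by simp
  qed
  have 3: "gen_fun N = gen_fun Z + fps_X^6 * gen_fun U + fps_X^5 * gen_fun V + fps_X^2 * gen_fun N"
  proof -
    let ?L1 = "{w\<in>N. \<not> prefix [LY,LY] w}"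
    let ?L2 = "{w\<in>?L1. \<not> prefix [LX,LY,LX,LY,LY] w}"
    have "gen_fun N = gen_fun ?L1 + fps_X^2 * gen_fun N"
      using sp[of "[LY,LY]" N N 2] by (simp add: N_def)
    also have "gen_fun ?L1 = gen_fun ?L2 + fps_X^5 * gen_fun V"
      using sp[of "[LX,LY,LX,LY,LY]" ?L1 V 5] by (simp add: N_def V_def normal_simps(2) del: normal.simps(2))
    also have "gen_fun ?L2 = gen_fun {w\<in>?L2. \<not> prefix [LX,LY,LY,LX,LY,LY] w} + fps_X^6 * gen_fun U"
      using sp[of "[LX,LY,LY,LX,LY,LY]" ?L2 U 6] by (simp add: N_def U_def normal_simps(3) del: normal.simps(2))
    also have "{w\<in>?L2. \<not> prefix [LX,LY,LY,LX,LY,LY] w} = Z"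
      by (simp add: Z_def N_def normal_simps(4) del: normal.simps(2))
    finally show ?thesis .
  qed
  have 4: "gen_fun N = gen_fun G + fps_X^7 * gen_fun U + fps_X^6 * gen_fun V + fps_X^3 * gen_fun N + fps_X^2 * gen_fun Z"
  proof -
    let ?L1 = "{w\<in>N. \<not> prefix [LX,LY] w}"
    let ?L2 = "{w\<in>?L1. \<not> prefix [LY,LY,LY] w}"
    let ?L3 = "{w\<in>?L2. \<not> prefix [LY,LX,LY,LX,LY,LY] w}"
    have "gen_fun N = gen_fun ?L1 + fps_X^2 * gen_fun Z"
      using sp[of "[LX,LY]" N Z 2] by (simp add: N_def Z_def  del: normal.simps(2))
    also have "gen_fun ?L1 = gen_fun ?L2 + fps_X^3 * gen_fun N"
      using sp[of "[LY,LY,LY]" ?L1 N 3] by (simp add: N_def)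
    also have "gen_fun ?L2 = gen_fun ?L3 + fps_X^6 * gen_fun V"
      using sp[of "[LY,LX,LY,LX,LY,LY]" ?L2 V 6] by (simp add: N_def V_def normal_simps(2) del: normal.simps(2))
    also have "gen_fun ?L3 = gen_fun {w\<in>?L3. \<not> prefix [LY,LX,LY,LY,LX,LY,LY] w} + fps_X^7 * gen_fun U"
      using sp[of "[LY,LX,LY,LY,LX,LY,LY]" ?L3 U 7] by (simp add: N_def U_def normal_simps(3) del: normal.simps(2))
    also have "{w\<in>?L3. \<not> prefix [LY,LX,LY,LY,LX,LY,LY] w} = G"
      by (auto simp: G_def N_def bad_def)
    finally show ?thesis .
  qed
  have 5: "gen_fun N = 1 + fps_X * gen_fun G + fps_X * gen_fun N"
  proof -
    let ?L1 = "{w\<in>N. \<not> prefix [LX] w}"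
    have "gen_fun N = gen_fun ?L1 + fps_X * gen_fun G"
      using sp[of "[LX]" N G 1] by (simp add: N_def G_def del: normal.simps(2))
    also have "gen_fun ?L1 = gen_fun {w\<in>?L1. \<not> prefix [LY] w} + fps_X * gen_fun N"
      using sp[of "[LY]" ?L1 N 1] by (simp add: N_def)
    also have "{w\<in>?L1. \<not> prefix [LY] w} = {[]}"
    proof -
      have "w = []" if "\<not> prefix [LX] w" "\<not> prefix [LY] w" for w
      proof (cases w)
        case (Cons l u)
        then show ?thesis using that by (cases l) auto
      qed
      then show ?thesis by (auto simp: N_def)
    qed
    also have "gen_fun {[]} = 1"
    proof (rule fps_ext)
      fix n
      have "{w \<in> {[] :: letter list}. length w = n} = (if n = 0 then {[]} else {})" by auto
      then show "fps_nth (gen_fun {[]}) n = fps_nth 1 n" by (simp add: gen_fun_def)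
    qed
    finally show ?thesis by (simp add: add_ac)
  qed
  define X :: "rat fps" where "X = fps_X"
  define H where "H = gen_fun N"
  have U: "gen_fun U = H - X * H" using 1 by (simp add: H_def X_def algebra_simps)
  have V: "gen_fun V = (H - X * H) - X^3 * (H - X * H)" using 2 unfolding U X_def[symmetric] by (simp add: algebra_simps)
  have Z: "gen_fun Z = H - X^6 * gen_fun U - X^5 * gen_fun V - X^2 * H"
    using 3 by (simp add: H_def X_def algebra_simps)
  have G: "gen_fun G = H - X^7 * gen_fun U - X^6 * gen_fun V - X^3 * H - X^2 * gen_fun Z"
    using 4 by (simp add: H_def X_def algebra_simps)
  have "1 = H - X * gen_fun G - X * H" using 5 by (simp add: H_def X_def algebra_simps)
  also have "\<dots> = H * ((1 - X)^2 * (1 - X^2) * (1 - X^3) * (1 - X^5))"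
    unfolding G Z V U by (simp add: algebra_simps numeral_eq_Suc)
  finally show ?thesis by (simp add: H_def X_def N_def)
qed

lemma gen_fun_normal_nth: "fps_nth (gen_fun {w. normal w}) n = of_nat (card (normal_words n))"
  by (simp add: gen_fun_def normal_words_def)

theorem hilbert_series:
  "Abs_fps (\<lambda>i. of_nat (A.dim (gradeA i :: 'k::field algA set))) =
     (1 / ((1 - fps_X)^2 * (1 - fps_X^2) * (1 - fps_X^3) * (1 - fps_X^5)) :: rat fps)"
proof -
  let ?D = "(1 - fps_X)^2 * (1 - fps_X^2) * (1 - fps_X^3) * (1 - fps_X^5) :: rat fps"
  have "Abs_fps (\<lambda>i. of_nat (A.dim (gradeA i :: 'k algA set))) = gen_fun {w. normal w}"
    by (simp add: gen_fun_def dim_gradeA normal_words_def)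
  moreover have "inverse ?D = gen_fun {w. normal w}"
    by (rule fps_inverse_unique) (use gen_fun_normal in \<open>simp add: mult.commute\<close>)
  moreover have "1 / ?D = inverse ?D"
    by (simp add: fps_divide_unit power2_eq_square fps_power_nth)
  ultimately show ?thesis by simp
qed

text \<open>Dividing by 1 - X^k means G(n) = F(n) + G(n - k), and n^(p + 1) \<le> n (n + 1)^p bounds
  the second summand. So each factor of the denominator costs one power of n + 1.\<close>

lemma fps_geometric_bound:
  fixes F G :: "rat fps"
  assumes "G * (1 - fps_X ^ k) = F" "0 < k" and F: "\<And>n. 0 \<le> fps_nth F n \<and> fps_nth F n \<le> (of_nat n + 1) ^ p"
  shows "0 \<le> fps_nth G n \<and> fps_nth G n \<le> (of_nat n + 1) ^ Suc p"
proof (induction n rule: less_induct)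
  case (less n)
  have "F = G - fps_X ^ k * G" unfolding assms(1)[symmetric] by (simp add: algebra_simps)
  then have eq: "fps_nth G n = fps_nth F n + (if n < k then 0 else fps_nth G (n - k))"
    by (simp add: fps_X_power_mult_nth)
  show ?case
  proof (cases "n < k")
    case True
    have le: "(of_nat n + 1 :: rat) ^ p \<le> (of_nat n + 1) ^ Suc p" by (rule power_increasing) auto
    have "fps_nth G n = fps_nth F n" using eq True by simp
    then show ?thesis using conjunct1[OF F[of n]] order_trans[OF conjunct2[OF F[of n]] le] by (simp only: simp_thms)
  next
    case False
    then have "n - k < n" "n > 0" using assms(2) by auto
    have "(of_nat (n - k) + 1 :: rat) ^ Suc p \<le> of_nat n ^ Suc p"
      using False assms(2) by (intro power_mono) (auto simp: of_nat_diff)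
    also have "\<dots> \<le> of_nat n * (of_nat n + 1) ^ p"
      by (auto intro!: mult_left_mono power_mono)
    finally have "fps_nth G (n - k) \<le> of_nat n * (of_nat n + 1) ^ p" using less[OF \<open>n - k < n\<close>] by linarith
    then show ?thesis using eq False F[of n] less[OF \<open>n - k < n\<close>] by (simp add: algebra_simps)
  qed
qed

text \<open>The denominator has five factors of the form 1 - X^k, starting from the constant series
  1 with exponent 0.\<close>

lemma card_normal_words_le: "card (normal_words n) \<le> (n + 1) ^ 5"
proof -
  let ?H = "gen_fun {w. normal w}"
  let ?B = "\<lambda>(G :: rat fps) p. \<forall>n. 0 \<le> fps_nth G n \<and> fps_nth G n \<le> (of_nat n + 1) ^ p"
  have step: "?B G (Suc p)" if "?B (G * (1 - fps_X ^ k)) p" "0 < k" for G k p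
    using fps_geometric_bound[OF refl that(2)] that(1) by blast
  have "?H * (1 - fps_X^1) * (1 - fps_X^1) * (1 - fps_X^2) * (1 - fps_X^3) * (1 - fps_X^5) = 1"
    using gen_fun_normal by (simp add: power2_eq_square mult.assoc)
  moreover have "?B 1 0" by simp
  ultimately have "?B (?H * (1 - fps_X^1) * (1 - fps_X^1) * (1 - fps_X^2) * (1 - fps_X^3) * (1 - fps_X^5)) 0" by simp
  then have "?B ?H (Suc (Suc (Suc (Suc (Suc 0)))))" by - ((rule step)+, assumption, simp_all)
  then have "fps_nth ?H n \<le> (of_nat n + 1) ^ 5" by (simp add: numeral_eq_Suc)
  then have "(of_nat (card (normal_words n)) :: rat) \<le> of_nat ((n + 1) ^ 5)"
    by (simp add: gen_fun_normal_nth add.commute)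
  then show ?thesis by (simp only: of_nat_le_iff)
qed

lemma polynomial_growth_algA: "polynomial_growth (scaleA :: 'k::field \<Rightarrow> 'k algA \<Rightarrow> 'k algA) gradeA"
  unfolding polynomial_growth_def
proof (intro conjI allI exI)
  show "finite (mon ` normal_words i :: 'k algA set)" for i using finite_normal_words by simp
  show "gradeA i \<subseteq> A.span (mon ` normal_words i :: 'k algA set)" for i by (simp add: gradeA_eq_span_normal)
  show "real (A.dim (gradeA i :: 'k algA set)) \<le> poly ([:1, 1:] ^ 5) (real i)" for i
    using card_normal_words_le[of i, THEN of_nat_mono, where ?'a = real] by (simp add: dim_gradeA add.commute)
qed

section \<open>The filtration by degree and the Gelfand-Kirillov dimension\<close>

definition filtA :: "nat \<Rightarrow> 'k::field algA set" where
  "filtA n = A.span (mon ` (\<Union>i\<le>n. normal_words i))"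

lemma projA_filtA: "(\<And>i. n < i \<Longrightarrow> projA i a = 0) \<Longrightarrow> a \<in> filtA n"
proof -
  assume *: "\<And>i. n < i \<Longrightarrow> projA i a = 0"
  have "projA i a \<in> filtA n" if "i \<le> n" for i
    using projA_in_gradeA[of i a] that A.span_mono[of "mon ` normal_words i" "mon ` (\<Union>i\<le>n. normal_words i)"]
    unfolding gradeA_eq_span_normal filtA_def by blast
  then have "(\<Sum>i\<le>n. projA i a) \<in> filtA n" unfolding filtA_def by (intro A.span_sum) auto
  also have "(\<Sum>i\<le>n. projA i a) = a"
    by (rule projA_sum_superset) (use * not_less in \<open>auto simp: not_le[symmetric]\<close>)
  finally show ?thesis .
qed

lemma filtA_projA: "a \<in> filtA n \<Longrightarrow> n < i \<Longrightarrow> projA i a = 0"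
  unfolding filtA_def
  by (induction rule: A.span_induct_alt) (auto simp: projA_add projA_scale projA_mon normal_words_def)

lemma filtA_mult: assumes "a \<in> filtA m" "b \<in> filtA n" shows "a * b \<in> filtA (m + n)"
proof (rule projA_filtA)
  fix i assume i: "m + n < i"
  have "a = (\<Sum>k\<le>m. projA k a)"
    by (rule projA_sum_superset[symmetric]) (use filtA_projA[OF assms(1)] in \<open>auto simp: not_le[symmetric]\<close>)
  then have "projA i (a * b) = (\<Sum>k\<le>m. projA i (projA k a * b))"
    by (metis projA_sum sum_distrib_right)
  also have "\<dots> = 0"
    using filtA_projA[OF assms(2)] i by (intro sum.neutral) (auto simp: projA_mult_left[OF projA_in_gradeA])
  finally show "projA i (a * b) = 0" .
qed

text \<open>Exponent 5 for each single degree, and one more for the n + 1 degrees.\<close>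

lemma dim_span_filtA:
  assumes "W \<subseteq> (filtA n :: 'k::field algA set)"
  shows "A.dim (A.span W) \<le> (n + 1) ^ 6"
proof -
  have "A.dim (A.span W) \<le> card (mon ` (\<Union>i\<le>n. normal_words i) :: 'k algA set)"
    using assms A.span_minimal[of W "filtA n"] unfolding filtA_def
    by (intro A.dim_le_card) (auto simp: finite_normal_words)
  also have "\<dots> \<le> card (\<Union>i\<le>n. normal_words i)" by (intro card_image_le) (auto simp: finite_normal_words)
  also have "\<dots> \<le> (\<Sum>i\<le>n. card (normal_words i))" by (rule card_UN_le) simp
  also have "\<dots> \<le> (\<Sum>i\<le>n. (n + 1) ^ 5)"
    by (intro sum_mono order_trans[OF card_normal_words_le] power_mono) auto
  also have "\<dots> = (n + 1) ^ 6" by (simp add: power_Suc[symmetric] del: power_Suc)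
  finally show ?thesis .
qed

text \<open>If a finite set lies in degrees up to m, products of at most n factors lie in degrees up
  to m n, and the dimension of their span is at most the sixth power of m n + 1.\<close>

lemma gk_dimension_algA: "gk_dimension (scaleA :: 'k::field \<Rightarrow> 'k algA \<Rightarrow> 'k algA) < \<infinity>"
proof -
  have "limsup (\<lambda>n. ereal (ln (real (A.dim (A.span {prod_list w | w. set w \<subseteq> S \<and> length w \<le> n}))) / ln (real n))) \<le> 7"
    if "finite S" for S :: "'k algA set"
  proof -
    have "finite (\<Union>s\<in>S. {n. projA n s \<noteq> 0})" using that finite_projA by auto
    then obtain m where m: "\<And>n s. s \<in> S \<Longrightarrow> projA n s \<noteq> 0 \<Longrightarrow> n \<le> m"
      unfolding finite_nat_set_iff_bounded_le by blast
    have S: "s \<in> filtA m" if "s \<in> S" for s using m[OF that] by (intro projA_filtA) (auto simp: not_le[symmetric])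
    have prod: "set w \<subseteq> S \<Longrightarrow> prod_list w \<in> filtA (m * length w)" for w
    proof (induction w)
      case Nil
      show ?case by (rule projA_filtA) (simp add: projA_mon[of _ "[]", simplified])
    next
      case (Cons a w)
      then have "a * prod_list w \<in> filtA (m + m * length w)" by (intro filtA_mult S) auto
      then show ?case by simp
    qed
    have filt_mono: "filtA i \<subseteq> (filtA j :: 'k algA set)" if "i \<le> j" for i j
      unfolding filtA_def using that by (intro A.span_mono image_mono) (auto intro: order_trans)
    have dim: "A.dim (A.span {prod_list w | w. set w \<subseteq> S \<and> length w \<le> n}) \<le> (m * n + 1) ^ 6" (is "?d n \<le> _") for n
    proof (rule dim_span_filtA, clarify)
      fix w assume "set w \<subseteq> S" "length w \<le> n"
      then show "prod_list w \<in> filtA (m * n)" using prod filt_mono[of "m * length w" "m * n"] by auto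
    qed
    \<comment> \<open>From this bound on, the constant factor (m + 2)^6 is absorbed by one more
      power of n; this is the origin of the 7.\<close>
    have "ln (real (?d n)) / ln (real n) \<le> 7" if n: "n \<ge> (m + 2) ^ 6" for n
    proof -
      have "(m + 2) ^ 1 \<le> (m + 2) ^ 6" by (rule power_increasing) auto
      then have n2: "n \<ge> 2" using n by simp
      have "m * n + 1 \<le> (m + 2) * n" using n2 by (simp add: algebra_simps)
      then have "?d n \<le> ((m + 2) * n) ^ 6" using dim[of n] power_mono[of "m * n + 1" "(m + 2) * n" 6] by linarith
      also have "\<dots> = (m + 2) ^ 6 * n ^ 6" by (simp only: power_mult_distrib)
      also have "\<dots> \<le> n * n ^ 6" using n by (intro mult_right_mono) auto
      also have "\<dots> = n ^ 7" by (simp flip: power_Suc)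
      finally have le: "?d n \<le> n ^ 7" .
      have "ln (real D) / ln (real n) \<le> 7" if "D \<le> n ^ 7" for D
      proof -
        have "real D \<le> real n ^ 7" using that by (simp only: of_nat_le_iff flip: of_nat_power)
        \<comment> \<open>Dimension 0 is covered by the convention that the logarithm of 0 is
          0.\<close>
        then have "ln (real D) \<le> 7 * ln (real n)"
          using n2 ln_mono[of "real D" "real n ^ 7"] by (cases "D = 0") (auto simp: ln_realpow)
        then show ?thesis using n2 by (simp add: divide_le_eq)
      qed
      from this[OF le] show ?thesis .
    qed
    then show ?thesis
      by (intro Limsup_bounded eventually_sequentiallyI[of "(m + 2) ^ 6"]) simp
  qed
  then have "gk_dimension (scaleA :: 'k \<Rightarrow> 'k algA \<Rightarrow> 'k algA) \<le> 7"
    unfolding gk_dimension_def by (intro SUP_least) simp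
  also have "(7 :: ereal) < \<infinity>" by simp
  finally show ?thesis .
qed

section \<open>Right modules, free modules and projective modules\<close>

context right_module
begin

lemma act_zero: "smult M a \<zero> = \<zero>"
proof -
  have "smult M a \<zero> \<oplus> smult M a \<zero> = smult M a \<zero> \<oplus> \<zero>"
    using act_add[of \<zero> \<zero> a] act_closed[of \<zero> a] by simp
  then show ?thesis using act_closed[of \<zero> a] by simp
qed

lemma zero_act: assumes "m \<in> carrier M" shows "smult M 0 m = \<zero>"
proof -
  have "smult M 0 m \<oplus> smult M 0 m = smult M 0 m \<oplus> \<zero>"
    using add_act[OF assms, of 0 0] act_closed[OF assms, of 0] by simp
  then show ?thesis using act_closed[OF assms, of 0] by simp
qed

lemma neg_act: assumes "m \<in> carrier M" shows "smult M (- 1) m = \<ominus> m"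
proof -
  have "smult M (- 1) m \<oplus> m = \<zero>"
    using add_act[OF assms, of "-1" 1] act_one[OF assms] zero_act[OF assms] by simp
  then show ?thesis using assms act_closed by (metis minus_equality)
qed

lemma act_neg: assumes "m \<in> carrier M" shows "smult M a (\<ominus> m) = \<ominus> smult M a m"
proof -
  have "smult M a (\<ominus> m) = smult M ((- 1) * a) m" using assms by (simp only: act_act neg_act)
  also have "\<dots> = smult M (a * (- 1)) m" by simp
  also have "\<dots> = \<ominus> smult M a m" using assms by (simp only: act_act neg_act act_closed)
  finally show ?thesis .
qed

lemma act_finsum:
  "f \<in> S \<rightarrow> carrier M \<Longrightarrow> smult M a (finsum M f S) = finsum M (\<lambda>s. smult M a (f s)) S"
proof (induction S rule: infinite_finite_induct)
  case (insert s S)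
  then have "f s \<in> carrier M" "f \<in> S \<rightarrow> carrier M" by auto
  then show ?case using insert by (simp add: act_add act_closed Pi_iff)
qed (simp_all add: act_zero)

lemma finsum_superset:
  assumes "finite B" "A \<subseteq> B" "\<And>b. b \<in> B - A \<Longrightarrow> f b = \<zero>" "f \<in> B \<rightarrow> carrier M"
  shows "finsum M f A = finsum M f B"
  using assms by (intro add.finprod_mono_neutral_cong_left) auto

end

lemma module_homD:
  assumes "module_hom M N f"
  shows "m \<in> carrier M \<Longrightarrow> f m \<in> carrier N"
    "m \<in> carrier M \<Longrightarrow> n \<in> carrier M \<Longrightarrow> f (m \<oplus>\<^bsub>M\<^esub> n) = f m \<oplus>\<^bsub>N\<^esub> f n"
    "m \<in> carrier M \<Longrightarrow> f (smult M a m) = smult N a (f m)"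
  using assms by (auto simp: module_hom_def)

lemma module_homI:
  assumes "\<And>m. m \<in> carrier M \<Longrightarrow> f m \<in> carrier N"
    "\<And>m n. m \<in> carrier M \<Longrightarrow> n \<in> carrier M \<Longrightarrow> f (m \<oplus>\<^bsub>M\<^esub> n) = f m \<oplus>\<^bsub>N\<^esub> f n"
    "\<And>a m. m \<in> carrier M \<Longrightarrow> f (smult M a m) = smult N a (f m)"
  shows "module_hom M N f"
  using assms by (auto simp: module_hom_def)

lemma module_hom_zero:
  assumes "right_module M" "right_module N" "module_hom M N f"
  shows "f \<zero>\<^bsub>M\<^esub> = \<zero>\<^bsub>N\<^esub>"
proof -
  interpret M: right_module M by fact
  interpret N: right_module N by fact
  have "f (smult M 0 \<zero>\<^bsub>M\<^esub>) = smult N 0 (f \<zero>\<^bsub>M\<^esub>)" using module_homD(3)[OF assms(3)] by simp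
  then show ?thesis using N.zero_act module_homD(1)[OF assms(3)] M.zero_act by simp
qed

lemma module_hom_neg:
  assumes "right_module M" "right_module N" "module_hom M N f" "m \<in> carrier M"
  shows "f (\<ominus>\<^bsub>M\<^esub> m) = \<ominus>\<^bsub>N\<^esub> f m"
proof -
  interpret M: right_module M by fact
  interpret N: right_module N by fact
  show ?thesis using module_homD[OF assms(3)] assms(4) by (metis M.neg_act N.neg_act)
qed

lemma module_hom_minus:
  assumes "right_module M" "right_module N" "module_hom M N f" "m \<in> carrier M" "n \<in> carrier M"
  shows "f (m \<ominus>\<^bsub>M\<^esub> n) = f m \<ominus>\<^bsub>N\<^esub> f n"
proof -
  interpret M: right_module M by fact
  interpret N: right_module N by fact
  show ?thesis unfolding M.minus_eq N.minus_eq
    using module_homD[OF assms(3)] module_hom_neg[OF assms(1-4)] assms by (simp add: module_hom_neg)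
qed

lemma module_hom_comp:
  "module_hom L M f \<Longrightarrow> module_hom M N g \<Longrightarrow> module_hom L N (\<lambda>x. g (f x))"
  by (rule module_homI) (simp_all add: module_homD)

lemma module_hom_id: "module_hom M M (\<lambda>x. x)"
  by (auto simp: module_hom_def)

lemma module_hom_diff:
  assumes "right_module N" "module_hom M N f" "module_hom M N g"
  shows "module_hom M N (\<lambda>x. f x \<ominus>\<^bsub>N\<^esub> g x)"
proof -
  interpret N: right_module N by fact
  show ?thesis
  proof (rule module_homI)
    fix m n assume mn: "m \<in> carrier M" "n \<in> carrier M"
    note c = module_homD(1)[OF assms(2) mn(1)] module_homD(1)[OF assms(2) mn(2)]
      module_homD(1)[OF assms(3) mn(1)] module_homD(1)[OF assms(3) mn(2)]
    show "f (m \<oplus>\<^bsub>M\<^esub> n) \<ominus>\<^bsub>N\<^esub> g (m \<oplus>\<^bsub>M\<^esub> n) = f m \<ominus>\<^bsub>N\<^esub> g m \<oplus>\<^bsub>N\<^esub> (f n \<ominus>\<^bsub>N\<^esub> g n)"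
      using c mn by (simp add: module_homD[OF assms(2)] module_homD[OF assms(3)] N.minus_eq N.minus_add N.a_ac)
  next
    fix a m assume m: "m \<in> carrier M"
    then show "f (smult M a m) \<ominus>\<^bsub>N\<^esub> g (smult M a m) = smult N a (f m \<ominus>\<^bsub>N\<^esub> g m)"
      using module_homD(1)[OF assms(2) m] module_homD(1)[OF assms(3) m]
      by (simp add: module_homD(3)[OF assms(2) m] module_homD(3)[OF assms(3) m] N.minus_eq N.act_add N.act_neg)
  qed (use module_homD(1) assms in \<open>auto intro!: N.minus_closed\<close>)
qed

lemma right_moduleI:
  fixes M (structure)
  assumes "abelian_group M"
    and "\<And>m a. m \<in> carrier M \<Longrightarrow> smult M a m \<in> carrier M"
    and "\<And>m n a. m \<in> carrier M \<Longrightarrow> n \<in> carrier M \<Longrightarrow> smult M a (m \<oplus> n) = smult M a m \<oplus> smult M a n"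
    and "\<And>m a b. m \<in> carrier M \<Longrightarrow> smult M (a + b) m = smult M a m \<oplus> smult M b m"
    and "\<And>m a b. m \<in> carrier M \<Longrightarrow> smult M (a * b) m = smult M b (smult M a m)"
    and "\<And>m. m \<in> carrier M \<Longrightarrow> smult M 1 m = m"
  shows "right_module M"
  using assms by (auto intro!: right_module.intro right_module_axioms.intro)

section \<open>Free modules and their universal property\<close>

lemma lookup_map_mult: "Poly_Mapping.lookup (Poly_Mapping.map (\<lambda>c. c * a) f) k = Poly_Mapping.lookup f k * (a :: 'a::ring_1)"
  by (simp add: map.rep_eq when_def)

lemma free_module_simps:
  "f \<in> carrier (free_module B) \<longleftrightarrow> Poly_Mapping.keys f \<subseteq> B"
  "\<zero>\<^bsub>free_module B\<^esub> = 0" "f \<oplus>\<^bsub>free_module B\<^esub> g = f + g"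
  "smult (free_module B) a f = Poly_Mapping.map (\<lambda>c. c * a) f"
  by (simp_all add: free_module_def)

lemma right_module_free_module: "right_module (free_module B :: ('a::ring_1, 'b \<Rightarrow>\<^sub>0 'a) module)"
proof (rule right_moduleI)
  show "abelian_group (free_module B :: ('a, 'b \<Rightarrow>\<^sub>0 'a) module)"
  proof (rule abelian_groupI)
    fix f :: "'b \<Rightarrow>\<^sub>0 'a" assume "f \<in> carrier (free_module B)"
    then show "\<exists>g\<in>carrier (free_module B). g \<oplus>\<^bsub>free_module B\<^esub> f = \<zero>\<^bsub>free_module B\<^esub>"
      by (intro bexI[of _ "- f"]) (auto simp: free_module_simps in_keys_iff)
  qed (use keys_add in \<open>fastforce simp: free_module_simps add_ac\<close>)+
next
  fix m :: "'b \<Rightarrow>\<^sub>0 'a" and a assume "m \<in> carrier (free_module B)"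
  then show "smult (free_module B) a m \<in> carrier (free_module B)"
    by (force simp: free_module_simps in_keys_iff lookup_map_mult)
qed (rule poly_mapping_eqI;
    simp only: free_module_simps lookup_map_mult lookup_add,
    simp only: distrib_left distrib_right mult.assoc mult_1_right)+

definition free_lift ::
    "('a::ring_1, 'm, 'z) module_scheme \<Rightarrow> ('b \<Rightarrow> 'm) \<Rightarrow> ('b \<Rightarrow>\<^sub>0 'a) \<Rightarrow> 'm" where
  "free_lift M k f = finsum M (\<lambda>b. smult M (Poly_Mapping.lookup f b) (k b)) (Poly_Mapping.keys f)"

lemma free_lift_superset:
  assumes "right_module M" "k \<in> B \<rightarrow> carrier M" "finite S" "Poly_Mapping.keys f \<subseteq> S" "S \<subseteq> B"
  shows "free_lift M k f = finsum M (\<lambda>b. smult M (Poly_Mapping.lookup f b) (k b)) S"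
proof -
  interpret right_module M by fact
  show ?thesis unfolding free_lift_def
    using assms by (intro finsum_superset) (auto simp: in_keys_iff zero_act act_closed Pi_iff subset_iff)
qed

lemma module_hom_free_lift:
  fixes M :: "('a::ring_1, 'm, 'z) module_scheme" (structure) and k :: "'b \<Rightarrow> 'm"
  assumes M: "right_module M" and k: "k \<in> B \<rightarrow> carrier M"
  shows "module_hom (free_module B) M (free_lift M k)"
proof -
  interpret right_module M by fact
  show ?thesis
  proof (rule module_homI)
    fix f g :: "'b \<Rightarrow>\<^sub>0 'a" assume fg: "f \<in> carrier (free_module B)" "g \<in> carrier (free_module B)"
    let ?S = "Poly_Mapping.keys f \<union> Poly_Mapping.keys g"
    have S: "?S \<subseteq> B" using fg by (auto simp: free_module_simps)
    have kS: "k s \<in> carrier M" if "s \<in> ?S" for s using k S that by auto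
    have "free_lift M k (f \<oplus>\<^bsub>free_module B\<^esub> g) = finsum M (\<lambda>b. smult M (Poly_Mapping.lookup (f + g) b) (k b)) ?S"
      using S k keys_add[of f g] by (simp only: free_module_simps) (intro free_lift_superset[OF M k]; auto)
    also have "\<dots> = finsum M (\<lambda>b. smult M (Poly_Mapping.lookup f b) (k b) \<oplus> smult M (Poly_Mapping.lookup g b) (k b)) ?S"
      using kS by (intro finsum_cong') (auto simp: lookup_add add_act act_closed)
    also have "\<dots> = free_lift M k f \<oplus> free_lift M k g"
      using kS S by (subst finsum_addf) (auto simp: act_closed free_lift_superset[OF M k, of ?S])
    finally show "free_lift M k (f \<oplus>\<^bsub>free_module B\<^esub> g) = free_lift M k f \<oplus> free_lift M k g" .
  next
    fix f :: "'b \<Rightarrow>\<^sub>0 'a" and a assume f: "f \<in> carrier (free_module B)"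
    have kS: "k s \<in> carrier M" if "s \<in> Poly_Mapping.keys f" for s
      using k f that by (auto simp: free_module_simps)
    have "free_lift M k (smult (free_module B) a f) =
        finsum M (\<lambda>b. smult M (Poly_Mapping.lookup f b * a) (k b)) (Poly_Mapping.keys f)"
      using f by (subst free_lift_superset[OF M k, of "Poly_Mapping.keys f"])
        (auto simp: free_module_simps in_keys_iff lookup_map_mult)
    also have "\<dots> = finsum M (\<lambda>b. smult M a (smult M (Poly_Mapping.lookup f b) (k b))) (Poly_Mapping.keys f)"
      using kS by (intro finsum_cong') (auto simp: act_act act_closed)
    also have "\<dots> = smult M a (free_lift M k f)"
      unfolding free_lift_def using kS by (intro act_finsum[symmetric]) (auto simp: act_closed)
    finally show "free_lift M k (smult (free_module B) a f) = smult M a (free_lift M k f)" .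
  next
    fix f :: "'b \<Rightarrow>\<^sub>0 'a" assume "f \<in> carrier (free_module B)"
    then show "free_lift M k f \<in> carrier M"
      using k unfolding free_lift_def by (intro finsum_closed) (auto simp: free_module_simps intro!: act_closed)
  qed
qed

lemma free_lift_single:
  assumes "right_module M" "k b \<in> carrier M"
  shows "free_lift M k (Poly_Mapping.single b a) = smult M a (k b)"
proof -
  interpret right_module M by fact
  have "free_lift M k (Poly_Mapping.single b a) = finsum M (\<lambda>c. smult M (Poly_Mapping.lookup (Poly_Mapping.single b a) c) (k c)) {b}"
    by (rule free_lift_superset[of M k "{b}"]) (use assms in auto)
  then show ?thesis using assms by (simp add: act_closed)
qed

lemma free_module_hom_ext:
  assumes N: "right_module N" and f: "module_hom (free_module B) N f" and g: "module_hom (free_module B) N g"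
    and eq: "\<And>b. b \<in> B \<Longrightarrow> f (Poly_Mapping.single b 1) = g (Poly_Mapping.single b 1)"
    and p: "p \<in> carrier (free_module B :: ('a::ring_1, 'b \<Rightarrow>\<^sub>0 'a) module)"
  shows "f p = g p"
proof -
  let ?F = "free_module B :: ('a::ring_1, 'b \<Rightarrow>\<^sub>0 'a) module"
  have F: "right_module ?F" by (rule right_module_free_module)
  have "finite S \<Longrightarrow> S \<subseteq> B \<Longrightarrow> Poly_Mapping.keys p \<subseteq> S \<Longrightarrow> f p = g p" for S p
  proof (induction S arbitrary: p rule: finite_induct)
    case empty
    then have "p = \<zero>\<^bsub>?F\<^esub>" by (auto simp: free_module_simps intro!: poly_mapping_eqI simp: in_keys_iff)
    then show ?case using module_hom_zero[OF F N f] module_hom_zero[OF F N g] by simp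
  next
    case (insert b S)
    let ?s = "Poly_Mapping.single b (Poly_Mapping.lookup p b)"
    have k: "Poly_Mapping.keys (p - ?s) \<subseteq> S"
    proof
      fix c assume c: "c \<in> Poly_Mapping.keys (p - ?s)"
      then have "c \<noteq> b" by (auto simp: in_keys_iff lookup_minus)
      then have "Poly_Mapping.lookup p c \<noteq> 0" using c by (auto simp: in_keys_iff lookup_minus lookup_single)
      then show "c \<in> S" using insert(5) \<open>c \<noteq> b\<close> by (auto simp: in_keys_iff)
    qed
    have b: "Poly_Mapping.single b (1::'a) \<in> carrier ?F" using insert by (simp add: free_module_simps)
    have s: "?s = smult ?F (Poly_Mapping.lookup p b) (Poly_Mapping.single b 1)"
      by (simp add: free_module_simps)
    have "f ?s = g ?s" unfolding s module_homD(3)[OF f b] module_homD(3)[OF g b] using eq insert by simp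
    moreover have "f (p - ?s) = g (p - ?s)" using insert k by auto
    moreover have "p = (p - ?s) \<oplus>\<^bsub>?F\<^esub> ?s" by (simp add: free_module_simps)
    moreover have "p - ?s \<in> carrier ?F" "?s \<in> carrier ?F" using k insert by (auto simp: free_module_simps)
    ultimately show ?case using module_homD(2)[OF f] module_homD(2)[OF g] by metis
  qed
  from this[of "Poly_Mapping.keys p" p] p show ?thesis by (simp add: free_module_simps)
qed

section \<open>Isomorphisms of modules and transport of structure\<close>

definition module_iso ::
    "('a::ring_1, 'm, 'y) module_scheme \<Rightarrow> ('a, 'n, 'z) module_scheme \<Rightarrow> ('m \<Rightarrow> 'n) \<Rightarrow> ('n \<Rightarrow> 'm) \<Rightarrow> bool" where
  "module_iso M N f g \<longleftrightarrow> right_module M \<and> right_module N \<and> module_hom M N f \<and> module_hom N M g \<and>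
    (\<forall>m\<in>carrier M. g (f m) = m) \<and> (\<forall>n\<in>carrier N. f (g n) = n)"

lemma module_iso_sym: "module_iso M N f g \<Longrightarrow> module_iso N M g f"
  by (auto simp: module_iso_def)

text \<open>\<open>N\<close> is not presupposed to be a module: its laws are pulled back along the
  bijection to those of \<open>M\<close>.\<close>

lemma module_isoI_bij:
  fixes M :: "('a::ring_1, 'm, 'y) module_scheme" (structure) and N :: "('a, 'n, 'z) module_scheme"
  assumes M: "right_module M" and bij: "bij_betw f (carrier M) (carrier N)" and hom: "module_hom M N f"
    and zero: "f \<zero>\<^bsub>M\<^esub> = \<zero>\<^bsub>N\<^esub>"
  shows "module_iso M N f (inv_into (carrier M) f)"
proof -
  interpret right_module M by fact
  let ?g = "inv_into (carrier M) f"
  have fg: "f (?g n) = n" "?g n \<in> carrier M" if "n \<in> carrier N" for n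
    using bij that by (auto simp: bij_betw_def f_inv_into_f inv_into_into)
  have gf: "?g (f m) = m" if "m \<in> carrier M" for m
    using bij that by (simp add: bij_betw_def)
  note h = module_homD[OF hom]
  have add: "n \<oplus>\<^bsub>N\<^esub> n' = f (?g n \<oplus> ?g n')" if "n \<in> carrier N" "n' \<in> carrier N" for n n'
    using h(2)[of "?g n" "?g n'"] fg that by simp
  have act: "smult N a n = f (smult M a (?g n))" if "n \<in> carrier N" for a n
    using h(3)[of "?g n"] fg that by simp
  have N: "right_module N"
  proof (rule right_moduleI)
    show "abelian_group N"
    proof (rule abelian_groupI)
      show "x \<oplus>\<^bsub>N\<^esub> y \<oplus>\<^bsub>N\<^esub> z = x \<oplus>\<^bsub>N\<^esub> (y \<oplus>\<^bsub>N\<^esub> z)"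
        if "x \<in> carrier N" "y \<in> carrier N" "z \<in> carrier N" for x y z
        using that by (simp add: add fg gf h(1) a_assoc)
      show "\<exists>y\<in>carrier N. y \<oplus>\<^bsub>N\<^esub> x = \<zero>\<^bsub>N\<^esub>" if "x \<in> carrier N" for x
        using that by (intro bexI[of _ "f (\<ominus> ?g x)"]) (simp_all add: add fg gf h(1) l_neg zero)
    qed (simp_all add: add fg gf h(1) zero[symmetric] a_comm)
  qed (simp_all add: add act fg gf h(1) act_closed act_add add_act act_act act_one)
  moreover have "module_hom N M ?g"
    by (rule module_homI) (simp_all add: add act fg gf act_closed)
  ultimately show ?thesis using M hom fg gf by (simp add: module_iso_def)
qed

text \<open>Moves a module along an injection into another type. It is needed because projective
  dimension only admits resolutions by modules with elements in \<open>universe\<close>.\<close>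

definition transport :: "('m \<Rightarrow> 'n) \<Rightarrow> ('a, 'm, 'z) module_scheme \<Rightarrow> ('a, 'n) module" where
  "transport g M = \<lparr>carrier = g ` carrier M, mult = undefined, one = undefined, zero = g \<zero>\<^bsub>M\<^esub>,
     add = (\<lambda>p q. g (inv_into (carrier M) g p \<oplus>\<^bsub>M\<^esub> inv_into (carrier M) g q)),
     smult = (\<lambda>a p. g (smult M a (inv_into (carrier M) g p)))\<rparr>"

lemma transport_iso:
  assumes "right_module M" "inj_on g (carrier M)"
  shows "module_iso M (transport g M) g (inv_into (carrier M) g)"
proof (rule module_isoI_bij[OF assms(1)])
  show "bij_betw g (carrier M) (carrier (transport g M))"
    using assms(2) by (simp add: transport_def bij_betw_def)
  show "module_hom M (transport g M) g"
    by (rule module_homI) (use assms(2) in \<open>simp_all add: transport_def\<close>)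
qed (simp add: transport_def)

lemma resolution_iso:
  assumes res: "resolution M P d e" and M: "module_iso M M' f f'"
    and P: "\<And>n. module_iso (P n) (P' n) (\<phi> n) (\<psi> n)"
  shows "resolution M' P' (\<lambda>n p. \<phi> n (d n (\<psi> (Suc n) p))) (\<lambda>p. f (e (\<psi> 0 p)))"
proof -
  have r: "right_module M" "right_module (P n)" "module_hom (P (Suc n)) (P n) (d n)" "module_hom (P 0) M e"
      "e ` carrier (P 0) = carrier M" "d 0 ` carrier (P 1) = a_kernel (P 0) M e"
      "d (Suc n) ` carrier (P (Suc (Suc n))) = a_kernel (P (Suc n)) (P n) (d n)" for n
    using res by (auto simp: resolution_def)
  have m: "right_module M'" "module_hom M M' f" "module_hom M' M f'" "\<And>m. m \<in> carrier M \<Longrightarrow> f' (f m) = m"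
    "\<And>m. m \<in> carrier M' \<Longrightarrow> f (f' m) = m" using M by (auto simp: module_iso_def)
  have p: "right_module (P' n)" "module_hom (P n) (P' n) (\<phi> n)" "module_hom (P' n) (P n) (\<psi> n)"
    "\<And>m. m \<in> carrier (P n) \<Longrightarrow> \<psi> n (\<phi> n m) = m" "\<And>m. m \<in> carrier (P' n) \<Longrightarrow> \<phi> n (\<psi> n m) = m" for n
    using P[of n] by (auto simp: module_iso_def)
  have f0: "f m = \<zero>\<^bsub>M'\<^esub> \<longleftrightarrow> m = \<zero>\<^bsub>M\<^esub>" if "m \<in> carrier M" for m
    using module_hom_zero[OF r(1) m(1,2)] module_hom_zero[OF m(1) r(1) m(3)] m(4)[OF that] by metis
  have \<phi>0: "\<phi> n m = \<zero>\<^bsub>P' n\<^esub> \<longleftrightarrow> m = \<zero>\<^bsub>P n\<^esub>" if "m \<in> carrier (P n)" for m n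
    using module_hom_zero[OF r(2) p(1,2), of n] module_hom_zero[OF p(1) r(2) p(3)] p(4)[OF that] by metis
  \<comment> \<open>One statement for both kinds of exactness: the next map is either the
    augmentation or a differential, abstracted to \<open>k\<close> and its conjugate.\<close>
  have ker: "(\<lambda>p. g' (g (\<psi> (Suc n) p))) ` carrier (P' (Suc n)) = {q \<in> carrier (P' n). k' (k (\<psi> n q)) = z'}"
    if g: "g ` carrier (P (Suc n)) = {q \<in> carrier (P n). k q = z}" "\<And>q. q \<in> carrier (P n) \<Longrightarrow> g' q = \<phi> n q"
      and k: "\<And>q. q \<in> carrier (P n) \<Longrightarrow> k' (k q) = z' \<longleftrightarrow> k q = z" for g k z g' k' z' n
  proof (intro equalityI subsetI)
    fix x assume "x \<in> (\<lambda>p. g' (g (\<psi> (Suc n) p))) ` carrier (P' (Suc n))"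
    then obtain q where q: "q \<in> carrier (P' (Suc n))" "x = g' (g (\<psi> (Suc n) q))" by blast
    then have "g (\<psi> (Suc n) q) \<in> {q \<in> carrier (P n). k q = z}"
      using g(1) module_homD(1)[OF p(3)] by blast
    moreover from this have "k' (k (g (\<psi> (Suc n) q))) = z'" using k by blast
    ultimately show "x \<in> {q \<in> carrier (P' n). k' (k (\<psi> n q)) = z'}"
      using q(2) g(2) module_homD(1)[OF p(2)] p(4) by simp
  next
    fix x assume x: "x \<in> {q \<in> carrier (P' n). k' (k (\<psi> n q)) = z'}"
    then have x': "\<psi> n x \<in> carrier (P n)" using module_homD(1)[OF p(3)] by blast
    then have "\<psi> n x \<in> {q \<in> carrier (P n). k q = z}" using x k by simp
    then obtain q where q: "q \<in> carrier (P (Suc n))" "\<psi> n x = g q" using g(1) by (metis (no_types, lifting) imageE)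
    have "x \<in> carrier (P' n)" using x by simp
    then have "x = g' (\<psi> n x)" using p(5) g(2)[OF x'] by metis
    then have "x = g' (g (\<psi> (Suc n) (\<phi> (Suc n) q)))" unfolding q(2) p(4)[OF q(1)] .
    then show "x \<in> (\<lambda>p. g' (g (\<psi> (Suc n) p))) ` carrier (P' (Suc n))"
      using q(1) module_homD(1)[OF p(2)] by blast
  qed
  show ?thesis unfolding resolution_def
  proof (intro conjI allI)
    show "(\<lambda>p. f (e (\<psi> 0 p))) ` carrier (P' 0) = carrier M'"
    proof (intro equalityI subsetI)
      fix x assume x: "x \<in> carrier M'"
      then obtain q where q: "q \<in> carrier (P 0)" "f' x = e q" using r(5) module_homD(1)[OF m(3)] by (metis imageE)
      then have "x = f (e (\<psi> 0 (\<phi> 0 q)))" using p(4) m(5)[OF x] by simp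
      then show "x \<in> (\<lambda>p. f (e (\<psi> 0 p))) ` carrier (P' 0)" using q(1) module_homD(1)[OF p(2)] by blast
    qed (use module_homD(1)[OF p(3)] module_homD(1)[OF r(4)] module_homD(1)[OF m(2)] in blast)
    show "(\<lambda>p. \<phi> 0 (d 0 (\<psi> (Suc 0) p))) ` carrier (P' 1) = a_kernel (P' 0) M' (\<lambda>p. f (e (\<psi> 0 p)))"
      unfolding a_kernel_def' One_nat_def using r(6) f0 module_homD(1)[OF r(4)]
      by (intro ker) (auto simp: a_kernel_def')
    show "(\<lambda>p. \<phi> (Suc n) (d (Suc n) (\<psi> (Suc (Suc n)) p))) ` carrier (P' (Suc (Suc n))) =
        a_kernel (P' (Suc n)) (P' n) (\<lambda>p. \<phi> n (d n (\<psi> (Suc n) p)))" for n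
      unfolding a_kernel_def' using r(7)[of n] \<phi>0 module_homD(1)[OF r(3)]
      by (intro ker) (auto simp: a_kernel_def')
    show "module_hom (P' (Suc n)) (P' n) (\<lambda>p. \<phi> n (d n (\<psi> (Suc n) p)))" for n
      by (intro module_hom_comp[OF p(3)] module_hom_comp[OF r(3)] p(2))
    show "module_hom (P' 0) M' (\<lambda>p. f (e (\<psi> 0 p)))"
      by (intro module_hom_comp[OF p(3)] module_hom_comp[OF r(4)] m(2))
  qed (use p(1) m(1) in auto)
qed

text \<open>\<open>projective_module\<close> wants a basis inside the carrier type of
  \<open>P\<close>, while the given free module has an arbitrary index type. The injection
  \<open>h\<close> relabels the basis; its values may lie outside the carrier.\<close>

lemma projective_moduleI:
  fixes P :: "('a::ring_1, 'm, 'z) module_scheme" and h :: "'i \<Rightarrow> 'm"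
  assumes iso: "module_iso P (free_module I) f g" and h: "inj_on h I"
  shows "projective_module P"
proof -
  let ?F = "free_module I :: ('a, 'i \<Rightarrow>\<^sub>0 'a) module" and ?G = "free_module (h ` I) :: ('a, 'm \<Rightarrow>\<^sub>0 'a) module"
  let ?s = "free_lift ?G (\<lambda>i. Poly_Mapping.single (h i) 1)"
  let ?r = "free_lift ?F (\<lambda>b. Poly_Mapping.single (inv_into I h b) 1)"
  have F: "right_module ?F" and G: "right_module ?G" by (rule right_module_free_module)+
  have s: "module_hom ?F ?G ?s" by (rule module_hom_free_lift[OF G]) (auto simp: free_module_simps)
  have r: "module_hom ?G ?F ?r"
    by (rule module_hom_free_lift[OF F]) (auto simp: free_module_simps inv_into_into)
  have rs: "?r (?s p) = p" if "p \<in> carrier ?F" for p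
  proof (rule free_module_hom_ext[OF F module_hom_comp[OF s r] module_hom_id _ that])
    fix i assume i: "i \<in> I"
    have "?s (Poly_Mapping.single i 1) = smult ?G 1 (Poly_Mapping.single (h i) 1)"
      by (rule free_lift_single[OF G]) (use i in \<open>simp add: free_module_simps\<close>)
    also have "\<dots> = Poly_Mapping.single (h i) 1" by (simp add: free_module_simps)
    finally have "?r (?s (Poly_Mapping.single i 1)) = smult ?F 1 (Poly_Mapping.single (inv_into I h (h i)) 1)"
      using i by (simp add: free_lift_single[OF F] free_module_simps inv_into_into)
    then show "?r (?s (Poly_Mapping.single i 1)) = Poly_Mapping.single i 1"
      using h i by (simp add: free_module_simps)
  qed
  have i: "right_module P" "module_hom P ?F f" "module_hom ?F P g" "\<And>p. p \<in> carrier P \<Longrightarrow> g (f p) = p"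
    using iso by (auto simp: module_iso_def)
  show ?thesis unfolding projective_module_def
    using i rs module_hom_comp[OF i(2) s] module_hom_comp[OF r i(3)] module_homD(1)[OF i(2)]
    by (intro conjI exI[of _ "h ` I"] exI[of _ "\<lambda>p. ?s (f p)"] exI[of _ "\<lambda>p. g (?r p)"]) auto
qed

text \<open>Preimages are chosen for the basis of a free module, and the section \<open>s\<close>
  carries the lift back to \<open>P\<close>. The condition on images is the form in which exactness
  of a resolution supplies preimages.\<close>

lemma lift_projective:
  fixes P :: "('a::ring_1, 'm, 'z) module_scheme"
  assumes P: "projective_module P" and N: "right_module N" and K: "right_module K"
    and g: "module_hom P N g" and h: "module_hom K N h"
    and sub: "\<And>p. p \<in> carrier P \<Longrightarrow> g p \<in> h ` carrier K"
  shows "\<exists>l. module_hom P K l \<and> (\<forall>p\<in>carrier P. h (l p) = g p)"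
proof -
  obtain B :: "'m set" and s r where s: "module_hom P (free_module B) s" and r: "module_hom (free_module B) P r"
    and rs: "\<And>p. p \<in> carrier P \<Longrightarrow> r (s p) = p" and PM: "right_module P"
    using P unfolding projective_module_def by blast
  define k where "k b = (SOME k. k \<in> carrier K \<and> h k = g (r (Poly_Mapping.single b 1)))" for b
  have k: "k b \<in> carrier K" "h (k b) = g (r (Poly_Mapping.single b 1))" if "b \<in> B" for b
  proof -
    have "r (Poly_Mapping.single b 1) \<in> carrier P"
      using that by (intro module_homD(1)[OF r]) (simp add: free_module_simps)
    from sub[OF this] have "\<exists>k. k \<in> carrier K \<and> h k = g (r (Poly_Mapping.single b 1))" by force
    from someI_ex[OF this] show "k b \<in> carrier K" "h (k b) = g (r (Poly_Mapping.single b 1))"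
      by (auto simp: k_def)
  qed
  have L: "module_hom (free_module B) K (free_lift K k)"
    by (rule module_hom_free_lift[OF K]) (use k in auto)
  have "h (free_lift K k q) = g (r q)" if "q \<in> carrier (free_module B)" for q
  proof (rule free_module_hom_ext[OF N module_hom_comp[OF L h] module_hom_comp[OF r g] _ that])
    fix b assume b: "b \<in> B"
    interpret K: right_module K by fact
    have "free_lift K k (Poly_Mapping.single b 1) = k b"
      using k(1)[OF b] K.act_one by (simp add: free_lift_single[OF K])
    then show "h (free_lift K k (Poly_Mapping.single b 1)) = g (r (Poly_Mapping.single b 1))"
      using k(2)[OF b] by simp
  qed
  then show ?thesis
    using module_hom_comp[OF s L] rs module_homD(1)[OF s]
    by (intro exI[of _ "\<lambda>p. free_lift K k (s p)"]) auto
qed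

lemma resolutionD:
  assumes "resolution M P d e"
  shows "right_module M" "right_module (P n)" "module_hom (P (Suc n)) (P n) (d n)" "module_hom (P 0) M e"
    "m \<in> carrier M \<Longrightarrow> m \<in> e ` carrier (P 0)"
    "p \<in> carrier (P (Suc 0)) \<Longrightarrow> e (d 0 p) = \<zero>\<^bsub>M\<^esub>"
    "q \<in> carrier (P 0) \<Longrightarrow> e q = \<zero>\<^bsub>M\<^esub> \<Longrightarrow> q \<in> d 0 ` carrier (P (Suc 0))"
    "r \<in> carrier (P (Suc (Suc n))) \<Longrightarrow> d n (d (Suc n) r) = \<zero>\<^bsub>P n\<^esub>"
    "s \<in> carrier (P (Suc n)) \<Longrightarrow> d n s = \<zero>\<^bsub>P n\<^esub> \<Longrightarrow> s \<in> d (Suc n) ` carrier (P (Suc (Suc n)))"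
proof -
  have r: "right_module M" "right_module (P n)" "module_hom (P (Suc n)) (P n) (d n)" "module_hom (P 0) M e"
      "e ` carrier (P 0) = carrier M" "d 0 ` carrier (P 1) = a_kernel (P 0) M e"
      "d (Suc n) ` carrier (P (Suc (Suc n))) = a_kernel (P (Suc n)) (P n) (d n)" for n
    using assms by (auto simp: resolution_def)
  show "right_module M" "right_module (P n)" "module_hom (P (Suc n)) (P n) (d n)" "module_hom (P 0) M e"
    "m \<in> carrier M \<Longrightarrow> m \<in> e ` carrier (P 0)" using r by auto
  show "p \<in> carrier (P (Suc 0)) \<Longrightarrow> e (d 0 p) = \<zero>\<^bsub>M\<^esub>"
    "q \<in> carrier (P 0) \<Longrightarrow> e q = \<zero>\<^bsub>M\<^esub> \<Longrightarrow> q \<in> d 0 ` carrier (P (Suc 0))"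
    using r(6) by (auto simp: a_kernel_def' set_eq_iff image_iff)
  show "r \<in> carrier (P (Suc (Suc n))) \<Longrightarrow> d n (d (Suc n) r) = \<zero>\<^bsub>P n\<^esub>"
    "s \<in> carrier (P (Suc n)) \<Longrightarrow> d n s = \<zero>\<^bsub>P n\<^esub> \<Longrightarrow> s \<in> d (Suc n) ` carrier (P (Suc (Suc n)))"
    using r(7)[of n] by (auto simp: a_kernel_def' set_eq_iff image_iff)
qed

text \<open>The chain map is built degree by degree: the composite with the differential lands in
  cycles, which are boundaries in \<open>Q\<close>, so projectivity lifts it.\<close>

lemma comparison:
  assumes P: "resolution M P d e" "\<And>n. projective_module (P n)" and Q: "resolution M Q \<delta> \<epsilon>"
  shows "\<exists>\<phi>. (\<forall>n. module_hom (P n) (Q n) (\<phi> n)) \<and> (\<forall>p\<in>carrier (P 0). \<epsilon> (\<phi> 0 p) = e p) \<and>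
    (\<forall>n. \<forall>p\<in>carrier (P (Suc n)). \<delta> n (\<phi> (Suc n) p) = \<phi> n (d n p))"
proof -
  note p = resolutionD[OF P(1)] and q = resolutionD[OF Q]
  \<comment> \<open>Dependent choice sees only the current map. So the invariant states what the
    next step needs, namely that cycles go to cycles, without mentioning the previous map.\<close>
  let ?R = "\<lambda>n \<phi>. module_hom (P n) (Q n) \<phi> \<and> (n = 0 \<longrightarrow> (\<forall>p\<in>carrier (P 0). \<epsilon> (\<phi> p) = e p)) \<and>
    (\<forall>k. n = Suc k \<longrightarrow> (\<forall>p\<in>carrier (P (Suc k)). d k p = \<zero>\<^bsub>P k\<^esub> \<longrightarrow> \<delta> k (\<phi> p) = \<zero>\<^bsub>Q k\<^esub>))"
  have "\<exists>\<phi>. \<forall>n. ?R n (\<phi> n) \<and> (\<forall>p\<in>carrier (P (Suc n)). \<delta> n (\<phi> (Suc n) p) = \<phi> n (d n p))"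
  proof (rule dependent_nat_choice)
    have "e x \<in> \<epsilon> ` carrier (Q 0)" if "x \<in> carrier (P 0)" for x
      by (rule q(5)[OF module_homD(1)[OF p(4) that]])
    from lift_projective[OF P(2) p(1) q(2) p(4) q(4) this]
    obtain l where "module_hom (P 0) (Q 0) l \<and> (\<forall>p\<in>carrier (P 0). \<epsilon> (l p) = e p)" by blast
    then show "\<exists>\<phi>. ?R 0 \<phi>" by (intro exI[of _ l]) simp
    fix \<phi> n assume \<phi>: "?R n \<phi>"
    have in_im: "\<phi> (d n x) \<in> \<delta> n ` carrier (Q (Suc n))" if x: "x \<in> carrier (P (Suc n))" for x
    proof -
      have dx: "d n x \<in> carrier (P n)" using module_homD(1)[OF p(3) x] .
      show ?thesis
      proof (cases n)
        case 0
        then have "\<epsilon> (\<phi> (d 0 x)) = \<zero>\<^bsub>M\<^esub>" using \<phi> dx p(6) x by auto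
        then show ?thesis using q(7) module_homD(1)[of "P n" "Q n" \<phi>] \<phi> dx 0 by simp
      next
        case (Suc k)
        then have "\<delta> k (\<phi> (d n x)) = \<zero>\<^bsub>Q k\<^esub>" using \<phi> dx p(8)[of x k] x by auto
        then show ?thesis using q(9) module_homD(1)[of "P n" "Q n" \<phi>] \<phi> dx Suc by simp
      qed
    qed
    have "module_hom (P (Suc n)) (Q n) (\<lambda>x. \<phi> (d n x))" using \<phi> by (intro module_hom_comp[OF p(3)]) simp
    from lift_projective[OF P(2) q(2) q(2) this q(3) in_im]
    obtain l where l: "module_hom (P (Suc n)) (Q (Suc n)) l" "\<And>x. x \<in> carrier (P (Suc n)) \<Longrightarrow> \<delta> n (l x) = \<phi> (d n x)"
      by blast
    moreover have "\<phi> \<zero>\<^bsub>P n\<^esub> = \<zero>\<^bsub>Q n\<^esub>" using \<phi> by (intro module_hom_zero[OF p(2) q(2)]) simp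
    ultimately show "\<exists>l. ?R (Suc n) l \<and> (\<forall>x\<in>carrier (P (Suc n)). \<delta> n (l x) = \<phi> (d n x))"
      by (intro exI[of _ l]) auto
  qed
  then obtain \<phi> where \<phi>: "\<forall>n. ?R n (\<phi> n) \<and> (\<forall>p\<in>carrier (P (Suc n)). \<delta> n (\<phi> (Suc n) p) = \<phi> n (d n p))"
    by (rule exE)
  show ?thesis
  proof (intro exI[of _ \<phi>] conjI allI)
    fix n
    show "module_hom (P n) (Q n) (\<phi> n)" using spec[OF \<phi>, of n] by (elim conjE)
    show "\<forall>p\<in>carrier (P (Suc n)). \<delta> n (\<phi> (Suc n) p) = \<phi> n (d n p)" using spec[OF \<phi>, of n] by (elim conjE)
  next
    show "\<forall>p\<in>carrier (P 0). \<epsilon> (\<phi> 0 p) = e p" using spec[OF \<phi>, of 0] by simp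
  qed
qed

text \<open>A chain map over the zero map is null-homotopic. Only the half that is used is stated:
  \<open>\<theta> - s d\<close> consists of cycles. In the construction it is lifted through the
  next differential to give the next \<open>s\<close>.\<close>

lemma null_homotopy:
  assumes F: "resolution M F d e" "\<And>n. projective_module (F n)"
    and \<theta>: "\<And>n. module_hom (F n) (F n) (\<theta> n)" "\<And>p. p \<in> carrier (F 0) \<Longrightarrow> e (\<theta> 0 p) = \<zero>\<^bsub>M\<^esub>"
      "\<And>n p. p \<in> carrier (F (Suc n)) \<Longrightarrow> d n (\<theta> (Suc n) p) = \<theta> n (d n p)"
  shows "\<exists>s. (\<forall>n. module_hom (F n) (F (Suc n)) (s n)) \<and>
    (\<forall>n. \<forall>p\<in>carrier (F (Suc n)). d n (\<theta> (Suc n) p \<ominus>\<^bsub>F (Suc n)\<^esub> s n (d n p)) = \<zero>\<^bsub>F n\<^esub>)"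
proof -
  note f = resolutionD[OF F(1)]
  note fm = module_hom_minus[OF f(2) f(2) f(3)]
  let ?R = "\<lambda>n s. module_hom (F n) (F (Suc n)) s \<and>
    (\<forall>p\<in>carrier (F (Suc n)). d n (\<theta> (Suc n) p \<ominus>\<^bsub>F (Suc n)\<^esub> s (d n p)) = \<zero>\<^bsub>F n\<^esub>)"
  have "\<exists>s. \<forall>n. ?R n (s n) \<and> True"
  proof (rule dependent_nat_choice)
    have "\<theta> 0 x \<in> d 0 ` carrier (F (Suc 0))" if "x \<in> carrier (F 0)" for x
      by (rule f(7)[OF module_homD(1)[OF \<theta>(1) that] \<theta>(2)[OF that]])
    from lift_projective[OF F(2) f(2) f(2) \<theta>(1) f(3) this]
    obtain s where s: "module_hom (F 0) (F (Suc 0)) s" "\<And>p. p \<in> carrier (F 0) \<Longrightarrow> d 0 (s p) = \<theta> 0 p"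
      by blast
    have "d 0 (\<theta> (Suc 0) p \<ominus>\<^bsub>F (Suc 0)\<^esub> s (d 0 p)) = \<zero>\<^bsub>F 0\<^esub>" if p: "p \<in> carrier (F (Suc 0))" for p
    proof -
      interpret F0: right_module "F 0" by (rule f(2))
      have dp: "d 0 p \<in> carrier (F 0)" using module_homD(1)[OF f(3) p] .
      then show ?thesis using module_homD(1)[OF \<theta>(1)] module_homD(1)[OF s(1)] p
        by (simp add: fm \<theta>(3) s(2) F0.minus_eq F0.r_neg)
    qed
    then show "\<exists>s. ?R 0 s" using s(1) by blast
  next
    fix s n assume s: "?R n s"
    let ?g = "\<lambda>p. \<theta> (Suc n) p \<ominus>\<^bsub>F (Suc n)\<^esub> s (d n p)"
    have g: "module_hom (F (Suc n)) (F (Suc n)) ?g"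
      using s by (intro module_hom_diff[OF f(2) \<theta>(1)] module_hom_comp[OF f(3)]) simp
    have "?g x \<in> d (Suc n) ` carrier (F (Suc (Suc n)))" if x: "x \<in> carrier (F (Suc n))" for x
      by (rule f(9)[OF module_homD(1)[OF g x]]) (use s x in blast)
    from lift_projective[OF F(2) f(2) f(2) g f(3) this]
    obtain t where t: "module_hom (F (Suc n)) (F (Suc (Suc n))) t" "\<And>p. p \<in> carrier (F (Suc n)) \<Longrightarrow> d (Suc n) (t p) = ?g p"
      by blast
    have "d (Suc n) (\<theta> (Suc (Suc n)) p \<ominus>\<^bsub>F (Suc (Suc n))\<^esub> t (d (Suc n) p)) = \<zero>\<^bsub>F (Suc n)\<^esub>"
      if p: "p \<in> carrier (F (Suc (Suc n)))" for p
    proof -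
      interpret F1: right_module "F (Suc n)" by (rule f(2))
      have dp: "d (Suc n) p \<in> carrier (F (Suc n))" using module_homD(1)[OF f(3) p] .
      have mz: "\<ominus>\<^bsub>F (Suc n)\<^esub> \<zero>\<^bsub>F (Suc n)\<^esub> = \<zero>\<^bsub>F (Suc n)\<^esub>"
        by (rule F1.minus_equality) simp_all
      have "s \<zero>\<^bsub>F n\<^esub> = \<zero>\<^bsub>F (Suc n)\<^esub>" using s by (intro module_hom_zero[OF f(2) f(2)]) simp
      then show ?thesis using dp module_homD(1)[OF \<theta>(1)] module_homD(1)[OF t(1)] p
        by (simp add: fm \<theta>(3) t(2) f(8) F1.minus_eq F1.r_neg mz)
    qed
    then show "\<exists>t. ?R (Suc n) t \<and> True" using t(1) by blast
  qed
  then obtain s where s: "\<forall>n. ?R n (s n) \<and> True" by (rule exE)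
  show ?thesis
  proof (intro exI[of _ s] conjI allI)
    fix n
    show "module_hom (F n) (F (Suc n)) (s n)" using spec[OF s, of n] by (elim conjE)
    show "\<forall>p\<in>carrier (F (Suc n)). d n (\<theta> (Suc n) p \<ominus>\<^bsub>F (Suc n)\<^esub> s n (d n p)) = \<zero>\<^bsub>F n\<^esub>"
      using spec[OF s, of n] by (elim conjE)
  qed
qed

text \<open>If \<open>P\<close> is a projective resolution with \<open>P\<^sub>N = 0\<close>, then comparing it with the free
  resolution \<open>F\<close> shows that \<open>- id\<close> on the last term of \<open>F\<close> factors through the last differential.\<close>

lemma short_resolution:
  assumes F: "resolution M F d e" "\<And>n. projective_module (F n)" "carrier (F (Suc (Suc N))) = {\<zero>\<^bsub>F (Suc (Suc N))\<^esub>}"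
    and P: "resolution M P d' e'" "\<And>n. projective_module (P n)" "carrier (P (Suc N)) = {\<zero>\<^bsub>P (Suc N)\<^esub>}"
  shows "\<exists>s. module_hom (F N) (F (Suc N)) s \<and> (\<forall>p\<in>carrier (F (Suc N)). s (d N p) = \<ominus>\<^bsub>F (Suc N)\<^esub> p)"
proof -
  note f = resolutionD[OF F(1)] and p = resolutionD[OF P(1)]
  obtain \<phi> where \<phi>: "\<And>n. module_hom (F n) (P n) (\<phi> n)" "\<And>x. x \<in> carrier (F 0) \<Longrightarrow> e' (\<phi> 0 x) = e x"
    "\<And>n x. x \<in> carrier (F (Suc n)) \<Longrightarrow> d' n (\<phi> (Suc n) x) = \<phi> n (d n x)"
    using comparison[OF F(1,2) P(1)] by blast
  obtain \<psi> where \<psi>: "\<And>n. module_hom (P n) (F n) (\<psi> n)" "\<And>x. x \<in> carrier (P 0) \<Longrightarrow> e (\<psi> 0 x) = e' x"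
    "\<And>n x. x \<in> carrier (P (Suc n)) \<Longrightarrow> d n (\<psi> (Suc n) x) = \<psi> n (d' n x)"
    using comparison[OF P(1,2) F(1)] by blast
  define \<theta> where "\<theta> n x = \<psi> n (\<phi> n x) \<ominus>\<^bsub>F n\<^esub> x" for n x
  note c = module_homD(1)[OF \<phi>(1)] module_homD(1)[OF \<psi>(1)] module_homD(1)[OF f(3)]
  have "\<exists>s. (\<forall>n. module_hom (F n) (F (Suc n)) (s n)) \<and>
    (\<forall>n. \<forall>x\<in>carrier (F (Suc n)). d n (\<theta> (Suc n) x \<ominus>\<^bsub>F (Suc n)\<^esub> s n (d n x)) = \<zero>\<^bsub>F n\<^esub>)"
  proof (rule null_homotopy[OF F(1,2)])
    show "module_hom (F n) (F n) (\<theta> n)" for n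
      unfolding \<theta>_def by (intro module_hom_diff[OF f(2)] module_hom_comp[OF \<phi>(1) \<psi>(1)] module_hom_id)
    show "e (\<theta> 0 x) = \<zero>\<^bsub>M\<^esub>" if "x \<in> carrier (F 0)" for x
    proof -
      interpret M: right_module M by (rule f(1))
      show ?thesis using that c module_homD(1)[OF f(4)]
        by (simp add: \<theta>_def module_hom_minus[OF f(2) f(1) f(4)] \<psi>(2) \<phi>(2) M.minus_eq M.r_neg)
    qed
    show "d n (\<theta> (Suc n) x) = \<theta> n (d n x)" if "x \<in> carrier (F (Suc n))" for n x
      using that c by (simp add: \<theta>_def module_hom_minus[OF f(2) f(2) f(3)] \<psi>(3) \<phi>(3))
  qed
  then obtain s where s: "\<And>n. module_hom (F n) (F (Suc n)) (s n)"
    "\<And>n x. x \<in> carrier (F (Suc n)) \<Longrightarrow> d n (\<theta> (Suc n) x \<ominus>\<^bsub>F (Suc n)\<^esub> s n (d n x)) = \<zero>\<^bsub>F n\<^esub>" by blast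
  have "s N (d N x) = \<ominus>\<^bsub>F (Suc N)\<^esub> x" if x: "x \<in> carrier (F (Suc N))" for x
  proof -
    interpret FN: right_module "F (Suc N)" by (rule f(2))
    have "\<phi> (Suc N) x = \<zero>\<^bsub>P (Suc N)\<^esub>" using c(1)[OF x] P(3) by simp
    then have "\<psi> (Suc N) (\<phi> (Suc N) x) = \<zero>\<^bsub>F (Suc N)\<^esub>" using module_hom_zero[OF p(2) f(2) \<psi>(1)] by metis
    then have th: "\<theta> (Suc N) x = \<ominus>\<^bsub>F (Suc N)\<^esub> x" using x by (simp add: \<theta>_def FN.minus_eq)
    have sc: "s N (d N x) \<in> carrier (F (Suc N))" using module_homD(1)[OF s(1)] c(3)[OF x] .
    have "\<theta> (Suc N) x \<ominus>\<^bsub>F (Suc N)\<^esub> s N (d N x) \<in> d (Suc N) ` carrier (F (Suc (Suc N)))"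
      using s(2)[OF x] x sc by (intro f(9)) (auto simp: th intro!: FN.minus_closed)
    also have "\<dots> = {\<zero>\<^bsub>F (Suc N)\<^esub>}" unfolding F(3) using module_hom_zero[OF f(2) f(2) f(3)] by auto
    finally have "\<ominus>\<^bsub>F (Suc N)\<^esub> x \<ominus>\<^bsub>F (Suc N)\<^esub> s N (d N x) = \<zero>\<^bsub>F (Suc N)\<^esub>" by (simp add: th)
    moreover have "\<ominus>\<^bsub>F (Suc N)\<^esub> x = (\<ominus>\<^bsub>F (Suc N)\<^esub> x \<ominus>\<^bsub>F (Suc N)\<^esub> s N (d N x)) \<oplus>\<^bsub>F (Suc N)\<^esub> s N (d N x)"
      using x sc by (simp add: FN.minus_eq FN.a_assoc FN.l_neg)
    ultimately show ?thesis using sc by simp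
  qed
  then show ?thesis using s(1) by blast
qed

section \<open>The residue field\<close>

lemma projA_0_mult: "projA 0 (a * b) = projA 0 a * projA 0 b"
proof (induction a rule: algA_induct)
  case (mon w)
  then show ?case by (cases w) (simp_all add: projA_mult_left[OF mon_in_gradeA] projA_mon[of 0 "[]", simplified] projA_mon)
qed (simp_all add: projA_add projA_scale distrib_right flip: scaleA_mult_left)

lemma projA_0_one [simp]: "projA 0 1 = 1"
  using projA_mon[of 0 "[]"] by simp

lemma positive_part_gradeA: "positive_part gradeA = {a :: 'k::field algA. projA 0 a = 0}"
proof
  show "positive_part gradeA \<subseteq> {a :: 'k algA. projA 0 a = 0}"
  proof
    fix a :: "'k algA" assume "a \<in> positive_part gradeA"
    then obtain f and I :: "nat set" where f: "a = (\<Sum>i\<in>I. f i)" "\<forall>i\<in>I. 0 < i \<and> f i \<in> gradeA i"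
      unfolding positive_part_def by blast
    have "projA 0 (f i) = 0" if "i \<in> I" for i using projA_gradeA[of "f i" i 0] f(2) that by auto
    then show "a \<in> {a. projA 0 a = 0}" by (simp add: f(1) projA_sum)
  qed
  show "{a :: 'k algA. projA 0 a = 0} \<subseteq> positive_part gradeA"
  proof
    fix a :: "'k algA" assume "a \<in> {a. projA 0 a = 0}"
    moreover have "a = (\<Sum>n\<in>{n. projA n a \<noteq> 0}. projA n a)"
      by (rule projA_sum_superset[symmetric]) (auto simp: finite_projA)
    ultimately show "a \<in> positive_part gradeA"
      unfolding positive_part_def using finite_projA[of a]
      by (intro CollectI exI[of _ "\<lambda>n. projA n a"] exI[of _ "{n. projA n a \<noteq> 0}"])
        (auto simp: projA_in_gradeA intro: gr0I)
  qed
qed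

text \<open>The cosets of the positive part are the fibres of the augmentation
  \<open>projA 0\<close>; all computations in the residue field use this description.\<close>

definition res_class :: "'k::field algA \<Rightarrow> 'k algA set" where
  "res_class z = {a. projA 0 a = projA 0 z}"

lemma res_class_eq_iff: "res_class z = res_class w \<longleftrightarrow> projA 0 z = projA 0 w"
  by (auto simp: res_class_def)

lemma coset_right_regular: "positive_part gradeA +>\<^bsub>right_regular gradeA\<^esub> z = res_class z"
proof -
  have "a \<in> (\<Union>h\<in>{h. projA 0 h = 0}. {h + z}) \<longleftrightarrow> projA 0 a = projA 0 z" for a
  proof
    assume "projA 0 a = projA 0 z"
    then show "a \<in> (\<Union>h\<in>{h. projA 0 h = 0}. {h + z})" by (intro UN_I[of "a - z"]) (auto simp: projA_diff)
  qed (auto simp: projA_add)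
  then show ?thesis unfolding a_r_coset_def' positive_part_gradeA res_class_def by (auto simp: right_regular_def)
qed

lemma coset_left_regular: "positive_part gradeA +>\<^bsub>left_regular gradeA\<^esub> z = res_class z"
  using coset_right_regular[of z] unfolding a_r_coset_def' by (simp add: right_regular_def left_regular_def)

lemma augmentation_eq: "augmentation gradeA v = res_class (v $ 0)"
  by (simp add: augmentation_def coset_right_regular)

lemma positive_part_eq: "positive_part gradeA = res_class 0"
  by (simp add: positive_part_gradeA res_class_def)

lemma res_class_add: "(\<Union>h\<in>res_class z. \<Union>k\<in>res_class w. {h + k}) = res_class (z + w)"
proof -
  have "a \<in> (\<Union>h\<in>res_class z. \<Union>k\<in>res_class w. {h + k})" if "projA 0 a = projA 0 (z + w)" for a
    using that by (intro UN_I[of "a - w"] UN_I[of w]) (auto simp: res_class_def projA_add projA_diff)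
  then show ?thesis by (auto simp: res_class_def projA_add)
qed

lemma residue_field_simps:
  fixes G defines "G \<equiv> (gradeA :: nat \<Rightarrow> 'k::field algA set)"
  shows "carrier (right_residue_field G) = range res_class"
    "\<zero>\<^bsub>right_residue_field G\<^esub> = res_class 0"
    "res_class z \<oplus>\<^bsub>right_residue_field G\<^esub> res_class w = res_class (z + w)"
    "smult (right_residue_field G) a (res_class z) = res_class (z * a)"
    "grade (right_residue_field G) i = res_class ` int_grade gradeA i"
proof -
  have grr: "grade (right_regular gradeA) i = (int_grade gradeA i :: 'k algA set)" by (simp add: right_regular_def)
  show "carrier (right_residue_field G) = range res_class"
    by (simp add: right_residue_field_def subquotient_def G_def coset_right_regular)
  show "grade (right_residue_field G) i = res_class ` int_grade gradeA i"
    by (simp add: right_residue_field_def subquotient_def G_def coset_right_regular grr)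
  show "\<zero>\<^bsub>right_residue_field G\<^esub> = res_class 0"
    by (simp add: right_residue_field_def subquotient_def G_def positive_part_eq)
  show "res_class z \<oplus>\<^bsub>right_residue_field G\<^esub> res_class w = res_class (z + w)"
    by (subst res_class_add[symmetric])
      (simp add: right_residue_field_def subquotient_def set_add_def' right_regular_def)
  have "(\<Union>h\<in>res_class 0. \<Union>k\<in>(\<lambda>m. m * a) ` res_class z. {h + k}) = res_class (z * a)"
  proof -
    have "b \<in> (\<Union>h\<in>res_class 0. \<Union>k\<in>(\<lambda>m. m * a) ` res_class z. {h + k})" if "projA 0 b = projA 0 (z * a)" for b
      using that by (intro UN_I[of "b - z * a"] UN_I[of "z * a"]) (auto simp: res_class_def projA_diff)
    then show ?thesis by (auto simp: res_class_def projA_add projA_0_mult)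
  qed
  then show "smult (right_residue_field G) a (res_class z) = res_class (z * a)"
    by (simp add: right_residue_field_def subquotient_def set_add_def' right_regular_def positive_part_eq[symmetric] G_def)
qed

lemma right_module_residue_field: "right_module (right_residue_field (gradeA :: nat \<Rightarrow> 'k::field algA set))"
proof (rule right_moduleI)
  show "abelian_group (right_residue_field (gradeA :: nat \<Rightarrow> 'k algA set))"
  proof (rule abelian_groupI)
    fix X assume "X \<in> carrier (right_residue_field (gradeA :: nat \<Rightarrow> 'k algA set))"
    then obtain z where z: "X = res_class z" by (auto simp: residue_field_simps)
    show "\<exists>Y\<in>carrier (right_residue_field gradeA). Y \<oplus>\<^bsub>right_residue_field gradeA\<^esub> X = \<zero>\<^bsub>right_residue_field gradeA\<^esub>"
      by (rule bexI[of _ "res_class (- z)"]) (simp_all add: z residue_field_simps)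
  qed (auto simp: residue_field_simps add_ac)
qed (auto simp: residue_field_simps distrib_left distrib_right mult.assoc)

section \<open>Graded modules\<close>

lemma (in right_module) additive_subgroupI:
  assumes "H \<subseteq> carrier M" "\<zero> \<in> H" "\<And>x y. x \<in> H \<Longrightarrow> y \<in> H \<Longrightarrow> x \<oplus> y \<in> H" "\<And>x. x \<in> H \<Longrightarrow> smult M (- 1) x \<in> H"
  shows "additive_subgroup H M"
proof (rule additive_subgroup.intro, rule add.subgroupI)
  show "\<ominus> x \<in> H" if "x \<in> H" for x using assms(4)[OF that] neg_act[of x] that assms(1) by auto
qed (use assms in auto)

lemma subspace_int_grade: "A.subspace (int_grade gradeA i :: 'k::field algA set)"
  by (simp add: int_grade_def subspace_gradeA)

lemma int_grade_mult: "a \<in> int_grade gradeA i \<Longrightarrow> b \<in> gradeA j \<Longrightarrow> a * b \<in> int_grade gradeA (i + int j)"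
  using gradeA_mult[of a "nat i" b j] A.subspace_0[OF subspace_gradeA]
  by (auto simp: int_grade_def nat_add_distrib split: if_splits)

definition projZ :: "int \<Rightarrow> 'k::field algA \<Rightarrow> 'k algA" where
  "projZ i a = (if i < 0 then 0 else projA (nat i) a)"

lemma projZ_in: "projZ i a \<in> int_grade gradeA i"
  by (simp add: projZ_def int_grade_def projA_in_gradeA)

lemma projZ_int_grade: "a \<in> int_grade gradeA i \<Longrightarrow> projZ j a = (if i = j then a else 0)"
  by (auto simp: projZ_def int_grade_def projA_gradeA split: if_splits)

lemma projZ_sum: "projZ i (\<Sum>s\<in>S. f s) = (\<Sum>s\<in>S. projZ i (f s))"
  by (simp add: projZ_def projA_sum)

lemma finite_projZ: "finite {i. projZ i a \<noteq> 0}"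
  by (rule finite_subset[OF _ finite_imageI[OF finite_projA[of a], of int]])
    (auto simp: projZ_def image_iff split: if_splits intro!: exI[of _ "nat _"])

lemma sum_projZ: assumes "finite S" "{i. projZ i a \<noteq> 0} \<subseteq> S" shows "(\<Sum>i\<in>S. projZ i a) = a"
proof -
  have "(\<Sum>i\<in>S. projZ i a) = (\<Sum>i\<in>{i\<in>S. 0 \<le> i}. projA (nat i) a)"
    using assms(1) by (intro sum.mono_neutral_cong_right) (auto simp: projZ_def)
  also have "\<dots> = (\<Sum>n\<in>nat ` {i\<in>S. 0 \<le> i}. projA n a)"
    by (subst sum.reindex) (auto simp: inj_on_def)
  also have "\<dots> = a"
  proof (rule projA_sum_superset)
    show "{n. projA n a \<noteq> 0} \<subseteq> nat ` {i\<in>S. 0 \<le> i}"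
    proof
      fix n assume "n \<in> {n. projA n a \<noteq> 0}"
      then have "int n \<in> S" using assms(2) by (auto simp: projZ_def)
      then show "n \<in> nat ` {i\<in>S. 0 \<le> i}" by (intro image_eqI[of _ _ "int n"]) auto
    qed
  qed (use assms(1) in simp)
  finally show ?thesis .
qed

lemma set_eqI_iff: "(\<And>x. x \<in> A \<longleftrightarrow> x \<in> B) \<Longrightarrow> A = B"
  by blast

lemma graded_residue_field:
  "graded_right_module (gradeA :: nat \<Rightarrow> 'k::field algA set) (right_residue_field gradeA)"
proof -
  let ?K = "right_residue_field (gradeA :: nat \<Rightarrow> 'k algA set)"
  interpret K: right_module ?K by (rule right_module_residue_field)
  \<comment> \<open>The residue field is concentrated in degree 0, which makes decompositions
    trivial.\<close>
  have g: "grade ?K i = (if i = 0 then carrier ?K else {\<zero>\<^bsub>?K\<^esub>})" for i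
  proof (cases "i = 0")
    case True
    have "res_class z \<in> res_class ` gradeA 0" for z :: "'k algA"
      by (rule image_eqI[of _ _ "projA 0 z"]) (auto simp: res_class_eq_iff projA_projA projA_in_gradeA)
    then show ?thesis using True by (auto simp: residue_field_simps int_grade_def)
  next
    case False
    have z: "res_class z = res_class 0" if "z \<in> int_grade gradeA i" for z :: "'k algA"
      using that False by (auto simp: res_class_eq_iff int_grade_def projA_gradeA split: if_splits)
    have 0: "0 \<in> (int_grade gradeA i :: 'k algA set)" using A.subspace_0[OF subspace_int_grade] .
    have "res_class ` (int_grade gradeA i :: 'k algA set) = (\<lambda>_. res_class 0) ` (int_grade gradeA i :: 'k algA set)"
      by (rule image_cong[OF refl z])
    also have "\<dots> = {res_class 0}" using 0 by blast
    finally show ?thesis using False by (simp add: residue_field_simps)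
  qed
  show ?thesis
  proof (intro graded_right_module.intro graded_right_module_axioms.intro right_module_residue_field)
    fix i
    show "additive_subgroup (grade ?K i) ?K"
      by (rule K.additive_subgroupI) (auto simp: g K.act_zero K.act_closed)
  next
    fix m assume m: "m \<in> carrier ?K"
    show "\<exists>!f. (\<forall>i. f i \<in> grade ?K i) \<and> finite {i. f i \<noteq> \<zero>\<^bsub>?K\<^esub>} \<and> m = finsum ?K f {i. f i \<noteq> \<zero>\<^bsub>?K\<^esub>}"
    proof (rule ex1I[of _ "\<lambda>i. if i = 0 then m else \<zero>\<^bsub>?K\<^esub>"])
      have S: "{i::int. (if i = 0 then m else \<zero>\<^bsub>?K\<^esub>) \<noteq> \<zero>\<^bsub>?K\<^esub>} = (if m = \<zero>\<^bsub>?K\<^esub> then {} else {0 :: int})" by auto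
      have 1: "(if i = 0 then m else \<zero>\<^bsub>?K\<^esub>) \<in> grade ?K i" for i using m by (simp add: g)
      have 2: "finite (if m = \<zero>\<^bsub>?K\<^esub> then {} else {0 :: int})" by simp
      have 3: "m = finsum ?K (\<lambda>i. if i = 0 then m else \<zero>\<^bsub>?K\<^esub>) (if m = \<zero>\<^bsub>?K\<^esub> then {} else {0 :: int})"
        using m by (cases "m = \<zero>\<^bsub>?K\<^esub>") simp_all
      show "(\<forall>i. (if i = 0 then m else \<zero>\<^bsub>?K\<^esub>) \<in> grade ?K i) \<and>
          finite {i::int. (if i = 0 then m else \<zero>\<^bsub>?K\<^esub>) \<noteq> \<zero>\<^bsub>?K\<^esub>} \<and>
          m = finsum ?K (\<lambda>i::int. if i = 0 then m else \<zero>\<^bsub>?K\<^esub>) {i::int. (if i = 0 then m else \<zero>\<^bsub>?K\<^esub>) \<noteq> \<zero>\<^bsub>?K\<^esub>}"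
        unfolding S by (rule conjI[OF allI[OF 1] conjI[OF 2 3]])
      fix f assume f: "(\<forall>i. f i \<in> grade ?K i) \<and> finite {i. f i \<noteq> \<zero>\<^bsub>?K\<^esub>} \<and> m = finsum ?K f {i. f i \<noteq> \<zero>\<^bsub>?K\<^esub>}"
      have f0: "f i = \<zero>\<^bsub>?K\<^esub>" if "i \<noteq> 0" for i using f that g[of i] by auto
      have c: "f 0 \<in> carrier ?K" using f g[of 0] by auto
      have T: "{i. f i \<noteq> \<zero>\<^bsub>?K\<^esub>} = (if f 0 = \<zero>\<^bsub>?K\<^esub> then {} else {0})" (is "?L = ?R")
      proof (rule set_eqI_iff)
        show "i \<in> ?L \<longleftrightarrow> i \<in> ?R" for i by (cases "i = 0") (simp_all add: f0)
      qed
      have "m = finsum ?K f {i. f i \<noteq> \<zero>\<^bsub>?K\<^esub>}" using f by (elim conjE)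
      also have "\<dots> = finsum ?K f (if f 0 = \<zero>\<^bsub>?K\<^esub> then {} else {0})" unfolding T ..
      also have "finsum ?K f (if f 0 = \<zero>\<^bsub>?K\<^esub> then {} else {0}) = f 0"
        using c by (cases "f 0 = \<zero>\<^bsub>?K\<^esub>") simp_all
      finally have "m = f 0" .
      then show "f = (\<lambda>i. if i = 0 then m else \<zero>\<^bsub>?K\<^esub>)" by (intro ext) (simp add: f0)
    qed
  next
    fix m i and a :: "'k algA" and j assume "m \<in> grade ?K i" "a \<in> gradeA j"
    then obtain z where z: "m = res_class z" "z \<in> int_grade gradeA i" by (auto simp: residue_field_simps)
    have "z * a \<in> int_grade gradeA (i + int j)" by (rule int_grade_mult[OF z(2) \<open>a \<in> gradeA j\<close>])
    with z(1) show "smult ?K a m \<in> grade ?K (i + int j)" by (simp add: residue_field_simps)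
  qed
qed

section \<open>Graded free modules of column vectors\<close>

lemma free_graded_simps:
  "carrier (free_graded_module G js) = carrier_vec (length js)"
  "\<zero>\<^bsub>free_graded_module G js\<^esub> = 0\<^sub>v (length js)"
  "v \<oplus>\<^bsub>free_graded_module G js\<^esub> w = v + w"
  "smult (free_graded_module G js) a v = map_vec (\<lambda>c. c * a) v"
  "grade (free_graded_module G js) i = {v \<in> carrier_vec (length js). \<forall>r<length js. v $ r \<in> int_grade G (i - js ! r)}"
  by (simp_all add: free_graded_module_def)

lemma right_module_free_graded: "right_module (free_graded_module G js :: ('a::ring_1, 'a vec) graded_module)"
proof (rule right_moduleI)
  show "abelian_group (free_graded_module G js :: ('a, 'a vec) graded_module)"
  proof (rule abelian_groupI)
    fix v :: "'a vec" assume "v \<in> carrier (free_graded_module G js)"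
    then show "\<exists>w\<in>carrier (free_graded_module G js). w \<oplus>\<^bsub>free_graded_module G js\<^esub> v = \<zero>\<^bsub>free_graded_module G js\<^esub>"
      by (intro bexI[of _ "- v"]) (auto simp: free_graded_simps)
  qed (auto simp: free_graded_simps comm_add_vec assoc_add_vec)
qed (auto simp: free_graded_simps distrib_left distrib_right mult.assoc)

lemma finsum_free_graded:
  assumes "f \<in> S \<rightarrow> carrier_vec (length js)" "r < length js" "finite S"
  shows "finsum (free_graded_module G js) f S $ r = (\<Sum>s\<in>S. f s $ r)"
proof -
  interpret right_module "free_graded_module G js" by (rule right_module_free_graded)
  have "finsum (free_graded_module G js) f S \<in> carrier_vec (length js) \<and>
    finsum (free_graded_module G js) f S $ r = (\<Sum>s\<in>S. f s $ r)"
    using assms(3,1)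
  proof induction
    case empty
    then show ?case using assms(2) by (simp add: free_graded_simps)
  next
    case (insert s S)
    then have fs: "f s \<in> carrier_vec (length js)" "f \<in> S \<rightarrow> carrier_vec (length js)" by auto
    then have "finsum (free_graded_module G js) f (insert s S) = f s + finsum (free_graded_module G js) f S"
      using insert by (subst finsum_insert) (auto simp: free_graded_simps)
    moreover have "finsum (free_graded_module G js) f S \<in> carrier_vec (length js)"
        "finsum (free_graded_module G js) f S $ r = (\<Sum>s\<in>S. f s $ r)" using insert.IH fs(2) by auto
    ultimately show ?case using insert fs(1) assms(2) by simp
  qed
  then show ?thesis by simp
qed

lemma graded_free_graded:
  "graded_right_module gradeA (free_graded_module gradeA js :: ('k::field algA, 'k algA vec) graded_module)"
proof -
  let ?F = "free_graded_module gradeA js :: ('k algA, 'k algA vec) graded_module"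
  interpret F: right_module ?F by (rule right_module_free_graded)
  show ?thesis
  proof (intro graded_right_module.intro graded_right_module_axioms.intro right_module_free_graded)
    show "additive_subgroup (grade ?F i) ?F" for i
      by (rule F.additive_subgroupI)
        (auto simp: free_graded_simps carrier_vecD A.subspace_0[OF subspace_int_grade]
          intro!: A.subspace_add[OF subspace_int_grade] A.subspace_neg[OF subspace_int_grade])
  next
    fix m i and a :: "'k algA" and j assume "m \<in> grade ?F i" "a \<in> gradeA j"
    then show "smult ?F a m \<in> grade ?F (i + int j)"
      using int_grade_mult[of _ "i - js ! _" a j] by (auto simp: free_graded_simps carrier_vecD algebra_simps)
  next
    fix m assume m: "m \<in> carrier ?F"
    define h where "h i = vec (length js) (\<lambda>r. projZ (i - js ! r) (m $ r))" for i
    have hc: "h i \<in> carrier_vec (length js)" for i by (simp add: h_def)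
    have hr: "h i $ r = projZ (i - js ! r) (m $ r)" if "r < length js" for i r using that by (simp add: h_def)
    have z: "v = 0\<^sub>v (length js) \<longleftrightarrow> (\<forall>r<length js. v $ r = 0)" if "v \<in> carrier_vec (length js)" for v :: "'k algA vec"
      using that by (auto simp: vec_eq_iff)
    have fin: "finite {i. h i \<noteq> \<zero>\<^bsub>?F\<^esub>}"
    proof (rule finite_subset)
      show "{i. h i \<noteq> \<zero>\<^bsub>?F\<^esub>} \<subseteq> (\<Union>r\<in>{..<length js}. (\<lambda>i. i + js ! r) ` {i. projZ i (m $ r) \<noteq> 0})"
      proof
        fix i assume "i \<in> {i. h i \<noteq> \<zero>\<^bsub>?F\<^esub>}"
        then obtain r where "r < length js" "projZ (i - js ! r) (m $ r) \<noteq> 0"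
          using z[OF hc] hr by (auto simp: free_graded_simps)
        then show "i \<in> (\<Union>r\<in>{..<length js}. (\<lambda>i. i + js ! r) ` {i. projZ i (m $ r) \<noteq> 0})"
          by (intro UN_I[of r] image_eqI[of _ _ "i - js ! r"]) auto
      qed
    qed (auto simp: finite_projZ)
    show "\<exists>!f. (\<forall>i. f i \<in> grade ?F i) \<and> finite {i. f i \<noteq> \<zero>\<^bsub>?F\<^esub>} \<and> m = finsum ?F f {i. f i \<noteq> \<zero>\<^bsub>?F\<^esub>}"
    proof (rule ex1I[of _ h], intro conjI allI)
      show "h i \<in> grade ?F i" for i by (auto simp: free_graded_simps h_def projZ_in)
      show "finite {i. h i \<noteq> \<zero>\<^bsub>?F\<^esub>}" by (rule fin)
      show "m = finsum ?F h {i. h i \<noteq> \<zero>\<^bsub>?F\<^esub>}" (is "_ = finsum ?F h ?S")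
      proof (rule eq_vecI)
        have "finsum ?F h ?S \<in> carrier ?F" using hc by (intro F.finsum_closed) (auto simp: free_graded_simps)
        then show dim: "dim_vec m = dim_vec (finsum ?F h ?S)" using m by (simp add: free_graded_simps carrier_vecD)
        fix r assume "r < dim_vec (finsum ?F h ?S)"
        then have r: "r < length js" using dim m by (simp add: free_graded_simps carrier_vecD)
        have "finsum ?F h ?S $ r = (\<Sum>i\<in>?S. projZ (i - js ! r) (m $ r))"
          using hc r fin by (subst finsum_free_graded) (auto simp: hr)
        also have "\<dots> = (\<Sum>i\<in>(\<lambda>i. i - js ! r) ` ?S. projZ i (m $ r))"
          by (subst sum.reindex) (auto simp: inj_on_def)
        also have "\<dots> = m $ r"
        proof (rule sum_projZ)
          show "{i. projZ i (m $ r) \<noteq> 0} \<subseteq> (\<lambda>i. i - js ! r) ` ?S"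
          proof
            fix i assume "i \<in> {i. projZ i (m $ r) \<noteq> 0}"
            then have "h (i + js ! r) \<noteq> \<zero>\<^bsub>?F\<^esub>" using z[OF hc] hr[OF r] r by (auto simp: free_graded_simps)
            then show "i \<in> (\<lambda>i. i - js ! r) ` ?S" by (intro image_eqI[of _ _ "i + js ! r"]) auto
          qed
        qed (use fin in simp)
        finally show "m $ r = finsum ?F h ?S $ r" by simp
      qed
      fix f assume f: "(\<forall>i. f i \<in> grade ?F i) \<and> finite {i. f i \<noteq> \<zero>\<^bsub>?F\<^esub>} \<and> m = finsum ?F f {i. f i \<noteq> \<zero>\<^bsub>?F\<^esub>}"
      then have fc: "f i \<in> carrier_vec (length js)" and fg: "\<And>r. r < length js \<Longrightarrow> f i $ r \<in> int_grade gradeA (i - js ! r)" for i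
        by (auto simp: free_graded_simps)
      have "f n = h n" for n
      proof (rule eq_vecI)
        show "dim_vec (f n) = dim_vec (h n)" using fc[of n] hc[of n] by (simp add: carrier_vecD)
        fix r assume "r < dim_vec (h n)"
        then have r: "r < length js" using hc[of n] by (simp add: carrier_vecD)
        let ?T = "{i. f i \<noteq> \<zero>\<^bsub>?F\<^esub>}"
        have "m $ r = (\<Sum>i\<in>?T. f i $ r)" using f finsum_free_graded[of f ?T js r gradeA] fc r by auto
        then have "h n $ r = (\<Sum>i\<in>?T. projZ (n - js ! r) (f i $ r))" by (simp add: hr[OF r] projZ_sum)
        also have "\<dots> = (\<Sum>i\<in>?T. if i = n then f n $ r else 0)"
          using projZ_int_grade[OF fg[OF r]] by (intro sum.cong) auto
        also have "\<dots> = f n $ r" using f r by (subst sum.delta) (auto simp: free_graded_simps)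
        finally show "f n $ r = h n $ r" by simp
      qed
      then show "f = h" by auto
    qed
  qed
qed

section \<open>The graded free resolution of the residue field\<close>

definition res_shifts :: "int list list" where
  "res_shifts = [[0], [1, 1], [3, 4, 7], [5, 8, 9], [11, 11], [12]]"

definition shifts :: "nat \<Rightarrow> int list" where
  "shifts n = (if n < length res_shifts then res_shifts ! n else [])"

definition off :: "nat \<Rightarrow> nat" where "off n = (if n < 7 then [0,1,3,6,9,11,12] ! n else 12)"

definition rank :: "nat \<Rightarrow> nat" where "rank n = length (shifts n)"

text \<open>Puts the column vectors of the \<open>n\<close>-th term into their block of generators
  in the total complex, where the exactness theorem is formulated.\<close>

definition emb :: "nat \<Rightarrow> 'k::field algA vec \<Rightarrow> nat \<Rightarrow> 'k algA" where
  "emb n v i = (if off n \<le> i \<and> i < off n + rank n then v $ (i - off n) else 0)"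

definition unemb :: "nat \<Rightarrow> (nat \<Rightarrow> 'k::field algA) \<Rightarrow> 'k algA vec" where
  "unemb n f = vec (rank n) (\<lambda>r. f (off n + r))"

lemma less_6_cases: assumes "P 0" "P (Suc 0)" "P 2" "P 3" "P 4" "P 5" "\<And>n. 6 \<le> n \<Longrightarrow> P n" shows "P (n::nat)"
proof -
  have "n = 0 \<or> n = Suc 0 \<or> n = 2 \<or> n = 3 \<or> n = 4 \<or> n = 5 \<or> 6 \<le> n" by arith
  then show ?thesis using assms by blast
qed

lemma rank_simps: "rank 0 = 1" "rank (Suc 0) = 2" "rank 2 = 3" "rank (Suc (Suc 0)) = 3" "rank 3 = 3" "rank 4 = 2" "rank 5 = 1"
    "6 \<le> n \<Longrightarrow> rank n = 0"
  and off_simps: "off 0 = 0" "off (Suc 0) = 1" "off 2 = 3" "off (Suc (Suc 0)) = 3" "off 3 = 6" "off 4 = 9" "off 5 = 11" "6 \<le> n \<Longrightarrow> off n = 12"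
  by (auto simp: rank_def off_def shifts_def res_shifts_def nth_Cons split: nat.splits)

text \<open>The generators of one homological degree form a consecutive block, so support conditions
  on the total complex are the same as membership in a block.\<close>

lemma hdeg_iff: "i < 12 \<and> hdeg i = n \<longleftrightarrow> off n \<le> i \<and> i < off n + rank n"
proof -
  have "\<forall>i<12. hdeg i = n \<longleftrightarrow> off n \<le> i \<and> i < off n + rank n"
    by (induction n rule: less_6_cases; unfold all_lt12) (simp_all add: rank_simps off_simps hdeg_def)
  moreover have "off n + rank n \<le> 12"
    by (induction n rule: less_6_cases) (simp_all add: rank_simps off_simps)
  ultimately show ?thesis by auto
qed

lemma shifts_gdeg: "r < rank n \<Longrightarrow> shifts n ! r = int (gdeg (off n + r))"
  by (induction n rule: less_6_cases)
    (auto simp: gdeg_def off_def rank_def shifts_def res_shifts_def less_Suc_eq numeral_eq_Suc)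

lemma emb_support: "\<not> (i < 12 \<and> hdeg i = n) \<Longrightarrow> emb n v i = 0"
  unfolding hdeg_iff by (auto simp: emb_def)

lemma unemb_emb: "v \<in> carrier_vec (rank n) \<Longrightarrow> unemb n (emb n v) = v"
  by (auto simp: unemb_def emb_def vec_eq_iff)

lemma emb_unemb: "(\<And>i. \<not> (i < 12 \<and> hdeg i = n) \<Longrightarrow> f i = 0) \<Longrightarrow> emb n (unemb n f) = f"
  unfolding hdeg_iff by (auto simp: unemb_def emb_def fun_eq_iff)

lemma unemb_carrier: "unemb n f \<in> carrier_vec (rank n)"
  by (simp add: unemb_def)

lemma emb_inject: "v \<in> carrier_vec (rank n) \<Longrightarrow> w \<in> carrier_vec (rank n) \<Longrightarrow> emb n v = emb n w \<Longrightarrow> v = w"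
  by (metis unemb_emb)

abbreviation res_term :: "nat \<Rightarrow> ('k::field algA, 'k algA vec) graded_module" where
  "res_term \<equiv> free_terms gradeA res_shifts"

abbreviation res_map :: "nat \<Rightarrow> 'k::field algA vec \<Rightarrow> 'k algA vec" where
  "res_map \<equiv> matrix_maps res_shifts [d1, d2, d3, d4, d5]"

lemma res_term_eq: "res_term n = free_graded_module gradeA (shifts n)"
  by (simp add: free_terms_def shifts_def)

lemma res_term_simps:
  "carrier (res_term n) = carrier_vec (rank n)" "\<zero>\<^bsub>res_term n\<^esub> = 0\<^sub>v (rank n)"
  "v \<oplus>\<^bsub>res_term n\<^esub> w = v + w" "smult (res_term n) a v = map_vec (\<lambda>c. c * a) v"
  by (simp_all add: res_term_eq free_graded_simps rank_def)

lemma emb_zero: "emb n (0\<^sub>v (rank n)) = 0"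
  by (auto simp: emb_def fun_eq_iff)

lemma res_map_carrier: "v \<in> carrier_vec (rank (Suc n)) \<Longrightarrow> res_map n v \<in> carrier_vec (rank n)"
  by (induction n rule: less_6_cases)
    (auto simp: matrix_maps_def rank_def shifts_def res_shifts_def d1_def d2_def d3_def d4_def d5_def
      mat_of_rows_list_def Let_def numeral_eq_Suc intro!: carrier_vecI)

lemma sum_upto: "(\<Sum>i\<in>{0..<Suc 0}. f i) = f 0" "(\<Sum>i\<in>{0..<2}. f i) = f 0 + f (Suc 0)"
  "(\<Sum>i\<in>{0..<3}. f i) = f 0 + f (Suc 0) + f 2" for f :: "nat \<Rightarrow> 'a::comm_monoid_add"
  by (simp_all add: numeral_2_eq_2 numeral_3_eq_3 sum.atLeast0_lessThan_Suc)

lemmas matrix_row = mat_of_rows_list_def scalar_prod_def Let_def sum_upto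

lemma d1_mult: "dim_vec v = 2 \<Longrightarrow> (d1 *\<^sub>v v) $ 0 = xA * v $ 0 + yA * v $ Suc 0"
  by (simp add: d1_def matrix_row)

lemma d2_mult: assumes "dim_vec v = 3"
  shows "(d2 *\<^sub>v v) $ 0 = xA * yA * v $ 0 + yA^3 * v $ Suc 0 + yA * RA * yA * v $ 2"
    "(d2 *\<^sub>v v) $ Suc 0 = - (xA^2 * v $ 0) - yA^2 * xA * v $ Suc 0 - RA * yA * xA * v $ 2"
  by (simp_all add: d2_def matrix_row assms)

lemma d3_mult: assumes "dim_vec v = 3"
  shows "(d3 *\<^sub>v v) $ 0 = yA^2 * v $ 0 + RA * yA * v $ Suc 0"
    "(d3 *\<^sub>v v) $ Suc 0 = - (xA * v $ 0) - yA * RA * v $ 2"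
    "(d3 *\<^sub>v v) $ 2 = - (xA * v $ Suc 0) + yA^2 * v $ 2"
  by (simp_all add: d3_def matrix_row assms)

lemma d4_mult: assumes "dim_vec v = 2"
  shows "(d4 *\<^sub>v v) $ 0 = - (yA * RA * yA * v $ 0) + xA * yA * RA * v $ Suc 0"
    "(d4 *\<^sub>v v) $ Suc 0 = yA^3 * v $ 0 - xA * yA^2 * v $ Suc 0"
    "(d4 *\<^sub>v v) $ 2 = yA * xA * v $ 0 - xA^2 * v $ Suc 0"
  by (simp_all add: d4_def matrix_row assms)

lemma d5_mult: assumes "dim_vec v = Suc 0"
  shows "(d5 *\<^sub>v v) $ 0 = xA * v $ 0" "(d5 *\<^sub>v v) $ Suc 0 = yA * v $ 0"
  by (simp_all add: d5_def matrix_row assms)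

lemma res_map_simps: "res_map 0 v = d1 *\<^sub>v v" "res_map (Suc 0) v = d2 *\<^sub>v v" "res_map 2 v = d3 *\<^sub>v v"
    "res_map 3 v = d4 *\<^sub>v v" "res_map 4 v = d5 *\<^sub>v v" "5 \<le> n \<Longrightarrow> res_map n v = 0\<^sub>v (rank n)"
  by (auto simp: matrix_maps_def rank_def shifts_def)

text \<open>Here the five matrices meet \<open>diff\<close>: after embedding, each acts as the total
  differential, and the zero maps beyond them act on zero modules.\<close>

lemma emb_res_map:
  fixes v :: "'k::field algA vec"
  assumes "v \<in> carrier_vec (rank (Suc n))"
  shows "emb n (res_map n v) = diff (emb (Suc n) v)"
proof -
  have *: "\<forall>i<12. emb n (res_map n v) i = diff (emb (Suc n) v) i"
  proof (cases "5 \<le> n")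
    case True
    then have "emb (Suc n) v = 0" by (intro ext) (auto simp: emb_def rank_simps)
    then show ?thesis using True by (simp add: res_map_simps emb_zero)
  next
    case False
    then consider "n = 0" | "n = Suc 0" | "n = 2" | "n = 3" | "n = 4" by linarith
    then show ?thesis
    proof cases
      case 1
      then have "dim_vec v = 2" using assms by (simp add: rank_simps carrier_vecD)
      then show ?thesis unfolding all_lt12 1
        by (simp add: emb_def diff_def Let_def res_map_simps rank_simps off_simps d1_mult)
    next
      case 2
      then have "dim_vec v = 3" using assms by (simp add: rank_simps carrier_vecD)
      then show ?thesis unfolding all_lt12 2
        by (simp add: emb_def diff_def Let_def res_map_simps rank_simps off_simps d2_mult)
    next
      case 3
      then have "dim_vec v = 3" using assms by (simp add: rank_simps carrier_vecD)
      then show ?thesis unfolding all_lt12 3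
        by (simp add: emb_def diff_def Let_def res_map_simps rank_simps off_simps d3_mult)
    next
      case 4
      then have "dim_vec v = 2" using assms by (simp add: rank_simps carrier_vecD)
      then show ?thesis unfolding all_lt12 4
        by (simp add: emb_def diff_def Let_def res_map_simps rank_simps off_simps d4_mult)
    next
      case 5
      then have "dim_vec v = Suc 0" using assms by (simp add: rank_simps carrier_vecD)
      then show ?thesis unfolding all_lt12 5
        by (simp add: emb_def diff_def Let_def res_map_simps rank_simps off_simps d5_mult)
    qed
  qed
  show ?thesis
  proof
    fix i show "emb n (res_map n v) i = diff (emb (Suc n) v) i"
    proof (cases "i < 12")
      case False
      then show ?thesis using emb_support[of i n] by (simp add: diff_def Let_def)
    qed (use * in blast)
  qed
qed

lemma emb_add: "v \<in> carrier_vec (rank n) \<Longrightarrow> w \<in> carrier_vec (rank n) \<Longrightarrow> emb n (v + w) = emb n v + emb n w"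
  by (auto simp: emb_def fun_eq_iff carrier_vecD)

lemma emb_act: "v \<in> carrier_vec (rank n) \<Longrightarrow> emb n (map_vec (\<lambda>c. c * a) v) = (\<lambda>i. emb n v i * a)"
  by (auto simp: emb_def fun_eq_iff carrier_vecD)

lemma diff_act: "diff (\<lambda>i. f i * a) = (\<lambda>i. diff f i * a)"
  by (auto simp: diff_def Let_def fun_eq_iff distrib_right left_diff_distrib mult.assoc)

lemma module_hom_res_map: "module_hom (res_term (Suc n)) (res_term n) (res_map n)"
proof (rule module_homI; unfold res_term_simps)
  fix v w :: "'a algA vec" and a assume v: "v \<in> carrier_vec (rank (Suc n))"
  show c: "res_map n v \<in> carrier_vec (rank n)" by (rule res_map_carrier[OF v])
  show "res_map n (map_vec (\<lambda>c. c * a) v) = map_vec (\<lambda>c. c * a) (res_map n v)"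
    by (rule emb_inject[of _ n]) (use v c in \<open>simp_all add: res_map_carrier emb_res_map emb_act diff_act\<close>)
  assume w: "w \<in> carrier_vec (rank (Suc n))"
  show "res_map n (v + w) = res_map n v + res_map n w"
    by (rule emb_inject[of _ n]) (use v w in \<open>simp_all add: res_map_carrier emb_res_map emb_add diff_add\<close>)
qed

lemma right_module_res_term: "right_module (res_term n)"
  unfolding res_term_eq by (rule right_module_free_graded)

theorem resolution_residue_field:
  "resolution (right_residue_field (gradeA :: nat \<Rightarrow> 'k::field algA set)) res_term res_map (augmentation gradeA)"
  unfolding resolution_def
proof (intro conjI allI)
  let ?K = "right_residue_field (gradeA :: nat \<Rightarrow> 'k algA set)"
  show "module_hom (res_term 0) ?K (augmentation gradeA)"
    by (rule module_homI) (simp_all add: res_term_simps rank_simps augmentation_eq residue_field_simps)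
  have "res_class z \<in> augmentation gradeA ` carrier (res_term 0)" for z :: "'k algA"
    by (rule image_eqI[of _ _ "vec 1 (\<lambda>_. z)"]) (simp_all add: res_term_simps rank_simps augmentation_eq)
  then show "augmentation gradeA ` carrier (res_term 0) = carrier ?K"
    by (auto simp: residue_field_simps augmentation_eq)
  \<comment> \<open>Exactness of the total complex, pulled back through \<open>emb\<close>; the
    embedding is injective and hits everything supported on the block.\<close>
  have ex: "v \<in> res_map n ` carrier_vec (rank (Suc n))"
    if v: "v \<in> carrier_vec (rank n)" and d: "diff (emb n v) = 0" and a: "n = 0 \<Longrightarrow> projA 0 (v $ 0) = 0"
    for n and v :: "'k algA vec"
  proof -
    have "projA 0 (emb n v 0) = 0" if "n = 0" using a that by (simp add: emb_def off_simps rank_simps)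
    then obtain u where u: "\<And>i. \<not> (i < 12 \<and> hdeg i = Suc n) \<Longrightarrow> u i = 0" "emb n v = diff u"
      using exact_total[of n "emb n v", OF emb_support d] by blast
    have "emb n (res_map n (unemb (Suc n) u)) = emb n v"
      using emb_res_map[OF unemb_carrier, of n u] emb_unemb[OF u(1)] u(2) by simp
    then have "v = res_map n (unemb (Suc n) u)"
      using emb_inject[OF v res_map_carrier[OF unemb_carrier]] by metis
    then show ?thesis using unemb_carrier by blast
  qed
  have dd: "diff (emb n (res_map n v)) = 0" if "v \<in> carrier_vec (rank (Suc n))" for n and v :: "'k algA vec"
    unfolding emb_res_map[OF that] by (rule diff_diff)
  have aug0: "augmentation gradeA (res_map 0 v) = res_class 0" if v: "v \<in> carrier_vec (rank (Suc 0))" for v :: "'k algA vec"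
  proof -
    have "dim_vec v = 2" using v by (simp add: rank_simps carrier_vecD)
    then show ?thesis
      by (simp add: augmentation_eq res_map_simps d1_mult res_class_eq_iff projA_add projA_gens)
  qed
  show "res_map 0 ` carrier (res_term 1) = a_kernel (res_term 0) ?K (augmentation gradeA)"
  proof (rule set_eqI_iff)
    fix v :: "'k algA vec"
    have *: "emb 0 w 1 = 0" "emb 0 w 2 = 0" for w :: "'k algA vec" by (simp_all add: emb_def off_simps rank_simps)
    have "diff (emb 0 v) = 0"
    proof
      fix r show "diff (emb 0 v) r = 0 r" by (simp add: diff_def Let_def emb_def off_simps rank_simps)
    qed
    then show "v \<in> res_map 0 ` carrier (res_term 1) \<longleftrightarrow> v \<in> a_kernel (res_term 0) ?K (augmentation gradeA)"
      using ex[of v 0] res_map_carrier[of _ 0] aug0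
      by (auto simp: a_kernel_def' res_term_simps residue_field_simps augmentation_eq res_class_eq_iff)
  qed
  show "res_map (Suc n) ` carrier (res_term (Suc (Suc n)) :: ('k algA, 'k algA vec) graded_module) =
    a_kernel (res_term (Suc n)) (res_term n) (res_map n)" for n
  proof (rule set_eqI_iff)
    fix v :: "'k algA vec"
    have "diff (emb (Suc n) v) = 0 \<longleftrightarrow> res_map n v = 0\<^sub>v (rank n)" if "v \<in> carrier_vec (rank (Suc n))"
      using emb_res_map[OF that] emb_inject[OF res_map_carrier[OF that] zero_carrier_vec] emb_zero[of n] by metis
    then show "v \<in> res_map (Suc n) ` carrier (res_term (Suc (Suc n))) \<longleftrightarrow>
        v \<in> a_kernel (res_term (Suc n)) (res_term n) (res_map n)"
      using ex[of v "Suc n"] res_map_carrier[of _ "Suc n"] dd[of _ "Suc n"]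
      by (auto simp: a_kernel_def' res_term_simps)
  qed
qed (auto intro: right_module_residue_field right_module_res_term module_hom_res_map)

text \<open>\<open>upper\<close> is indexed by natural numbers, so negative degrees, where
  everything is 0, are kept apart.\<close>

lemma grade_res_term: "v \<in> grade (res_term n) i \<longleftrightarrow>
    v \<in> carrier_vec (rank n) \<and> (if i < 0 then emb n v = 0 else emb n v \<in> upper n (nat i) 0)"
proof -
  have "v \<in> grade (res_term n) i \<longleftrightarrow> v \<in> carrier_vec (rank n) \<and>
      (\<forall>r<rank n. v $ r \<in> int_grade gradeA (i - int (gdeg (off n + r))))"
    by (auto simp: res_term_eq free_graded_simps rank_def[symmetric] shifts_gdeg)
  also have "(\<forall>r<rank n. v $ r \<in> int_grade gradeA (i - int (gdeg (off n + r)))) \<longleftrightarrow>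
      (\<forall>j. if j < 12 \<and> hdeg j = n then emb n v j \<in> int_grade gradeA (i - int (gdeg j)) else emb n v j = 0)"
    (is "?L \<longleftrightarrow> ?R")
  proof
    assume L: ?L
    show ?R unfolding hdeg_iff
    proof
      fix j
      show "if off n \<le> j \<and> j < off n + rank n then emb n v j \<in> int_grade gradeA (i - int (gdeg j)) else emb n v j = 0"
        using L[rule_format, of "j - off n"] by (auto simp: emb_def)
    qed
  next
    assume R: ?R
    show ?L
    proof (intro allI impI)
      fix r assume "r < rank n"
      then show "v $ r \<in> int_grade gradeA (i - int (gdeg (off n + r)))"
        using spec[OF R, of "off n + r"] unfolding hdeg_iff by (simp add: emb_def)
    qed
  qed
  also have "?R \<longleftrightarrow> (if i < 0 then emb n v = 0 else emb n v \<in> upper n (nat i) 0)"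
  proof (cases "i < 0")
    case True
    then have "int_grade gradeA (i - int (gdeg j)) = {0 :: 'a algA}" for j by (simp add: int_grade_def)
    then show ?thesis using True by (auto simp: fun_eq_iff)
  next
    case False
    then have "emb n v j \<in> int_grade gradeA (i - int (gdeg j)) \<longleftrightarrow>
        (if gdeg j \<le> nat i then emb n v j \<in> gradeA (nat i - gdeg j) else emb n v j = 0)" for j
      by (auto simp: int_grade_def nat_diff_distrib)
    then show ?thesis using False unfolding upper_zero_iff by (auto split: if_splits)
  qed
  finally show ?thesis .
qed

lemma diff_upper: assumes "v \<in> upper (Suc h) n 0" shows "diff v \<in> upper h n 0"
proof -
  have "hom_part n v = v"
  proof
    fix i show "hom_part n v i = v i"
      using assms[unfolded upper_zero_iff, rule_format, of i]
      by (cases "i < 12 \<and> hdeg i = Suc h \<and> gdeg i \<le> n") (auto simp: hom_part_def gradeA_iff_projA)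
  qed
  moreover have "emb (Suc h) (unemb (Suc h) v) = v"
    using assms[unfolded upper_zero_iff] by (intro emb_unemb) (auto split: if_splits)
  ultimately have "diff v = hom_part n (emb h (res_map h (unemb (Suc h) v)))"
    using emb_res_map[OF unemb_carrier, of h v] hom_part_diff[of n v] by simp
  also have "\<dots> \<in> upper h n 0" by (rule hom_part_in_upper) (rule emb_support)
  finally show ?thesis .
qed

lemma graded_hom_res_map: "graded_hom (res_term (Suc n)) (res_term n) 0 (res_map n)"
  unfolding graded_hom_def
proof (intro conjI module_hom_res_map allI image_subsetI)
  fix i :: int and v :: "'a algA vec" assume "v \<in> grade (res_term (Suc n)) i"
  then show "res_map n v \<in> grade (res_term n) (i + 0)"
    unfolding grade_res_term by (auto simp: res_map_carrier emb_res_map diff_upper split: if_splits)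
qed

theorem graded_resolution_residue_field:
  "graded_resolution (gradeA :: nat \<Rightarrow> 'k::field algA set) (right_residue_field gradeA) res_term res_map (augmentation gradeA)"
  unfolding graded_resolution_def
proof (intro conjI allI resolution_residue_field graded_residue_field graded_hom_res_map)
  show "graded_right_module gradeA (res_term n :: ('k algA, 'k algA vec) graded_module)" for n
    unfolding res_term_eq by (rule graded_free_graded)
  show "graded_hom (res_term 0) (right_residue_field (gradeA :: nat \<Rightarrow> 'k algA set)) 0 (augmentation gradeA)"
    unfolding graded_hom_def
  proof (intro conjI allI image_subsetI)
    show "module_hom (res_term 0) (right_residue_field (gradeA :: nat \<Rightarrow> 'k algA set)) (augmentation gradeA)"
      by (rule resolutionD(4)[OF resolution_residue_field])
    fix i :: int and v :: "'k algA vec" assume v: "v \<in> grade (res_term 0) i"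
    have "shifts 0 = [0]" by (simp add: shifts_def res_shifts_def)
    then have "v $ 0 \<in> int_grade gradeA i" using v unfolding res_term_eq free_graded_simps by simp
    then show "augmentation gradeA v \<in> grade (right_residue_field gradeA) (i + 0)"
      by (simp add: augmentation_eq residue_field_simps)
  qed
qed

section \<open>Projectivity of the terms\<close>

lemma lookup_sum_single:
  "Poly_Mapping.lookup (\<Sum>r<n. Poly_Mapping.single r (f r)) i = (if i < n then f i else 0)" for f :: "nat \<Rightarrow> 'a::comm_monoid_add"
  by (auto simp: lookup_sum lookup_single when_def)

lemma res_term_iso_free:
  "module_iso (res_term n :: ('k::field algA, 'k algA vec) graded_module) (free_module {..<rank n})
    (\<lambda>v. \<Sum>r<rank n. Poly_Mapping.single r (v $ r)) (\<lambda>f. vec (rank n) (Poly_Mapping.lookup f))"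
  unfolding module_iso_def
proof (intro conjI right_module_res_term right_module_free_module ballI)
  show "module_hom (res_term n :: ('k algA, 'k algA vec) graded_module) (free_module {..<rank n}) (\<lambda>v. \<Sum>r<rank n. Poly_Mapping.single r (v $ r))"
  proof (rule module_homI)
    fix v :: "'k algA vec"
    show "(\<Sum>r<rank n. Poly_Mapping.single r (v $ r)) \<in> carrier (free_module {..<rank n})"
      by (auto simp: free_module_simps in_keys_iff lookup_sum_single split: if_splits)
  qed (auto simp: res_term_simps free_module_simps carrier_vecD lookup_sum_single lookup_add lookup_map_mult
      intro!: poly_mapping_eqI)
  show "module_hom (free_module {..<rank n}) (res_term n :: ('k algA, 'k algA vec) graded_module) (\<lambda>f. vec (rank n) (Poly_Mapping.lookup f))"
    by (rule module_homI) (auto simp: res_term_simps free_module_simps lookup_add lookup_map_mult vec_eq_iff)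
  show "vec (rank n) (Poly_Mapping.lookup (\<Sum>r<rank n. Poly_Mapping.single r (v $ r))) = v"
    if "v \<in> carrier (res_term n)" for v :: "'k algA vec"
    using that by (auto simp: res_term_simps lookup_sum_single vec_eq_iff)
  show "(\<Sum>r<rank n. Poly_Mapping.single r (vec (rank n) (Poly_Mapping.lookup f) $ r)) = f"
    if "f \<in> carrier (free_module {..<rank n})" for f :: "nat \<Rightarrow>\<^sub>0 'k algA"
    using that by (auto simp: free_module_simps lookup_sum_single in_keys_iff subset_iff intro!: poly_mapping_eqI)
qed

lemma module_iso_trans:
  assumes "module_iso L M f g" "module_iso M N f' g'"
  shows "module_iso L N (\<lambda>x. f' (f x)) (\<lambda>y. g (g' y))"
proof -
  have 1: "right_module L" "module_hom L M f" "module_hom M L g" "\<And>x. x \<in> carrier L \<Longrightarrow> g (f x) = x"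
      "\<And>y. y \<in> carrier M \<Longrightarrow> f (g y) = y" using assms(1) unfolding module_iso_def by auto
  have 2: "right_module N" "module_hom M N f'" "module_hom N M g'" "\<And>x. x \<in> carrier M \<Longrightarrow> g' (f' x) = x"
      "\<And>y. y \<in> carrier N \<Longrightarrow> f' (g' y) = y" using assms(2) unfolding module_iso_def by auto
  show ?thesis unfolding module_iso_def
    using 1 2 module_hom_comp[OF 1(2) 2(2)] module_hom_comp[OF 2(3) 1(3)] module_homD(1)[OF 1(2)] module_homD(1)[OF 2(3)]
    by simp
qed

section \<open>Resolutions of arbitrary modules\<close>

text \<open>Let \<open>B\<close> be a \<open>k\<close>-basis of \<open>M\<close>. The resolution of \<open>k\<close>, tensored with \<open>M\<close> over \<open>k\<close>, is a
  complex of free modules on \<open>B\<close> times the generators. Its differentials are corrected by terms of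
  lower degree, one after the other, so that they form a resolution of \<open>M\<close>.\<close>

definition lincomb :: "('k::field algA, 'm, 'z) module_scheme \<Rightarrow> ('m \<Rightarrow> 'k) \<Rightarrow> 'm set \<Rightarrow> 'm" where
  "lincomb M c S = finsum M (\<lambda>s. smult M (scaleA (c s) 1) s) S"

definition lin_indep :: "('k::field algA, 'm, 'z) module_scheme \<Rightarrow> 'm set \<Rightarrow> bool" where
  "lin_indep M B \<longleftrightarrow> B \<subseteq> carrier M \<and>
    (\<forall>S c. finite S \<longrightarrow> S \<subseteq> B \<longrightarrow> lincomb M c S = \<zero>\<^bsub>M\<^esub> \<longrightarrow> (\<forall>s\<in>S. c s = 0))"

text \<open>\<open>M\<close> is a vector space through the scalars \<open>scaleA c 1\<close>. Zorn's
  lemma applies because a relation involves finitely many elements and so lies in one member of a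
  chain; a maximal independent set spans.\<close>

lemma lin_basis_exists:
  fixes M :: "('k::field algA, 'm, 'z) module_scheme" (structure)
  assumes "right_module M"
  shows "\<exists>B. lin_indep M B \<and> (\<forall>m\<in>carrier M. \<exists>S c. finite S \<and> S \<subseteq> B \<and> m = lincomb M c S)"
proof -
  interpret right_module M by fact
  have "\<exists>B\<in>{B. lin_indep M B}. \<forall>X\<in>{B. lin_indep M B}. B \<subseteq> X \<longrightarrow> X = B"
  proof (rule subset_Zorn')
    fix \<C> assume ch: "subset.chain {B. lin_indep M B} \<C>"
    then have C: "lin_indep M B" if "B \<in> \<C>" for B using that by (auto simp: subset.chain_def)
    have "lin_indep M (\<Union>\<C>)" unfolding lin_indep_def
    proof (intro conjI allI impI)
      show "\<Union>\<C> \<subseteq> carrier M" using C by (auto simp: lin_indep_def)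
      fix S and c :: "'m \<Rightarrow> 'k" assume S: "finite S" "S \<subseteq> \<Union>\<C>" "lincomb M c S = \<zero>"
      show "\<forall>s\<in>S. c s = 0"
      proof (cases "\<C> = {}")
        case False
        obtain B where "B \<in> \<C>" "S \<subseteq> B" using finite_subset_Union_chain[OF S(1,2) False ch] .
        then show ?thesis using C[of B] S unfolding lin_indep_def by simp
      qed (use S in auto)
    qed
    then show "\<Union>\<C> \<in> {B. lin_indep M B}" by simp
  qed
  then obtain B where B: "lin_indep M B" and max: "\<And>X. lin_indep M X \<Longrightarrow> B \<subseteq> X \<Longrightarrow> X = B" by auto
  have Bc: "B \<subseteq> carrier M" using B by (simp add: lin_indep_def)
  have ind: "c s = 0" if "finite S" "S \<subseteq> B" "lincomb M c S = \<zero>" "s \<in> S" for S c s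
    using conjunct2[OF B[unfolded lin_indep_def]] that by blast
  have "\<exists>S c. finite S \<and> S \<subseteq> B \<and> m = lincomb M c S" if m: "m \<in> carrier M" for m
  proof (cases "m \<in> B")
    case True
    have "m = lincomb M (\<lambda>_. 1) {m}" using m by (simp add: lincomb_def act_one)
    then show ?thesis using True by (intro exI[of _ "{m}"] exI[of _ "\<lambda>_. 1"]) simp
  next
    case False
    then have "\<not> lin_indep M (insert m B)" using max[of "insert m B"] by blast
    then obtain S c s where S: "finite S" "S \<subseteq> insert m B" "lincomb M c S = \<zero>" and s: "s \<in> S" "c s \<noteq> 0"
      using Bc m unfolding lin_indep_def by auto
    have Sc: "S \<subseteq> carrier M" using S(2) Bc m by auto
    have cl: "smult M a x \<in> carrier M" if "x \<in> S" for x a using that Sc act_closed by auto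
    have mS: "m \<in> S"
    proof (rule ccontr)
      assume "m \<notin> S"
      then have "S \<subseteq> B" using S(2) by auto
      then show False using ind[OF S(1) _ S(3) s(1)] s(2) by simp
    qed
    let ?T = "S - {m}"
    have ST: "S = insert m ?T" using mS by auto
    have e: "smult M (scaleA (c m) 1) m \<oplus> lincomb M c ?T = \<zero>"
    proof -
      have "lincomb M c S = smult M (scaleA (c m) 1) m \<oplus> lincomb M c ?T"
        unfolding lincomb_def by (subst ST, subst finsum_insert) (use S(1) cl m act_closed in auto)
      then show ?thesis using S(3) by simp
    qed
    have Tc: "lincomb M c ?T \<in> carrier M" unfolding lincomb_def using cl by (intro finsum_closed) auto
    \<comment> \<open>A zero coefficient at \<open>m\<close> would leave a nontrivial relation
      inside \<open>B\<close>.\<close>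
    have cm: "c m \<noteq> 0"
    proof
      assume "c m = 0"
      then have "lincomb M c ?T = \<zero>" using e m Tc by (simp add: zero_act)
      then have "c s = 0" if "s \<noteq> m"
        using ind[of ?T c s] S(1,2) s(1) that by auto
      then show False using s(2) \<open>c m = 0\<close> by (cases "s = m") simp_all
    qed
    let ?a = "scaleA (- inverse (c m)) 1 :: 'k algA"
    have "smult M (scaleA (c m) 1) m = \<ominus> lincomb M c ?T"
      using e Tc m act_closed by (intro minus_equality[symmetric]) auto
    then have "smult M ?a (smult M (scaleA (c m) 1) m) = smult M ?a (\<ominus> lincomb M c ?T)" by simp
    moreover have "smult M ?a (smult M (scaleA (c m) 1) m) = smult M (- 1) m"
      using cm m by (simp add: act_act[symmetric] scaleA_conv_mult(1)[symmetric] A.scale_scale)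
    ultimately have "\<ominus> m = \<ominus> (smult M ?a (lincomb M c ?T))" using m Tc by (simp add: neg_act act_neg)
    then have "m = smult M ?a (lincomb M c ?T)" using m Tc act_closed by (metis minus_minus)
    also have "\<dots> = lincomb M (\<lambda>t. - inverse (c m) * c t) ?T"
    proof -
      have "smult M ?a (lincomb M c ?T) = finsum M (\<lambda>t. smult M ?a (smult M (scaleA (c t) 1) t)) ?T"
        unfolding lincomb_def using cl by (intro act_finsum) auto
      also have "\<dots> = lincomb M (\<lambda>t. - inverse (c m) * c t) ?T"
        unfolding lincomb_def
      proof (intro finsum_cong' refl)
        fix t assume "t \<in> ?T"
        then have "t \<in> carrier M" using Sc by auto
        then show "smult M ?a (smult M (scaleA (c t) 1) t) = smult M (scaleA (- inverse (c m) * c t) 1) t"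
          by (simp add: act_act[symmetric] scaleA_conv_mult(1)[symmetric] A.scale_scale mult.commute del: A.scale_minus_left)
      qed (use cl in auto)
      finally show ?thesis .
    qed
    finally show ?thesis using S(1,2) by (intro exI[of _ ?T] exI[of _ "\<lambda>t. - inverse (c m) * c t"]) auto
  qed
  then show ?thesis using B by blast
qed

section \<open>The tensored complex and its filtration by degree\<close>

type_synonym ('k, 'm) big = "('m \<times> nat) \<Rightarrow>\<^sub>0 'k algA"

definition slice :: "('k::field, 'm) big \<Rightarrow> 'm \<Rightarrow> nat \<Rightarrow> 'k algA" where
  "slice f b j = Poly_Mapping.lookup f (b, j)"

lemma slice_eqI: "(\<And>b. slice f b = slice g b) \<Longrightarrow> f = g"
  by (auto simp: slice_def fun_eq_iff intro!: poly_mapping_eqI)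

definition big_of :: "'m set \<Rightarrow> ('m \<Rightarrow> nat \<Rightarrow> 'k algA) \<Rightarrow> ('k::field, 'm) big" where
  "big_of S v = (\<Sum>b\<in>S. \<Sum>j<12. Poly_Mapping.single (b, j) (v b j))"

lemma slice_big_of:
  assumes "finite S" "\<And>b. b \<notin> S \<Longrightarrow> v b = 0" "\<And>b j. \<not> j < 12 \<Longrightarrow> v b j = 0"
  shows "slice (big_of S v) = v"
proof (intro ext)
  fix b j
  have "slice (big_of S v) b j = (\<Sum>b'\<in>S. \<Sum>j'<12. if b' = b then if j' = j then v b j else 0 else 0)"
    unfolding slice_def big_of_def lookup_sum by (intro sum.cong) (auto simp: lookup_single when_def)
  also have "\<dots> = (\<Sum>b'\<in>S. if b' = b then \<Sum>j'<12. if j' = j then v b j else 0 else 0)"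
    by (intro sum.cong) auto
  also have "\<dots> = v b j" using assms by (auto simp: sum.delta)
  finally show "slice (big_of S v) b j = v b j" .
qed

lemma slice_add: "slice (f + g) b = slice f b + slice g b"
  by (auto simp: slice_def lookup_add)

lemma slice_minus: "slice (f - g) b = slice f b - slice g b"
  by (auto simp: slice_def lookup_minus)

lemma slice_zero: "slice 0 b = 0"
  by (auto simp: slice_def)

lemma slice_act: "slice (Poly_Mapping.map (\<lambda>c. c * a) f) b = (\<lambda>j. slice f b j * a)"
  by (auto simp: slice_def lookup_map_mult)

lemma finite_slice: "finite {b. slice f b \<noteq> 0}"
  by (rule finite_subset[OF _ finite_imageI[OF finite_keys[of f], of fst]])
    (auto simp: slice_def fun_eq_iff in_keys_iff image_iff intro!: bexI[of _ "(_, _)"])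

definition gens :: "'m set \<Rightarrow> nat \<Rightarrow> ('m \<times> nat) set" where
  "gens B i = B \<times> {j. j < 12 \<and> hdeg j = i}"

abbreviation term_module :: "'m set \<Rightarrow> nat \<Rightarrow> ('k::field algA, ('k, 'm) big) module" where
  "term_module B i \<equiv> free_module (gens B i)"

lemma term_module_iff:
  "f \<in> carrier (term_module B i) \<longleftrightarrow>
    (\<forall>b j. slice f b j \<noteq> 0 \<longrightarrow> b \<in> B \<and> j < 12 \<and> hdeg j = i)"
  by (auto simp: free_module_simps gens_def slice_def in_keys_iff subset_iff)

lemma term_module_slice:
  assumes "f \<in> carrier (term_module B i)" shows "\<not> (j < 12 \<and> hdeg j = i) \<Longrightarrow> slice f b j = 0" "b \<notin> B \<Longrightarrow> slice f b = 0"
proof -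
  note a = assms[unfolded term_module_iff, rule_format]
  show "\<not> (j < 12 \<and> hdeg j = i) \<Longrightarrow> slice f b j = 0" using a by blast
  show "b \<notin> B \<Longrightarrow> slice f b = 0" using a by (intro ext) auto
qed

lemma term_module_minus: "f \<in> carrier (term_module B i) \<Longrightarrow> g \<in> carrier (term_module B i) \<Longrightarrow> f - g \<in> carrier (term_module B i)"
  unfolding term_module_iff slice_minus by (metis diff_0_right fun_diff_def)

text \<open>The copies of the complex indexed by \<open>B\<close> do not interact, as if positive
  degrees acted on \<open>M\<close> by zero. The true action enters through the augmentation and the
  corrections made later.\<close>

definition diff_big :: "('k::field, 'm) big \<Rightarrow> ('k, 'm) big" where
  "diff_big f = big_of {b. slice f b \<noteq> 0} (\<lambda>b. diff (slice f b))"

lemma diff_high: "\<not> j < 12 \<Longrightarrow> diff v j = 0"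
  by (simp add: diff_def Let_def)

lemma slice_diff_big: "slice (diff_big f) b = diff (slice f b)"
  unfolding diff_big_def by (subst slice_big_of) (auto simp: finite_slice diff_high)

lemma diff_support:
  assumes "\<And>i. \<not> (i < 12 \<and> hdeg i = Suc h) \<Longrightarrow> v i = 0" "\<not> (i < 12 \<and> hdeg i = h)"
  shows "diff v i = 0"
proof -
  have "diff v = emb h (res_map h (unemb (Suc h) v))"
    using emb_res_map[OF unemb_carrier, of h v] emb_unemb[OF assms(1)] by simp
  then show ?thesis using emb_support[OF assms(2)] by simp
qed

lemma diff_big_closed: "f \<in> carrier (term_module B (Suc i)) \<Longrightarrow> diff_big f \<in> carrier (term_module B i)"
  unfolding term_module_iff[of "diff_big f"] slice_diff_big
proof (intro allI impI)
  fix b j assume f: "f \<in> carrier (term_module B (Suc i))" and nz: "diff (slice f b) j \<noteq> 0"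
  have "j < 12 \<and> hdeg j = i"
    using diff_support[of i "slice f b" j] term_module_slice(1)[OF f, of _ b] nz by blast
  moreover have "b \<in> B"
  proof (rule ccontr)
    assume "b \<notin> B"
    then have "slice f b = 0" by (rule term_module_slice(2)[OF f])
    then show False using nz by simp
  qed
  ultimately show "b \<in> B \<and> j < 12 \<and> hdeg j = i" by simp
qed

lemma module_hom_diff_big: "module_hom (term_module B (Suc i)) (term_module B i) diff_big"
  by (rule module_homI) (auto simp: diff_big_closed free_module_simps slice_diff_big slice_add slice_act diff_add diff_act
      simp del: free_module_simps(1) intro!: slice_eqI)

text \<open>The part of degree \<open>i\<close> in the coordinate at \<open>(b, j)\<close> counts as
  degree \<open>i + gdeg j\<close>; elements of \<open>B\<close> count as degree 0, since
  \<open>M\<close> has no grading. The bound is strict, so that \<open>below 0\<close> leaves only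
  zero.\<close>

definition below :: "nat \<Rightarrow> ('k::field, 'm) big \<Rightarrow> bool" where
  "below n f \<longleftrightarrow> (\<forall>b j i. n \<le> i + gdeg j \<longrightarrow> projA i (slice f b j) = 0)"

lemma below_add: "below n f \<Longrightarrow> below n g \<Longrightarrow> below n (f + g)"
  and below_minus: "below n f \<Longrightarrow> below n g \<Longrightarrow> below n (f - g)"
  and below_zero: "below n 0"
  by (auto simp: below_def slice_add slice_minus slice_zero projA_add projA_diff)

lemma below_mono: "below m f \<Longrightarrow> m \<le> n \<Longrightarrow> below n f"
  by (auto simp: below_def)

lemma below_0: assumes "below 0 f" shows "f = 0"
proof (rule slice_eqI, rule ext)
  fix b j
  show "slice f b j = slice 0 b j"
    by (rule projA_eqI) (use assms in \<open>simp add: below_def slice_zero\<close>)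
qed

lemma below_exists: "\<exists>n. below n f"
proof -
  have "finite (\<Union>k\<in>Poly_Mapping.keys f. (\<lambda>i. i + gdeg (snd k)) ` {i. projA i (Poly_Mapping.lookup f k) \<noteq> 0})" (is "finite ?S")
    by (auto simp: finite_projA)
  then obtain n where n: "\<forall>m\<in>?S. m < n" unfolding finite_nat_set_iff_bounded by (rule exE)
  have "projA i (slice f b j) = 0" if "n \<le> i + gdeg j" for b j i
  proof (rule ccontr)
    assume c: "projA i (slice f b j) \<noteq> 0"
    then have "(b, j) \<in> Poly_Mapping.keys f" by (auto simp: slice_def in_keys_iff)
    then have "i + gdeg j \<in> ?S" using c by (intro UN_I[of "(b, j)"] image_eqI[of _ _ i]) (auto simp: slice_def)
    from bspec[OF n this] that show False by simp
  qed
  then show ?thesis unfolding below_def by blast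
qed

lemma below_act:
  assumes "below p f" "\<And>i. q < i \<Longrightarrow> projA i a = 0"
  shows "below (p + q) (Poly_Mapping.map (\<lambda>c. c * a) f)"
  unfolding below_def slice_act
proof (intro allI impI)
  fix b j i assume i: "p + q \<le> i + gdeg j"
  have pf: "projA k (slice f b j) = 0" if "p \<le> k + gdeg j" for k using assms(1) that by (auto simp: below_def)
  have a: "a \<in> filtA q" by (rule projA_filtA) (rule assms(2))
  show "projA i (slice f b j * a) = 0"
  proof (cases "p \<le> gdeg j")
    case True
    have "slice f b j = 0" by (rule projA_eqI) (use pf True in simp)
    then show ?thesis by simp
  next
    case False
    \<comment> \<open>Strictly below \<open>p\<close> means degree at most
      \<open>p - gdeg j - 1\<close>; the 1 saved here makes the conclusion strict again.\<close>
    have "slice f b j \<in> filtA (p - gdeg j - 1)" by (rule projA_filtA) (rule pf, use False in arith)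
    from filtA_projA[OF filtA_mult[OF this a], of i] show ?thesis using i False by auto
  qed
qed

definition top_part :: "nat \<Rightarrow> ('k::field, 'm) big \<Rightarrow> ('k, 'm) big" where
  "top_part n f = big_of {b. slice f b \<noteq> 0} (\<lambda>b. hom_part n (slice f b))"

lemma slice_top_part: "slice (top_part n f) b = hom_part n (slice f b)"
proof -
  have "hom_part n 0 = (0 :: nat \<Rightarrow> 'a algA)" by (auto simp: hom_part_def fun_eq_iff)
  then show ?thesis unfolding top_part_def
    by (subst slice_big_of) (auto simp: finite_slice hom_part_def)
qed

lemma below_top: assumes "below (Suc n) f" "f \<in> carrier (term_module B i)" shows "below n (f - top_part n f)"
  unfolding below_def slice_minus slice_top_part
proof (intro allI impI)
  fix b j k assume k: "n \<le> k + gdeg j"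
  show "projA k ((slice f b - hom_part n (slice f b)) j) = 0"
  proof (cases "j < 12")
    case True
    then show ?thesis using k assms(1)[unfolded below_def, rule_format, of k j b]
      by (cases "n = k + gdeg j") (auto simp: projA_diff hom_part_def projA_projA)
  qed (use term_module_slice(1)[OF assms(2), of j b] in \<open>simp add: hom_part_def\<close>)
qed

lemma below_top_part: "below n f \<Longrightarrow> top_part n f = 0"
  by (rule slice_eqI, rule ext) (simp add: slice_top_part slice_zero hom_part_def below_def)

lemma finsum_free_module:
  assumes "finite S" "\<And>s. s \<in> S \<Longrightarrow> h s \<in> carrier (free_module B)"
  shows "finsum (free_module B) h S = sum h S"
proof -
  interpret right_module "free_module B" by (rule right_module_free_module)
  show ?thesis using assms
  proof (induction S rule: finite_induct)
    case (insert s S)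
    then show ?case by (subst finsum_insert) (auto simp: free_module_simps(3))
  qed (simp add: free_module_simps)
qed

text \<open>\<open>adapted i N D\<close>: up to terms of lower degree, \<open>D\<close> behaves like the tensored differential on
  the \<open>i\<close>-th term.\<close>

definition adapted :: "'m set \<Rightarrow> nat \<Rightarrow> ('k::field algA, 'n, 'z) module_scheme \<Rightarrow> (('k, 'm) big \<Rightarrow> 'n) \<Rightarrow> bool" where
  "adapted B i N D \<longleftrightarrow> right_module N \<and> module_hom (term_module B i) N D \<and>
    (\<forall>n. \<forall>f\<in>carrier (term_module B i). below (Suc n) f \<longrightarrow> D f = \<zero>\<^bsub>N\<^esub> \<longrightarrow>
      diff_big (top_part n f) = 0 \<and> (i = 0 \<longrightarrow> n = 0 \<longrightarrow> f = 0)) \<and>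
    (\<forall>n. \<forall>u\<in>carrier (term_module B i). below (Suc n) u \<longrightarrow> diff_big u = 0 \<longrightarrow> (i, n) \<noteq> (0, 0) \<longrightarrow>
      (\<exists>w\<in>carrier (term_module B i). below n w \<and> D w = D u))"

text \<open>The new differential is \<open>diff_big\<close> minus a correction \<open>R\<close> of
  lower degree with \<open>D R = D diff_big\<close>, so that \<open>D D' = 0\<close>. Its top part
  is still \<open>diff_big\<close>; hence exactness follows from that of the complex for k, one
  degree of the filtration at a time.\<close>

lemma adapted_step:
  fixes N :: "('k::field algA, 'n, 'z) module_scheme" and B :: "'m set"
  assumes ad: "adapted B i N D"
  shows "\<exists>D'. adapted B (Suc i) (term_module B i) D' \<and>
    D' ` carrier (term_module B (Suc i)) = a_kernel (term_module B i) N D"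
proof -
  let ?F = "term_module B i :: ('k algA, ('k, 'm) big) module"
  let ?F' = "term_module B (Suc i) :: ('k algA, ('k, 'm) big) module"
  have N: "right_module N" and D: "module_hom ?F N D"
    and top: "\<And>n f. f \<in> carrier ?F \<Longrightarrow> below (Suc n) f \<Longrightarrow> D f = \<zero>\<^bsub>N\<^esub> \<Longrightarrow>
      diff_big (top_part n f) = 0 \<and> (i = 0 \<longrightarrow> n = 0 \<longrightarrow> f = 0)"
    and corr: "\<And>n u. u \<in> carrier ?F \<Longrightarrow> below (Suc n) u \<Longrightarrow> diff_big u = 0 \<Longrightarrow> (i, n) \<noteq> (0, 0) \<Longrightarrow>
      \<exists>w\<in>carrier ?F. below n w \<and> D w = D u"
    using ad unfolding adapted_def by blast+
  have F: "right_module ?F" and F': "right_module ?F'" by (rule right_module_free_module)+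
  interpret F: right_module ?F by (rule F)
  interpret N: right_module N by (rule N)
  have minus: "D (f - g) = D f \<ominus>\<^bsub>N\<^esub> D g" if "f \<in> carrier ?F" "g \<in> carrier ?F" for f g
  proof -
    have "f \<ominus>\<^bsub>?F\<^esub> g = f - g"
    proof -
      have "\<ominus>\<^bsub>?F\<^esub> g = - g"
        by (rule F.minus_equality) (use that(2) in \<open>auto simp: free_module_simps in_keys_iff\<close>)
      then show ?thesis by (simp add: F.minus_eq free_module_simps)
    qed
    then show ?thesis using module_hom_minus[OF F N D that] by simp
  qed
  have e_in: "Poly_Mapping.single k (1 :: 'k algA) \<in> carrier ?F'" if "k \<in> gens B (Suc i)" for k
    using that by (simp add: free_module_simps)
  have slice_single: "slice (Poly_Mapping.single (b, j) (1 :: 'k algA)) b' = (if b = b' then bas j [] else 0)" for b b' :: 'm and j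
    by (auto simp: slice_def lookup_single when_def bas_def fun_eq_iff)
  \<comment> \<open>The last clause of \<open>adapted\<close>, applied to the boundary of a new
    generator, yields an element of lower degree with the same image under \<open>D\<close>. It
    becomes the correction at that generator.\<close>
  have "\<exists>w\<in>carrier ?F. below (gdeg (snd k)) w \<and> D w = D (diff_big (Poly_Mapping.single k 1))"
    if k: "k \<in> gens B (Suc i)" for k
  proof -
    obtain b j where bj: "k = (b, j)" "j < 12" "hdeg j = Suc i" using k by (auto simp: gens_def)
    have up: "diff (bas j [] :: nat \<Rightarrow> 'k algA) \<in> upper i (gdeg j) 0"
      by (rule diff_upper, rule bas_upper) (use bj in auto)
    have "below (Suc (gdeg j)) (diff_big (Poly_Mapping.single (b, j) (1 :: 'k algA)))"
      unfolding below_def slice_diff_big slice_single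
    proof (intro allI impI)
      fix b' j' i' assume i': "Suc (gdeg j) \<le> i' + gdeg j'"
      show "projA i' (diff (if b = b' then bas j [] else 0 :: nat \<Rightarrow> 'k algA) j') = 0"
      proof (cases "b = b' \<and> diff (bas j [] :: nat \<Rightarrow> 'k algA) j' \<noteq> 0")
        case True
        then have "gdeg j' \<le> gdeg j" "diff (bas j [] :: nat \<Rightarrow> 'k algA) j' \<in> gradeA (gdeg j - gdeg j')"
          using True up[unfolded upper_zero_iff, rule_format, of j'] by presburger+
        then show ?thesis using True i' by (simp add: projA_gradeA)
      qed auto
    qed
    moreover have "diff_big (diff_big (Poly_Mapping.single (b, j) (1 :: 'k algA))) = 0"
      by (rule slice_eqI) (simp add: slice_diff_big diff_diff slice_zero)
    \<comment> \<open>Generators beyond the first term have positive degree, so the exceptional pair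
      (0, 0) does not occur.\<close>
    moreover have "gdeg j \<noteq> 0"
      using bj(2,3) unfolding lt12 by (auto simp: gdeg_def hdeg_def)
    ultimately show ?thesis
      using corr[OF diff_big_closed[OF e_in[OF k]], of "gdeg j"] unfolding bj by simp
  qed
  then obtain w where w: "\<And>k. k \<in> gens B (Suc i) \<Longrightarrow> w k \<in> carrier ?F"
      "\<And>k. k \<in> gens B (Suc i) \<Longrightarrow> below (gdeg (snd k)) (w k)"
      "\<And>k. k \<in> gens B (Suc i) \<Longrightarrow> D (w k) = D (diff_big (Poly_Mapping.single k 1))"
    by metis
  define R where "R = free_lift ?F w"
  define D' where "D' f = diff_big f - R f" for f
  have R: "module_hom ?F' ?F R" unfolding R_def by (rule module_hom_free_lift[OF F]) (use w(1) in auto)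
  \<comment> \<open>Every \<open>w k\<close> lies strictly below the degree of its generator, so
    \<open>R\<close> lowers the filtration by at least one.\<close>
  have Rb: "below n (R f)" if f: "f \<in> carrier ?F'" "below (Suc n) f" for n f
  proof -
    have kf: "k \<in> gens B (Suc i)" if "k \<in> Poly_Mapping.keys f" for k using f(1) that by (auto simp: free_module_simps)
    have "R f = (\<Sum>k\<in>Poly_Mapping.keys f. smult ?F (Poly_Mapping.lookup f k) (w k))"
      unfolding R_def free_lift_def using kf w(1) F.act_closed by (intro finsum_free_module) auto
    moreover have "below n (smult ?F (Poly_Mapping.lookup f k) (w k))" if k: "k \<in> Poly_Mapping.keys f" for k
    proof -
      have pr: "projA i' (Poly_Mapping.lookup f k) = 0" if "Suc n \<le> i' + gdeg (snd k)" for i'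
        using f(2)[unfolded below_def, rule_format, of i' "snd k" "fst k"] that by (simp add: slice_def)
      have le: "gdeg (snd k) \<le> n"
      proof (rule ccontr)
        assume "\<not> gdeg (snd k) \<le> n"
        then have g: "n < gdeg (snd k)" by simp
        have "Poly_Mapping.lookup f k = 0" by (rule projA_eqI) (use pr g in simp)
        then show False using k by (simp add: in_keys_iff)
      qed
      have "below (gdeg (snd k) + (n - gdeg (snd k))) (Poly_Mapping.map (\<lambda>c. c * Poly_Mapping.lookup f k) (w k))"
        by (rule below_act[OF w(2)[OF kf[OF k]]]) (rule pr, use le in arith)
      then show ?thesis using le by (simp add: free_module_simps)
    qed
    moreover have "below n (\<Sum>k\<in>K. g k)" if "\<And>k. k \<in> K \<Longrightarrow> below n (g k)" for K and g :: "'m \<times> nat \<Rightarrow> ('k, 'm) big"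
      using that by (induction K rule: infinite_finite_induct) (auto simp: below_zero below_add)
    ultimately show ?thesis by simp
  qed
  have DR: "D (R f) = D (diff_big f)" if "f \<in> carrier ?F'" for f
  proof (rule free_module_hom_ext[OF N module_hom_comp[OF R D] module_hom_comp[OF module_hom_diff_big D] _ that])
    fix k assume k: "k \<in> gens B (Suc i)"
    have "R (Poly_Mapping.single k 1) = w k"
      unfolding R_def using w(1)[OF k] by (simp add: free_lift_single[OF F] F.act_one)
    then show "D (R (Poly_Mapping.single k 1)) = D (diff_big (Poly_Mapping.single k 1))" using w(3)[OF k] by simp
  qed
  have D'c: "D' f \<in> carrier ?F" if "f \<in> carrier ?F'" for f
    unfolding D'_def by (rule term_module_minus[OF diff_big_closed[OF that] module_homD(1)[OF R that]])
  have DD': "D (D' f) = \<zero>\<^bsub>N\<^esub>" if f: "f \<in> carrier ?F'" for f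
  proof -
    have "D (diff_big f) \<in> carrier N" using module_homD(1)[OF D] diff_big_closed[OF f] by blast
    then show ?thesis unfolding D'_def minus[OF diff_big_closed[OF f] module_homD(1)[OF R f]] DR[OF f]
      by (simp add: N.minus_eq N.r_neg)
  qed
  have D'hom: "module_hom ?F' ?F D'"
  proof (rule module_homI)
    fix f g :: "('k, 'm) big" and a assume f: "f \<in> carrier ?F'"
    show "D' f \<in> carrier ?F" by (rule D'c[OF f])
    show "D' (smult ?F' a f) = smult ?F a (D' f)"
      using module_homD(3)[OF R f, of a] module_homD(3)[OF module_hom_diff_big f, of a]
      by (auto simp: D'_def free_module_simps lookup_map_mult lookup_minus left_diff_distrib intro!: poly_mapping_eqI)
    assume g: "g \<in> carrier ?F'"
    show "D' (f \<oplus>\<^bsub>?F'\<^esub> g) = D' f \<oplus>\<^bsub>?F\<^esub> D' g"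
      using module_homD(2)[OF R f g] module_homD(2)[OF module_hom_diff_big f g] by (simp add: D'_def free_module_simps)
  qed
  \<comment> \<open>The top part of a cycle of \<open>D\<close> is a cycle of
    \<open>diff_big\<close>, hence a boundary slice by slice. Subtracting \<open>D' Y\<close> lowers
    the degree, because \<open>D'\<close> and \<open>diff_big\<close> agree at the top. The bound on
    the preimage is kept, since the next step needs it.\<close>
  have exact: "below n z \<Longrightarrow> z \<in> carrier ?F \<Longrightarrow> D z = \<zero>\<^bsub>N\<^esub> \<Longrightarrow> \<exists>y\<in>carrier ?F'. below n y \<and> z = D' y" for n z
  proof (induction n arbitrary: z)
    case 0
    have "D' 0 = 0" using module_hom_zero[OF F' F D'hom] by (simp add: free_module_simps)
    then show ?case using below_0[OF 0(1)] below_zero by (intro bexI[of _ 0]) (auto simp: free_module_simps)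
  next
    case (Suc n)
    have dt: "diff_big (top_part n z) = 0" and z0: "i = 0 \<Longrightarrow> n = 0 \<Longrightarrow> z = 0" using top[OF Suc.prems(2,1,3)] by auto
    show ?case
    proof (cases "i = 0 \<and> n = 0")
      case True
      have "D' 0 = 0" using module_hom_zero[OF F' F D'hom] by (simp add: free_module_simps)
      then show ?thesis using z0 True below_zero by (intro bexI[of _ 0]) (auto simp: free_module_simps)
    next
      case False
      have "\<exists>y. y \<in> upper (Suc i) n 0 \<and> hom_part n (slice z b) = diff y \<and> (slice z b = 0 \<longrightarrow> y = 0)" for b
      proof (cases "slice z b = 0")
        case True
        have "hom_part n 0 = (0 :: nat \<Rightarrow> 'k algA)" by (auto simp: hom_part_def fun_eq_iff)
        then show ?thesis using True by (intro exI[of _ 0]) (simp add: upper_zero)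
      next
        case nz: False
        have "hom_part n (slice z b) \<in> upper i n 0"
          by (rule hom_part_in_upper) (rule term_module_slice(1)[OF Suc.prems(2)])
        moreover have "diff (hom_part n (slice z b)) = 0"
          using dt slice_diff_big[of "top_part n z" b] by (simp add: slice_top_part slice_zero)
        ultimately show ?thesis using exact_homogeneous[of i n] False nz by auto
      qed
      then obtain y where y: "\<And>b. y b \<in> upper (Suc i) n 0" "\<And>b. hom_part n (slice z b) = diff (y b)"
        "\<And>b. slice z b = 0 \<Longrightarrow> y b = 0" by metis
      have yz: "y b j = 0" if "\<not> (j < 12 \<and> hdeg j = Suc i)" for b j
        using y(1)[of b, unfolded upper_zero_iff, rule_format, of j] that by (auto split: if_splits)
      define Y where "Y = big_of {b. slice z b \<noteq> 0} y"
      have Y: "slice Y = y" unfolding Y_def by (rule slice_big_of) (auto simp: finite_slice y(3) yz)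
      have Yc: "Y \<in> carrier ?F'"
        unfolding term_module_iff Y
      proof (intro allI impI)
        fix b j assume nz: "y b j \<noteq> 0"
        then have "j < 12 \<and> hdeg j = Suc i" using yz by blast
        moreover have "b \<in> B"
        proof (rule ccontr)
          assume "b \<notin> B"
          then have "y b = 0" by (intro y(3) term_module_slice(2)[OF Suc.prems(2)])
          then show False using nz by simp
        qed
        ultimately show "b \<in> B \<and> j < 12 \<and> hdeg j = Suc i" by simp
      qed
      have Yb: "below (Suc n) Y" unfolding below_def Y
      proof (intro allI impI)
        fix b j k assume "Suc n \<le> k + gdeg j"
        show "projA k (y b j) = 0"
        proof (cases "y b j = 0")
          case False
          then have "gdeg j \<le> n" "y b j \<in> gradeA (n - gdeg j)"
            using False y(1)[of b, unfolded upper_zero_iff, rule_format, of j] by presburger+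
          moreover have "k \<noteq> n - gdeg j" using \<open>Suc n \<le> k + gdeg j\<close> \<open>gdeg j \<le> n\<close> by arith
          ultimately show ?thesis by (simp add: projA_gradeA)
        qed simp
      qed
      have "diff_big Y = top_part n z" by (rule slice_eqI) (simp add: slice_diff_big slice_top_part Y y(2))
      then have e: "z - D' Y = (z - top_part n z) + R Y" by (simp add: D'_def)
      have "below n (z - D' Y)" unfolding e by (rule below_add[OF below_top[OF Suc.prems(1,2)] Rb[OF Yc Yb]])
      moreover have "z - D' Y \<in> carrier ?F" by (rule term_module_minus[OF Suc.prems(2) D'c[OF Yc]])
      moreover have "D (z - D' Y) = \<zero>\<^bsub>N\<^esub>"
        using minus[OF Suc.prems(2) D'c[OF Yc]] Suc.prems(3) DD'[OF Yc] by (simp add: N.minus_eq N.r_neg)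
      ultimately obtain y' where y': "y' \<in> carrier ?F'" "below n y'" "z - D' Y = D' y'" using Suc.IH by blast
      have "z = D' (y' + Y)"
        using module_homD(2)[OF D'hom y'(1) Yc] y'(3) by (simp add: free_module_simps algebra_simps)
      moreover have "y' + Y \<in> carrier ?F'"
        using right_module.act_closed[OF F'] F' y'(1) Yc abelian_monoid.a_closed[of ?F' y' Y]
          abelian_group.axioms(1)[OF right_module.axioms(1)[OF F']] by (simp only: free_module_simps(3))
      moreover have "below (Suc n) (y' + Y)" by (rule below_add[OF below_mono[OF y'(2)] Yb]) simp
      ultimately show ?thesis by blast
    qed
  qed
  have "adapted B (Suc i) ?F D'"
    unfolding adapted_def
  proof (intro conjI F D'hom allI ballI impI)
    fix n f assume f: "f \<in> carrier ?F'" "below (Suc n) f"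
    {
      assume "D' f = \<zero>\<^bsub>?F\<^esub>"
      then have "diff_big f = R f" by (simp add: D'_def free_module_simps)
      then have "top_part n (diff_big f) = 0" using below_top_part[OF Rb[OF f]] by simp
      then have "hom_part n (diff (slice f b)) = 0" for b
        using slice_top_part[of n "diff_big f" b] by (simp add: slice_diff_big slice_zero)
      then show "diff_big (top_part n f) = 0"
        by (intro slice_eqI) (simp add: slice_diff_big slice_top_part hom_part_diff[symmetric] slice_zero)
    next
      assume "diff_big f = 0"
      \<comment> \<open>On cycles of \<open>diff_big\<close> the new differential is minus the
        correction, of lower degree and in the kernel of \<open>D\<close>. Exactness with its degree
        bound then gives the preimage required by the last clause.\<close>
      then have "below n (D' f)" unfolding D'_def using below_minus[OF below_zero Rb[OF f]] by simp
      then show "\<exists>w\<in>carrier ?F'. below n w \<and> D' w = D' f"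
        using exact[OF _ D'c[OF f(1)] DD'[OF f(1)]] by metis
    }
  qed simp
  moreover have "D' ` carrier ?F' = a_kernel ?F N D"
  proof (rule set_eqI_iff)
    fix z
    show "z \<in> D' ` carrier ?F' \<longleftrightarrow> z \<in> a_kernel ?F N D"
      using below_exists[of z] exact[of _ z] D'c DD' unfolding a_kernel_def' by auto
  qed
  ultimately show ?thesis by blast
qed

lemma hdeg_eq_0_iff: "j < 12 \<and> hdeg j = 0 \<longleftrightarrow> j = 0"
  unfolding hdeg_iff by (auto simp: off_simps rank_simps)

lemma gradeA_0: "(a :: 'k::field algA) \<in> gradeA 0 \<Longrightarrow> \<exists>c. a = scaleA c 1"
  using connected_graded_algebra.connected[OF connected_graded_algebra_algA] by auto

lemma free_lift_const:
  fixes M :: "('k::field algA, 'm, 'z) module_scheme" and w :: "('k, 'm) big"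
  assumes M: "right_module M" and B: "B \<subseteq> carrier M" and S: "finite S" "S \<subseteq> B"
    and w: "\<And>b j. slice w b j = (if j = 0 \<and> b \<in> S then scaleA (c b) 1 else 0)"
  shows "w \<in> carrier (term_module B 0)" "free_lift M fst w = lincomb M c S"
proof -
  interpret right_module M by fact
  have h0: "hdeg 0 = 0" by (simp add: hdeg_def)
  show "w \<in> carrier (term_module B 0)" unfolding term_module_iff w
  proof (intro allI impI)
    fix b :: 'm and j :: nat assume nz: "(if j = 0 \<and> b \<in> S then scaleA (c b) 1 else 0) \<noteq> (0 :: 'k algA)"
    have "j = 0 \<and> b \<in> S"
    proof (rule ccontr)
      assume "\<not> (j = 0 \<and> b \<in> S)"
      then show False using nz by auto
    qed
    then show "b \<in> B \<and> j < 12 \<and> hdeg j = 0" using S(2) h0 by auto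
  qed
  have l: "Poly_Mapping.lookup w (b, j) = (if j = 0 \<and> b \<in> S then scaleA (c b) 1 else 0)" for b j
    using w[of b j] by (simp add: slice_def)
  let ?T = "(\<lambda>b. (b, 0::nat)) ` S"
  have keys: "Poly_Mapping.keys w \<subseteq> ?T"
  proof
    fix k assume "k \<in> Poly_Mapping.keys w"
    then have "Poly_Mapping.lookup w (fst k, snd k) \<noteq> 0" by (simp add: in_keys_iff)
    then have "snd k = 0 \<and> fst k \<in> S" unfolding l by presburger
    then show "k \<in> ?T" by (intro image_eqI[of _ _ "fst k"]) (auto simp: prod_eq_iff)
  qed
  have SM: "s \<in> carrier M" if "s \<in> S" for s using that S(2) B by blast
  have "free_lift M fst w = finsum M (\<lambda>k. smult M (Poly_Mapping.lookup w k) (fst k)) ?T"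
    by (rule free_lift_superset[OF M _ _ keys subset_refl]) (use S(1) SM in auto)
  also have "\<dots> = finsum M (\<lambda>b. smult M (Poly_Mapping.lookup w (b, 0)) b) S"
    by (subst finsum_reindex) (use SM in \<open>auto simp: inj_on_def act_closed\<close>)
  also have "\<dots> = lincomb M c S"
    unfolding lincomb_def by (rule finsum_cong') (use SM in \<open>auto simp: l act_closed\<close>)
  finally show "free_lift M fst w = lincomb M c S" .
qed

lemma diff_concentrated_0: "(\<And>j. j \<noteq> 0 \<Longrightarrow> v j = 0) \<Longrightarrow> diff v = 0"
  by (rule ext) (simp add: diff_def Let_def)

text \<open>\<open>B\<close> spans, so every element of \<open>M\<close> is the image of a
  combination with scalar coefficients; this is the correction clause, as degree 0 is below every
  \<open>n > 0\<close>. \<open>B\<close> is independent, so no nonzero such combination is killed;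
  this is the clause for degree 0.\<close>

lemma adapted_zero:
  fixes M :: "('k::field algA, 'm, 'z) module_scheme" and B :: "'m set"
  assumes M: "right_module M" and B: "lin_indep M B"
    and sp: "\<And>m. m \<in> carrier M \<Longrightarrow> \<exists>S c. finite S \<and> S \<subseteq> B \<and> m = lincomb M c S"
  shows "adapted B 0 M (free_lift M fst)"
    and "free_lift M fst ` carrier (term_module B 0 :: ('k algA, ('k, 'm) big) module) = carrier M"
proof -
  let ?F = "term_module B 0 :: ('k algA, ('k, 'm) big) module"
  let ?D = "free_lift M fst :: ('k, 'm) big \<Rightarrow> 'm"
  have Bc: "B \<subseteq> carrier M" using B by (simp add: lin_indep_def)
  have ind: "c s = 0" if "finite S" "S \<subseteq> B" "lincomb M c S = \<zero>\<^bsub>M\<^esub>" "s \<in> S" for S c s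
    using conjunct2[OF B[unfolded lin_indep_def]] that by blast
  have hom: "module_hom ?F M ?D" by (rule module_hom_free_lift[OF M]) (use Bc in \<open>auto simp: gens_def\<close>)
  have one: "projA i (1 :: 'k algA) = 0" if "0 < i" for i using projA_mon[of i "[]"] that by simp
  have g0: "gdeg 0 = 0" by (simp add: gdeg_def)
  have ex: "\<exists>w\<in>carrier ?F. below 1 w \<and> ?D w = m" if m: "m \<in> carrier M" for m
  proof -
    obtain S c where S: "finite S" "S \<subseteq> B" "m = lincomb M c S" using sp[OF m] by (elim exE conjE)
    define w :: "('k, 'm) big" where "w = big_of S (\<lambda>b j. if j = 0 \<and> b \<in> S then scaleA (c b) 1 else 0)"
    have "slice w = (\<lambda>b j. if j = 0 \<and> b \<in> S then scaleA (c b) 1 else 0)"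
      unfolding w_def by (rule slice_big_of) (auto simp: S(1) fun_eq_iff)
    then have w: "slice w b j = (if j = 0 \<and> b \<in> S then scaleA (c b) 1 else 0)" for b j by simp
    have "below 1 w" unfolding below_def w
      by (auto simp: projA_scale one g0)
    then show ?thesis using free_lift_const[OF M Bc S(1,2) w] S(3) by (intro bexI[of _ w]) auto
  qed
  have s0: "slice f b j = 0" if "f \<in> carrier ?F" "j \<noteq> 0" for f b j
    by (rule term_module_slice(1)[OF that(1)]) (unfold hdeg_eq_0_iff, rule that(2))
  show "?D ` carrier ?F = carrier M"
  proof (intro equalityI subsetI)
    fix m assume "m \<in> ?D ` carrier ?F"
    then obtain f where f: "f \<in> carrier ?F" "m = ?D f" by (elim imageE)
    show "m \<in> carrier M" using module_homD(1)[OF hom f(1)] f(2) by simp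
  next
    fix m assume "m \<in> carrier M"
    from ex[OF this] obtain w where "w \<in> carrier ?F" "?D w = m" by (elim bexE conjE)
    then show "m \<in> ?D ` carrier ?F" by (intro image_eqI[of _ _ w]) simp_all
  qed
  show "adapted B 0 M ?D"
    unfolding adapted_def
  proof (intro conjI M hom allI ballI impI)
    fix n f assume f: "f \<in> carrier ?F" "below (Suc n) f"
    {
      assume D: "?D f = \<zero>\<^bsub>M\<^esub>"
      show "diff_big (top_part n f) = 0"
        by (intro slice_eqI) (simp add: slice_diff_big slice_top_part slice_zero diff_concentrated_0 hom_part_def s0[OF f(1)])
      assume "n = 0"
      have "\<exists>c. slice f b 0 = scaleA c 1" for b
      proof (rule gradeA_0)
        have pz: "projA i (slice f b 0) = 0" if "i \<noteq> 0" for i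
          using f(2)[unfolded below_def, rule_format, of i 0 b] that by (simp add: \<open>n = 0\<close> g0)
        have "projA 0 (slice f b 0) = slice f b 0"
        proof (rule projA_eqI)
          fix i show "projA i (projA 0 (slice f b 0)) = projA i (slice f b 0)"
            using pz[of i] by (cases "i = 0") (simp_all add: projA_projA)
        qed
        then show "slice f b 0 \<in> gradeA 0" using projA_in_gradeA[of 0 "slice f b 0"] by simp
      qed
      then obtain c where c: "\<And>b. slice f b 0 = scaleA (c b) 1" by metis
      let ?S = "{b. slice f b \<noteq> 0}"
      have S: "finite ?S" by (rule finite_slice)
      have SB: "?S \<subseteq> B" using term_module_slice(2)[OF f(1)] by auto
      have w: "slice f b j = (if j = 0 \<and> b \<in> ?S then scaleA (c b) 1 else 0)" for b j
      proof (cases "j = 0")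
        case True
        then show ?thesis by (cases "slice f b = 0") (simp_all add: c)
      qed (simp add: s0[OF f(1)])
      have "lincomb M c ?S = \<zero>\<^bsub>M\<^esub>" using free_lift_const(2)[OF M Bc S SB w] D by simp
      from ind[OF S SB this] have c0: "c b = 0" if "b \<in> ?S" for b using that .
      show "f = 0"
      proof (rule slice_eqI, rule ext)
        fix b j
        have "slice f b j = 0"
        proof (cases "slice f b = 0")
          case False
          then have "c b = 0" using c0[of b] by simp
          then show ?thesis using c[of b] s0[OF f(1), of j b] by (cases "j = 0") simp_all
        qed simp
        then show "slice f b j = slice 0 b j" by (simp add: slice_zero)
      qed
    next
      assume n: "(0, n) \<noteq> (0, 0)"
      have "?D f \<in> carrier M" by (rule module_homD(1)[OF hom f(1)])
      from ex[OF this] obtain w where w: "w \<in> carrier ?F" "below 1 w" "?D w = ?D f" by (elim bexE conjE)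
      have "below n w" by (rule below_mono[OF w(2)]) (use n in simp)
      then show "\<exists>w\<in>carrier ?F. below n w \<and> ?D w = ?D f" using w(1,3) by (intro bexI[of _ w]) simp_all
    }
  qed
qed

lemma resolution_exists:
  fixes M :: "('k::field algA, 'm, 'z) module_scheme"
  assumes M: "right_module M"
  shows "\<exists>(B :: 'm set) d e. resolution M (term_module B :: nat \<Rightarrow> ('k algA, ('k, 'm) big) module) d e"
proof -
  obtain B where B: "lin_indep M B" and sp: "\<forall>m\<in>carrier M. \<exists>S c. finite S \<and> S \<subseteq> B \<and> m = lincomb M c S"
    using lin_basis_exists[OF M] by (elim exE conjE)
  let ?T = "term_module B :: nat \<Rightarrow> ('k algA, ('k, 'm) big) module"
  let ?e = "free_lift M fst :: ('k, 'm) big \<Rightarrow> 'm"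
  have sp': "\<exists>S c. finite S \<and> S \<subseteq> B \<and> m = lincomb M c S" if "m \<in> carrier M" for m
    by (rule bspec[OF sp that])
  have z: "adapted B 0 M ?e" and z': "?e ` carrier (?T 0) = carrier M"
    using adapted_zero[OF M B sp'] by simp_all
  \<comment> \<open>The condition at \<open>n = 0\<close> ties the first differential to the
    augmentation, which is not among the consecutive pairs covered by \<open>?Q\<close>.\<close>
  let ?P = "\<lambda>n D. adapted B (Suc n) (?T n) D \<and> (n = 0 \<longrightarrow> D ` carrier (?T (Suc 0)) = a_kernel (?T 0) M ?e)"
  let ?Q = "\<lambda>n D D'. D' ` carrier (?T (Suc (Suc n))) = a_kernel (?T (Suc n)) (?T n) D"
  have "\<exists>d. \<forall>n. ?P n (d n) \<and> ?Q n (d n) (d (Suc n))"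
  proof (rule dependent_nat_choice)
    show "\<exists>D. ?P 0 D" using adapted_step[OF z] by simp
    fix D n assume "?P n D"
    then have "adapted B (Suc n) (?T n) D" by (elim conjE)
    from adapted_step[OF this] show "\<exists>D'. ?P (Suc n) D' \<and> ?Q n D D'" by simp
  qed
  then obtain d where "\<forall>n. ?P n (d n) \<and> ?Q n (d n) (d (Suc n))" by (rule exE)
  then have d: "?P n (d n)" "?Q n (d n) (d (Suc n))" for n by simp_all
  have "resolution M ?T d ?e"
    unfolding resolution_def
  proof (intro conjI allI M right_module_free_module z' d(2))
    show "module_hom (?T (Suc n)) (?T n) (d n)" for n using d(1)[of n] unfolding adapted_def by (elim conjE)
    show "module_hom (?T 0) M ?e" using z unfolding adapted_def by (elim conjE)
    show "d 0 ` carrier (?T 1) = a_kernel (?T 0) M ?e" using d(1)[of 0] by simp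
  qed
  then show ?thesis by (intro exI)
qed

section \<open>Encoding the resolutions in the universe type\<close>

definition enc_key :: "('a, 'u) universe \<times> nat \<Rightarrow> ('a, 'u) universe" where
  "enc_key k = Tuple [fst k, Tuple (replicate (snd k) (Tuple []))]"

lemma enc_key_inject: "enc_key k = enc_key l \<Longrightarrow> k = l"
  by (auto simp: enc_key_def prod_eq_iff)

text \<open>The finite graph of a coefficient function, listed in a chosen order; the set of entries
  alone recovers the function. Generator numbers are written in unary as lengths of tuples by
  \<open>enc_key\<close>.\<close>

definition enc_big :: "((('a::zero, 'u) universe \<times> nat) \<Rightarrow>\<^sub>0 'a) \<Rightarrow> ('a, 'u) universe" where
  "enc_big f = Tuple (map (\<lambda>k. Tuple [enc_key k, Scalar (Poly_Mapping.lookup f k)])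
    (SOME ks. set ks = Poly_Mapping.keys f))"

lemma enc_big_inject:
  fixes f g :: "(('a::zero, 'u) universe \<times> nat) \<Rightarrow>\<^sub>0 'a"
  assumes "enc_big f = enc_big g" shows "f = g"
proof -
  have s: "set (SOME ks. set ks = Poly_Mapping.keys f) = Poly_Mapping.keys f" for f :: "(('a, 'u) universe \<times> nat) \<Rightarrow>\<^sub>0 'a"
    by (rule someI_ex[OF finite_list[OF finite_keys]])
  let ?h = "\<lambda>f k. Tuple [enc_key k, Scalar (Poly_Mapping.lookup f k)] :: ('a, 'u) universe"
  have "map (?h f) (SOME ks. set ks = Poly_Mapping.keys f) = map (?h g) (SOME ks. set ks = Poly_Mapping.keys g)"
    using assms by (simp add: enc_big_def)
  from arg_cong[OF this, of set] have e: "?h f ` Poly_Mapping.keys f = ?h g ` Poly_Mapping.keys g" by (simp add: s)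
  have k: "Poly_Mapping.lookup p k = Poly_Mapping.lookup q k" if "?h p ` Poly_Mapping.keys p = ?h q ` Poly_Mapping.keys q"
      "k \<in> Poly_Mapping.keys p" for p q k
  proof -
    have "?h p k \<in> ?h q ` Poly_Mapping.keys q" by (rule subsetD[OF equalityD1[OF that(1)] imageI[OF that(2)]])
    then obtain l where "?h p k = ?h q l" by (elim imageE)
    then show ?thesis using enc_key_inject[of k l] by simp
  qed
  show ?thesis
  proof (rule poly_mapping_eqI)
    fix x
    show "Poly_Mapping.lookup f x = Poly_Mapping.lookup g x"
    proof (cases "x \<in> Poly_Mapping.keys f")
      case True
      show ?thesis by (rule k[OF e True])
    next
      case f: False
      show ?thesis
      proof (cases "x \<in> Poly_Mapping.keys g")
        case True
        show ?thesis by (rule k[OF e[symmetric] True, symmetric])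
      qed (use f in \<open>simp add: in_keys_iff\<close>)
    qed
  qed
qed

lemma hdeg_le_5: "j < 12 \<Longrightarrow> hdeg j \<le> 5"
proof -
  have "\<forall>j<12. hdeg j \<le> 5" unfolding all_lt12 by (simp add: hdeg_def)
  then show "j < 12 \<Longrightarrow> hdeg j \<le> 5" by simp
qed

text \<open>The resolution built on a basis of \<open>M\<close> has no generators beyond homological
  degree 5, and its encoding has elements in the same universe as \<open>M\<close>.\<close>

lemma projective_dimension_le:
  fixes M :: "('k::field algA, ('k algA, 'u) universe) module"
  assumes M: "right_module M" shows "projective_dimension M \<le> enat 5"
proof -
  obtain B :: "('k algA, 'u) universe set" and d e
    where res: "resolution M (term_module B :: nat \<Rightarrow> ('k algA, ('k, ('k algA, 'u) universe) big) module) d e"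
    using resolution_exists[OF M] by (elim exE)
  let ?T = "term_module B :: nat \<Rightarrow> ('k algA, ('k, ('k algA, 'u) universe) big) module"
  let ?P = "\<lambda>n. transport enc_big (?T n)"
  have inj: "inj_on enc_big (carrier (?T n))" for n by (rule inj_onI) (rule enc_big_inject)
  have iso: "module_iso (?T n) (?P n) enc_big (inv_into (carrier (?T n)) enc_big)" for n
    by (rule transport_iso[OF right_module_free_module inj])
  have idM: "module_iso M M (\<lambda>x. x) (\<lambda>x. x)" using M by (simp add: module_iso_def module_hom_id)
  note r = resolution_iso[OF res idM iso]
  have p: "projective_module (?P n)" for n
    by (rule projective_moduleI[OF module_iso_sym[OF iso], of enc_key]) (auto intro: inj_onI enc_key_inject)
  have c: "carrier (?P n) = {\<zero>\<^bsub>?P n\<^esub>}" if "n > 5" for n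
  proof -
    have "gens B n = {}" using that hdeg_le_5 by (fastforce simp: gens_def)
    then have "carrier (?T n) = {0}" by (auto simp: free_module_def)
    then show ?thesis by (simp add: transport_def free_module_simps)
  qed
  show ?thesis unfolding projective_dimension_def
    by (rule Inf_lower, rule CollectI, rule exI[of _ 5], rule conjI[OF refl], intro exI conjI allI impI, rule r, rule p, rule c)
qed

section \<open>Projective dimension of the residue field\<close>

lemma module_iso_id: "right_module M \<Longrightarrow> module_iso M M (\<lambda>x. x) (\<lambda>x. x)"
  by (simp add: module_iso_def module_hom_id)

lemma projective_res_term: "projective_module (res_term n :: ('k::field algA, 'k algA vec) graded_module)"
proof (rule projective_moduleI[OF res_term_iso_free])
  show "inj_on (\<lambda>r. unit_vec (rank n) r :: 'k algA vec) {..<rank n}"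
  proof (rule inj_onI)
    fix r s assume r: "r \<in> {..<rank n}" and s: "s \<in> {..<rank n}" and e: "unit_vec (rank n) r = (unit_vec (rank n) s :: 'k algA vec)"
    have "unit_vec (rank n) r $ r = (1 :: 'k algA)" using r by simp
    then have "unit_vec (rank n) s $ r = (1 :: 'k algA)" unfolding e .
    then show "r = s" using r s by (simp split: if_splits)
  qed
qed

text \<open>As \<open>x\<close> and \<open>y\<close> have no component in degree \<open>0\<close>, the last differential has no left inverse.\<close>

lemma no_splitting:
  fixes s :: "'k::field algA vec \<Rightarrow> 'k algA vec"
  assumes s: "module_hom (res_term 4) (res_term (Suc 4)) s"
    and eq: "\<And>p. p \<in> carrier (res_term (Suc 4)) \<Longrightarrow> s (res_map 4 p) = \<ominus>\<^bsub>res_term (Suc 4)\<^esub> p"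
  shows False
proof -
  let ?p = "vec 1 (\<lambda>_. 1) :: 'k algA vec"
  let ?e = "\<lambda>r. unit_vec 2 r :: 'k algA vec"
  let ?F = "res_term 4 :: ('k algA, 'k algA vec) graded_module"
  let ?G = "res_term (Suc 4) :: ('k algA, 'k algA vec) graded_module"
  interpret G: right_module ?G by (rule right_module_res_term)
  have r: "rank (Suc 4) = 1" "rank 4 = 2" "rank 5 = 1" by (simp_all add: rank_simps)
  have p: "?p \<in> carrier ?G" by (simp add: res_term_simps r)
  have e: "?e i \<in> carrier ?F" for i by (simp add: res_term_simps r)
  have a: "smult ?F a (?e i) \<in> carrier ?F" for a i
    by (simp add: res_term_simps r)
  have c: "res_map 4 ?p \<in> carrier_vec 2" using res_map_carrier[of ?p 4] p by (simp add: res_term_simps r)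
  have "res_map 4 ?p = smult ?F xA (?e 0) \<oplus>\<^bsub>?F\<^esub> smult ?F yA (?e 1)"
  proof (rule eq_vecI)
    show "dim_vec (res_map 4 ?p) = dim_vec (smult ?F xA (?e 0) \<oplus>\<^bsub>?F\<^esub> smult ?F yA (?e 1))"
      using c by (simp add: res_term_simps)
    fix i assume "i < dim_vec (smult ?F xA (?e 0) \<oplus>\<^bsub>?F\<^esub> smult ?F yA (?e 1))"
    then have "i = 0 \<or> i = Suc 0" by (auto simp: res_term_simps)
    then show "res_map 4 ?p $ i = (smult ?F xA (?e 0) \<oplus>\<^bsub>?F\<^esub> smult ?F yA (?e 1)) $ i"
      by (auto simp: res_term_simps res_map_simps d5_mult)
  qed
  then have "s (res_map 4 ?p) = smult ?G xA (s (?e 0)) \<oplus>\<^bsub>?G\<^esub> smult ?G yA (s (?e 1))"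
    by (simp only: module_homD(2)[OF s a a] module_homD(3)[OF s e])
  moreover have sd: "dim_vec (s (unit_vec 2 i)) = 1" for i
    using module_homD(1)[OF s e, of i] r carrier_vecD unfolding res_term_simps by metis
  ultimately have "s (res_map 4 ?p) $ 0 = (s (?e 0)) $ 0 * xA + (s (?e 1)) $ 0 * yA"
    by (simp add: res_term_simps sd)
  moreover have "s (res_map 4 ?p) = smult ?G (- 1) ?p" using eq[OF p] G.neg_act[OF p] by simp
  moreover have "smult ?G (- 1) ?p $ 0 = - 1" by (simp add: res_term_simps)
  ultimately have "(s (?e 0)) $ 0 * xA + (s (?e 1)) $ 0 * yA = - 1" by simp
  then have "projA 0 ((s (?e 0)) $ 0 * xA + (s (?e 1)) $ 0 * yA) = projA 0 (- 1)" by simp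
  then have "(0 :: 'k algA) = - 1" by (simp add: projA_add projA_0_mult projA_uminus projA_gradeA[OF grade_gens(1)] projA_gradeA[OF grade_gens(2)])
  then show ?thesis by simp
qed

text \<open>The elements of k are cosets, hence sets; a chosen representative turns each into a
  scalar of the universe, where \<open>global_dimension\<close> can see the module.\<close>

definition residue_copy :: "('k::field algA, ('k algA, 'u) universe) module" where
  "residue_copy = transport (\<lambda>X. Scalar (SOME z. X = res_class z)) (right_residue_field gradeA)"

lemma residue_copy_iso:
  "module_iso (right_residue_field (gradeA :: nat \<Rightarrow> 'k::field algA set)) (residue_copy :: ('k algA, ('k algA, 'u) universe) module)
    (\<lambda>X. Scalar (SOME z. X = res_class z))
    (inv_into (carrier (right_residue_field (gradeA :: nat \<Rightarrow> 'k algA set))) (\<lambda>X. Scalar (SOME z. X = res_class z)))"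
  unfolding residue_copy_def
proof (rule transport_iso[OF right_module_residue_field])
  show "inj_on (\<lambda>X. Scalar (SOME z. X = res_class z) :: ('k algA, 'u) universe) (carrier (right_residue_field (gradeA :: nat \<Rightarrow> 'k algA set)))"
  proof (rule inj_onI)
    fix X Y assume XY: "X \<in> carrier (right_residue_field (gradeA :: nat \<Rightarrow> 'k algA set))"
        "Y \<in> carrier (right_residue_field (gradeA :: nat \<Rightarrow> 'k algA set))"
      and e: "(Scalar (SOME z. X = res_class z) :: ('k algA, 'u) universe) = Scalar (SOME z. Y = res_class z)"
    have s: "Z = res_class (SOME z. Z = res_class z)" if "Z \<in> carrier (right_residue_field (gradeA :: nat \<Rightarrow> 'k algA set))" for Z
    proof -
      have "\<exists>z. Z = res_class z" using that by (auto simp: residue_field_simps)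
      then show ?thesis by (rule someI_ex)
    qed
    have "(SOME z. X = res_class z) = (SOME z. Y = res_class z)" using e by simp
    then show "X = Y" using s[OF XY(1)] s[OF XY(2)] by metis
  qed
qed

lemma right_module_residue_copy: "right_module (residue_copy :: ('k::field algA, ('k algA, 'u) universe) module)"
  using residue_copy_iso unfolding module_iso_def by (elim conjE)

lemma projective_dimension_residue_copy:
  "enat 5 \<le> projective_dimension (residue_copy :: ('k::field algA, ('k algA, 'u) universe) module)"
proof (rule ccontr)
  let ?M = "residue_copy :: ('k algA, ('k algA, 'u) universe) module"
  assume "\<not> enat 5 \<le> projective_dimension ?M"
  then have "projective_dimension ?M < enat 5" by simp
  then obtain n and P :: "nat \<Rightarrow> ('k algA, ('k algA, 'u) universe) module" and d e
    where n: "n < 5" and P: "resolution ?M P d e" "\<And>i. projective_module (P i)" "\<And>i. n < i \<Longrightarrow> carrier (P i) = {\<zero>\<^bsub>P i\<^esub>}"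
    unfolding projective_dimension_def Inf_less_iff by auto
  have iso: "module_iso (P i) (P i) (\<lambda>x. x) (\<lambda>x. x)" for i
    by (rule module_iso_id[OF resolutionD(2)[OF P(1)]])
  note res = resolution_iso[OF P(1) module_iso_sym[OF residue_copy_iso] iso]
  have z: "carrier (res_term (Suc (Suc 4))) = {\<zero>\<^bsub>res_term (Suc (Suc 4))\<^esub> :: 'k algA vec}"
    by (auto simp: res_term_simps rank_simps)
  \<comment> \<open>A resolution of length below 5 vanishes at term 5, so the comparison would split
    the last differential, which goes from term 5 to term 4.\<close>
  have "carrier (P (Suc 4)) = {\<zero>\<^bsub>P (Suc 4)\<^esub>}" using P(3)[of "Suc 4"] n by simp
  from short_resolution[OF resolution_residue_field projective_res_term z res P(2) this]
  obtain s :: "'k algA vec \<Rightarrow> 'k algA vec" where "module_hom (res_term 4) (res_term (Suc 4)) s"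
    "\<forall>p\<in>carrier (res_term (Suc 4)). s (res_map 4 p) = \<ominus>\<^bsub>res_term (Suc 4)\<^esub> p" by (elim exE conjE)
  from no_splitting[OF this(1) bspec[OF this(2)]] show False .
qed

section \<open>The Gorenstein condition\<close>

definition enc_vec :: "'a vec \<Rightarrow> ('a, 'u) universe" where
  "enc_vec v = Tuple (map Scalar (list_of_vec v))"

definition dec_vec :: "('a, 'u) universe \<Rightarrow> 'a vec" where
  "dec_vec p = (case p of Tuple us \<Rightarrow> vec_of_list (map (\<lambda>s. case s of Scalar a \<Rightarrow> a) us))"

lemma dec_enc [simp]: "dec_vec (enc_vec v) = v"
  by (simp add: dec_vec_def enc_vec_def o_def vec_list)

text \<open>Written out with the explicit inverse \<open>dec_vec\<close>, because the Gorenstein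
  condition needs the grades of the terms and \<open>transport\<close> produces ungraded
  modules.\<close>

definition copy_term :: "nat \<Rightarrow> ('k::field algA, ('k algA, 'u) universe) graded_module" where
  "copy_term n = \<lparr>carrier = enc_vec ` carrier_vec (rank n), mult = undefined, one = undefined,
     zero = enc_vec (0\<^sub>v (rank n)), add = (\<lambda>p q. enc_vec (dec_vec p + dec_vec q)),
     smult = (\<lambda>a p. enc_vec (map_vec (\<lambda>c. c * a) (dec_vec p))),
     grade = (\<lambda>i. enc_vec ` grade (res_term n) i)\<rparr>"

lemma copy_simps:
  "carrier (copy_term n) = enc_vec ` carrier_vec (rank n)" "\<zero>\<^bsub>copy_term n\<^esub> = enc_vec (0\<^sub>v (rank n))"
  "p \<oplus>\<^bsub>copy_term n\<^esub> q = enc_vec (dec_vec p + dec_vec q)"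
  "smult (copy_term n) a p = enc_vec (map_vec (\<lambda>c. c * a) (dec_vec p))"
  "grade (copy_term n) i = enc_vec ` grade (res_term n) i"
  by (simp_all add: copy_term_def)

lemma copy_iso:
  "module_iso (res_term n :: ('k::field algA, 'k algA vec) graded_module)
    (copy_term n :: ('k algA, ('k algA, 'u) universe) graded_module) enc_vec dec_vec"
proof -
  let ?F = "res_term n :: ('k algA, 'k algA vec) graded_module"
  let ?C = "copy_term n :: ('k algA, ('k algA, 'u) universe) graded_module"
  let ?e = "enc_vec :: 'k algA vec \<Rightarrow> ('k algA, 'u) universe"
  have hom: "module_hom ?F ?C ?e"
    by (rule module_homI) (auto simp: res_term_simps copy_simps)
  have "inj_on ?e (carrier ?F)" by (rule inj_on_inverseI[of _ dec_vec]) simp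
  then have bij: "bij_betw ?e (carrier ?F) (carrier ?C)" by (simp add: bij_betw_def copy_simps res_term_simps)
  have zero: "?e \<zero>\<^bsub>?F\<^esub> = \<zero>\<^bsub>?C\<^esub>" by (simp add: copy_simps res_term_simps)
  have C: "right_module ?C"
    using module_isoI_bij[OF right_module_res_term bij hom zero] unfolding module_iso_def by (elim conjE)
  have "module_hom ?C ?F dec_vec"
    by (rule module_homI) (auto simp: res_term_simps copy_simps)
  then show ?thesis unfolding module_iso_def using hom C right_module_res_term by (auto simp: copy_simps)
qed

lemma module_hom_finsum:
  assumes M: "right_module M" and N: "right_module N" and f: "module_hom M N f"
    and S: "finite S" "\<And>s. s \<in> S \<Longrightarrow> h s \<in> carrier M"
  shows "f (finsum M h S) = finsum N (\<lambda>s. f (h s)) S"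
proof -
  interpret M: right_module M by fact
  interpret N: right_module N by fact
  show ?thesis using S
  proof (induction S rule: finite_induct)
    case empty
    show ?case by (simp add: module_hom_zero[OF M N f])
  next
    case (insert s S)
    have h: "h \<in> S \<rightarrow> carrier M" "h s \<in> carrier M" "(\<lambda>s. f (h s)) \<in> S \<rightarrow> carrier N" "f (h s) \<in> carrier N"
      using insert.prems module_homD(1)[OF f] by auto
    have "f (finsum M h (insert s S)) = f (h s) \<oplus>\<^bsub>N\<^esub> f (finsum M h S)"
      using insert.hyps h by (simp add: M.finsum_insert module_homD(2)[OF f] M.finsum_closed)
    also have "f (finsum M h S) = finsum N (\<lambda>s. f (h s)) S" using insert by auto
    finally show ?case using insert.hyps h by (simp add: N.finsum_insert)
  qed
qed

text \<open>Applied to the isomorphism for the existence of decompositions and to its inverse for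
  their uniqueness.\<close>

lemma decomposition_iso:
  fixes M :: "('a::ring_1, 'm) graded_module" and N :: "('a, 'n) graded_module"
  assumes iso: "module_iso M N f g" and gr: "\<And>i. f ` grade M i \<subseteq> grade N i" and c: "\<And>i. grade M i \<subseteq> carrier M"
    and h: "(\<forall>i. h i \<in> grade M i) \<and> finite {i. h i \<noteq> \<zero>\<^bsub>M\<^esub>} \<and> m = finsum M h {i. h i \<noteq> \<zero>\<^bsub>M\<^esub>}"
  shows "(\<forall>i. f (h i) \<in> grade N i) \<and> finite {i. f (h i) \<noteq> \<zero>\<^bsub>N\<^esub>} \<and>
    f m = finsum N (\<lambda>i. f (h i)) {i. f (h i) \<noteq> \<zero>\<^bsub>N\<^esub>}"
proof -
  have M: "right_module M" and N: "right_module N" and f: "module_hom M N f" and g: "module_hom N M g"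
    and gf: "\<And>m. m \<in> carrier M \<Longrightarrow> g (f m) = m" using iso unfolding module_iso_def by auto
  have z: "f x = \<zero>\<^bsub>N\<^esub> \<longleftrightarrow> x = \<zero>\<^bsub>M\<^esub>" if "x \<in> carrier M" for x
    using module_hom_zero[OF M N f] module_hom_zero[OF N M g] gf[OF that] by metis
  have h1: "h i \<in> grade M i" for i using h by (elim conjE) simp
  have hc: "h i \<in> carrier M" for i using subsetD[OF c h1] .
  have fin: "finite {i. h i \<noteq> \<zero>\<^bsub>M\<^esub>}" and m: "m = finsum M h {i. h i \<noteq> \<zero>\<^bsub>M\<^esub>}" using h by simp_all
  have e: "{i. f (h i) \<noteq> \<zero>\<^bsub>N\<^esub>} = {i. h i \<noteq> \<zero>\<^bsub>M\<^esub>}" using z[OF hc] by simp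
  have "f (h i) \<in> grade N i" for i using subsetD[OF gr imageI[OF h1]] .
  moreover have "f m = finsum N (\<lambda>i. f (h i)) {i. h i \<noteq> \<zero>\<^bsub>M\<^esub>}"
    unfolding m by (rule module_hom_finsum[OF M N f fin hc])
  ultimately show ?thesis unfolding e using fin by simp
qed

lemma graded_right_module_iso:
  fixes M :: "('a::ring_1, 'm) graded_module" and N :: "('a, 'n) graded_module"
  assumes gm: "graded_right_module G M" and iso: "module_iso M N f g" and gr: "\<And>i. grade N i = f ` grade M i"
  shows "graded_right_module G N"
proof -
  interpret M: graded_right_module G M by fact
  have M: "right_module M" and N: "right_module N" and f: "module_hom M N f" and g: "module_hom N M g"
    and gf: "\<And>m. m \<in> carrier M \<Longrightarrow> g (f m) = m" and fg: "\<And>n. n \<in> carrier N \<Longrightarrow> f (g n) = n"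
    using iso unfolding module_iso_def by auto
  interpret N: right_module N by (rule N)
  note sub = M.grade_subgroup
  have c: "grade M i \<subseteq> carrier M" for i by (rule additive_subgroup.a_subset[OF sub])
  have cN: "grade N i \<subseteq> carrier N" for i using c module_homD(1)[OF f] unfolding gr by blast
  show ?thesis
  proof (intro graded_right_module.intro graded_right_module_axioms.intro N)
    fix i
    show "additive_subgroup (grade N i) N"
    proof (rule N.additive_subgroupI[OF cN])
      show "\<zero>\<^bsub>N\<^esub> \<in> grade N i"
        unfolding gr module_hom_zero[OF M N f, symmetric] by (rule imageI[OF additive_subgroup.zero_closed[OF sub]])
      fix x assume "x \<in> grade N i"
      then obtain x' where x: "x' \<in> grade M i" "x = f x'" unfolding gr by (elim imageE)
      have xc: "x' \<in> carrier M" using subsetD[OF c x(1)] .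
      have "smult N (- 1) x = f (\<ominus>\<^bsub>M\<^esub> x')" unfolding x(2) by (simp add: M.neg_act[OF xc, symmetric] module_homD(3)[OF f xc])
      then show "smult N (- 1) x \<in> grade N i"
        unfolding gr using additive_subgroup.a_inv_closed[OF sub x(1)] by simp
      fix y assume "y \<in> grade N i"
      then obtain y' where y: "y' \<in> grade M i" "y = f y'" unfolding gr by (elim imageE)
      have yc: "y' \<in> carrier M" using subsetD[OF c y(1)] .
      have "x \<oplus>\<^bsub>N\<^esub> y = f (x' \<oplus>\<^bsub>M\<^esub> y')" unfolding x(2) y(2) by (simp add: module_homD(2)[OF f xc yc])
      then show "x \<oplus>\<^bsub>N\<^esub> y \<in> grade N i"
        unfolding gr using additive_subgroup.a_closed[OF sub x(1) y(1)] by simp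
    qed
  next
    fix m assume m: "m \<in> carrier N"
    let ?Q = "\<lambda>h. (\<forall>i. h i \<in> grade M i) \<and> finite {i. h i \<noteq> \<zero>\<^bsub>M\<^esub>} \<and> g m = finsum M h {i. h i \<noteq> \<zero>\<^bsub>M\<^esub>}"
    from M.grade_decomposition[OF module_homD(1)[OF g m]]
    obtain h where h: "?Q h" and u: "\<forall>k. ?Q k \<longrightarrow> k = h" by (elim ex1E)
    have gr1: "f ` grade M i \<subseteq> grade N i" for i by (simp add: gr)
    have gr2: "g ` grade N i \<subseteq> grade M i" for i
    proof
      fix x assume "x \<in> g ` grade N i"
      then obtain y where "y \<in> grade M i" "x = g (f y)" unfolding gr by (elim imageE) simp
      then show "x \<in> grade M i" using gf[OF subsetD[OF c]] by simp
    qed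
    show "\<exists>!h. (\<forall>i. h i \<in> grade N i) \<and> finite {i. h i \<noteq> \<zero>\<^bsub>N\<^esub>} \<and> m = finsum N h {i. h i \<noteq> \<zero>\<^bsub>N\<^esub>}"
    proof (rule ex1I)
      show "(\<forall>i. f (h i) \<in> grade N i) \<and> finite {i. f (h i) \<noteq> \<zero>\<^bsub>N\<^esub>} \<and> m = finsum N (\<lambda>i. f (h i)) {i. f (h i) \<noteq> \<zero>\<^bsub>N\<^esub>}"
        using decomposition_iso[OF iso gr1 c h] unfolding fg[OF m] .
      fix k assume k: "(\<forall>i. k i \<in> grade N i) \<and> finite {i. k i \<noteq> \<zero>\<^bsub>N\<^esub>} \<and> m = finsum N k {i. k i \<noteq> \<zero>\<^bsub>N\<^esub>}"
      have kc: "k i \<in> carrier N" for i by (rule subsetD[OF cN spec[OF conjunct1[OF k]]])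
      have "(\<lambda>i. g (k i)) = h" by (rule mp[OF spec[OF u]]) (rule decomposition_iso[OF module_iso_sym[OF iso] gr2 cN k])
      then show "k = (\<lambda>i. f (h i))" using fg[OF kc] by auto
    qed
  next
    fix m i and a :: 'a and j assume m: "m \<in> grade N i" and a: "a \<in> G j"
    obtain m' where m': "m' \<in> grade M i" "m = f m'" using m unfolding gr by (elim imageE)
    have "smult N a m = f (smult M a m')" unfolding m'(2) by (rule module_homD(3)[OF f subsetD[OF c m'(1)], symmetric])
    then show "smult N a m \<in> grade N (i + int j)" unfolding gr using M.grade_act[OF m'(1) a] by simp
  qed
qed

definition copy_map :: "nat \<Rightarrow> ('k::field algA, 'u) universe \<Rightarrow> ('k algA, 'u) universe" where
  "copy_map = (\<lambda>n p. enc_vec (res_map n (dec_vec p)))"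

definition copy_aug :: "('k::field algA, 'u) universe \<Rightarrow> 'k algA set" where
  "copy_aug = (\<lambda>p. augmentation gradeA (dec_vec p))"

lemma graded_resolution_copy:
  "graded_resolution (gradeA :: nat \<Rightarrow> 'k::field algA set) (right_residue_field gradeA)
    (copy_term :: nat \<Rightarrow> ('k algA, ('k algA, 'u) universe) graded_module) copy_map copy_aug"
proof -
  let ?C = "copy_term :: nat \<Rightarrow> ('k algA, ('k algA, 'u) universe) graded_module"
  let ?K = "right_residue_field (gradeA :: nat \<Rightarrow> 'k algA set)"
  have idK: "module_iso ?K ?K (\<lambda>x. x) (\<lambda>x. x)" by (simp add: module_iso_def module_hom_id right_module_residue_field)
  have res: "resolution ?K ?C copy_map copy_aug"
    unfolding copy_map_def copy_aug_def by (rule resolution_iso[OF resolution_residue_field idK copy_iso])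
  have gr: "graded_right_module gradeA (res_term n :: ('k algA, 'k algA vec) graded_module)" for n
    unfolding res_term_eq by (rule graded_free_graded)
  show ?thesis unfolding graded_resolution_def
  proof (intro conjI allI res graded_residue_field)
    show "graded_right_module gradeA (?C n)" for n
      by (rule graded_right_module_iso[OF gr copy_iso]) (simp add: copy_simps)
    show "graded_hom (?C (Suc n)) (?C n) 0 (copy_map n)" for n
      unfolding graded_hom_def
    proof (intro conjI allI image_subsetI resolutionD(3)[OF res])
      fix i and p :: "('k algA, 'u) universe" assume "p \<in> grade (?C (Suc n)) i"
      then obtain v :: "'k algA vec" where v: "v \<in> grade (res_term (Suc n)) i" "p = enc_vec v" unfolding copy_simps by (elim imageE)
      have "res_map n v \<in> grade (res_term n) (i + 0)"
        using graded_hom_res_map[of n, where 'a = 'k] v(1) unfolding graded_hom_def by blast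
      then show "copy_map n p \<in> grade (?C n) (i + 0)" by (simp add: v(2) copy_map_def copy_simps)
    qed
    show "graded_hom (?C 0) ?K 0 copy_aug"
      unfolding graded_hom_def
    proof (intro conjI allI image_subsetI resolutionD(4)[OF res])
      fix i and p :: "('k algA, 'u) universe" assume "p \<in> grade (?C 0) i"
      then obtain v :: "'k algA vec" where v: "v \<in> grade (res_term 0) i" "p = enc_vec v" unfolding copy_simps by (elim imageE)
      have "graded_hom (res_term 0) ?K 0 (augmentation gradeA)"
        using graded_resolution_residue_field[where 'k = 'k] unfolding graded_resolution_def by (elim conjE)
      then have "augmentation gradeA v \<in> grade ?K (i + 0)"
        using v(1) unfolding graded_hom_def by blast
      then show "copy_aug p \<in> grade ?K (i + 0)" by (simp add: v(2) copy_aug_def)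
    qed
  qed
qed

lemma copy_iso_free:
  "module_iso (copy_term n :: ('k::field algA, ('k algA, 'u) universe) graded_module) (free_module {..<rank n})
    (\<lambda>p. \<Sum>r<rank n. Poly_Mapping.single r (dec_vec p $ r)) (\<lambda>f. enc_vec (vec (rank n) (Poly_Mapping.lookup f)))"
  by (rule module_iso_trans[OF module_iso_sym[OF copy_iso] res_term_iso_free])

lemma projective_copy: "projective_module (copy_term n :: ('k::field algA, ('k algA, 'u) universe) graded_module)"
proof (rule projective_moduleI[OF copy_iso_free])
  show "inj_on (\<lambda>r. Tuple (replicate r (Tuple [])) :: ('k algA, 'u) universe) {..<rank n}"
    by (rule inj_onI) simp
qed

section \<open>Homomorphisms to the algebra as rows\<close>

definition pairing :: "(nat \<Rightarrow> 'k::field algA) \<Rightarrow> (nat \<Rightarrow> 'k algA) \<Rightarrow> 'k algA" where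
  "pairing r u = (\<Sum>i<12. r i * u i)"

text \<open>Adjointness of the matrix action on columns and on rows; composing a homomorphism with a
  differential thus becomes \<open>codiff\<close>.\<close>

lemma pairing_diff: "pairing r (diff u) = pairing (codiff r) u"
proof -
  have s: "(\<Sum>i<12. f i) = f 0 + f 1 + f 2 + f 3 + f 4 + f 5 + f 6 + f 7 + f 8 + f 9 + f 10 + f 11" for f :: "nat \<Rightarrow> 'a algA"
    by (simp add: eval_nat_numeral)
  show ?thesis unfolding pairing_def s
    by (simp add: diff_def codiff_def Let_def algebra_simps)
qed

lemma pairing_delta: "i < 12 \<Longrightarrow> pairing r (\<lambda>j. if j = i then 1 else 0) = r i"
proof -
  assume i: "i < 12"
  have "pairing r (\<lambda>j. if j = i then 1 else 0) = (\<Sum>k<12. if k = i then r k else 0)"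
    unfolding pairing_def by (rule sum.cong) auto
  then show ?thesis using i by simp
qed

definition supp :: "nat \<Rightarrow> (nat \<Rightarrow> 'k::field algA) \<Rightarrow> bool" where
  "supp n r \<longleftrightarrow> (\<forall>i. \<not> (i < 12 \<and> hdeg i = n) \<longrightarrow> r i = 0)"

lemma suppD: "supp n r \<Longrightarrow> \<not> (i < 12 \<and> hdeg i = n) \<Longrightarrow> r i = 0"
  by (simp add: supp_def)

lemma supp_zero: "supp n 0"
  and supp_add: "supp n r \<Longrightarrow> supp n s \<Longrightarrow> supp n (r + s)"
  and supp_minus: "supp n r \<Longrightarrow> supp n s \<Longrightarrow> supp n (r - s)"
  by (auto simp: supp_def)

lemma supp_codiff: assumes r: "supp n r" shows "supp (Suc n) (codiff r)"
  unfolding supp_def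
proof (intro allI impI)
  fix j assume j: "\<not> (j < 12 \<and> hdeg j = Suc n)"
  have h: "hdeg i \<noteq> n \<Longrightarrow> r i = 0" for i using suppD[OF r] by blast
  have hs: "n \<noteq> 0 \<Longrightarrow> r 0 = 0" "n \<noteq> 1 \<Longrightarrow> r 1 = 0" "n \<noteq> 1 \<Longrightarrow> r 2 = 0" "n \<noteq> 2 \<Longrightarrow> r 3 = 0" "n \<noteq> 2 \<Longrightarrow> r 4 = 0"
    "n \<noteq> 2 \<Longrightarrow> r 5 = 0" "n \<noteq> 3 \<Longrightarrow> r 6 = 0" "n \<noteq> 3 \<Longrightarrow> r 7 = 0" "n \<noteq> 3 \<Longrightarrow> r 8 = 0" "n \<noteq> 4 \<Longrightarrow> r 9 = 0" "n \<noteq> 4 \<Longrightarrow> r 10 = 0"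
    by (rule h, simp add: hdeg_def)+
  have h1: "Suc 0 \<noteq> n \<Longrightarrow> r (Suc 0) = 0" by (rule h) (simp add: hdeg_def)
  have "\<forall>j<12. hdeg j \<noteq> Suc n \<longrightarrow> codiff r j = 0"
    unfolding all_lt12 by (simp add: codiff_def Let_def hdeg_def hs h1)
  then show "codiff r j = 0" using j by (cases "j < 12") (simp_all add: codiff_def Let_def)
qed

lemma codiff_zero: "codiff 0 = 0"
  and codiff_add: "codiff (r + s) = codiff r + codiff s"
  and codiff_minus: "codiff (r - s) = codiff r - codiff s"
  by (simp_all add: fun_eq_iff codiff_def Let_def distrib_right left_diff_distrib)

text \<open>Homomorphisms from the \<open>n\<close>-th term to \<open>A\<close> are rows of length \<open>rank n\<close>; the rows of all terms
  are written into one family indexed by the generators, on which the dual differential is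
  \<open>codiff\<close>.\<close>

definition hom_of :: "nat \<Rightarrow> (nat \<Rightarrow> 'k::field algA) \<Rightarrow> ('k algA, 'u) universe \<Rightarrow> 'k algA" where
  "hom_of n r = (\<lambda>p\<in>carrier (copy_term n). pairing r (emb n (dec_vec p)))"

lemma hom_of_enc: "v \<in> carrier_vec (rank n) \<Longrightarrow> hom_of n r (enc_vec v) = pairing r (emb n v)"
  by (simp add: hom_of_def copy_simps)

lemma regular_simps:
  "carrier (right_regular G) = UNIV" "\<zero>\<^bsub>right_regular G\<^esub> = 0" "a \<oplus>\<^bsub>right_regular G\<^esub> b = a + b"
  "smult (right_regular G) a b = b * a" "grade (right_regular G) i = int_grade G i"
  by (simp_all add: right_regular_def)

lemma right_module_regular: "right_module (right_regular G :: ('a::ring_1, 'a) graded_module)"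
proof (rule right_moduleI)
  show "abelian_group (right_regular G :: ('a, 'a) graded_module)"
  proof (rule abelian_groupI)
    fix a :: 'a
    show "\<exists>b\<in>carrier (right_regular G). b \<oplus>\<^bsub>right_regular G\<^esub> a = \<zero>\<^bsub>right_regular G\<^esub>"
      by (rule bexI[of _ "- a"]) (simp_all add: regular_simps)
  qed (simp_all add: regular_simps add_ac)
qed (simp_all add: regular_simps distrib_left distrib_right mult.assoc)

lemma pairing_add: "pairing r (u + w) = pairing r u + pairing r w"
  and pairing_act: "pairing r (\<lambda>i. u i * a) = pairing r u * a"
  by (simp_all add: pairing_def distrib_left sum.distrib sum_distrib_right mult.assoc)

lemma module_hom_hom_of:
  "module_hom (copy_term n) (right_regular gradeA) (hom_of n r :: ('k::field algA, 'u) universe \<Rightarrow> 'k algA)"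
  by (rule module_homI) (auto simp: copy_simps regular_simps hom_of_enc emb_add emb_act pairing_add pairing_act)

lemma emb_delta: "i < 12 \<and> hdeg i = n \<Longrightarrow> emb n (unemb n (\<lambda>j. if j = i then 1 else 0)) = (\<lambda>j. if j = i then 1 else 0)"
  by (rule emb_unemb) auto

lemma hom_of_delta:
  fixes r :: "nat \<Rightarrow> 'k::field algA"
  assumes "i < 12 \<and> hdeg i = n"
  shows "(hom_of n r :: ('k algA, 'u) universe \<Rightarrow> 'k algA) (enc_vec (unemb n (\<lambda>j. if j = i then 1 else 0))) = r i"
  using assms by (simp add: hom_of_enc[OF unemb_carrier] emb_delta pairing_delta)

lemma hom_of_inject:
  assumes "supp n r" "supp n s" "(hom_of n r :: ('k::field algA, 'u) universe \<Rightarrow> 'k algA) = hom_of n s"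
  shows "r = s"
proof
  fix i show "r i = s i"
  proof (cases "i < 12 \<and> hdeg i = n")
    case True
    show ?thesis using hom_of_delta[OF True, of r, where 'u = 'u] hom_of_delta[OF True, of s, where 'u = 'u] assms(3) by simp
  qed (use assms suppD in metis)
qed

text \<open>The terms are free, so a homomorphism is determined by its values at the unit vectors,
  and these form its row.\<close>

lemma hom_row:
  fixes g :: "('k::field algA, 'u) universe \<Rightarrow> 'k algA"
  assumes g: "module_hom (copy_term n) (right_regular gradeA) g"
  shows "\<exists>r. supp n r \<and> (\<forall>p\<in>carrier (copy_term n). g p = hom_of n r p)"
proof -
  let ?C = "copy_term n :: ('k algA, ('k algA, 'u) universe) graded_module"
  let ?d = "\<lambda>i. enc_vec (unemb n (\<lambda>j. if j = i then 1 else 0)) :: ('k algA, 'u) universe"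
  define r where "r i = (if i < 12 \<and> hdeg i = n then g (?d i) else 0)" for i
  let ?\<Phi> = "\<lambda>p. \<Sum>r<rank n. Poly_Mapping.single r (dec_vec p $ r) :: nat \<Rightarrow>\<^sub>0 'k algA"
  let ?\<Psi> = "\<lambda>f. enc_vec (vec (rank n) (Poly_Mapping.lookup f)) :: ('k algA, 'u) universe"
  have iso: "module_iso ?C (free_module {..<rank n}) ?\<Phi> ?\<Psi>" by (rule copy_iso_free)
  have \<Phi>: "module_hom ?C (free_module {..<rank n}) ?\<Phi>" and \<Psi>: "module_hom (free_module {..<rank n}) ?C ?\<Psi>"
    and inv: "\<And>p. p \<in> carrier ?C \<Longrightarrow> ?\<Psi> (?\<Phi> p) = p"
    using iso unfolding module_iso_def by simp_all
  have "g p = hom_of n r p" if p: "p \<in> carrier ?C" for p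
  proof -
    have "g (?\<Psi> (?\<Phi> p)) = hom_of n r (?\<Psi> (?\<Phi> p))"
    proof (rule free_module_hom_ext[OF right_module_regular module_hom_comp[OF \<Psi> g] module_hom_comp[OF \<Psi> module_hom_hom_of] _ module_homD(1)[OF \<Phi> p]])
      fix b assume "b \<in> {..<rank n}"
      then have b: "off n + b < 12 \<and> hdeg (off n + b) = n" unfolding hdeg_iff by simp
      have "?\<Psi> (Poly_Mapping.single b 1) = ?d (off n + b)"
        by (rule arg_cong[of _ _ enc_vec]) (auto simp: unemb_def vec_eq_iff lookup_single when_def)
      then show "g (?\<Psi> (Poly_Mapping.single b 1)) = hom_of n r (?\<Psi> (Poly_Mapping.single b 1))"
        using hom_of_delta[OF b, of r, where 'u = 'u] b by (simp add: r_def)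
    qed
    then show ?thesis unfolding inv[OF p] .
  qed
  moreover have "supp n r" by (simp add: supp_def r_def)
  ultimately show ?thesis by blast
qed

text \<open>The unit vector at generator \<open>i\<close> has degree \<open>gdeg i\<close>, so a
  homomorphism of degree \<open>j\<close> has its entry there in degree
  \<open>gdeg i + j\<close>.\<close>

lemma hom_of_grade:
  assumes r: "\<And>i. i < 12 \<Longrightarrow> r i \<in> int_grade gradeA (int (gdeg i) + j)"
  shows "(hom_of n r :: ('k::field algA, 'u) universe \<Rightarrow> 'k algA) \<in> dual_grade gradeA (copy_term n) j"
  unfolding dual_grade_def graded_hom_def
proof (intro CollectI conjI allI image_subsetI module_hom_hom_of)
  show "(hom_of n r :: ('k algA, 'u) universe \<Rightarrow> 'k algA) \<in> extensional (carrier (copy_term n))"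
    unfolding hom_of_def by (rule restrict_extensional)
  fix i and p :: "('k algA, 'u) universe" assume "p \<in> grade (copy_term n) i"
  then obtain v :: "'k algA vec" where v: "v \<in> grade (res_term n) i" "p = enc_vec v" unfolding copy_simps by (elim imageE)
  have vc: "v \<in> carrier_vec (rank n)" and up: "if i < 0 then emb n v = 0 else emb n v \<in> upper n (nat i) 0"
    using v(1) unfolding grade_res_term by simp_all
  note sub = subspace_int_grade[of "i + j", where 'k = 'k]
  have "r k * emb n v k \<in> int_grade gradeA (i + j)" if k: "k < 12" for k
  proof (cases "emb n v k = 0")
    case True
    then show ?thesis using A.subspace_0[OF sub] by simp
  next
    case False
    then have i: "0 \<le> i" using up by (auto split: if_splits)
    then have "emb n v \<in> upper n (nat i) 0" using up by simp
    then have "gdeg k \<le> nat i" "emb n v k \<in> gradeA (nat i - gdeg k)"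
      using False unfolding upper_zero_iff by meson+
    from int_grade_mult[OF r[OF k] this(2)] this(1) show ?thesis using i by (simp add: of_nat_diff algebra_simps)
  qed
  then have "pairing r (emb n v) \<in> int_grade gradeA (i + j)"
    unfolding pairing_def by (intro A.subspace_sum[OF sub]) simp
  then show "hom_of n r p \<in> grade (right_regular gradeA) (i + j)" by (simp add: v(2) hom_of_enc[OF vc] regular_simps)
qed

text \<open>The terms are finitely generated, so every homomorphism is a finite sum of homogeneous
  ones, and the graded dual consists of all rows.\<close>

lemma dual_carrier:
  "carrier (graded_dual gradeA (copy_term n :: ('k::field algA, ('k algA, 'u) universe) graded_module)) =
    hom_of n ` {r. supp n r}"
proof (intro equalityI subsetI)
  let ?C = "copy_term n :: ('k algA, ('k algA, 'u) universe) graded_module"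
  interpret C: right_module ?C using copy_iso unfolding module_iso_def by blast
  fix f assume "f \<in> carrier (graded_dual gradeA ?C)"
  then obtain g and J :: "int set" where f: "f = (\<lambda>p\<in>carrier ?C. \<Sum>j\<in>J. g j p)" and g: "\<forall>j\<in>J. g j \<in> dual_grade gradeA ?C j"
    unfolding graded_dual_def by auto
  have gh: "module_hom ?C (right_regular gradeA) (g j)" if "j \<in> J" for j
    using bspec[OF g that] unfolding dual_grade_def graded_hom_def by simp
  have "module_hom ?C (right_regular gradeA) (\<lambda>p. \<Sum>j\<in>J. g j p)"
  proof (rule module_homI)
    fix p q a assume p: "p \<in> carrier ?C"
    show "(\<Sum>j\<in>J. g j p) \<in> carrier (right_regular gradeA)" by (simp add: regular_simps)
    show "(\<Sum>j\<in>J. g j (smult ?C a p)) = smult (right_regular gradeA) a (\<Sum>j\<in>J. g j p)"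
      using module_homD(3)[OF gh p] by (simp add: regular_simps sum_distrib_right)
    assume q: "q \<in> carrier ?C"
    show "(\<Sum>j\<in>J. g j (p \<oplus>\<^bsub>?C\<^esub> q)) = (\<Sum>j\<in>J. g j p) \<oplus>\<^bsub>right_regular gradeA\<^esub> (\<Sum>j\<in>J. g j q)"
      using module_homD(2)[OF gh p q] by (simp add: regular_simps sum.distrib)
  qed
  from hom_row[OF this] obtain r where r: "supp n r" "\<forall>p\<in>carrier ?C. (\<Sum>j\<in>J. g j p) = hom_of n r p" by (elim exE conjE)
  have "f = hom_of n r"
  proof
    fix p show "f p = hom_of n r p"
      using r(2) by (cases "p \<in> carrier ?C") (simp_all add: f, simp add: hom_of_def)
  qed
  then show "f \<in> hom_of n ` {r. supp n r}" using r(1) by blast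
next
  let ?C = "copy_term n :: ('k algA, ('k algA, 'u) universe) graded_module"
  fix f :: "('k algA, 'u) universe \<Rightarrow> 'k algA" assume "f \<in> hom_of n ` {r. supp n r}"
  then obtain r where r: "supp n r" "f = hom_of n r" by auto
  \<comment> \<open>All degrees in which some entry contributes: a part of degree \<open>z\<close>
    at generator \<open>i\<close> belongs to a homomorphism of degree
    \<open>z - gdeg i\<close>.\<close>
  define J where "J = (\<Union>i\<in>{..<12}. (\<lambda>z. z - int (gdeg i)) ` {z. projZ z (r i) \<noteq> 0})"
  have J: "finite J" unfolding J_def using finite_projZ by blast
  define q where "q j i = projZ (int (gdeg i) + j) (r i)" for j i
  have s: "(\<Sum>j\<in>J. q j i) = r i" if i: "i < 12" for i
  proof -
    have "(\<Sum>j\<in>J. q j i) = (\<Sum>z\<in>(\<lambda>j. int (gdeg i) + j) ` J. projZ z (r i))"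
      unfolding q_def by (subst sum.reindex) (auto simp: inj_on_def)
    also have "\<dots> = r i"
    proof (rule sum_projZ)
      show "{z. projZ z (r i) \<noteq> 0} \<subseteq> (\<lambda>j. int (gdeg i) + j) ` J"
      proof
        fix z assume z: "z \<in> {z. projZ z (r i) \<noteq> 0}"
        have "z - int (gdeg i) \<in> J" unfolding J_def by (rule UN_I[of i]) (use i z in auto)
        then show "z \<in> (\<lambda>j. int (gdeg i) + j) ` J" by (rule rev_image_eqI) simp
      qed
    qed (use J in simp)
    finally show ?thesis .
  qed
  have "f = (\<lambda>p\<in>carrier ?C. \<Sum>j\<in>J. hom_of n (q j) p)"
  proof
    fix p
    show "f p = (\<lambda>p\<in>carrier ?C. \<Sum>j\<in>J. hom_of n (q j) p) p"
    proof (cases "p \<in> carrier ?C")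
      case True
      have "(\<Sum>j\<in>J. pairing (q j) u) = pairing r u" for u
      proof -
        have "(\<Sum>j\<in>J. pairing (q j) u) = (\<Sum>i<12. \<Sum>j\<in>J. q j i * u i)" unfolding pairing_def by (rule sum.swap)
        also have "\<dots> = pairing r u" unfolding pairing_def by (rule sum.cong[OF refl]) (simp add: sum_distrib_right[symmetric] s)
        finally show ?thesis .
      qed
      then show ?thesis using True by (simp add: r(2) hom_of_def)
    qed (simp add: r(2) hom_of_def)
  qed
  moreover have "hom_of n (q j) \<in> dual_grade gradeA ?C j" for j
    by (rule hom_of_grade) (simp add: q_def projZ_in)
  ultimately have "\<exists>g J. f = (\<lambda>p\<in>carrier ?C. \<Sum>j\<in>J. g j p) \<and> finite J \<and> (\<forall>j\<in>J. g j \<in> dual_grade gradeA ?C j)"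
    using J by (intro exI[of _ "\<lambda>j. hom_of n (q j)"] exI[of _ J] conjI ballI)
  then show "f \<in> carrier (graded_dual gradeA ?C)" by (simp add: graded_dual_def)
qed

lemma dual_ops:
  fixes n defines "D \<equiv> graded_dual gradeA (copy_term n :: ('k::field algA, ('k algA, 'u) universe) graded_module)"
  shows "\<zero>\<^bsub>D\<^esub> = hom_of n 0" "hom_of n r \<oplus>\<^bsub>D\<^esub> hom_of n s = hom_of n (r + s)"
    "smult D a (hom_of n r) = hom_of n (\<lambda>i. a * r i)"
  unfolding D_def by (auto simp: graded_dual_def hom_of_def fun_eq_iff restrict_def pairing_def distrib_right
      sum.distrib sum_distrib_left mult.assoc)

lemma dual_map_hom_of:
  "dual_map copy_term copy_map n (hom_of n r :: ('k::field algA, 'u) universe \<Rightarrow> 'k algA) = hom_of (Suc n) (codiff r)"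
proof
  fix p :: "('k algA, 'u) universe"
  show "dual_map copy_term copy_map n (hom_of n r) p = hom_of (Suc n) (codiff r) p"
  proof (cases "p \<in> carrier (copy_term (Suc n))")
    case True
    then obtain v :: "'k algA vec" where v: "v \<in> carrier_vec (rank (Suc n))" "p = enc_vec v" unfolding copy_simps by (elim imageE)
    have "dual_map copy_term copy_map n (hom_of n r) p = hom_of n r (enc_vec (res_map n v) :: ('k algA, 'u) universe)"
      using True by (simp add: dual_map_def v(2) copy_map_def)
    also have "\<dots> = pairing (codiff r) (emb (Suc n) v)"
      by (simp add: hom_of_enc[OF res_map_carrier[OF v(1)]] emb_res_map[OF v(1)] pairing_diff)
    finally show ?thesis by (simp add: v(2) hom_of_enc[OF v(1)])
  qed (simp add: dual_map_def hom_of_def)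
qed

section \<open>The Ext modules\<close>

fun cob :: "nat \<Rightarrow> (nat \<Rightarrow> 'k::field algA) set" where
  "cob 0 = {0}"
| "cob (Suc n) = codiff ` {r. supp n r}"

lemma cob_add: "r \<in> cob n \<Longrightarrow> s \<in> cob n \<Longrightarrow> r + s \<in> cob n"
  by (cases n) (auto simp: codiff_add[symmetric] supp_add)

lemma cob_minus: "r \<in> cob n \<Longrightarrow> s \<in> cob n \<Longrightarrow> r - s \<in> cob n"
  by (cases n) (auto simp: codiff_minus[symmetric] supp_minus)

lemma cob_zero: "0 \<in> cob n"
  by (cases n) (auto intro!: image_eqI[of _ _ 0] simp: codiff_zero supp_zero)

lemma coboundaries_eq:
  "dual_coboundaries gradeA (copy_term :: nat \<Rightarrow> ('k::field algA, ('k algA, 'u) universe) graded_module) copy_map n = hom_of n ` cob n"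
  by (cases n) (simp_all add: dual_ops dual_carrier image_image dual_map_hom_of)

lemma cocycles_eq:
  "dual_cocycles gradeA (copy_term :: nat \<Rightarrow> ('k::field algA, ('k algA, 'u) universe) graded_module) copy_map n =
    hom_of n ` {r. supp n r \<and> codiff r = 0}"
proof -
  have "(hom_of (Suc n) (codiff r) :: ('k algA, 'u) universe \<Rightarrow> 'k algA) = hom_of (Suc n) 0 \<longleftrightarrow> codiff r = 0" if "supp n r" for r
    using hom_of_inject[OF supp_codiff[OF that] supp_zero] by auto
  then show ?thesis unfolding dual_cocycles_def a_kernel_def' dual_carrier dual_ops by (auto simp: dual_map_hom_of)
qed

lemma dual_coset:
  "hom_of n ` W +>\<^bsub>graded_dual gradeA (copy_term n :: ('k::field algA, ('k algA, 'u) universe) graded_module)\<^esub> hom_of n r =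
    hom_of n ` ((\<lambda>w. w + r) ` W)"
  unfolding a_r_coset_def' by (auto simp: dual_ops)

text \<open>Up to degree 5 this is exactness of the transposed complex; beyond it there are no
  generators, so the row is 0.\<close>

lemma cocycle_cob:
  assumes r: "supp n r" "codiff r = 0" and n: "n = 5 \<Longrightarrow> projA 0 (r 11) = 0"
  shows "r \<in> cob n"
proof (cases "n \<le> 5")
  case True
  have "\<exists>g. (\<forall>i. \<not> (i < 12 \<and> Suc (hdeg i) = n) \<longrightarrow> g i = 0) \<and> r = codiff g"
    by (rule coexact_total[OF _ True r(2) n]) (rule suppD[OF r(1)])
  then obtain g where g: "\<forall>i. \<not> (i < 12 \<and> Suc (hdeg i) = n) \<longrightarrow> g i = 0" "r = codiff g" by (elim exE conjE)
  show ?thesis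
  proof (cases n)
    case 0
    then have "g = 0" using g(1) by (auto simp: fun_eq_iff)
    then show ?thesis using g(2) 0 by (simp add: codiff_zero)
  next
    case (Suc m)
    then have "supp m g" using g(1) by (simp add: supp_def)
    then show ?thesis using g(2) Suc by simp
  qed
next
  case False
  have "r = 0"
  proof
    fix i
    show "r i = 0 i" using suppD[OF r(1), of i] hdeg_le_5[of i] False by (cases "i < 12") auto
  qed
  then show ?thesis using cob_zero by simp
qed

lemma Ext_zero:
  fixes n defines "E \<equiv> Ext_of gradeA (copy_term :: nat \<Rightarrow> ('k::field algA, ('k algA, 'u) universe) graded_module) copy_map n"
  assumes n: "n \<noteq> 5"
  shows "carrier E = {\<zero>\<^bsub>E\<^esub>}"
proof -
  let ?h = "hom_of n :: (nat \<Rightarrow> 'k algA) \<Rightarrow> ('k algA, 'u) universe \<Rightarrow> 'k algA"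
  let ?Z = "{r :: nat \<Rightarrow> 'k algA. supp n r \<and> codiff r = 0}"
  have "?h ` ((\<lambda>w. w + r) ` cob n) = ?h ` cob n" if "r \<in> ?Z" for r
  proof -
    have r: "r \<in> cob n" using that n by (intro cocycle_cob) auto
    have "(\<lambda>w. w + r) ` cob n = cob n"
    proof (intro equalityI subsetI)
      fix s :: "nat \<Rightarrow> 'k algA" assume "s \<in> cob n"
      then show "s \<in> (\<lambda>w. w + r) ` cob n" using cob_minus[OF _ r, of s] by (intro image_eqI[of _ _ "s - r"]) simp_all
    qed (auto simp: cob_add r)
    then show ?thesis by simp
  qed
  moreover have "0 \<in> ?Z" by (simp add: supp_zero codiff_zero)
  moreover have "carrier E = (\<lambda>r. ?h ` ((\<lambda>w. w + r) ` cob n)) ` ?Z"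
    unfolding E_def Ext_of_def subquotient_def cocycles_eq coboundaries_eq by (simp add: image_image dual_coset[unfolded image_image])
  moreover have "\<zero>\<^bsub>E\<^esub> = ?h ` cob n"
    unfolding E_def Ext_of_def subquotient_def coboundaries_eq by simp
  ultimately show ?thesis by auto
qed

definition top_row :: "'k::field algA \<Rightarrow> nat \<Rightarrow> 'k algA" where
  "top_row a i = (if i = 11 then a else 0)"

lemma supp_5: "supp 5 r \<longleftrightarrow> r = top_row (r 11)"
proof -
  have "i < 12 \<and> hdeg i = 5 \<longleftrightarrow> i = 11" for i unfolding hdeg_iff by (auto simp: off_simps rank_simps)
  then show ?thesis unfolding supp_def by (auto simp: top_row_def fun_eq_iff)
qed

lemma supp_top_row: "supp 5 (top_row a)"
  unfolding supp_5 by (simp add: top_row_def)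

lemma codiff_top_row: "codiff (top_row a) = 0"
  by (rule ext) (simp add: codiff_def Let_def top_row_def)

lemma top_row_add: "top_row a + top_row b = top_row (a + b)"
  and top_row_act: "(\<lambda>i. c * top_row a i) = top_row (c * a)"
  by (auto simp: top_row_def fun_eq_iff)

text \<open>The last coboundary sends a row to \<open>r 9 * xA + r 10 * yA\<close>, which has no
  constant term; conversely such an entry is a coboundary by exactness of the transposed
  complex.\<close>

lemma cob_5: "cob 5 = (top_row ` res_class 0 :: (nat \<Rightarrow> 'k::field algA) set)"
proof (intro equalityI subsetI)
  have c5: "cob 5 = codiff ` {r :: nat \<Rightarrow> 'k algA. supp 4 r}" using cob.simps(2)[of 4, where 'k = 'k] by simp
  fix r :: "nat \<Rightarrow> 'k algA" assume "r \<in> cob 5"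
  then obtain s where s: "supp 4 s" "r = codiff s" unfolding c5 by auto
  have "supp 5 r" using supp_codiff[OF s(1)] s(2) by simp
  then have "r = top_row (r 11)" unfolding supp_5 .
  moreover have "projA 0 (r 11) = 0"
    by (simp add: s(2) codiff_def Let_def projA_add projA_0_mult projA_gradeA[OF grade_gens(1)] projA_gradeA[OF grade_gens(2)])
  ultimately show "r \<in> top_row ` res_class 0" by (intro image_eqI[of _ _ "r 11"]) (simp_all add: res_class_def)
next
  fix r :: "nat \<Rightarrow> 'k algA" assume "r \<in> top_row ` res_class 0"
  then obtain a where a: "r = top_row a" "projA 0 a = 0" by (auto simp: res_class_def)
  show "r \<in> cob 5"
    by (rule cocycle_cob) (simp_all add: a supp_top_row codiff_top_row, simp add: top_row_def a(2))
qed

lemma left_residue_field_simps: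
  fixes G defines "G \<equiv> (gradeA :: nat \<Rightarrow> 'k::field algA set)"
  shows "carrier (left_residue_field G) = range res_class"
    "res_class z \<oplus>\<^bsub>left_residue_field G\<^esub> res_class w = res_class (z + w)"
    "smult (left_residue_field G) a (res_class z) = res_class (a * z)"
    "grade (left_residue_field G) i = res_class ` int_grade gradeA i"
proof -
  have grr: "grade (left_regular gradeA) i = (int_grade gradeA i :: 'k algA set)" by (simp add: left_regular_def)
  show "carrier (left_residue_field G) = range res_class"
    by (simp add: left_residue_field_def subquotient_def G_def coset_left_regular)
  show "grade (left_residue_field G) i = res_class ` int_grade gradeA i"
    by (simp add: left_residue_field_def subquotient_def G_def coset_left_regular grr)
  show "res_class z \<oplus>\<^bsub>left_residue_field G\<^esub> res_class w = res_class (z + w)"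
    by (subst res_class_add[symmetric])
      (simp add: left_residue_field_def subquotient_def set_add_def' left_regular_def)
  have "(\<Union>h\<in>res_class 0. \<Union>k\<in>(\<lambda>m. a * m) ` res_class z. {h + k}) = res_class (a * z)"
  proof -
    have "b \<in> (\<Union>h\<in>res_class 0. \<Union>k\<in>(\<lambda>m. a * m) ` res_class z. {h + k})" if "projA 0 b = projA 0 (a * z)" for b
      using that by (intro UN_I[of "b - a * z"] UN_I[of "a * z"]) (auto simp: res_class_def projA_diff)
    then show ?thesis by (auto simp: res_class_def projA_add projA_0_mult)
  qed
  then show "smult (left_residue_field G) a (res_class z) = res_class (a * z)"
    by (simp add: left_residue_field_def subquotient_def set_add_def' left_regular_def positive_part_eq[symmetric] G_def)
qed

lemma res_class_shift: "(\<lambda>b. b + a) ` res_class 0 = res_class a"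
proof (intro equalityI subsetI)
  fix b assume "b \<in> res_class a"
  then show "b \<in> (\<lambda>b. b + a) ` res_class 0" by (intro image_eqI[of _ _ "b - a"]) (simp_all add: res_class_def projA_diff)
qed (auto simp: res_class_def projA_add)

text \<open>Cocycles are single entries and coboundaries are those without constant term, so the
  quotient is k. The shift is 12 because the only generator of the last term has degree 12.\<close>

lemma Ext_5:
  "graded_isomorphic (Ext_of gradeA (copy_term :: nat \<Rightarrow> ('k::field algA, ('k algA, 'u) universe) graded_module) copy_map 5)
    (shift (left_residue_field gradeA) 12)"
proof -
  let ?C = "copy_term 5 :: ('k algA, ('k algA, 'u) universe) graded_module"
  let ?D = "graded_dual gradeA ?C"
  let ?E = "Ext_of gradeA (copy_term :: nat \<Rightarrow> ('k algA, ('k algA, 'u) universe) graded_module) copy_map 5"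
  let ?L = "shift (left_residue_field gradeA) 12 :: ('k algA, 'k algA set) graded_module"
  define h :: "'k algA \<Rightarrow> ('k algA, 'u) universe \<Rightarrow> 'k algA" where "h a = hom_of 5 (top_row a)" for a
  define C where "C a = h ` res_class a" for a
  \<comment> \<open>The generator of the last term. Evaluation at it recovers the entry of the row,
    so \<open>F\<close> sends a coset of homomorphisms to a residue class.\<close>
  define p0 :: "('k algA, 'u) universe" where "p0 = enc_vec (vec 1 (\<lambda>_. 1))"
  define F :: "(('k algA, 'u) universe \<Rightarrow> 'k algA) set \<Rightarrow> 'k algA set" where "F X = (\<lambda>f. f p0) ` X" for X
  have e0: "emb 5 (vec 1 (\<lambda>_. 1 :: 'k algA)) = (\<lambda>j. if j = 11 then 1 else 0)"
    by (auto simp: emb_def off_simps rank_simps fun_eq_iff)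
  have c0: "vec 1 (\<lambda>_. 1 :: 'k algA) \<in> carrier_vec (rank 5)" by (simp add: rank_simps)
  have hp: "h a p0 = a" for a
    unfolding h_def p0_def hom_of_enc[OF c0] e0 by (subst pairing_delta) (simp_all add: top_row_def)
  have FC: "F (C a) = res_class a" for a unfolding F_def C_def by (simp add: image_image hp)
  have h_add: "h a \<oplus>\<^bsub>?D\<^esub> h b = h (a + b)" and h_act: "smult ?D c (h a) = h (c * a)" for a b c
    unfolding h_def by (simp_all add: dual_ops top_row_add top_row_act)
  have B: "dual_coboundaries gradeA copy_map' copy_map 5 = C 0" if "copy_map' = copy_term" for copy_map'
    unfolding that coboundaries_eq cob_5 C_def h_def by (simp add: image_image)
  have Z: "dual_cocycles gradeA (copy_term :: nat \<Rightarrow> ('k algA, ('k algA, 'u) universe) graded_module) copy_map 5 = range h"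
  proof -
    have "{r :: nat \<Rightarrow> 'k algA. supp 5 r \<and> codiff r = 0} = range top_row"
      by (auto simp: supp_top_row codiff_top_row) (auto simp: supp_5)
    then show ?thesis unfolding cocycles_eq by (simp add: image_image h_def)
  qed
  have coset: "C 0 +>\<^bsub>?D\<^esub> h a = C a" for a
  proof -
    have "C 0 +>\<^bsub>?D\<^esub> h a = (\<Union>b\<in>res_class 0. {h (b + a)})"
      unfolding a_r_coset_def' C_def by (simp add: h_add)
    also have "\<dots> = h ` ((\<lambda>b. b + a) ` res_class 0)" by (auto simp: image_image)
    finally show ?thesis unfolding res_class_shift C_def .
  qed
  have E: "carrier ?E = range C" "\<And>X Y. X \<oplus>\<^bsub>?E\<^esub> Y = X <+>\<^bsub>?D\<^esub> Y" "\<And>c X. smult ?E c X = C 0 <+>\<^bsub>?D\<^esub> (smult ?D c ` X)"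
    "\<And>i. grade ?E i = (\<lambda>f. C 0 +>\<^bsub>?D\<^esub> f) ` (range h \<inter> dual_grade gradeA ?C i)"
    unfolding Ext_of_def subquotient_def Z B[OF refl] by (simp_all add: image_image coset graded_dual_def[of gradeA ?C, THEN arg_cong[of _ _ grade]])
  have E_add: "C a \<oplus>\<^bsub>?E\<^esub> C b = C (a + b)" for a b
  proof -
    have "C a \<oplus>\<^bsub>?E\<^esub> C b = h ` (\<Union>x\<in>res_class a. \<Union>y\<in>res_class b. {x + y})"
      unfolding E set_add_def' C_def by (auto simp: h_add)
    then show ?thesis unfolding res_class_add C_def .
  qed
  have E_act: "smult ?E c (C a) = C (c * a)" for c a
  proof -
    have "smult ?E c (C a) = h ` (\<Union>x\<in>res_class 0. \<Union>y\<in>res_class a. {x + c * y})"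
      unfolding E set_add_def' C_def by (auto simp: h_add h_act)
    also have "(\<Union>x\<in>res_class 0. \<Union>y\<in>res_class a. {x + c * y}) = res_class (c * a)"
    proof (intro equalityI subsetI)
      fix b assume "b \<in> res_class (c * a)"
      then show "b \<in> (\<Union>x\<in>res_class 0. \<Union>y\<in>res_class a. {x + c * y})"
        by (intro UN_I[of "b - c * a"] UN_I[of a]) (auto simp: res_class_def projA_diff)
    qed (auto simp: res_class_def projA_add projA_0_mult)
    finally show ?thesis unfolding C_def .
  qed
  have L: "carrier ?L = range res_class" "\<And>z w. res_class z \<oplus>\<^bsub>?L\<^esub> res_class w = res_class (z + w)"
    "\<And>c z. smult ?L c (res_class z) = res_class (c * z)" "\<And>i. grade ?L i = res_class ` int_grade gradeA (i + 12)"
    by (simp_all add: shift_def left_residue_field_simps)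
  have hom: "module_hom ?E ?L F"
    by (rule module_homI) (auto simp: E(1) FC L E_add E_act)
  have bij: "bij_betw F (carrier ?E) (carrier ?L)"
  proof (rule bij_betwI')
    fix X Y assume "X \<in> carrier ?E" "Y \<in> carrier ?E"
    then obtain a b where "X = C a" "Y = C b" unfolding E(1) by auto
    note ab = this
    show "F X = F Y \<longleftrightarrow> X = Y"
    proof
      assume "F X = F Y"
      then have "res_class a = res_class b" by (simp add: ab FC)
      then show "X = Y" by (simp add: ab C_def)
    qed simp
  qed (auto simp: E(1) L(1) FC)
  have p0: "p0 \<in> grade ?C 12"
  proof -
    have "vec 1 (\<lambda>_. 1 :: 'k algA) \<in> grade (res_term 5) 12"
      unfolding grade_res_term e0 upper_zero_iff
    proof (intro conjI c0)
      have "(1 :: 'k algA) \<in> gradeA 0" using mon_in_gradeA[of "[]"] by simp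
      moreover have "gdeg 11 = 12" "hdeg 11 = 5" by (simp_all add: gdeg_def hdeg_def)
      moreover have "0 \<in> (gradeA m :: 'k algA set)" for m by (rule A.subspace_0[OF subspace_gradeA])
      ultimately show "if (12::int) < 0 then (\<lambda>j. if j = 11 then 1 else 0) = (0 :: nat \<Rightarrow> 'k algA) else
        (\<forall>i. if i < 12 \<and> hdeg i = 5 \<and> gdeg i \<le> nat 12 then (if i = 11 then 1 else 0 :: 'k algA) \<in> gradeA (nat 12 - gdeg i)
          else (if i = 11 then 1 else 0 :: 'k algA) = 0)" by auto
    qed
    then show ?thesis unfolding p0_def copy_simps by (rule imageI)
  qed
  \<comment> \<open>A homomorphism of degree \<open>i\<close> sends \<open>p0\<close>, which has
    degree 12, into degree \<open>i + 12\<close>, and its value there is the whole row.\<close>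
  have hg: "h a \<in> dual_grade gradeA ?C i \<longleftrightarrow> a \<in> int_grade gradeA (i + 12)" for a i
  proof
    assume "h a \<in> dual_grade gradeA ?C i"
    then have "h a ` grade ?C 12 \<subseteq> int_grade gradeA (12 + i)"
      unfolding dual_grade_def graded_hom_def by (simp add: regular_simps)
    then have "h a p0 \<in> int_grade gradeA (12 + i)" using p0 by blast
    then show "a \<in> int_grade gradeA (i + 12)" by (simp add: hp add.commute)
  next
    assume a: "a \<in> int_grade gradeA (i + 12)"
    have g11: "gdeg 11 = 12" by (simp add: gdeg_def)
    show "h a \<in> dual_grade gradeA ?C i" unfolding h_def
      by (rule hom_of_grade) (use a A.subspace_0[OF subspace_int_grade] in \<open>auto simp: top_row_def g11 add.commute\<close>)
  qed
  have gr: "F ` grade ?E i = grade ?L i" for i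
  proof -
    have "range h \<inter> dual_grade gradeA ?C i = h ` int_grade gradeA (i + 12)" using hg[of _ i] by blast
    then show ?thesis unfolding E L by (simp add: image_image coset FC)
  qed
  show ?thesis unfolding graded_isomorphic_def using hom bij gr by blast
qed

theorem gorenstein_algA: "gorenstein TYPE('u) (gradeA :: nat \<Rightarrow> 'k::field algA set) 5"
  unfolding gorenstein_def
  using graded_resolution_copy projective_copy Ext_zero Ext_5 by blast

lemma global_dimension_algA: "global_dimension TYPE('u) TYPE('k::field algA) = enat 5"
  unfolding global_dimension_def
proof (rule antisym)
  show "(SUP M\<in>{M :: ('k algA, ('k algA, 'u) universe) module. right_module M}. projective_dimension M) \<le> enat 5"
    by (rule SUP_least) (simp add: projective_dimension_le)
  show "enat 5 \<le> (SUP M\<in>{M :: ('k algA, ('k algA, 'u) universe) module. right_module M}. projective_dimension M)"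
    by (rule SUP_upper2[of residue_copy]) (simp_all add: right_module_residue_copy projective_dimension_residue_copy)
qed

theorem theorem4p2:
  "artin_schelter_regular TYPE('u) (scaleA :: 'k::field \<Rightarrow> 'k algA \<Rightarrow> 'k algA) gradeA \<and>
   graded_resolution (gradeA :: nat \<Rightarrow> 'k algA set) (right_residue_field gradeA)
     (free_terms gradeA [[0], [1, 1], [3, 4, 7], [5, 8, 9], [11, 11], [12]])
     (matrix_maps [[0], [1, 1], [3, 4, 7], [5, 8, 9], [11, 11], [12]] [d1, d2, d3, d4, d5])
     (augmentation gradeA) \<and>
   Abs_fps (\<lambda>i. of_nat (vector_space.dim (scaleA :: 'k \<Rightarrow> 'k algA \<Rightarrow> 'k algA) (gradeA i))) =
     (1 / ((1 - fps_X)^2 * (1 - fps_X^2) * (1 - fps_X^3) * (1 - fps_X^5)) :: rat fps)"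
proof (intro conjI)
  have "artin_schelter_regular_of_dim TYPE('u) (scaleA :: 'k \<Rightarrow> 'k algA \<Rightarrow> 'k algA) gradeA 5"
    unfolding artin_schelter_regular_of_dim_def
    using connected_graded_algebra_algA global_dimension_algA gk_dimension_algA polynomial_growth_algA gorenstein_algA
    by (intro conjI)
  then show "artin_schelter_regular TYPE('u) (scaleA :: 'k \<Rightarrow> 'k algA \<Rightarrow> 'k algA) gradeA"
    unfolding artin_schelter_regular_def by (rule exI)
  show "graded_resolution (gradeA :: nat \<Rightarrow> 'k algA set) (right_residue_field gradeA)
     (free_terms gradeA [[0], [1, 1], [3, 4, 7], [5, 8, 9], [11, 11], [12]])
     (matrix_maps [[0], [1, 1], [3, 4, 7], [5, 8, 9], [11, 11], [12]] [d1, d2, d3, d4, d5])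
     (augmentation gradeA)"
    using graded_resolution_residue_field unfolding res_shifts_def .
  show "Abs_fps (\<lambda>i. of_nat (vector_space.dim (scaleA :: 'k \<Rightarrow> 'k algA \<Rightarrow> 'k algA) (gradeA i))) =
     (1 / ((1 - fps_X)^2 * (1 - fps_X^2) * (1 - fps_X^3) * (1 - fps_X^5)) :: rat fps)"
    by (rule hilbert_series)
qed

end
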